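(* Let $R$ be a local ring and $M$ a finite $R$-module such that $\operatorname{Ext}_R^i(M,M\oplus R)=0$ for all $i>0$. If $\operatorname{G-dim}_R M^*<\infty$ and $\operatorname{pd}_R\operatorname{Hom}_R(M,M)<\infty$, where $M^*=\operatorname{Hom}_R(M,R)$, then $M$ is free. (That is, the Auslander--Reiten conjecture holds for $M$ under these two finiteness conditions.)
   Context: Rings are commutative Noetherian; finite means finitely generated. $\operatorname{pd}$ is projective dimension. $\operatorname{G-dim}$ is the Auslander--Bridger Gorenstein dimension: the least length of a resolution by totally reflexive modules, where a finite $R$-module $X$ is totally reflexive if $X\to X^{**}$ is an isomorphism and $\operatorname{Ext}_R^{i}(X,R)=0=\operatorname{Ext}^i_R(X^*,R)$ for all $i>0$. The (commutative local) Auslander--Reiten conjecture predicts that a finite module $M$ over a local ring $R$ with $\operatorname{Ext}_R^{>0}(M,M\oplus R)=0$ must be free. *)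

theory Defs
  imports
    "HOL-Algebra.Ring_Divisibility"
    "HOL-Algebra.Elementary_Groups"
    "HOL-Library.Extended_Nat"
    "Jordan_Normal_Form.Missing_VectorSpace"
begin

locale noetherian_local_ring = cring R + noetherian_ring R for R (structure) +
  assumes unique_maximal_ideal: "\<exists>!I. maximalideal I R"

definition finite_module ::
    "('a, 'r) ring_scheme \<Rightarrow> ('a, 'b, 'm) module_scheme \<Rightarrow> bool" where
  "finite_module R M \<longleftrightarrow>
     module R M \<and> (\<exists>A. finite A \<and> A \<subseteq> carrier M \<and> module.gen_set R M A)"

definition free_module ::
    "('a, 'r) ring_scheme \<Rightarrow> ('a, 'b, 'm) module_scheme \<Rightarrow> bool" where
  "free_module R M \<longleftrightarrow>
     module R M \<and>
     (\<exists>B. B \<subseteq> carrier M \<and> \<not> module.lin_dep R M B \<and> module.gen_set R M B)"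

text \<open>
  A module is projective if it is a direct summand of a free module. It is enough to look for
  complements \<open>Q\<close> with elements of type \<open>'b \<Rightarrow> 'a\<close>: the kernel of the canonical
  surjection from the free module on the set \<open>carrier P\<close> (realised as finitely supported functions
  \<open>'b \<Rightarrow> 'a\<close>) onto \<open>P\<close> is such a complement whenever there is any complement at all.
\<close>

definition projective_module ::
    "('a, 'r) ring_scheme \<Rightarrow> ('a, 'b, 'm) module_scheme \<Rightarrow> bool" where
  "projective_module R P \<longleftrightarrow>
     module R P \<and>
     (\<exists>Q :: ('a, 'b \<Rightarrow> 'a) module. module R Q \<and> free_module R (direct_sum P Q))"

definition self_module :: "('a, 'r) ring_scheme \<Rightarrow> ('a, 'a) module" where
  "self_module R = \<lparr>carrier = carrier R, monoid.mult = monoid.mult R, one = one R,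
     ring.zero = ring.zero R, ring.add = ring.add R, smult = monoid.mult R\<rparr>"

text \<open>
  Linear maps are represented by extensional functions, so that equality in \<open>hom_module R M N\<close> is
  equality of maps on \<open>carrier M\<close>. The fields \<open>mult\<close> and \<open>one\<close>, which every
  module record has, carry no meaning.
\<close>

definition hom_module ::
    "('a, 'r) ring_scheme \<Rightarrow> ('a, 'b, 'm) module_scheme \<Rightarrow> ('a, 'c, 'n) module_scheme
      \<Rightarrow> ('a, 'b \<Rightarrow> 'c) module" where
  "hom_module R M N =
     \<lparr>carrier = module_hom R M N \<inter> extensional (carrier M),
      monoid.mult = (\<lambda>f g. \<lambda>x\<in>carrier M. \<zero>\<^bsub>N\<^esub>),
      one = (\<lambda>x\<in>carrier M. \<zero>\<^bsub>N\<^esub>),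
      ring.zero = (\<lambda>x\<in>carrier M. \<zero>\<^bsub>N\<^esub>),
      ring.add = (\<lambda>f g. \<lambda>x\<in>carrier M. f x \<oplus>\<^bsub>N\<^esub> g x),
      smult = (\<lambda>r f. \<lambda>x\<in>carrier M. r \<odot>\<^bsub>N\<^esub> f x)\<rparr>"

definition dual_module ::
    "('a, 'r) ring_scheme \<Rightarrow> ('a, 'b, 'm) module_scheme \<Rightarrow> ('a, 'b \<Rightarrow> 'a) module" where
  "dual_module R M = hom_module R M (self_module R)"

definition biduality ::
    "('a, 'r) ring_scheme \<Rightarrow> ('a, 'b, 'm) module_scheme \<Rightarrow> 'b \<Rightarrow> ('b \<Rightarrow> 'a) \<Rightarrow> 'a" where
  "biduality R M x = (\<lambda>f\<in>carrier (dual_module R M). f x)"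

text \<open>
  \<open>resolution R M P d e\<close>: the sequence
  \<open>\<dots> \<rightarrow> P 2 \<rightarrow> P 1 \<rightarrow> P 0 \<rightarrow> M \<rightarrow> 0\<close>
  with maps \<open>d i : P (i + 1) \<rightarrow> P i\<close> and \<open>e : P 0 \<rightarrow> M\<close> is exact.
\<close>

definition resolution ::
    "('a, 'r) ring_scheme \<Rightarrow> ('a, 'b, 'm) module_scheme \<Rightarrow> (nat \<Rightarrow> ('a, 'p) module)
      \<Rightarrow> (nat \<Rightarrow> 'p \<Rightarrow> 'p) \<Rightarrow> ('p \<Rightarrow> 'b) \<Rightarrow> bool" where
  "resolution R M P d e \<longleftrightarrow>
     (\<forall>i. module R (P i)) \<and>
     (\<forall>i. d i \<in> module_hom R (P (Suc i)) (P i)) \<and>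
     e \<in> module_hom R (P 0) M \<and>
     e ` carrier (P 0) = carrier M \<and>
     a_kernel (P 0) M e = d 0 ` carrier (P 1) \<and>
     (\<forall>i. a_kernel (P (Suc i)) (P i) (d i) = d (Suc i) ` carrier (P (Suc (Suc i))))"

definition projective_resolution ::
    "('a, 'r) ring_scheme \<Rightarrow> ('a, 'b, 'm) module_scheme \<Rightarrow> (nat \<Rightarrow> ('a, 'p) module)
      \<Rightarrow> (nat \<Rightarrow> 'p \<Rightarrow> 'p) \<Rightarrow> ('p \<Rightarrow> 'b) \<Rightarrow> bool" where
  "projective_resolution R M P d e \<longleftrightarrow>
     resolution R M P d e \<and> (\<forall>i. projective_module R (P i))"

definition vanishes_above :: "(nat \<Rightarrow> ('a, 'p) module) \<Rightarrow> nat \<Rightarrow> bool" where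
  "vanishes_above P n \<longleftrightarrow> (\<forall>i>n. carrier (P i) = {\<zero>\<^bsub>P i\<^esub>})"

text \<open>
  The notions below involve resolutions of a finite module over a Noetherian ring \<open>R\<close>. All
  modules occurring in them are taken with elements of type \<open>nat \<Rightarrow> 'a\<close>. This loses nothing:
  the free module \<open>R^n\<close> lives there (functions supported on \<open>{..<n}\<close>), hence so do its
  submodules, and up to isomorphism these include all finite projective modules and all totally
  reflexive modules \<open>T\<close> (as \<open>T\<close> is isomorphic to the dual of its dual, which is finite).
  A finite module has a resolution by modules \<open>R^n\<close>, and if it has a projective resolution of
  length \<open>n\<close> at all, then also one by finite projective modules.
\<close>

definition chosen_resolution ::
    "('a, 'r) ring_scheme \<Rightarrow> ('a, 'b, 'm) module_scheme \<Rightarrow>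
      (nat \<Rightarrow> ('a, nat \<Rightarrow> 'a) module) \<times> (nat \<Rightarrow> (nat \<Rightarrow> 'a) \<Rightarrow> nat \<Rightarrow> 'a) \<times> ((nat \<Rightarrow> 'a) \<Rightarrow> 'b)" where
  "chosen_resolution R M = (SOME (P, d, e). projective_resolution R M P d e)"

text \<open>
  \<open>Hom_R(P, N)\<close> as a cochain complex; \<open>hom_cohomology R P d N i\<close> is the additive group
  of its \<open>i\<close>-th cohomology.
\<close>

definition hom_diff ::
    "(nat \<Rightarrow> ('a, 'p) module) \<Rightarrow> (nat \<Rightarrow> 'p \<Rightarrow> 'p) \<Rightarrow> nat \<Rightarrow> ('p \<Rightarrow> 'c) \<Rightarrow> 'p \<Rightarrow> 'c" where
  "hom_diff P d i f = compose (carrier (P (Suc i))) f (d i)"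

definition hom_cocycles ::
    "('a, 'r) ring_scheme \<Rightarrow> (nat \<Rightarrow> ('a, 'p) module) \<Rightarrow> (nat \<Rightarrow> 'p \<Rightarrow> 'p)
      \<Rightarrow> ('a, 'c, 'n) module_scheme \<Rightarrow> nat \<Rightarrow> ('p \<Rightarrow> 'c) set" where
  "hom_cocycles R P d N i =
     a_kernel (hom_module R (P i) N) (hom_module R (P (Suc i)) N) (hom_diff P d i)"

definition hom_coboundaries ::
    "('a, 'r) ring_scheme \<Rightarrow> (nat \<Rightarrow> ('a, 'p) module) \<Rightarrow> (nat \<Rightarrow> 'p \<Rightarrow> 'p)
      \<Rightarrow> ('a, 'c, 'n) module_scheme \<Rightarrow> nat \<Rightarrow> ('p \<Rightarrow> 'c) set" where
  "hom_coboundaries R P d N i =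
     (case i of
        0 \<Rightarrow> {\<zero>\<^bsub>hom_module R (P 0) N\<^esub>}
      | Suc j \<Rightarrow> hom_diff P d j ` carrier (hom_module R (P j) N))"

definition hom_cohomology ::
    "('a, 'r) ring_scheme \<Rightarrow> (nat \<Rightarrow> ('a, 'p) module) \<Rightarrow> (nat \<Rightarrow> 'p \<Rightarrow> 'p)
      \<Rightarrow> ('a, 'c, 'n) module_scheme \<Rightarrow> nat \<Rightarrow> ('p \<Rightarrow> 'c) set monoid" where
  "hom_cohomology R P d N i =
     (hom_module R (P i) N)\<lparr>carrier := hom_cocycles R P d N i\<rparr>
       A_Mod hom_coboundaries R P d N i"

definition Ext ::
    "('a, 'r) ring_scheme \<Rightarrow> nat \<Rightarrow> ('a, 'b, 'm) module_scheme \<Rightarrow> ('a, 'c, 'n) module_scheme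
      \<Rightarrow> ((nat \<Rightarrow> 'a) \<Rightarrow> 'c) set monoid" where
  "Ext R i M N = (case chosen_resolution R M of (P, d, e) \<Rightarrow> hom_cohomology R P d N i)"

text \<open>
  Dimensions take values in \<open>enat\<close>, where \<open>Inf {} = \<infinity>\<close>. The zero module has
  dimension \<open>0\<close> here (some authors use \<open>-\<infinity>\<close>); finiteness is not affected.
\<close>

definition proj_dim :: "('a, 'r) ring_scheme \<Rightarrow> ('a, 'b, 'm) module_scheme \<Rightarrow> enat" where
  "proj_dim R M = Inf {enat n | n.
     \<exists>(P :: nat \<Rightarrow> ('a, nat \<Rightarrow> 'a) module) d e.
       projective_resolution R M P d e \<and> vanishes_above P n}"

definition totally_reflexive ::
    "('a, 'r) ring_scheme \<Rightarrow> ('a, 'b, 'm) module_scheme \<Rightarrow> bool" where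
  "totally_reflexive R T \<longleftrightarrow>
     finite_module R T \<and>
     bij_betw (biduality R T) (carrier T) (carrier (dual_module R (dual_module R T))) \<and>
     (\<forall>i>0. trivial_group (Ext R i T (self_module R))) \<and>
     (\<forall>i>0. trivial_group (Ext R i (dual_module R T) (self_module R)))"

definition G_dim :: "('a, 'r) ring_scheme \<Rightarrow> ('a, 'b, 'm) module_scheme \<Rightarrow> enat" where
  "G_dim R M = Inf {enat n | n.
     \<exists>(P :: nat \<Rightarrow> ('a, nat \<Rightarrow> 'a) module) d e.
       resolution R M P d e \<and> (\<forall>i. totally_reflexive R (P i)) \<and> vanishes_above P n}"

end

theory Submission
  imports Defs
begin

text \<open>
  Let \<open>xs\<close> be a maximal regular sequence in the maximal ideal, so that \<open>R/(xs)\<close> has a socle element \<open>y\<close>.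

  If \<open>0 \<rightarrow> G \<rightarrow> F \<rightarrow> Y \<rightarrow> 0\<close> is exact, \<open>G\<close> is totally reflexive, \<open>F\<close> is torsionless modulo \<open>xs\<close> and \<open>xs\<close> is weakly
  regular on \<open>Y\<close>, then every functional on \<open>G\<close> extends to \<open>F\<close>: otherwise the cokernel of \<open>F\<^sup>* \<rightarrow> G\<^sup>*\<close> has a nonzero map
  to \<open>R y \<subseteq> R/(xs)\<close>, induced by some \<open>u \<in> G\<close>, and \<open>u \<in> (xs)F \<inter> G = (xs)G\<close> is a contradiction. So \<open>Y\<close> is
  totally reflexive when \<open>F\<close> is, and descending along resolutions gives the Auslander--Bridger
  formula in this form: a module of finite G-dimension on which \<open>xs\<close> is weakly regular is totally reflexive,
  and in the case of finite projective dimension it is projective.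

  The vanishing of \<open>Ext(M, R)\<close> makes \<open>xs\<close> weakly regular on \<open>M\<^sup>*\<close>. Hence \<open>M\<^sup>*\<close> is totally reflexive, and so
  is \<open>M\<close>. As \<open>Ext(M, M)\<close> vanishes too, \<open>xs\<close> is weakly regular on \<open>Hom(M, M)\<close>, which is therefore
  projective.

  Finally let \<open>F \<rightarrow> M\<close> be a surjection from a finite free module, with kernel \<open>Z\<close>. The sequence
  \<open>0 \<rightarrow> Hom(M, M) \<rightarrow> Hom(F, M) \<rightarrow> Hom(Z, M) \<rightarrow> 0\<close> is of the above kind, so the coordinate functions of \<open>Hom(M, M)\<close> extend
  to \<open>Hom(F, M)\<close>, where they are combinations of functionals of \<open>M\<close>. If an idempotent \<open>p\<close> of \<open>Hom(M, M)\<close> is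
  such that no functional on \<open>M\<close> takes a unit value on \<open>p M\<close>, its coordinates are therefore nonunits,
  and \<open>p = 0\<close> by Nakayama's lemma. Hence copies of \<open>R\<close> can be split off \<open>M\<close> until nothing is left.
\<close>

section \<open>Linear maps and finite projective modules\<close>

text \<open>Quotient modules, Tor and depth do not occur. Membership in \<open>lmul xs L\<close>
  stands for vanishing modulo \<open>xs\<close>, and maps into a quotient are handled through
  representatives, so that modules keep their element types. The obstacle is regularity of
  \<open>xs\<close> on Hom modules: in general only the first two elements survive the passage to
  Hom. Vanishing of Ext in all positive degrees removes this bound, because a map that is linear or
  kills boundaries only modulo \<open>xs\<close> can then be corrected to an exact one. The passage
  from the dual of \<open>M\<close> to \<open>M\<close> is not formal either. Total reflexivity of
  the dual makes biduality onto for \<open>M\<close>, but injectivity for \<open>M\<close> rests on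
  surjectivity for the first syzygy. Ext is defined through one chosen resolution, whereas
  horseshoe, syzygy and possibly infinitely generated resolutions all occur. Its vanishing is
  therefore first made independent of the resolution, under a projectivity condition relative to a
  single target.\<close>

lemma (in module) a_inv_zero [simp]: "\<ominus>\<^bsub>M\<^esub> \<zero>\<^bsub>M\<^esub> = \<zero>\<^bsub>M\<^esub>"
  by (simp add: a_inv_def)

text \<open>Makes the \<open>algebra\<close> method normalise expressions in the additive group of a
  module, with scalars distributed over sums of vectors. Sums and products of scalars are not
  covered, so \<open>smult_l_distr\<close> and \<open>smult_assoc1\<close> are applied first where
  they matter.\<close>

lemmas (in module) module_simprules
  [algebra "module" "zero M" "add M" "a_inv M" "a_minus M" "smult M"] =
  M.a_closed M.zero_closed M.a_inv_closed M.minus_closed smult_closed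
  M.a_assoc M.l_zero M.l_neg M.a_comm M.minus_eq
  M.r_zero M.r_neg M.r_neg2 M.r_neg1 M.minus_add M.minus_minus a_inv_zero
  M.a_lcomm smult_r_distr smult_r_minus smult_r_null

text \<open>Instantiated by \<open>note\<close> for each map in play, so that the many maps of a
  diagram chase need no locale interpretation each.\<close>

lemma hom_simps:
  assumes "f \<in> module_hom R M N" "module R M" "module R N"
  shows "\<And>x. x \<in> carrier M \<Longrightarrow> f x \<in> carrier N"
    and "\<And>x y. x \<in> carrier M \<Longrightarrow> y \<in> carrier M \<Longrightarrow> f (x \<oplus>\<^bsub>M\<^esub> y) = f x \<oplus>\<^bsub>N\<^esub> f y"
    and "\<And>r x. r \<in> carrier R \<Longrightarrow> x \<in> carrier M \<Longrightarrow> f (r \<odot>\<^bsub>M\<^esub> x) = r \<odot>\<^bsub>N\<^esub> f x"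
    and "f \<zero>\<^bsub>M\<^esub> = \<zero>\<^bsub>N\<^esub>"
    and "\<And>x. x \<in> carrier M \<Longrightarrow> f (\<ominus>\<^bsub>M\<^esub> x) = \<ominus>\<^bsub>N\<^esub> f x"
    and "\<And>x y. x \<in> carrier M \<Longrightarrow> y \<in> carrier M \<Longrightarrow> f (x \<ominus>\<^bsub>M\<^esub> y) = f x \<ominus>\<^bsub>N\<^esub> f y"
proof -
  interpret mod_hom R M N f
    using assms by (simp add: mod_hom_def mod_hom_axioms_def)
  show "\<And>x. x \<in> carrier M \<Longrightarrow> f x \<in> carrier N"
    and "\<And>x y. x \<in> carrier M \<Longrightarrow> y \<in> carrier M \<Longrightarrow> f (x \<oplus>\<^bsub>M\<^esub> y) = f x \<oplus>\<^bsub>N\<^esub> f y"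
    and "\<And>r x. r \<in> carrier R \<Longrightarrow> x \<in> carrier M \<Longrightarrow> f (r \<odot>\<^bsub>M\<^esub> x) = r \<odot>\<^bsub>N\<^esub> f x"
    and "f \<zero>\<^bsub>M\<^esub> = \<zero>\<^bsub>N\<^esub>"
    and "\<And>x. x \<in> carrier M \<Longrightarrow> f (\<ominus>\<^bsub>M\<^esub> x) = \<ominus>\<^bsub>N\<^esub> f x"
    and "\<And>x y. x \<in> carrier M \<Longrightarrow> y \<in> carrier M \<Longrightarrow> f (x \<ominus>\<^bsub>M\<^esub> y) = f x \<ominus>\<^bsub>N\<^esub> f y"
    by simp_all
qed

lemma hom_cong:
  assumes "module R M" "f \<in> module_hom R M N" "\<And>x. x \<in> carrier M \<Longrightarrow> g x = f x"
  shows "g \<in> module_hom R M N"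
proof -
  interpret M: module R M by fact
  show ?thesis using assms by (auto simp: module_hom_def)
qed

lemma hom_comp:
  assumes "module R M" "f \<in> module_hom R M N" "g \<in> module_hom R N L"
  shows "(\<lambda>x. g (f x)) \<in> module_hom R M L"
proof -
  interpret M: module R M by fact
  show ?thesis using assms(2,3) by (simp add: module_hom_def Pi_iff)
qed

lemma hom_id: "(\<lambda>x. x) \<in> module_hom R M M"
  by (auto simp: module_hom_def)

lemma hom_plus:
  assumes "module R M" "module R N" "f \<in> module_hom R M N" "g \<in> module_hom R M N"
  shows "(\<lambda>x. f x \<oplus>\<^bsub>N\<^esub> g x) \<in> module_hom R M N"
proof -
  interpret M: module R M by fact
  interpret N: module R N by fact
  note [simp] = hom_simps[OF assms(3,1,2)] hom_simps[OF assms(4,1,2)]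
  show ?thesis by (auto simp: module_hom_def N.a_ac N.smult_r_distr)
qed

lemma hom_uminus:
  assumes "module R M" "module R N" "f \<in> module_hom R M N"
  shows "(\<lambda>x. \<ominus>\<^bsub>N\<^esub> f x) \<in> module_hom R M N"
proof -
  interpret M: module R M by fact
  interpret N: module R N by fact
  note [simp] = hom_simps[OF assms(3,1,2)]
  show ?thesis by (auto simp: module_hom_def N.minus_add N.smult_r_minus)
qed

lemma hom_minus:
  assumes "module R M" "module R N" "f \<in> module_hom R M N" "g \<in> module_hom R M N"
  shows "(\<lambda>x. f x \<ominus>\<^bsub>N\<^esub> g x) \<in> module_hom R M N"
  using hom_plus[OF assms(1-3) hom_uminus[OF assms(1,2,4)]] by (simp add: a_minus_def)

lemma hom_zero_map:
  assumes "module R M" "module R N"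
  shows "(\<lambda>x. \<zero>\<^bsub>N\<^esub>) \<in> module_hom R M N"
proof -
  interpret M: module R M by fact
  interpret N: module R N by fact
  show ?thesis by (auto simp: module_hom_def)
qed

lemma hom_smult_map:
  assumes "module R M" "module R N" "f \<in> module_hom R M N" "r \<in> carrier R"
  shows "(\<lambda>x. r \<odot>\<^bsub>N\<^esub> f x) \<in> module_hom R M N"
proof -
  interpret M: module R M by fact
  interpret N: module R N by fact
  note [simp] = hom_simps[OF assms(3,1,2)]
  show ?thesis using assms(4)
    by (auto simp: module_hom_def N.smult_r_distr N.smult_assoc1[symmetric] M.R.m_comm)
qed

lemma hom_restrict_iff [simp]:
  "module R M \<Longrightarrow> restrict f (carrier M) \<in> module_hom R M N \<longleftrightarrow> f \<in> module_hom R M N"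
  by (auto intro: hom_cong)

section \<open>The ring as a module, modules of homomorphisms, direct sums\<close>

lemma self_module_simps [simp]:
  "carrier (self_module R) = carrier R" "add (self_module R) = add R" 
  "zero (self_module R) = zero R" "smult (self_module R) = mult R"
  by (simp_all add: self_module_def)

lemma (in cring) self_module_module: "module R (self_module R)"
  by (rule module_criteria)
    (auto simp: is_cring a_ac m_assoc l_distr r_distr intro!: bexI[of _ "\<ominus> _"] r_neg)

lemma self_module_minus [simp]:
  "a_inv (self_module R) = a_inv R" "a_minus (self_module R) = a_minus R"
proof -
  show *: "a_inv (self_module R) = a_inv R"
    by (auto simp: a_inv_def m_inv_def fun_eq_iff)
  show "a_minus (self_module R) = a_minus R"
    by (auto simp: a_minus_def * fun_eq_iff)
qed

lemma hom_module_simps [simp]: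
  "carrier (hom_module R M N) = module_hom R M N \<inter> extensional (carrier M)"
  "\<zero>\<^bsub>hom_module R M N\<^esub> = (\<lambda>x\<in>carrier M. \<zero>\<^bsub>N\<^esub>)"
  "f \<oplus>\<^bsub>hom_module R M N\<^esub> g = (\<lambda>x\<in>carrier M. f x \<oplus>\<^bsub>N\<^esub> g x)"
  "r \<odot>\<^bsub>hom_module R M N\<^esub> f = (\<lambda>x\<in>carrier M. r \<odot>\<^bsub>N\<^esub> f x)"
  by (simp_all add: hom_module_def)

lemma hom_module_module:
  assumes "module R M" "module R N"
  shows "module R (hom_module R M N)"
proof -
  interpret M: module R M by fact
  interpret N: module R N by fact
  note cl = hom_simps(1)[OF _ assms]
  show ?thesis
  proof (rule module_criteria)
    show "\<forall>v\<in>carrier (hom_module R M N). \<exists>w\<in>carrier (hom_module R M N).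
        v \<oplus>\<^bsub>hom_module R M N\<^esub> w = \<zero>\<^bsub>hom_module R M N\<^esub>"
    proof
      fix v assume v: "v \<in> carrier (hom_module R M N)"
      show "\<exists>w\<in>carrier (hom_module R M N). v \<oplus>\<^bsub>hom_module R M N\<^esub> w = \<zero>\<^bsub>hom_module R M N\<^esub>"
        using v assms
        by (intro bexI[of _ "\<lambda>x\<in>carrier M. \<ominus>\<^bsub>N\<^esub> v x"])
          (auto simp: hom_uminus cl intro!: restrict_ext N.r_neg)
    qed
  qed (use assms in \<open>auto simp: M.R.is_cring hom_plus hom_zero_map hom_smult_map cl N.a_ac N.smult_assoc1
        N.smult_l_distr N.smult_r_distr hom_simps intro!: restrict_ext extensionalityI[of _ "carrier M"]\<close>)
qed

lemma direct_sum_simps [simp]: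
  "carrier (direct_sum M N) = carrier M \<times> carrier N"
  "\<zero>\<^bsub>direct_sum M N\<^esub> = (\<zero>\<^bsub>M\<^esub>, \<zero>\<^bsub>N\<^esub>)"
  "(a, b) \<oplus>\<^bsub>direct_sum M N\<^esub> (a', b') = (a \<oplus>\<^bsub>M\<^esub> a', b \<oplus>\<^bsub>N\<^esub> b')"
  "r \<odot>\<^bsub>direct_sum M N\<^esub> (a, b) = (r \<odot>\<^bsub>M\<^esub> a, r \<odot>\<^bsub>N\<^esub> b)"
  by (simp_all add: direct_sum_def)

text \<open>A form of projectivity relative to one target: a total linear relation from \<open>P\<close> to \<open>L\<close>
  contains the graph of a linear map.\<close>

definition linear_choice ::
    "('a, 'r) ring_scheme \<Rightarrow> ('a, 'p, 'm) module_scheme \<Rightarrow> ('a, 'l, 'n) module_scheme \<Rightarrow> bool" where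
  "linear_choice R P L \<longleftrightarrow>
     (\<forall>\<Phi>. (\<forall>p\<in>carrier P. \<exists>l\<in>carrier L. \<Phi> p l) \<longrightarrow> \<Phi> \<zero>\<^bsub>P\<^esub> \<zero>\<^bsub>L\<^esub> \<longrightarrow>
        (\<forall>p\<in>carrier P. \<forall>q\<in>carrier P. \<forall>l\<in>carrier L. \<forall>k\<in>carrier L.
           \<Phi> p l \<longrightarrow> \<Phi> q k \<longrightarrow> \<Phi> (p \<oplus>\<^bsub>P\<^esub> q) (l \<oplus>\<^bsub>L\<^esub> k)) \<longrightarrow>
        (\<forall>r\<in>carrier R. \<forall>p\<in>carrier P. \<forall>l\<in>carrier L. \<Phi> p l \<longrightarrow> \<Phi> (r \<odot>\<^bsub>P\<^esub> p) (r \<odot>\<^bsub>L\<^esub> l)) \<longrightarrow>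
        (\<exists>c\<in>module_hom R P L. \<forall>p\<in>carrier P. \<Phi> p (c p)))"

lemma linear_choiceE:
  assumes "linear_choice R P L" "\<And>p. p \<in> carrier P \<Longrightarrow> \<exists>l\<in>carrier L. \<Phi> p l" "\<Phi> \<zero>\<^bsub>P\<^esub> \<zero>\<^bsub>L\<^esub>"
    and "\<And>p q l k. p \<in> carrier P \<Longrightarrow> q \<in> carrier P \<Longrightarrow> l \<in> carrier L \<Longrightarrow> k \<in> carrier L \<Longrightarrow>
           \<Phi> p l \<Longrightarrow> \<Phi> q k \<Longrightarrow> \<Phi> (p \<oplus>\<^bsub>P\<^esub> q) (l \<oplus>\<^bsub>L\<^esub> k)"
    and "\<And>r p l. r \<in> carrier R \<Longrightarrow> p \<in> carrier P \<Longrightarrow> l \<in> carrier L \<Longrightarrow>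
           \<Phi> p l \<Longrightarrow> \<Phi> (r \<odot>\<^bsub>P\<^esub> p) (r \<odot>\<^bsub>L\<^esub> l)"
  obtains c where "c \<in> module_hom R P L" "\<And>p. p \<in> carrier P \<Longrightarrow> \<Phi> p (c p)"
proof -
  have "\<exists>c\<in>module_hom R P L. \<forall>p\<in>carrier P. \<Phi> p (c p)"
    by (rule assms(1)[unfolded linear_choice_def, rule_format, of \<Phi>]) (fact assms(2-))+
  then show thesis using that by blast
qed

text \<open>A sum over an initial segment of the naturals instead of \<open>finsum\<close>:
  generators may repeat, and the recursion unfolds without closure conditions.\<close>

primrec msum :: "('a, 'b, 'm) module_scheme \<Rightarrow> (nat \<Rightarrow> 'b) \<Rightarrow> nat \<Rightarrow> 'b" where
  "msum M g 0 = \<zero>\<^bsub>M\<^esub>"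
| "msum M g (Suc n) = msum M g n \<oplus>\<^bsub>M\<^esub> g n"

lemma msum_cong: "(\<And>i. i < n \<Longrightarrow> f i = g i) \<Longrightarrow> msum M f n = msum M g n"
  by (induction n) auto

lemma (in module) msum_closed: "(\<And>i. i < n \<Longrightarrow> g i \<in> carrier M) \<Longrightarrow> msum M g n \<in> carrier M"
  by (induction n) auto

lemma (in module) msum_plus:
  "(\<And>i. i < n \<Longrightarrow> f i \<in> carrier M) \<Longrightarrow> (\<And>i. i < n \<Longrightarrow> g i \<in> carrier M) \<Longrightarrow>
     msum M (\<lambda>i. f i \<oplus>\<^bsub>M\<^esub> g i) n = msum M f n \<oplus>\<^bsub>M\<^esub> msum M g n"
  by (induction n) (auto simp: msum_closed M.a_ac)

lemma (in module) msum_smult: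
  "r \<in> carrier R \<Longrightarrow> (\<And>i. i < n \<Longrightarrow> g i \<in> carrier M) \<Longrightarrow>
     msum M (\<lambda>i. r \<odot>\<^bsub>M\<^esub> g i) n = r \<odot>\<^bsub>M\<^esub> msum M g n"
  by (induction n) (auto simp: msum_closed smult_r_distr)

lemma (in module) msum_add_index:
  "(\<And>i. i < n + m \<Longrightarrow> g i \<in> carrier M) \<Longrightarrow>
     msum M g (n + m) = msum M g n \<oplus>\<^bsub>M\<^esub> msum M (\<lambda>i. g (n + i)) m"
  by (induction m) (auto simp: msum_closed M.a_ac)

lemma (in module) msum_zero: "(\<And>i. i < n \<Longrightarrow> g i = \<zero>\<^bsub>M\<^esub>) \<Longrightarrow> msum M g n = \<zero>\<^bsub>M\<^esub>"
  by (induction n) auto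

lemma (in module) msum_single:
  "k < n \<Longrightarrow> (\<And>i. i < n \<Longrightarrow> i \<noteq> k \<Longrightarrow> g i = \<zero>\<^bsub>M\<^esub>) \<Longrightarrow> g k \<in> carrier M \<Longrightarrow> msum M g n = g k"
  by (induction n) (auto simp: less_Suc_eq msum_zero)

lemma hom_msum:
  assumes "f \<in> module_hom R M N" "module R M" "module R N" "\<And>i. i < n \<Longrightarrow> g i \<in> carrier M"
  shows "f (msum M g n) = msum N (\<lambda>i. f (g i)) n"
  using assms(4)
  by (induction n) (auto simp: hom_simps[OF assms(1-3)] module.msum_closed[OF assms(2)])

lemma submodule_msum:
  assumes "submodule R S M" "\<And>i. i < n \<Longrightarrow> g i \<in> S"
  shows "msum M g n \<in> S"
  using assms(2) by (induction n) (auto intro: submodule.m_closed[OF assms(1)] submodule.zero_closed[OF assms(1)])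

text \<open>Finitely generated projective modules, in terms of a finite dual basis.\<close>

definition fgp :: "('a, 'r) ring_scheme \<Rightarrow> ('a, 'p, 'm) module_scheme \<Rightarrow> bool" where
  "fgp R P \<longleftrightarrow> module R P \<and>
     (\<exists>n (u :: nat \<Rightarrow> 'p) h. (\<forall>i<n. u i \<in> carrier P \<and> h i \<in> module_hom R P (self_module R)) \<and>
        (\<forall>q\<in>carrier P. q = msum P (\<lambda>i. h i q \<odot>\<^bsub>P\<^esub> u i) n))"

lemma fgpI:
  assumes "module R P" "\<And>i. i < n \<Longrightarrow> u i \<in> carrier P"
    and "\<And>i. i < n \<Longrightarrow> h i \<in> module_hom R P (self_module R)"
    and "\<And>q. q \<in> carrier P \<Longrightarrow> q = msum P (\<lambda>i. h i q \<odot>\<^bsub>P\<^esub> u i) n"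
  shows "fgp R P"
  unfolding fgp_def using assms by (intro conjI exI[of _ n] exI[of _ u] exI[of _ h]) auto

lemma fgpE:
  assumes "fgp R P"
  obtains n u h where "\<And>i. i < n \<Longrightarrow> u i \<in> carrier P"
    and "\<And>i. i < n \<Longrightarrow> h i \<in> module_hom R P (self_module R)"
    and "\<And>q. q \<in> carrier P \<Longrightarrow> msum P (\<lambda>i. h i q \<odot>\<^bsub>P\<^esub> u i) n = q"
proof -
  from assms obtain n :: nat and u h
    where 1: "\<forall>i<n. u i \<in> carrier P \<and> h i \<in> module_hom R P (self_module R)"
      and 2: "\<forall>q\<in>carrier P. q = msum P (\<lambda>i. h i q \<odot>\<^bsub>P\<^esub> u i) n"
    unfolding fgp_def by (elim conjE exE)
  show thesis
    by (rule that[of n u h]) (use 1 in blast, use 1 in blast, rule 2[rule_format, symmetric])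
qed

lemma fgp_module: "fgp R P \<Longrightarrow> module R P"
  by (simp add: fgp_def)

text \<open>Choose related values \<open>l i\<close> of the vectors \<open>u i\<close> of a dual
  basis and let \<open>c q\<close> be the sum of the \<open>h i q\<close> times \<open>l i\<close>.
  As \<open>q\<close> is the same combination of the \<open>u i\<close>, closure of
  \<open>\<Phi>\<close> under sums and multiples relates \<open>q\<close> to
  \<open>c q\<close>.\<close>

lemma fgp_linear_choice:
  assumes "fgp R P" "module R L"
  shows "linear_choice R P L"
  unfolding linear_choice_def
proof (intro allI impI)
  interpret P: module R P using assms by (simp add: fgp_module)
  interpret L: module R L by fact
  fix \<Phi> :: "_ \<Rightarrow> _ \<Rightarrow> bool"
  assume tot: "\<forall>p\<in>carrier P. \<exists>l\<in>carrier L. \<Phi> p l" and zero: "\<Phi> \<zero>\<^bsub>P\<^esub> \<zero>\<^bsub>L\<^esub>"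
    and add: "\<forall>p\<in>carrier P. \<forall>q\<in>carrier P. \<forall>l\<in>carrier L. \<forall>k\<in>carrier L.
           \<Phi> p l \<longrightarrow> \<Phi> q k \<longrightarrow> \<Phi> (p \<oplus>\<^bsub>P\<^esub> q) (l \<oplus>\<^bsub>L\<^esub> k)"
    and sm: "\<forall>r\<in>carrier R. \<forall>p\<in>carrier P. \<forall>l\<in>carrier L. \<Phi> p l \<longrightarrow> \<Phi> (r \<odot>\<^bsub>P\<^esub> p) (r \<odot>\<^bsub>L\<^esub> l)"
  obtain n u h where u: "\<And>i. i < n \<Longrightarrow> u i \<in> carrier P"
    and h: "\<And>i. i < n \<Longrightarrow> h i \<in> module_hom R P (self_module R)"
    and uh: "\<And>q. q \<in> carrier P \<Longrightarrow> msum P (\<lambda>i. h i q \<odot>\<^bsub>P\<^esub> u i) n = q"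
    by (rule fgpE[OF assms(1)]) blast
  note hs = hom_simps[OF h P.module_axioms P.self_module_module, simplified]
  have "\<forall>i\<in>{..<n}. \<exists>l. l \<in> carrier L \<and> \<Phi> (u i) l"
    using tot u by auto
  then obtain l where l: "\<And>i. i < n \<Longrightarrow> l i \<in> carrier L" "\<And>i. i < n \<Longrightarrow> \<Phi> (u i) (l i)"
    by (metis lessThan_iff)
  define c where "c q = msum L (\<lambda>i. h i q \<odot>\<^bsub>L\<^esub> l i) n" for q
  have "c \<in> module_hom R P L"
    unfolding module_hom_def c_def using l hs
    by (auto simp: L.msum_closed L.msum_plus[symmetric] L.msum_smult[symmetric] L.smult_l_distr
        L.smult_assoc1 intro!: msum_cong)
  moreover have "\<Phi> q (c q)" if q: "q \<in> carrier P" for q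
  proof -
    have "k \<le> n \<Longrightarrow> \<Phi> (msum P (\<lambda>i. h i q \<odot>\<^bsub>P\<^esub> u i) k) (msum L (\<lambda>i. h i q \<odot>\<^bsub>L\<^esub> l i) k)" for k
    proof (induction k)
      case (Suc k)
      have k: "k < n" using Suc by simp
      have mc: "msum P (\<lambda>i. h i q \<odot>\<^bsub>P\<^esub> u i) k \<in> carrier P" "msum L (\<lambda>i. h i q \<odot>\<^bsub>L\<^esub> l i) k \<in> carrier L"
        using Suc.prems u l hs(1) q by (auto intro!: P.msum_closed L.msum_closed)
      have 1: "\<Phi> (h k q \<odot>\<^bsub>P\<^esub> u k) (h k q \<odot>\<^bsub>L\<^esub> l k)"
        using sm hs(1)[OF k q] u[OF k] l[OF k] by blast
      have 2: "\<Phi> (msum P (\<lambda>i. h i q \<odot>\<^bsub>P\<^esub> u i) k) (msum L (\<lambda>i. h i q \<odot>\<^bsub>L\<^esub> l i) k)"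
        using Suc by simp
      show ?case
        using add[rule_format, OF mc(1) _ mc(2) _ 2 1] hs(1)[OF k q] u[OF k] l(1)[OF k] by simp
    qed (simp add: zero)
    from this[of n] show ?thesis by (simp add: c_def uh[OF q])
  qed
  ultimately show "\<exists>c\<in>module_hom R P L. \<forall>p\<in>carrier P. \<Phi> p (c p)" by blast
qed

lemma fgp_direct_sum:
  assumes "fgp R P" "fgp R Q"
  shows "fgp R (direct_sum P Q)"
proof -
  interpret P: module R P using assms by (simp add: fgp_module)
  interpret Q: module R Q using assms by (simp add: fgp_module)
  interpret PQ: module R "direct_sum P Q"
    by (rule direct_sum_is_module) (rule P.module_axioms Q.module_axioms)+
  obtain n u h where u: "\<And>i. i < n \<Longrightarrow> u i \<in> carrier P"
    and h: "\<And>i. i < n \<Longrightarrow> h i \<in> module_hom R P (self_module R)"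
    and uh: "\<And>q. q \<in> carrier P \<Longrightarrow> msum P (\<lambda>i. h i q \<odot>\<^bsub>P\<^esub> u i) n = q"
    by (rule fgpE[OF assms(1)]) blast
  obtain m v k where v: "\<And>i. i < m \<Longrightarrow> v i \<in> carrier Q"
    and k: "\<And>i. i < m \<Longrightarrow> k i \<in> module_hom R Q (self_module R)"
    and vk: "\<And>q. q \<in> carrier Q \<Longrightarrow> msum Q (\<lambda>i. k i q \<odot>\<^bsub>Q\<^esub> v i) m = q"
    by (rule fgpE[OF assms(2)]) blast
  note hs = hom_simps[OF h P.module_axioms P.self_module_module, simplified]
  note ks = hom_simps[OF k Q.module_axioms P.self_module_module, simplified]
  \<comment> \<open>Indices below \<open>n\<close> carry the dual basis of \<open>P\<close>, the
    next \<open>m\<close> that of \<open>Q\<close>.\<close>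
  define w where "w i = (if i < n then (u i, \<zero>\<^bsub>Q\<^esub>) else (\<zero>\<^bsub>P\<^esub>, v (i - n)))" for i
  define l where "l i x = (if i < n then h i (fst x) else k (i - n) (snd x))" for i x
  have left: "msum (direct_sum P Q) (\<lambda>i. (f i, \<zero>\<^bsub>Q\<^esub>)) j = (msum P f j, \<zero>\<^bsub>Q\<^esub>)" for f and j :: nat
    by (induction j) auto
  have right: "msum (direct_sum P Q) (\<lambda>i. (\<zero>\<^bsub>P\<^esub>, f i)) j = (\<zero>\<^bsub>P\<^esub>, msum Q f j)" for f and j :: nat
    by (induction j) auto
  show ?thesis
  proof (rule fgpI[where n = "n + m" and u = w and h = l])
    show "w i \<in> carrier (direct_sum P Q)" if "i < n + m" for i
      using that u v by (auto simp: w_def)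
    show "l i \<in> module_hom R (direct_sum P Q) (self_module R)" if "i < n + m" for i
      using that hs ks unfolding module_hom_def by (auto simp: l_def)
    show "q = msum (direct_sum P Q) (\<lambda>i. l i q \<odot>\<^bsub>direct_sum P Q\<^esub> w i) (n + m)"
      if "q \<in> carrier (direct_sum P Q)" for q
    proof -
      obtain a b where q: "q = (a, b)" and a: "a \<in> carrier P" and b: "b \<in> carrier Q"
        using \<open>q \<in> carrier (direct_sum P Q)\<close> by auto
      have wc: "w i \<in> carrier (direct_sum P Q) \<and> l i q \<in> carrier R" if "i < n + m" for i
        using that u v hs ks by (auto simp: w_def l_def q a b)
      have *: "msum (direct_sum P Q) (\<lambda>i. l i q \<odot>\<^bsub>direct_sum P Q\<^esub> w i) (n + m) =
          msum (direct_sum P Q) (\<lambda>i. l i q \<odot>\<^bsub>direct_sum P Q\<^esub> w i) n \<oplus>\<^bsub>direct_sum P Q\<^esub>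
          msum (direct_sum P Q) (\<lambda>i. l (n + i) q \<odot>\<^bsub>direct_sum P Q\<^esub> w (n + i)) m"
        using wc by (intro PQ.msum_add_index) (auto intro!: PQ.smult_closed simp del: direct_sum_simps)
      have 1: "msum (direct_sum P Q) (\<lambda>i. l i q \<odot>\<^bsub>direct_sum P Q\<^esub> w i) n =
          (msum P (\<lambda>i. h i a \<odot>\<^bsub>P\<^esub> u i) n, \<zero>\<^bsub>Q\<^esub>)"
        using hs a by (subst left[symmetric]) (auto intro!: msum_cong simp: l_def w_def q)
      have 2: "msum (direct_sum P Q) (\<lambda>i. l (n + i) q \<odot>\<^bsub>direct_sum P Q\<^esub> w (n + i)) m =
          (\<zero>\<^bsub>P\<^esub>, msum Q (\<lambda>i. k i b \<odot>\<^bsub>Q\<^esub> v i) m)"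
        using ks b by (subst right[symmetric]) (auto intro!: msum_cong simp: l_def w_def q)
      show ?thesis
        unfolding * 1 2 using a b by (simp add: q uh vk)
    qed
  qed (rule PQ.module_axioms)
qed

section \<open>Resolutions\<close>

lemma resolutionD:
  assumes "resolution R N P d e"
  shows "module R (P i)" "d i \<in> module_hom R (P (Suc i)) (P i)" "e \<in> module_hom R (P 0) N"
    and "\<And>n. n \<in> carrier N \<Longrightarrow> \<exists>p\<in>carrier (P 0). e p = n"
    and "\<And>p. p \<in> carrier (P (Suc 0)) \<Longrightarrow> e (d 0 p) = \<zero>\<^bsub>N\<^esub>"
    and "\<And>p. p \<in> carrier (P 0) \<Longrightarrow> e p = \<zero>\<^bsub>N\<^esub> \<Longrightarrow> \<exists>q\<in>carrier (P (Suc 0)). d 0 q = p"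
    and "\<And>p. p \<in> carrier (P (Suc (Suc i))) \<Longrightarrow> d i (d (Suc i) p) = \<zero>\<^bsub>P i\<^esub>"
    and "\<And>p. p \<in> carrier (P (Suc i)) \<Longrightarrow> d i p = \<zero>\<^bsub>P i\<^esub> \<Longrightarrow>
           \<exists>q\<in>carrier (P (Suc (Suc i))). d (Suc i) q = p"
proof -
  note r = assms[unfolded resolution_def a_kernel_def' One_nat_def]
  show "module R (P i)" "d i \<in> module_hom R (P (Suc i)) (P i)" "e \<in> module_hom R (P 0) N"
    using r by auto
  have 1: "n \<in> carrier N \<longleftrightarrow> (\<exists>p\<in>carrier (P 0). n = e p)" for n
    using r by (auto simp: set_eq_iff image_iff)
  show "\<And>n. n \<in> carrier N \<Longrightarrow> \<exists>p\<in>carrier (P 0). e p = n"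
    using 1 by metis
  have 2: "p \<in> carrier (P 0) \<and> e p = \<zero>\<^bsub>N\<^esub> \<longleftrightarrow> (\<exists>q\<in>carrier (P (Suc 0)). p = d 0 q)" for p
    using r by (auto simp: set_eq_iff image_iff)
  show "\<And>p. p \<in> carrier (P (Suc 0)) \<Longrightarrow> e (d 0 p) = \<zero>\<^bsub>N\<^esub>"
    using 2 by blast
  show "\<And>p. p \<in> carrier (P 0) \<Longrightarrow> e p = \<zero>\<^bsub>N\<^esub> \<Longrightarrow> \<exists>q\<in>carrier (P (Suc 0)). d 0 q = p"
    using 2 by metis
  have *: "p \<in> carrier (P (Suc i)) \<and> d i p = \<zero>\<^bsub>P i\<^esub> \<longleftrightarrow>
     (\<exists>q\<in>carrier (P (Suc (Suc i))). p = d (Suc i) q)" for p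
    using r by (auto simp: set_eq_iff image_iff)
  show "\<And>p. p \<in> carrier (P (Suc (Suc i))) \<Longrightarrow> d i (d (Suc i) p) = \<zero>\<^bsub>P i\<^esub>"
    using * by blast
  show "\<And>p. p \<in> carrier (P (Suc i)) \<Longrightarrow> d i p = \<zero>\<^bsub>P i\<^esub> \<Longrightarrow>
       \<exists>q\<in>carrier (P (Suc (Suc i))). d (Suc i) q = p"
    using * by metis
qed

lemma resolutionI:
  assumes "\<And>i. module R (P i)" "\<And>i. d i \<in> module_hom R (P (Suc i)) (P i)" "e \<in> module_hom R (P 0) N"
    and "\<And>n. n \<in> carrier N \<Longrightarrow> \<exists>p\<in>carrier (P 0). e p = n"
    and "\<And>p. p \<in> carrier (P (Suc 0)) \<Longrightarrow> e (d 0 p) = \<zero>\<^bsub>N\<^esub>"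
    and "\<And>p. p \<in> carrier (P 0) \<Longrightarrow> e p = \<zero>\<^bsub>N\<^esub> \<Longrightarrow> \<exists>q\<in>carrier (P (Suc 0)). d 0 q = p"
    and "\<And>i p. p \<in> carrier (P (Suc (Suc i))) \<Longrightarrow> d i (d (Suc i) p) = \<zero>\<^bsub>P i\<^esub>"
    and "\<And>i p. p \<in> carrier (P (Suc i)) \<Longrightarrow> d i p = \<zero>\<^bsub>P i\<^esub> \<Longrightarrow>
           \<exists>q\<in>carrier (P (Suc (Suc i))). d (Suc i) q = p"
  shows "resolution R N P d e"
proof -
  have e: "e p \<in> carrier N" if "p \<in> carrier (P 0)" for p
    using that assms(3) by (auto simp: module_hom_def)
  have d: "d i p \<in> carrier (P i)" if "p \<in> carrier (P (Suc i))" for i p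
    using that assms(2)[of i] by (auto simp: module_hom_def)
  have "e ` carrier (P 0) = carrier N"
    using assms(4) e by (auto simp: image_iff)
  moreover have "a_kernel (P 0) N e = d 0 ` carrier (P 1)"
    using assms(5,6) d unfolding a_kernel_def' by (auto simp: image_iff)
  moreover have "a_kernel (P (Suc i)) (P i) (d i) = d (Suc i) ` carrier (P (Suc (Suc i)))" for i
    using assms(7,8)[where i = i] d unfolding a_kernel_def' by (auto simp: image_iff)
  ultimately show ?thesis
    unfolding resolution_def using assms(1-3) by blast
qed

text \<open>The map leaving \<open>P 0\<close> is the augmentation, the one leaving
  \<open>P (Suc m)\<close> is \<open>d m\<close>. The case distinction lets degree 0 share its
  inductions with the higher degrees.\<close>

definition cyc :: "('a, 'b, 'm) module_scheme \<Rightarrow> (nat \<Rightarrow> ('a, 'p) module)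
      \<Rightarrow> (nat \<Rightarrow> 'p \<Rightarrow> 'p) \<Rightarrow> ('p \<Rightarrow> 'b) \<Rightarrow> nat \<Rightarrow> 'p \<Rightarrow> bool" where
  "cyc N P d e n p \<longleftrightarrow> (case n of 0 \<Rightarrow> e p = \<zero>\<^bsub>N\<^esub> | Suc m \<Rightarrow> d m p = \<zero>\<^bsub>P m\<^esub>)"

lemma resolution_cyc:
  assumes "resolution R N P d e"
  shows "p \<in> carrier (P n) \<Longrightarrow> cyc N P d e n p \<Longrightarrow> \<exists>q\<in>carrier (P (Suc n)). d n q = p"
    and "q \<in> carrier (P (Suc n)) \<Longrightarrow> cyc N P d e n (d n q)"
  using resolutionD[OF assms] by (auto simp: cyc_def split: nat.splits)

text \<open>The comparison theorem, with a mere complex \<open>X\<close> over \<open>N\<close> at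
  the source: exactness of \<open>P\<close> lets one lift degree by degree. The horseshoe
  construction applies it to a shifted complex with changed signs.\<close>

lemma lift_chain_map:
  assumes res: "resolution R N P d e" and N: "module R N"
    and X: "\<And>k. module R (X k)" "\<And>k. D k \<in> module_hom R (X (Suc k)) (X k)"
    and DD: "\<And>k x. x \<in> carrier (X (Suc (Suc k))) \<Longrightarrow> D k (D (Suc k) x) = \<zero>\<^bsub>X k\<^esub>"
    and f: "f \<in> module_hom R (X 0) N" "\<And>x. x \<in> carrier (X (Suc 0)) \<Longrightarrow> f (D 0 x) = \<zero>\<^bsub>N\<^esub>"
    and proj: "\<And>k. linear_choice R (X k) (P k)"
  shows "\<exists>\<alpha>. (\<forall>k. \<alpha> k \<in> module_hom R (X k) (P k)) \<and> (\<forall>x\<in>carrier (X 0). e (\<alpha> 0 x) = f x) \<and>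
    (\<forall>k. \<forall>x\<in>carrier (X (Suc k)). d k (\<alpha> (Suc k) x) = \<alpha> k (D k x))"
proof -
  note P = resolutionD[OF res]
  note es = hom_simps[OF P(3) P(1) N]
  note ds = hom_simps[OF P(2) P(1) P(1)]
  note Ds = hom_simps[OF X(2) X(1) X(1)]
  note fs = hom_simps[OF f(1) X(1) N]
  \<comment> \<open>\<open>A n a\<close> includes that \<open>a\<close> after \<open>D n\<close> has
    values in cycles, which is what allows the next lift; \<open>B\<close> ties consecutive lifts
    together.\<close>
  define A where "A n a \<longleftrightarrow> a \<in> module_hom R (X n) (P n) \<and>
    (n = 0 \<longrightarrow> (\<forall>x\<in>carrier (X 0). e (a x) = f x)) \<and> (\<forall>x\<in>carrier (X (Suc n)). cyc N P d e n (a (D n x)))" for n a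
  define B where "B n a b \<longleftrightarrow> (\<forall>x\<in>carrier (X (Suc n)). d n (b x) = a (D n x))" for n a b
  have "\<exists>a. A 0 a"
  proof -
    obtain a where a: "a \<in> module_hom R (X 0) (P 0)" "\<And>x. x \<in> carrier (X 0) \<Longrightarrow> e (a x) = f x"
      by (rule linear_choiceE[OF proj[of 0], where \<Phi> = "\<lambda>x p. e p = f x"])
        (auto simp: es fs intro: P(4))
    then show ?thesis using f(2) Ds by (auto simp: A_def cyc_def)
  qed
  moreover have "\<exists>b. A (Suc n) b \<and> B n a b" if "A n a" for n a
  proof -
    have a: "a \<in> module_hom R (X n) (P n)" and cyc: "\<And>x. x \<in> carrier (X (Suc n)) \<Longrightarrow> cyc N P d e n (a (D n x))"
      using that by (auto simp: A_def)
    note as = hom_simps[OF a X(1) P(1)]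
    obtain b where b: "b \<in> module_hom R (X (Suc n)) (P (Suc n))"
        "\<And>x. x \<in> carrier (X (Suc n)) \<Longrightarrow> d n (b x) = a (D n x)"
    proof (rule linear_choiceE[OF proj[of "Suc n"], where \<Phi> = "\<lambda>x p. d n p = a (D n x)"])
      show "\<exists>l\<in>carrier (P (Suc n)). d n l = a (D n p)" if "p \<in> carrier (X (Suc n))" for p
        using resolution_cyc(1)[OF res _ cyc[OF that]] as Ds that by auto
    qed (auto simp: ds as Ds)
    moreover have "d n (b (D (Suc n) x)) = \<zero>\<^bsub>P n\<^esub>" if "x \<in> carrier (X (Suc (Suc n)))" for x
      using b(2)[of "D (Suc n) x"] that Ds as by (simp add: DD)
    ultimately show ?thesis
      by (auto simp: A_def B_def cyc_def)
  qed
  ultimately obtain \<alpha> where \<alpha>: "\<And>n. A n (\<alpha> n) \<and> B n (\<alpha> n) (\<alpha> (Suc n))"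
    using dependent_nat_choice[of A B] by blast
  show ?thesis
    by (rule exI[of _ \<alpha>]) (use \<alpha> in \<open>auto simp: A_def B_def\<close>)
qed

text \<open>The usual recursion: \<open>g\<close> minus the identity minus the part of the homotopy
  already built has values in cycles, which lift by exactness. The formula is recorded from degree 1
  on, the degrees that \<open>ext_van\<close> speaks of.\<close>

lemma chain_homotopy_id:
  assumes res: "resolution R N P d e" and N: "module R N"
    and g: "\<And>k. g k \<in> module_hom R (P k) (P k)"
    and eg: "\<And>p. p \<in> carrier (P 0) \<Longrightarrow> e (g 0 p) = e p"
    and dg: "\<And>k p. p \<in> carrier (P (Suc k)) \<Longrightarrow> d k (g (Suc k) p) = g k (d k p)"
    and proj: "\<And>k. linear_choice R (P k) (P (Suc k))"
  obtains h where "\<And>k. h k \<in> module_hom R (P k) (P (Suc k))"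
    and "\<And>k p. p \<in> carrier (P (Suc k)) \<Longrightarrow>
           g (Suc k) p = p \<oplus>\<^bsub>P (Suc k)\<^esub> (h k (d k p) \<oplus>\<^bsub>P (Suc k)\<^esub> d (Suc k) (h (Suc k) p))"
proof -
  note P = resolutionD[OF res]
  note es = hom_simps[OF P(3) P(1) N]
  note ds = hom_simps[OF P(2) P(1) P(1)]
  note gs = hom_simps[OF g P(1) P(1)]
  \<comment> \<open>\<open>A n h\<close> keeps only what the next step uses:
    \<open>g (Suc n) p\<close> and the sum of \<open>p\<close> and \<open>h (d n p)\<close> have the
    same image under \<open>d n\<close>. In degree 0 this comes from \<open>g 0 p\<close> being
    \<open>p\<close> plus a boundary.\<close>
  define A where "A n h \<longleftrightarrow> h \<in> module_hom R (P n) (P (Suc n)) \<and>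
    (\<forall>p\<in>carrier (P (Suc n)). d n (g (Suc n) p) = d n p \<oplus>\<^bsub>P n\<^esub> d n (h (d n p)))" for n h
  define B where "B n h h' \<longleftrightarrow> (\<forall>p\<in>carrier (P (Suc n)).
      g (Suc n) p = p \<oplus>\<^bsub>P (Suc n)\<^esub> (h (d n p) \<oplus>\<^bsub>P (Suc n)\<^esub> d (Suc n) (h' p)))" for n h h'
  have "\<exists>h. A 0 h"
  proof -
    interpret P0: module R "P 0" by (rule P)
    interpret N: module R N by (rule N)
    obtain h where h: "h \<in> module_hom R (P 0) (P (Suc 0))"
        "\<And>p. p \<in> carrier (P 0) \<Longrightarrow> g 0 p = p \<oplus>\<^bsub>P 0\<^esub> d 0 (h p)"
    proof (rule linear_choiceE[OF proj[of 0], where \<Phi> = "\<lambda>p l. g 0 p = p \<oplus>\<^bsub>P 0\<^esub> d 0 l"])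
      fix p assume p: "p \<in> carrier (P 0)"
      have "e (g 0 p \<ominus>\<^bsub>P 0\<^esub> p) = \<zero>\<^bsub>N\<^esub>"
        using p by (simp add: es gs eg N.M.minus_other_side)
      then obtain q where q: "q \<in> carrier (P (Suc 0))" "d 0 q = g 0 p \<ominus>\<^bsub>P 0\<^esub> p"
        using P(6)[of "g 0 p \<ominus>\<^bsub>P 0\<^esub> p"] p gs by auto
      have "g 0 p = p \<oplus>\<^bsub>P 0\<^esub> d 0 q"
        unfolding q(2) using p gs(1)[OF p] by algebra
      then show "\<exists>l\<in>carrier (P (Suc 0)). g 0 p = p \<oplus>\<^bsub>P 0\<^esub> d 0 l"
        using q(1) by blast
    qed (simp_all add: ds gs P0.a_ac P0.smult_r_distr)
    have "A 0 h"
      unfolding A_def using h(1) dg[of _ 0] h(2) ds by simp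
    then show ?thesis by blast
  qed
  moreover have "\<exists>h'. A (Suc n) h' \<and> B n h h'" if "A n h" for n h
  proof -
    interpret P0: module R "P n" by (rule P)
    interpret P1: module R "P (Suc n)" by (rule P)
    have h: "h \<in> module_hom R (P n) (P (Suc n))"
      and hd: "\<And>p. p \<in> carrier (P (Suc n)) \<Longrightarrow> d n (g (Suc n) p) = d n p \<oplus>\<^bsub>P n\<^esub> d n (h (d n p))"
      using that by (auto simp: A_def)
    note hs = hom_simps[OF h P(1) P(1)]
    obtain h' where h': "h' \<in> module_hom R (P (Suc n)) (P (Suc (Suc n)))"
        "\<And>p. p \<in> carrier (P (Suc n)) \<Longrightarrow>
           g (Suc n) p = p \<oplus>\<^bsub>P (Suc n)\<^esub> (h (d n p) \<oplus>\<^bsub>P (Suc n)\<^esub> d (Suc n) (h' p))"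
    proof (rule linear_choiceE[OF proj[of "Suc n"], where
          \<Phi> = "\<lambda>p l. g (Suc n) p = p \<oplus>\<^bsub>P (Suc n)\<^esub> (h (d n p) \<oplus>\<^bsub>P (Suc n)\<^esub> d (Suc n) l)"])
      fix p assume p: "p \<in> carrier (P (Suc n))"
      let ?w = "g (Suc n) p \<ominus>\<^bsub>P (Suc n)\<^esub> (p \<oplus>\<^bsub>P (Suc n)\<^esub> h (d n p))"
      have c: "h (d n p) \<in> carrier (P (Suc n))" "g (Suc n) p \<in> carrier (P (Suc n))"
        "d n (h (d n p)) \<in> carrier (P n)" "d n p \<in> carrier (P n)"
        using p by (auto simp: hs ds gs)
      have "d n ?w = \<zero>\<^bsub>P n\<^esub>"
        using p c by (simp add: ds hd P0.M.minus_other_side)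
      then obtain q where q: "q \<in> carrier (P (Suc (Suc n)))" "d (Suc n) q = ?w"
        using P(8)[of ?w n] p c by auto
      have "g (Suc n) p = p \<oplus>\<^bsub>P (Suc n)\<^esub> (h (d n p) \<oplus>\<^bsub>P (Suc n)\<^esub> d (Suc n) q)"
        unfolding q(2) using p c by algebra
      then show "\<exists>l\<in>carrier (P (Suc (Suc n))).
          g (Suc n) p = p \<oplus>\<^bsub>P (Suc n)\<^esub> (h (d n p) \<oplus>\<^bsub>P (Suc n)\<^esub> d (Suc n) l)"
        using q(1) by blast
    qed (simp_all add: ds gs hs P1.a_ac P1.smult_r_distr)
    have "A (Suc n) h'"
      unfolding A_def
    proof (intro conjI ballI)
      fix p assume p: "p \<in> carrier (P (Suc (Suc n)))"
      show "d (Suc n) (g (Suc (Suc n)) p) =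
          d (Suc n) p \<oplus>\<^bsub>P (Suc n)\<^esub> d (Suc n) (h' (d (Suc n) p))"
        using p h'(1) hom_simps(1)[OF h'(1) P(1) P(1)]
        by (simp add: dg h'(2) ds P(7) hs)
    qed (rule h')
    then show ?thesis using h'(2) by (auto simp: B_def)
  qed
  ultimately obtain h where h: "\<And>n. A n (h n) \<and> B n (h n) (h (Suc n))"
    using dependent_nat_choice[of A B] by blast
  show thesis
    by (rule that[of h]) (use h in \<open>auto simp: A_def B_def\<close>)
qed

text \<open>\<open>ext_van R P d L i\<close>: the cohomology of \<open>Hom(P, L)\<close> in degree \<open>i + 1\<close> vanishes.\<close>

definition ext_van :: "('a, 'r) ring_scheme \<Rightarrow> (nat \<Rightarrow> ('a, 'p) module) \<Rightarrow> (nat \<Rightarrow> 'p \<Rightarrow> 'p)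
      \<Rightarrow> ('a, 'l, 'n) module_scheme \<Rightarrow> nat \<Rightarrow> bool" where
  "ext_van R P d L i \<longleftrightarrow> (\<forall>c\<in>module_hom R (P (Suc i)) L.
     (\<forall>p\<in>carrier (P (Suc (Suc i))). c (d (Suc i) p) = \<zero>\<^bsub>L\<^esub>) \<longrightarrow>
     (\<exists>b\<in>module_hom R (P i) L. \<forall>p\<in>carrier (P (Suc i)). c p = b (d i p)))"

lemma ext_vanD:
  assumes "ext_van R P d L i" "c \<in> module_hom R (P (Suc i)) L"
    and "\<And>p. p \<in> carrier (P (Suc (Suc i))) \<Longrightarrow> c (d (Suc i) p) = \<zero>\<^bsub>L\<^esub>"
  obtains b where "b \<in> module_hom R (P i) L" "\<And>p. p \<in> carrier (P (Suc i)) \<Longrightarrow> c p = b (d i p)"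
  using assms unfolding ext_van_def by blast

text \<open>Pull \<open>c\<close> back along \<open>b\<close> to \<open>P\<close>, where it becomes
  the coboundary of \<open>f\<close>. Pulling \<open>f\<close> back along \<open>a\<close> returns
  \<open>c\<close> up to the homotopy, one of whose two terms is killed by the cocycle
  \<open>c\<close>. Projectivity is asked for relative to the given terms, so one resolution may
  consist of projectives that are not finitely generated.\<close>

lemma ext_van_indep:
  assumes resP: "resolution R N P d e" and resQ: "resolution R N Q d' e'"
    and N: "module R N" and L: "module R L"
    and proj: "\<And>k. linear_choice R (P k) (Q k)" "\<And>k. linear_choice R (Q k) (P k)"
      "\<And>k. linear_choice R (Q k) (Q (Suc k))"
    and ev: "ext_van R P d L i"
  shows "ext_van R Q d' L i"
  unfolding ext_van_def
proof (intro ballI impI)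
  fix c assume c: "c \<in> module_hom R (Q (Suc i)) L"
    and cd: "\<forall>p\<in>carrier (Q (Suc (Suc i))). c (d' (Suc i) p) = \<zero>\<^bsub>L\<^esub>"
  note P = resolutionD[OF resP]
  note Q = resolutionD[OF resQ]
  interpret L: module R L by fact
  interpret Qi: module R "Q (Suc i)" by (rule Q)
  note ds = hom_simps[OF P(2) P(1) P(1)]
  note d's = hom_simps[OF Q(2) Q(1) Q(1)]
  note cs = hom_simps[OF c Q(1) L]
  obtain a where "\<forall>k. a k \<in> module_hom R (Q k) (P k)"
      "\<forall>x\<in>carrier (Q 0). e (a 0 x) = e' x"
      "\<forall>k. \<forall>x\<in>carrier (Q (Suc k)). d k (a (Suc k) x) = a k (d' k x)"
    using lift_chain_map[OF resP N Q(1) Q(2) Q(7) Q(3) Q(5) proj(2)] by blast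
  note a = this[rule_format]
  obtain b where "\<forall>k. b k \<in> module_hom R (P k) (Q k)"
      "\<forall>x\<in>carrier (P 0). e' (b 0 x) = e x"
      "\<forall>k. \<forall>x\<in>carrier (P (Suc k)). d' k (b (Suc k) x) = b k (d k x)"
    using lift_chain_map[OF resQ N P(1) P(2) P(7) P(3) P(5) proj(1)] by blast
  note b = this[rule_format]
  note as = hom_simps[OF a(1) Q(1) P(1)]
  note bs = hom_simps[OF b(1) P(1) Q(1)]
  obtain h where h: "\<And>k. h k \<in> module_hom R (Q k) (Q (Suc k))"
      "\<And>k p. p \<in> carrier (Q (Suc k)) \<Longrightarrow> b (Suc k) (a (Suc k) p) =
          p \<oplus>\<^bsub>Q (Suc k)\<^esub> (h k (d' k p) \<oplus>\<^bsub>Q (Suc k)\<^esub> d' (Suc k) (h (Suc k) p))"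
  proof (rule chain_homotopy_id[OF resQ N, where g = "\<lambda>k x. b k (a k x)"])
    show "(\<lambda>x. b k (a k x)) \<in> module_hom R (Q k) (Q k)" for k
      by (rule hom_comp[OF Q(1) a(1) b(1)])
  qed (use a b as proj(3) d's in auto)
  note hs = hom_simps[OF h(1) Q(1) Q(1)]
  have cb: "(\<lambda>x. c (b (Suc i) x)) \<in> module_hom R (P (Suc i)) L"
    by (rule hom_comp[OF P(1) b(1) c])
  have "c (b (Suc i) (d (Suc i) p)) = \<zero>\<^bsub>L\<^esub>" if "p \<in> carrier (P (Suc (Suc i)))" for p
    using b(3)[OF that, symmetric] cd bs(1)[OF that] by simp
  then obtain f where f: "f \<in> module_hom R (P i) L"
      "\<And>p. p \<in> carrier (P (Suc i)) \<Longrightarrow> c (b (Suc i) p) = f (d i p)"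
    by (rule ext_vanD[OF ev cb]) blast+
  note fs = hom_simps[OF f(1) P(1) L]
  show "\<exists>f\<in>module_hom R (Q i) L. \<forall>p\<in>carrier (Q (Suc i)). c p = f (d' i p)"
  proof (intro bexI ballI)
    show "(\<lambda>x. f (a i x) \<ominus>\<^bsub>L\<^esub> c (h i x)) \<in> module_hom R (Q i) L"
      by (rule hom_minus[OF Q(1) L hom_comp[OF Q(1) a(1) f(1)] hom_comp[OF Q(1) h(1) c]])
    fix p assume p: "p \<in> carrier (Q (Suc i))"
    have "f (a i (d' i p)) = c (b (Suc i) (a (Suc i) p))"
      using f(2)[of "a (Suc i) p"] a(3) p as by simp
    also have "\<dots> = c p \<oplus>\<^bsub>L\<^esub> c (h i (d' i p))"
      using p d's hs cd by (simp add: h(2) cs)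
    finally have *: "f (a i (d' i p)) = c p \<oplus>\<^bsub>L\<^esub> c (h i (d' i p))" .
    have "c p \<in> carrier L" "c (h i (d' i p)) \<in> carrier L"
      using p d's hs cs by auto
    then show "c p = f (a i (d' i p)) \<ominus>\<^bsub>L\<^esub> c (h i (d' i p))"
      unfolding * by algebra
  qed
qed

section \<open>Short exact sequences\<close>

definition short_exact :: "('a, 'r) ring_scheme \<Rightarrow> ('a, 'b, 'm) module_scheme \<Rightarrow> ('a, 'c, 'n) module_scheme
    \<Rightarrow> ('a, 'd, 'o) module_scheme \<Rightarrow> ('b \<Rightarrow> 'c) \<Rightarrow> ('c \<Rightarrow> 'd) \<Rightarrow> bool" where
  "short_exact R A B C \<iota> \<pi> \<longleftrightarrow>
     module R A \<and> module R B \<and> module R C \<and> \<iota> \<in> module_hom R A B \<and> \<pi> \<in> module_hom R B C \<and>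
     inj_on \<iota> (carrier A) \<and> (\<forall>c\<in>carrier C. \<exists>b\<in>carrier B. \<pi> b = c) \<and>
     (\<forall>b\<in>carrier B. \<pi> b = \<zero>\<^bsub>C\<^esub> \<longleftrightarrow> (\<exists>a\<in>carrier A. \<iota> a = b))"

lemma short_exactD:
  assumes "short_exact R A B C \<iota> \<pi>"
  shows "module R A" "module R B" "module R C" "\<iota> \<in> module_hom R A B" "\<pi> \<in> module_hom R B C"
    and "\<And>a a'. a \<in> carrier A \<Longrightarrow> a' \<in> carrier A \<Longrightarrow> \<iota> a = \<iota> a' \<longleftrightarrow> a = a'"
    and "\<And>c. c \<in> carrier C \<Longrightarrow> \<exists>b\<in>carrier B. \<pi> b = c"
    and "\<And>b. b \<in> carrier B \<Longrightarrow> \<pi> b = \<zero>\<^bsub>C\<^esub> \<Longrightarrow> \<exists>a\<in>carrier A. \<iota> a = b"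
    and "\<And>a. a \<in> carrier A \<Longrightarrow> \<pi> (\<iota> a) = \<zero>\<^bsub>C\<^esub>"
  using assms unfolding short_exact_def by (auto simp: module_hom_def inj_on_def)

text \<open>\<open>l\<close> lifts the augmentation of \<open>C\<close> to \<open>B\<close>, and
  \<open>t\<close> is a cocycle for the class of the extension. Its sign is chosen so that
  \<open>\<iota> (t q)\<close> and \<open>l (d' 0 q)\<close> cancel, which makes the augmentation of
  the horseshoe resolution kill boundaries.\<close>

lemma connecting_map:
  assumes resC: "resolution R C Q d' e'" and S: "short_exact R A B C \<iota> \<pi>" and fg: "\<And>k. fgp R (Q k)"
  shows "\<exists>l\<in>module_hom R (Q 0) B. \<exists>t\<in>module_hom R (Q (Suc 0)) A. (\<forall>q\<in>carrier (Q 0). \<pi> (l q) = e' q) \<and>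
    (\<forall>q\<in>carrier (Q (Suc 0)). \<iota> (t q) = \<ominus>\<^bsub>B\<^esub> l (d' 0 q)) \<and>
    (\<forall>q\<in>carrier (Q (Suc (Suc 0))). t (d' (Suc 0) q) = \<zero>\<^bsub>A\<^esub>)"
proof -
  note Q = resolutionD[OF resC]
  note S = short_exactD[OF S]
  interpret A: module R A by (rule S)
  interpret B: module R B by (rule S)
  interpret C: module R C by (rule S)
  note e's = hom_simps[OF Q(3) Q(1) S(3)]
  note d's = hom_simps[OF Q(2) Q(1) Q(1)]
  note ios = hom_simps[OF S(4) S(1,2)]
  note ps = hom_simps[OF S(5) S(2,3)]
  obtain l where l: "l \<in> module_hom R (Q 0) B" "\<And>q. q \<in> carrier (Q 0) \<Longrightarrow> \<pi> (l q) = e' q"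
  proof (rule linear_choiceE[OF fgp_linear_choice[OF fg S(2)], where \<Phi> = "\<lambda>q b. \<pi> b = e' q"])
    show "\<exists>b\<in>carrier B. \<pi> b = e' q" if "q \<in> carrier (Q 0)" for q
      using S(7)[of "e' q"] e's that by auto
  qed (auto simp: ps e's)
  note ls = hom_simps[OF l(1) Q(1) S(2)]
  obtain t where t: "t \<in> module_hom R (Q (Suc 0)) A"
      "\<And>q. q \<in> carrier (Q (Suc 0)) \<Longrightarrow> \<iota> (t q) = \<ominus>\<^bsub>B\<^esub> l (d' 0 q)"
  proof (rule linear_choiceE[OF fgp_linear_choice[OF fg S(1)], where \<Phi> = "\<lambda>q a. \<iota> a = \<ominus>\<^bsub>B\<^esub> l (d' 0 q)"])
    show "\<exists>a\<in>carrier A. \<iota> a = \<ominus>\<^bsub>B\<^esub> l (d' 0 q)" if "q \<in> carrier (Q (Suc 0))" for q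
      using S(8)[of "\<ominus>\<^bsub>B\<^esub> l (d' 0 q)"] that by (simp add: ls d's ps l(2) Q(5))
  qed (simp_all add: ios ls d's B.minus_add B.smult_r_minus)
  have "t (d' (Suc 0) q) = \<zero>\<^bsub>A\<^esub>" if q: "q \<in> carrier (Q (Suc (Suc 0)))" for q
  proof -
    have "\<iota> (t (d' (Suc 0) q)) = \<iota> \<zero>\<^bsub>A\<^esub>"
      using q by (simp add: t(2) d's Q(7) ls ios)
    then show ?thesis
      using S(6) q hom_simps(1)[OF t(1) Q(1) S(1)] d's by simp
  qed
  then show ?thesis using l t by blast
qed

text \<open>The differential of the resolution of \<open>B\<close> is triangular. Its off-diagonal
  part \<open>\<theta>\<close> is a chain map over the cocycle \<open>t\<close>, from the complex of
  the \<open>Q (Suc k)\<close> with negated differentials to \<open>P\<close>. \<open>D\<close> and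
  \<open>\<theta>\<close> are returned explicitly because \<open>\<theta>\<close> induces the
  connecting maps of the long exact sequences.\<close>

lemma horseshoe:
  assumes resA: "resolution R A P d e" and resC: "resolution R C Q d' e'"
    and S: "short_exact R A B C \<iota> \<pi>"
    and fg: "\<And>k. fgp R (P k)" "\<And>k. fgp R (Q k)"
  shows "\<exists>D E \<theta>. resolution R B (\<lambda>k. direct_sum (P k) (Q k)) D E \<and>
    (\<forall>k. \<theta> k \<in> module_hom R (Q (Suc k)) (P k)) \<and>
    (\<forall>k. \<forall>q\<in>carrier (Q (Suc (Suc k))). d k (\<theta> (Suc k) q) = \<ominus>\<^bsub>P k\<^esub> \<theta> k (d' (Suc k) q)) \<and>
    D = (\<lambda>k (p, q). (d k p \<oplus>\<^bsub>P k\<^esub> \<theta> k q, d' k q)) \<and>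
    (\<forall>p\<in>carrier (P 0). E (p, \<zero>\<^bsub>Q 0\<^esub>) = \<iota> (e p))"
proof -
  note P = resolutionD[OF resA]
  note Q = resolutionD[OF resC]
  note S = short_exactD[OF S]
  interpret A: module R A by (rule S)
  interpret B: module R B by (rule S)
  interpret C: module R C by (rule S)
  note es = hom_simps[OF P(3) P(1) S(1)]
  note ds = hom_simps[OF P(2) P(1) P(1)]
  note e's = hom_simps[OF Q(3) Q(1) S(3)]
  note d's = hom_simps[OF Q(2) Q(1) Q(1)]
  note ios = hom_simps[OF S(4) S(1,2)]
  note ps = hom_simps[OF S(5) S(2,3)]
  obtain l t where lt: "l \<in> module_hom R (Q 0) B" "t \<in> module_hom R (Q (Suc 0)) A"
      "\<forall>q\<in>carrier (Q 0). \<pi> (l q) = e' q" "\<forall>q\<in>carrier (Q (Suc 0)). \<iota> (t q) = \<ominus>\<^bsub>B\<^esub> l (d' 0 q)"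
      "\<forall>q\<in>carrier (Q (Suc (Suc 0))). t (d' (Suc 0) q) = \<zero>\<^bsub>A\<^esub>"
    using connecting_map[OF resC \<open>short_exact R A B C \<iota> \<pi>\<close> fg(2)] by blast
  note l = lt(1) lt(3)[rule_format] and t = lt(2) lt(4)[rule_format]
  note ls = hom_simps[OF l(1) Q(1) S(2)]
  have t0: "t (\<ominus>\<^bsub>Q (Suc 0)\<^esub> d' (Suc 0) q) = \<zero>\<^bsub>A\<^esub>" if "q \<in> carrier (Q (Suc (Suc 0)))" for q
    using that lt(5) hom_simps[OF t(1) Q(1) S(1)] d's by simp
  have "\<exists>\<theta>. (\<forall>k. \<theta> k \<in> module_hom R (Q (Suc k)) (P k)) \<and>
      (\<forall>x\<in>carrier (Q (Suc 0)). e (\<theta> 0 x) = t x) \<and>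
      (\<forall>k. \<forall>x\<in>carrier (Q (Suc (Suc k))). d k (\<theta> (Suc k) x) = \<theta> k (\<ominus>\<^bsub>Q (Suc k)\<^esub> d' (Suc k) x))"
  proof (rule lift_chain_map[OF resA S(1), where X = "\<lambda>k. Q (Suc k)" and
        D = "\<lambda>k x. \<ominus>\<^bsub>Q (Suc k)\<^esub> d' (Suc k) x"])
    fix k
    show "(\<lambda>x. \<ominus>\<^bsub>Q (Suc k)\<^esub> d' (Suc k) x) \<in> module_hom R (Q (Suc (Suc k))) (Q (Suc k))"
      by (rule hom_uminus[OF Q(1) Q(1) Q(2)])
    show "\<ominus>\<^bsub>Q (Suc k)\<^esub> d' (Suc k) (\<ominus>\<^bsub>Q (Suc (Suc k))\<^esub> d' (Suc (Suc k)) x) = \<zero>\<^bsub>Q (Suc k)\<^esub>"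
      if "x \<in> carrier (Q (Suc (Suc (Suc k))))" for x
    proof -
      interpret Qk: module R "Q (Suc k)" by (rule Q)
      show ?thesis using that by (simp add: d's Q(7))
    qed
  qed (use t t0 Q(1) fgp_linear_choice[OF fg(2) P(1)] in auto)
  then obtain th where "\<forall>k. th k \<in> module_hom R (Q (Suc k)) (P k)"
      "\<forall>x\<in>carrier (Q (Suc 0)). e (th 0 x) = t x"
      "\<forall>k. \<forall>x\<in>carrier (Q (Suc (Suc k))). d k (th (Suc k) x) = th k (\<ominus>\<^bsub>Q (Suc k)\<^esub> d' (Suc k) x)"
    by (elim exE conjE)
  note th = this[rule_format]
  note ts = hom_simps[OF th(1) Q(1) P(1)]
  have th3: "d k (th (Suc k) q) = \<ominus>\<^bsub>P k\<^esub> th k (d' (Suc k) q)" if "q \<in> carrier (Q (Suc (Suc k)))" for k q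
    using that by (simp add: th(3) ts d's)
  have th2: "\<iota> (e (th 0 q)) = \<ominus>\<^bsub>B\<^esub> l (d' 0 q)" if "q \<in> carrier (Q (Suc 0))" for q
    using that by (simp add: th(2) t(2))
  have mPQ: "module R (direct_sum (P k) (Q k))" for k
    by (rule direct_sum_is_module[OF P(1) Q(1)])
  define E where "E = (\<lambda>(p, q). \<iota> (e p) \<oplus>\<^bsub>B\<^esub> l q)"
  define D where "D = (\<lambda>k (p, q). (d k p \<oplus>\<^bsub>P k\<^esub> th k q, d' k q))"
  have Dhom: "D k \<in> module_hom R (direct_sum (P (Suc k)) (Q (Suc k))) (direct_sum (P k) (Q k))" for k
  proof -
    interpret Pk: module R "P k" by (rule P)
    show ?thesis
      by (auto simp: module_hom_def D_def ds ts d's Pk.a_ac Pk.smult_r_distr)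
  qed
  have Ehom: "E \<in> module_hom R (direct_sum (P 0) (Q 0)) B"
    by (auto simp: module_hom_def E_def es ls ios B.a_ac B.smult_r_distr)
  have "resolution R B (\<lambda>k. direct_sum (P k) (Q k)) D E"
  proof (rule resolutionI)
    show "\<exists>x\<in>carrier (direct_sum (P 0) (Q 0)). E x = b" if b: "b \<in> carrier B" for b
    proof -
      obtain q where q: "q \<in> carrier (Q 0)" "e' q = \<pi> b"
        using Q(4)[of "\<pi> b"] ps b by auto
      have "\<pi> (b \<ominus>\<^bsub>B\<^esub> l q) = \<zero>\<^bsub>C\<^esub>"
        using q b by (simp add: ps ls l(2))
      then obtain a where a: "a \<in> carrier A" "\<iota> a = b \<ominus>\<^bsub>B\<^esub> l q"
        using S(8)[of "b \<ominus>\<^bsub>B\<^esub> l q"] b ls q by auto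
      obtain p where p: "p \<in> carrier (P 0)" "e p = a"
        using P(4)[OF a(1)] by auto
      have "E (p, q) = (b \<ominus>\<^bsub>B\<^esub> l q) \<oplus>\<^bsub>B\<^esub> l q"
        by (simp add: E_def p a)
      also have "\<dots> = b"
        using b ls(1)[OF q(1)] by algebra
      finally show ?thesis
        using p q by auto
    qed
    show "E (D 0 x) = \<zero>\<^bsub>B\<^esub>" if x0: "x \<in> carrier (direct_sum (P (Suc 0)) (Q (Suc 0)))" for x
    proof -
      obtain p q where x: "x = (p, q)" "p \<in> carrier (P (Suc 0))" "q \<in> carrier (Q (Suc 0))"
        using x0 by auto
      have "l (d' 0 q) \<in> carrier B"
        using x by (simp add: ls d's)
      then show ?thesis
        using x by (simp add: E_def D_def es ds ts ios P(5) th2 B.l_neg)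
    qed
    show "\<exists>y\<in>carrier (direct_sum (P (Suc 0)) (Q (Suc 0))). D 0 y = x"
      if x0: "x \<in> carrier (direct_sum (P 0) (Q 0))" "E x = \<zero>\<^bsub>B\<^esub>" for x
    proof -
      interpret P0: module R "P 0" by (rule P)
      obtain p q where x: "x = (p, q)" "p \<in> carrier (P 0)" "q \<in> carrier (Q 0)"
        using x0 by auto
      have "\<pi> (\<iota> (e p) \<oplus>\<^bsub>B\<^esub> l q) = e' q"
        using x by (simp add: ps ios es ls l(2) S(9) e's)
      then have "e' q = \<zero>\<^bsub>C\<^esub>"
        using x0(2) by (simp add: x E_def ps)
      then obtain q' where q': "q' \<in> carrier (Q (Suc 0))" "d' 0 q' = q"
        using Q(6)[OF x(3)] by auto
      have c: "\<iota> (e p) \<in> carrier B" "\<iota> (e (th 0 q')) \<in> carrier B" "th 0 q' \<in> carrier (P 0)" "l q \<in> carrier B"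
        using x q' by (auto simp: ios es ts ls)
      have "\<iota> (e p) \<oplus>\<^bsub>B\<^esub> l q = \<zero>\<^bsub>B\<^esub>"
        using x0(2) by (simp add: x E_def)
      then have "\<iota> (e p) = \<ominus>\<^bsub>B\<^esub> l q"
        using c B.minus_equality[of "\<iota> (e p)" "l q"] by simp
      then have "\<iota> (e p) = \<iota> (e (th 0 q'))"
        using th2[OF q'(1)] by (simp add: q'(2))
      then have "e (p \<ominus>\<^bsub>P 0\<^esub> th 0 q') = \<zero>\<^bsub>A\<^esub>"
        using x q' c by (simp add: S(6) es)
      then obtain p' where p': "p' \<in> carrier (P (Suc 0))" "d 0 p' = p \<ominus>\<^bsub>P 0\<^esub> th 0 q'"
        using P(6)[of "p \<ominus>\<^bsub>P 0\<^esub> th 0 q'"] c x by auto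
      have "D 0 (p', q') = (p \<ominus>\<^bsub>P 0\<^esub> th 0 q' \<oplus>\<^bsub>P 0\<^esub> th 0 q', q)"
        by (simp add: D_def p' q')
      also have "p \<ominus>\<^bsub>P 0\<^esub> th 0 q' \<oplus>\<^bsub>P 0\<^esub> th 0 q' = p"
        using c(3) x(2) by algebra
      finally show ?thesis
        using p' q' x by auto
    qed
    show "D i (D (Suc i) x) = \<zero>\<^bsub>direct_sum (P i) (Q i)\<^esub>"
      if x0: "x \<in> carrier (direct_sum (P (Suc (Suc i))) (Q (Suc (Suc i))))" for i x
    proof -
      interpret Pi: module R "P i" by (rule P)
      obtain p q where x: "x = (p, q)" "p \<in> carrier (P (Suc (Suc i)))" "q \<in> carrier (Q (Suc (Suc i)))"
        using x0 by auto
      have "th i (d' (Suc i) q) \<in> carrier (P i)"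
        using x by (simp add: ts d's)
      then show ?thesis
        using x by (simp add: D_def ds ts P(7) Q(7) th3 Pi.l_neg)
    qed
    show "\<exists>y\<in>carrier (direct_sum (P (Suc (Suc i))) (Q (Suc (Suc i)))). D (Suc i) y = x"
      if x0: "x \<in> carrier (direct_sum (P (Suc i)) (Q (Suc i)))" "D i x = \<zero>\<^bsub>direct_sum (P i) (Q i)\<^esub>" for i x
    proof -
      interpret Pi: module R "P i" by (rule P)
      interpret P1: module R "P (Suc i)" by (rule P)
      obtain p q where x: "x = (p, q)" "p \<in> carrier (P (Suc i))" "q \<in> carrier (Q (Suc i))"
        using x0 by auto
      have q0: "d' i q = \<zero>\<^bsub>Q i\<^esub>" and p0: "d i p \<oplus>\<^bsub>P i\<^esub> th i q = \<zero>\<^bsub>P i\<^esub>"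
        using x0(2) by (auto simp: x D_def)
      obtain q' where q': "q' \<in> carrier (Q (Suc (Suc i)))" "d' (Suc i) q' = q"
        using Q(8)[OF x(3) q0] by auto
      have c: "d i p \<in> carrier (P i)" "th i q \<in> carrier (P i)" "th (Suc i) q' \<in> carrier (P (Suc i))"
        using x q' by (auto simp: ds ts)
      have "d i p = \<ominus>\<^bsub>P i\<^esub> th i q"
        using c p0 Pi.minus_equality[of "d i p" "th i q"] by simp
      then have "d i (p \<ominus>\<^bsub>P (Suc i)\<^esub> th (Suc i) q') = \<zero>\<^bsub>P i\<^esub>"
        using x q' c by (simp add: ds th3)
      then obtain p' where p': "p' \<in> carrier (P (Suc (Suc i)))" "d (Suc i) p' = p \<ominus>\<^bsub>P (Suc i)\<^esub> th (Suc i) q'"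
        using P(8)[of "p \<ominus>\<^bsub>P (Suc i)\<^esub> th (Suc i) q'" i] c x by auto
      have "D (Suc i) (p', q') = (p \<ominus>\<^bsub>P (Suc i)\<^esub> th (Suc i) q' \<oplus>\<^bsub>P (Suc i)\<^esub> th (Suc i) q', q)"
        by (simp add: D_def p' q')
      also have "p \<ominus>\<^bsub>P (Suc i)\<^esub> th (Suc i) q' \<oplus>\<^bsub>P (Suc i)\<^esub> th (Suc i) q' = p"
        using c(3) x(2) by algebra
      finally show ?thesis
        using p' q' x by auto
    qed
  qed (rule mPQ Dhom Ehom)+
  moreover have "E (p, \<zero>\<^bsub>Q 0\<^esub>) = \<iota> (e p)" if "p \<in> carrier (P 0)" for p
    using that by (simp add: E_def ls ios es)
  ultimately show ?thesis
    using th(1) th3 D_def by blast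
qed

text \<open>The part \<open>Ext\<^sup>i(B) \<rightarrow> Ext\<^sup>i(A) \<rightarrow> Ext\<^sup>i\<^sup>+\<^sup>1(C)\<close> of the long exact sequence.\<close>

lemma ext_van_short_exact:
  assumes resA: "resolution R A P d e" and resC: "resolution R C Q d' e'"
    and S: "short_exact R A B C \<iota> \<pi>" and L: "module R L"
    and fg: "\<And>k. fgp R (P k)" "\<And>k. fgp R (Q k)"
    and vB: "\<And>D E. resolution R B (\<lambda>k. direct_sum (P k) (Q k)) D E \<Longrightarrow>
        ext_van R (\<lambda>k. direct_sum (P k) (Q k)) D L i"
    and vC: "ext_van R Q d' L (Suc i)"
  shows "ext_van R P d L i"
  unfolding ext_van_def
proof (intro ballI impI)
  fix c assume c: "c \<in> module_hom R (P (Suc i)) L"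
    and cd: "\<forall>p\<in>carrier (P (Suc (Suc i))). c (d (Suc i) p) = \<zero>\<^bsub>L\<^esub>"
  note P = resolutionD[OF resA]
  note Q = resolutionD[OF resC]
  interpret L: module R L by fact
  interpret Pi: module R "P (Suc i)" by (rule P)
  note ds = hom_simps[OF P(2) P(1) P(1)]
  note d's = hom_simps[OF Q(2) Q(1) Q(1)]
  note cs = hom_simps[OF c P(1) L]
  obtain D E th where res: "resolution R B (\<lambda>k. direct_sum (P k) (Q k)) D E"
    and th0: "\<forall>k. th k \<in> module_hom R (Q (Suc k)) (P k)"
       "\<forall>k. \<forall>q\<in>carrier (Q (Suc (Suc k))). d k (th (Suc k) q) = \<ominus>\<^bsub>P k\<^esub> th k (d' (Suc k) q)"
    and D: "D = (\<lambda>k (p, q). (d k p \<oplus>\<^bsub>P k\<^esub> th k q, d' k q))"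
    using horseshoe[OF resA resC S fg] by blast
  note th = th0[rule_format]
  note ts = hom_simps[OF th(1) Q(1) P(1)]
  have ct: "(\<lambda>q. c (th (Suc i) q)) \<in> module_hom R (Q (Suc (Suc i))) L"
    by (rule hom_comp[OF Q(1) th(1) c])
  have "c (th (Suc i) (d' (Suc (Suc i)) q)) = \<zero>\<^bsub>L\<^esub>" if "q \<in> carrier (Q (Suc (Suc (Suc i))))" for q
  proof -
    have w: "th (Suc i) (d' (Suc (Suc i)) q) \<in> carrier (P (Suc i))"
      using that by (simp add: ts d's)
    have "c (\<ominus>\<^bsub>P (Suc i)\<^esub> th (Suc i) (d' (Suc (Suc i)) q)) = \<zero>\<^bsub>L\<^esub>"
      using th(2)[OF that, symmetric] cd ts(1)[OF that] by simp
    then have "\<ominus>\<^bsub>L\<^esub> (\<ominus>\<^bsub>L\<^esub> c (th (Suc i) (d' (Suc (Suc i)) q))) = \<ominus>\<^bsub>L\<^esub> \<zero>\<^bsub>L\<^esub>"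
      using w by (simp add: cs)
    then show ?thesis using w cs by simp
  qed
  then obtain f where f: "f \<in> module_hom R (Q (Suc i)) L"
      "\<And>q. q \<in> carrier (Q (Suc (Suc i))) \<Longrightarrow> c (th (Suc i) q) = f (d' (Suc i) q)"
    by (rule ext_vanD[OF vC ct]) blast+
  note fs = hom_simps[OF f(1) Q(1) L]
  \<comment> \<open>Subtracting \<open>f\<close> cancels the contribution of the off-diagonal part
    of \<open>D\<close>, so that \<open>g\<close> is a cocycle on the resolution of
    \<open>B\<close>.\<close>
  define g where "g = (\<lambda>(p, q). c p \<ominus>\<^bsub>L\<^esub> f q)"
  have g: "g \<in> module_hom R (direct_sum (P (Suc i)) (Q (Suc i))) L"
    unfolding g_def module_hom_def
    by (auto simp: cs fs L.minus_eq L.minus_add L.a_ac L.smult_r_distr L.smult_r_minus)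
  have "g (D (Suc i) x) = \<zero>\<^bsub>L\<^esub>" if "x \<in> carrier (direct_sum (P (Suc (Suc i))) (Q (Suc (Suc i))))" for x
  proof -
    obtain p q where x: "x = (p, q)" "p \<in> carrier (P (Suc (Suc i)))" "q \<in> carrier (Q (Suc (Suc i)))"
      using \<open>x \<in> _\<close> by auto
    then show ?thesis
      using cd by (simp add: D g_def ds ts d's cs fs f(2))
  qed
  then obtain b where b: "b \<in> module_hom R (direct_sum (P i) (Q i)) L"
      "\<And>x. x \<in> carrier (direct_sum (P (Suc i)) (Q (Suc i))) \<Longrightarrow> g x = b (D i x)"
    by (rule ext_vanD[OF vB[OF res] g]) blast+
  interpret Pi': module R "P i" by (rule P)
  interpret Qi: module R "Q i" by (rule Q)
  interpret Qi': module R "Q (Suc i)" by (rule Q)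
  have "(\<lambda>p. (p, \<zero>\<^bsub>Q i\<^esub>)) \<in> module_hom R (P i) (direct_sum (P i) (Q i))"
    by (auto simp: module_hom_def)
  from hom_comp[OF P(1) this b(1)]
  have "(\<lambda>p. b (p, \<zero>\<^bsub>Q i\<^esub>)) \<in> module_hom R (P i) L" .
  moreover have "c p = b (d i p, \<zero>\<^bsub>Q i\<^esub>)" if "p \<in> carrier (P (Suc i))" for p
  proof -
    have "c p = g (p, \<zero>\<^bsub>Q (Suc i)\<^esub>)"
      using that by (simp add: g_def fs cs L.minus_eq)
    also have "\<dots> = b (d i p, \<zero>\<^bsub>Q i\<^esub>)"
      using that by (subst b(2)) (auto simp: D ts d's ds)
    finally show ?thesis .
  qed
  ultimately show "\<exists>b\<in>module_hom R (P i) L. \<forall>p\<in>carrier (P (Suc i)). c p = b (d i p)"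
    by (intro bexI[of _ "\<lambda>p. b (p, \<zero>\<^bsub>Q i\<^esub>)"]) auto
qed

section \<open>Weakly regular sequences\<close>

text \<open>Vanishing of Ext in all positive degrees, computed from one resolution by finitely
  generated projectives and by \<open>ext_vanishesD\<close> from every one. The bound resolution has
  the fixed element type \<open>nat \<Rightarrow> 'a\<close>, as a definition cannot quantify over
  types.\<close>

definition ext_vanishes ::
    "('a, 'r) ring_scheme \<Rightarrow> ('a, 'b, 'm) module_scheme \<Rightarrow> ('a, 'l, 'n) module_scheme \<Rightarrow> bool" where
  "ext_vanishes R N L \<longleftrightarrow> (\<exists>(P :: nat \<Rightarrow> ('a, nat \<Rightarrow> 'a) module) d e.
     resolution R N P d e \<and> (\<forall>i. fgp R (P i)) \<and> (\<forall>i. ext_van R P d L i))"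

lemma ext_vanishesD:
  assumes "ext_vanishes R N L" "module R N" "module R L"
    and "resolution R N Q d' e'" "\<And>i. fgp R (Q i)"
  shows "ext_van R Q d' L i"
proof -
  obtain P :: "nat \<Rightarrow> ('a, nat \<Rightarrow> 'a) module" and d e
    where P: "resolution R N P d e" "\<forall>i. fgp R (P i)" "\<forall>i. ext_van R P d L i"
    using assms(1) unfolding ext_vanishes_def by blast
  show ?thesis
    by (rule ext_van_indep[OF P(1) assms(4,2,3)])
      (use P(2,3) assms(5) in \<open>auto intro!: fgp_linear_choice[OF _ fgp_module]\<close>)
qed

lemma ext_vanishes_short_exact:
  fixes P :: "nat \<Rightarrow> ('a, nat \<Rightarrow> 'a) module"
  assumes "short_exact R A B C \<iota> \<pi>" "module R L" "ext_vanishes R B L" "ext_vanishes R C L"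
    and "resolution R A P d e" "\<And>i. fgp R (P i)"
  shows "ext_vanishes R A L"
proof -
  obtain Q :: "nat \<Rightarrow> ('a, nat \<Rightarrow> 'a) module" and d' e'
    where Q: "resolution R C Q d' e'" "\<forall>i. fgp R (Q i)" "\<forall>i. ext_van R Q d' L i"
    using assms(4) unfolding ext_vanishes_def by blast
  have "ext_van R P d L i" for i
  proof (rule ext_van_short_exact[OF assms(5) Q(1) assms(1,2)])
    fix D E assume "resolution R B (\<lambda>k. direct_sum (P k) (Q k)) D E"
    then show "ext_van R (\<lambda>k. direct_sum (P k) (Q k)) D L i"
      using Q(2) assms(6)
      by (intro ext_vanishesD[OF assms(3) short_exactD(2)[OF assms(1)] assms(2)] fgp_direct_sum) auto
  qed (use Q assms(6) in auto)
  then show ?thesis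
    using assms(5,6) unfolding ext_vanishes_def by blast
qed

text \<open>\<open>lmul xs M\<close> is the submodule \<open>(xs)M\<close>, and \<open>wreg xs M\<close> says that the reversed list \<open>xs\<close> is a
  weakly regular sequence on \<open>M\<close>: the head is regular modulo the tail.\<close>

primrec lmul :: "'a list \<Rightarrow> ('a, 'b, 'm) module_scheme \<Rightarrow> 'b set" where
  "lmul [] M = {\<zero>\<^bsub>M\<^esub>}"
| "lmul (x # xs) M = {j \<oplus>\<^bsub>M\<^esub> x \<odot>\<^bsub>M\<^esub> l | j l. j \<in> lmul xs M \<and> l \<in> carrier M}"

primrec wreg :: "'a list \<Rightarrow> ('a, 'b, 'm) module_scheme \<Rightarrow> bool" where
  "wreg [] M \<longleftrightarrow> True"
| "wreg (x # xs) M \<longleftrightarrow> wreg xs M \<and> (\<forall>l\<in>carrier M. x \<odot>\<^bsub>M\<^esub> l \<in> lmul xs M \<longrightarrow> l \<in> lmul xs M)"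

lemma lmul_ConsI: "j \<in> lmul xs M \<Longrightarrow> l \<in> carrier M \<Longrightarrow> j \<oplus>\<^bsub>M\<^esub> x \<odot>\<^bsub>M\<^esub> l \<in> lmul (x # xs) M"
  by auto

lemma submodule_diff:
  assumes "submodule R S M" "a \<in> S" "b \<in> S"
  shows "a \<ominus>\<^bsub>M\<^esub> b \<in> S" "\<ominus>\<^bsub>M\<^esub> b \<in> S"
proof -
  interpret M: module R M by (rule submodule.module) fact
  have b: "b \<in> carrier M" using assms submodule.subset by blast
  have "(\<ominus>\<^bsub>R\<^esub> \<one>\<^bsub>R\<^esub>) \<odot>\<^bsub>M\<^esub> b \<in> S"
    by (rule submodule.smult_closed[OF assms(1)]) (use assms in auto)
  then show *: "\<ominus>\<^bsub>M\<^esub> b \<in> S"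
    using b by (simp add: M.smult_l_minus)
  show "a \<ominus>\<^bsub>M\<^esub> b \<in> S"
    unfolding M.M.minus_eq using assms * by (intro submodule.m_closed[OF assms(1)])
qed

lemma lmul_submodule:
  assumes "module R M" "set xs \<subseteq> carrier R"
  shows "submodule R (lmul xs M) M"
  using assms(2)
proof (induction xs)
  interpret M: module R M by fact
  case Nil
  show ?case by (rule submodule.intro) (auto simp: M.module_axioms)
next
  interpret M: module R M by fact
  case (Cons x xs)
  interpret S: submodule R "lmul xs M" M using Cons by simp
  have x: "x \<in> carrier R" using Cons by simp
  show ?case
  proof (rule submodule.intro)
    show "lmul (x # xs) M \<subseteq> carrier M"
      using S.subset x by auto
    show "\<zero>\<^bsub>M\<^esub> \<in> lmul (x # xs) M"
      using lmul_ConsI[OF S.zero_closed M.M.zero_closed, of x] x by (simp del: lmul.simps)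
    fix v w assume vw: "v \<in> lmul (x # xs) M" "w \<in> lmul (x # xs) M"
    obtain j l where v: "v = j \<oplus>\<^bsub>M\<^esub> x \<odot>\<^bsub>M\<^esub> l" "j \<in> lmul xs M" "l \<in> carrier M"
      using vw(1) by auto
    obtain k m where w: "w = k \<oplus>\<^bsub>M\<^esub> x \<odot>\<^bsub>M\<^esub> m" "k \<in> lmul xs M" "m \<in> carrier M"
      using vw(2) by auto
    have "j \<in> carrier M" "k \<in> carrier M" using v w S.subset by auto
    then have "v \<oplus>\<^bsub>M\<^esub> w = (j \<oplus>\<^bsub>M\<^esub> k) \<oplus>\<^bsub>M\<^esub> x \<odot>\<^bsub>M\<^esub> (l \<oplus>\<^bsub>M\<^esub> m)"
      using v w x by (simp add: M.smult_r_distr M.a_ac)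
    then show "v \<oplus>\<^bsub>M\<^esub> w \<in> lmul (x # xs) M"
      using v w by (auto simp del: lmul.simps intro!: lmul_ConsI)
  next
    fix c v assume c: "c \<in> carrier R" and v: "v \<in> lmul (x # xs) M"
    obtain j l where v: "v = j \<oplus>\<^bsub>M\<^esub> x \<odot>\<^bsub>M\<^esub> l" "j \<in> lmul xs M" "l \<in> carrier M"
      using v by auto
    have "j \<in> carrier M" using v S.subset by auto
    then have "c \<odot>\<^bsub>M\<^esub> v = c \<odot>\<^bsub>M\<^esub> j \<oplus>\<^bsub>M\<^esub> x \<odot>\<^bsub>M\<^esub> (c \<odot>\<^bsub>M\<^esub> l)"
      using v x c by (simp add: M.smult_r_distr M.smult_assoc1[symmetric] M.R.m_comm)
    then show "c \<odot>\<^bsub>M\<^esub> v \<in> lmul (x # xs) M"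
      using v c by (auto simp del: lmul.simps intro!: lmul_ConsI)
  qed (rule M.module_axioms)
qed

lemma lmul_hom:
  assumes "module R M" "module R N" "f \<in> module_hom R M N" "set xs \<subseteq> carrier R" "v \<in> lmul xs M"
  shows "f v \<in> lmul xs N"
  using assms(4,5)
proof (induction xs arbitrary: v)
  case Nil
  then show ?case by (simp add: hom_simps[OF assms(3,1,2)])
next
  case (Cons x xs)
  interpret M: module R M by fact
  obtain j l where v: "v = j \<oplus>\<^bsub>M\<^esub> x \<odot>\<^bsub>M\<^esub> l" "j \<in> lmul xs M" "l \<in> carrier M"
    using Cons by auto
  have "j \<in> carrier M"
    using v Cons.prems submodule.subset[OF lmul_submodule[OF assms(1), of xs]] by auto
  then have "f v = f j \<oplus>\<^bsub>N\<^esub> x \<odot>\<^bsub>N\<^esub> f l"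
    using v Cons.prems by (simp add: hom_simps[OF assms(3,1,2)])
  then show ?case
    using Cons v by (auto simp del: lmul.simps simp: hom_simps[OF assms(3,1,2)] intro!: lmul_ConsI)
qed

lemma lmul_surj:
  assumes "module R F" "module R Y" "\<pi> \<in> module_hom R F Y"
    and surj: "\<And>c. c \<in> carrier Y \<Longrightarrow> \<exists>b\<in>carrier F. \<pi> b = c"
    and "set xs \<subseteq> carrier R" "y \<in> lmul xs Y"
  shows "\<exists>j\<in>lmul xs F. \<pi> j = y"
  using assms(5,6)
proof (induction xs arbitrary: y)
  case Nil
  then show ?case using hom_simps(4)[OF assms(3,1,2)] by auto
next
  interpret F: module R F by fact
  note ps = hom_simps[OF assms(3,1,2)]
  case (Cons z zs)
  then obtain a b where y: "y = a \<oplus>\<^bsub>Y\<^esub> z \<odot>\<^bsub>Y\<^esub> b" "a \<in> lmul zs Y" "b \<in> carrier Y"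
    by auto
  have z: "z \<in> carrier R" using Cons by simp
  obtain a' where a': "a' \<in> lmul zs F" "\<pi> a' = a"
    using Cons y by auto
  obtain b' where b': "b' \<in> carrier F" "\<pi> b' = b"
    using surj[OF y(3)] by auto
  have "a' \<in> carrier F"
    using a' Cons.prems submodule.subset[OF lmul_submodule[OF assms(1), of zs]] by auto
  then have "\<pi> (a' \<oplus>\<^bsub>F\<^esub> z \<odot>\<^bsub>F\<^esub> b') = y"
    using a' b' y z by (simp add: ps)
  then show ?case using lmul_ConsI[OF a'(1) b'(1), of z] by blast
qed

lemma lmul_iso:
  assumes F: "module R F" and B: "module R B" and b: "b \<in> module_hom R F B"
    and surj: "\<And>c. c \<in> carrier B \<Longrightarrow> \<exists>u\<in>carrier F. b u = c" and inj: "inj_on b (carrier F)"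
    and xs: "set xs \<subseteq> carrier R" and u: "u \<in> carrier F" "b u \<in> lmul xs B"
  shows "u \<in> lmul xs F"
proof -
  obtain j where j: "j \<in> lmul xs F" "b j = b u"
    using lmul_surj[OF F B b surj xs u(2)] by auto
  have "j \<in> carrier F"
    using j(1) submodule.subset[OF lmul_submodule[OF F xs]] by auto
  then show ?thesis using j inj u(1) by (auto dest: inj_onD)
qed

lemma wreg_iso:
  assumes F: "module R F" and B: "module R B" and b: "b \<in> module_hom R F B"
    and surj: "\<And>c. c \<in> carrier B \<Longrightarrow> \<exists>u\<in>carrier F. b u = c" and inj: "inj_on b (carrier F)"
    and xs: "set xs \<subseteq> carrier R" "wreg xs B"
  shows "wreg xs F"
  using xs
proof (induction xs)
  case (Cons x xs)
  have "u \<in> lmul xs F" if u: "u \<in> carrier F" "x \<odot>\<^bsub>F\<^esub> u \<in> lmul xs F" for u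
  proof (rule lmul_iso[OF F B b surj inj _ u(1)])
    have "b (x \<odot>\<^bsub>F\<^esub> u) \<in> lmul xs B"
      using lmul_hom[OF F B b _ u(2)] Cons.prems by auto
    then show "b u \<in> lmul xs B"
      using Cons.prems u hom_simps[OF b F B] by auto
  qed (use Cons.prems in auto)
  then show ?case using Cons by auto
qed simp

text \<open>If \<open>j + x l\<close> dies in \<open>Y\<close>, then \<open>x\<close> times
  \<open>\<pi> l\<close> lies in \<open>(xs)Y\<close>, and by regularity so does
  \<open>\<pi> l\<close>. Hence \<open>l\<close> is in \<open>G\<close> up to an element of
  \<open>(xs)F\<close>, which is absorbed into \<open>j\<close> before the induction continues. In
  terms of quotients, \<open>G/(xs)G\<close> embeds into \<open>F/(xs)F\<close>.\<close>

lemma lmul_short_exact: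
  assumes S: "short_exact R G F Y \<iota> \<pi>" and xs: "set xs \<subseteq> carrier R"
    and reg: "wreg xs Y" and f: "f \<in> lmul xs F" "\<pi> f = \<zero>\<^bsub>Y\<^esub>"
  shows "f \<in> \<iota> ` lmul xs G"
  using xs reg f
proof (induction xs arbitrary: f)
  note S = short_exactD[OF S]
  case Nil
  then show ?case
    using hom_simps(4)[OF S(4) S(1,2)] by auto
next
  note S = short_exactD[OF S]
  interpret G: module R G by (rule S)
  interpret F: module R F by (rule S)
  interpret Y: module R Y by (rule S)
  note ios = hom_simps[OF S(4) S(1,2)]
  note ps = hom_simps[OF S(5) S(2,3)]
  case (Cons x xs)
  have x: "x \<in> carrier R" and xs: "set xs \<subseteq> carrier R" using Cons.prems by auto
  interpret JF: submodule R "lmul xs F" F by (rule lmul_submodule[OF S(2) xs])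
  interpret JG: submodule R "lmul xs G" G by (rule lmul_submodule[OF S(1) xs])
  interpret JY: submodule R "lmul xs Y" Y by (rule lmul_submodule[OF S(3) xs])
  obtain j l where f: "f = j \<oplus>\<^bsub>F\<^esub> x \<odot>\<^bsub>F\<^esub> l" "j \<in> lmul xs F" "l \<in> carrier F"
    using Cons.prems(3) by auto
  have j: "j \<in> carrier F" using f JF.subset by auto
  have "\<pi> j \<oplus>\<^bsub>Y\<^esub> x \<odot>\<^bsub>Y\<^esub> \<pi> l = \<zero>\<^bsub>Y\<^esub>"
    using Cons.prems(4) f j x by (simp add: ps)
  then have "\<ominus>\<^bsub>Y\<^esub> (\<pi> j) = x \<odot>\<^bsub>Y\<^esub> \<pi> l"
    using j f x by (intro Y.minus_equality) (auto simp: ps Y.a_ac)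
  moreover have "\<ominus>\<^bsub>Y\<^esub> (\<pi> j) \<in> lmul xs Y"
    using submodule_diff(2)[OF JY.submodule_axioms _ lmul_hom[OF S(2,3,5) xs f(2)]] JY.zero_closed by blast
  ultimately have "\<pi> l \<in> lmul xs Y"
    using Cons.prems(2) f(3) ps(1) by simp
  obtain j' where j': "j' \<in> lmul xs F" "\<pi> j' = \<pi> l"
    using lmul_surj[OF S(2,3,5,7) xs \<open>\<pi> l \<in> lmul xs Y\<close>] by auto
  have j'c: "j' \<in> carrier F" using j' JF.subset by auto
  have "\<pi> (l \<ominus>\<^bsub>F\<^esub> j') = \<zero>\<^bsub>Y\<^esub>"
    using j' j'c f by (simp add: ps)
  then obtain g where g: "g \<in> carrier G" "\<iota> g = l \<ominus>\<^bsub>F\<^esub> j'"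
    using S(8)[of "l \<ominus>\<^bsub>F\<^esub> j'"] f j'c by auto
  have xg: "x \<odot>\<^bsub>F\<^esub> \<iota> g \<in> carrier F" using x g(1) by (simp add: ios)
  have fe: "f = (j \<oplus>\<^bsub>F\<^esub> x \<odot>\<^bsub>F\<^esub> j') \<oplus>\<^bsub>F\<^esub> x \<odot>\<^bsub>F\<^esub> \<iota> g"
    unfolding g(2) f(1) using j f(3) j'c x by algebra
  have w: "j \<oplus>\<^bsub>F\<^esub> x \<odot>\<^bsub>F\<^esub> j' \<in> lmul xs F"
    using f j' x by auto
  have "\<pi> (j \<oplus>\<^bsub>F\<^esub> x \<odot>\<^bsub>F\<^esub> j') = \<zero>\<^bsub>Y\<^esub>"
    using Cons.prems(4) xg j j'c x g(1) unfolding fe by (simp add: ps ios S(9))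
  then have "j \<oplus>\<^bsub>F\<^esub> x \<odot>\<^bsub>F\<^esub> j' \<in> \<iota> ` lmul xs G"
    using Cons.IH xs Cons.prems(2) w by auto
  then obtain k where k: "k \<in> lmul xs G" "\<iota> k = j \<oplus>\<^bsub>F\<^esub> x \<odot>\<^bsub>F\<^esub> j'"
    by auto
  have "k \<in> carrier G" using k JG.subset by auto
  then have "f = \<iota> (k \<oplus>\<^bsub>G\<^esub> x \<odot>\<^bsub>G\<^esub> g)"
    using g x by (simp add: fe ios k)
  then show ?case
    using lmul_ConsI[OF k(1) g(1), of x] by blast
qed

text \<open>Regularity on \<open>G\<close> is tested in \<open>F\<close>, and
  \<open>lmul_short_exact\<close> brings the conclusion back to \<open>G\<close>: a depth lemma for
  kernels.\<close>

lemma wreg_short_exact: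
  assumes S: "short_exact R G F Y \<iota> \<pi>" and xs: "set xs \<subseteq> carrier R"
    and reg: "wreg xs F" "wreg xs Y"
  shows "wreg xs G"
  using xs reg
proof (induction xs)
  note S' = short_exactD[OF S]
  note ios = hom_simps[OF S'(4) S'(1,2)]
  case (Cons x xs)
  have "g \<in> lmul xs G" if g: "g \<in> carrier G" "x \<odot>\<^bsub>G\<^esub> g \<in> lmul xs G" for g
  proof -
    have "\<iota> (x \<odot>\<^bsub>G\<^esub> g) \<in> lmul xs F"
      using lmul_hom[OF S'(1,2,4) _ g(2)] Cons.prems by auto
    then have "\<iota> g \<in> lmul xs F"
      using Cons.prems g by (simp add: ios)
    then have "\<iota> g \<in> \<iota> ` lmul xs G"
      using Cons.prems g S'(9) by (intro lmul_short_exact[OF S]) auto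
    then obtain k where k: "k \<in> lmul xs G" "\<iota> g = \<iota> k" by auto
    moreover have "k \<in> carrier G"
      using k(1) Cons.prems submodule.subset[OF lmul_submodule[OF S'(1), of xs]] by auto
    ultimately show ?thesis
      using S'(6) g by auto
  qed
  then show ?case using Cons by auto
qed simp

text \<open>Division by \<open>x\<close> modulo \<open>J\<close>: projectivity of \<open>P'\<close>
  lets the quotients be chosen linearly, and regularity of \<open>x\<close> modulo \<open>J\<close>
  passes the vanishing of \<open>f\<close> after \<open>d'\<close> modulo \<open>J\<close> on to
  \<open>c\<close> after \<open>d'\<close>.\<close>

lemma divide_mod_regular:
  assumes J: "submodule R J L" and x: "x \<in> carrier R"
    and reg: "\<And>l. l \<in> carrier L \<Longrightarrow> x \<odot>\<^bsub>L\<^esub> l \<in> J \<Longrightarrow> l \<in> J"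
    and m: "module R P'" "module R P''" and d': "d' \<in> module_hom R P'' P'"
    and lc: "linear_choice R P' L" and f: "f \<in> module_hom R P' L"
    and fd: "\<And>p. p \<in> carrier P'' \<Longrightarrow> f (d' p) \<in> J"
    and fJ: "\<And>p. p \<in> carrier P' \<Longrightarrow> \<exists>j\<in>J. \<exists>l\<in>carrier L. f p = j \<oplus>\<^bsub>L\<^esub> x \<odot>\<^bsub>L\<^esub> l"
  obtains c where "c \<in> module_hom R P' L" "\<And>p. p \<in> carrier P' \<Longrightarrow> f p \<ominus>\<^bsub>L\<^esub> x \<odot>\<^bsub>L\<^esub> c p \<in> J"
    and "\<And>p. p \<in> carrier P'' \<Longrightarrow> c (d' p) \<in> J"
proof -
  interpret J: submodule R J L by fact
  interpret L: module R L by (rule J.module)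
  note fs = hom_simps[OF f m(1) J.module]
  note d's = hom_simps[OF d' m(2,1)]
  obtain c where c: "c \<in> module_hom R P' L" "\<And>p. p \<in> carrier P' \<Longrightarrow> f p \<ominus>\<^bsub>L\<^esub> x \<odot>\<^bsub>L\<^esub> c p \<in> J"
  proof (rule linear_choiceE[OF lc, where \<Phi> = "\<lambda>p l. f p \<ominus>\<^bsub>L\<^esub> x \<odot>\<^bsub>L\<^esub> l \<in> J"])
    fix p assume p: "p \<in> carrier P'"
    obtain j l where jl: "j \<in> J" "l \<in> carrier L" "f p = j \<oplus>\<^bsub>L\<^esub> x \<odot>\<^bsub>L\<^esub> l"
      using fJ[OF p] by blast
    have "j \<in> carrier L" using jl J.subset by auto
    then have "f p \<ominus>\<^bsub>L\<^esub> x \<odot>\<^bsub>L\<^esub> l = j"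
      unfolding jl(3) using jl(2) x by algebra
    then have "f p \<ominus>\<^bsub>L\<^esub> x \<odot>\<^bsub>L\<^esub> l \<in> J"
      using jl(1) by (simp only:)
    then show "\<exists>l\<in>carrier L. f p \<ominus>\<^bsub>L\<^esub> x \<odot>\<^bsub>L\<^esub> l \<in> J"
      using jl(2) by blast
  next
    show "f \<zero>\<^bsub>P'\<^esub> \<ominus>\<^bsub>L\<^esub> x \<odot>\<^bsub>L\<^esub> \<zero>\<^bsub>L\<^esub> \<in> J"
      using x by (simp add: fs L.M.minus_eq)
  next
    fix p q l k
    assume a: "p \<in> carrier P'" "q \<in> carrier P'" "l \<in> carrier L" "k \<in> carrier L"
      "f p \<ominus>\<^bsub>L\<^esub> x \<odot>\<^bsub>L\<^esub> l \<in> J" "f q \<ominus>\<^bsub>L\<^esub> x \<odot>\<^bsub>L\<^esub> k \<in> J"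
    have "f (p \<oplus>\<^bsub>P'\<^esub> q) \<ominus>\<^bsub>L\<^esub> x \<odot>\<^bsub>L\<^esub> (l \<oplus>\<^bsub>L\<^esub> k) =
        (f p \<ominus>\<^bsub>L\<^esub> x \<odot>\<^bsub>L\<^esub> l) \<oplus>\<^bsub>L\<^esub> (f q \<ominus>\<^bsub>L\<^esub> x \<odot>\<^bsub>L\<^esub> k)"
      unfolding fs(2)[OF a(1,2)] using a(3,4) x fs(1)[OF a(1)] fs(1)[OF a(2)] by algebra
    then show "f (p \<oplus>\<^bsub>P'\<^esub> q) \<ominus>\<^bsub>L\<^esub> x \<odot>\<^bsub>L\<^esub> (l \<oplus>\<^bsub>L\<^esub> k) \<in> J"
      using a by simp
  next
    fix r p l
    assume a: "r \<in> carrier R" "p \<in> carrier P'" "l \<in> carrier L" "f p \<ominus>\<^bsub>L\<^esub> x \<odot>\<^bsub>L\<^esub> l \<in> J"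
    have "f (r \<odot>\<^bsub>P'\<^esub> p) \<ominus>\<^bsub>L\<^esub> x \<odot>\<^bsub>L\<^esub> (r \<odot>\<^bsub>L\<^esub> l) = r \<odot>\<^bsub>L\<^esub> (f p \<ominus>\<^bsub>L\<^esub> x \<odot>\<^bsub>L\<^esub> l)"
      using a x fs(1)[OF a(2)]
      by (simp add: fs L.M.minus_eq L.smult_r_distr L.smult_r_minus L.smult_assoc1[symmetric] L.R.m_comm)
    then show "f (r \<odot>\<^bsub>P'\<^esub> p) \<ominus>\<^bsub>L\<^esub> x \<odot>\<^bsub>L\<^esub> (r \<odot>\<^bsub>L\<^esub> l) \<in> J"
      using a by simp
  qed blast
  note cs = hom_simps[OF c(1) m(1) J.module]
  have "c (d' p) \<in> J" if p: "p \<in> carrier P''" for p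
  proof (rule reg)
    have e: "f (d' p) \<in> carrier L" "c (d' p) \<in> carrier L"
      using p d's fs cs by auto
    have "x \<odot>\<^bsub>L\<^esub> c (d' p) = f (d' p) \<ominus>\<^bsub>L\<^esub> (f (d' p) \<ominus>\<^bsub>L\<^esub> x \<odot>\<^bsub>L\<^esub> c (d' p))"
      using e x by algebra
    also have "\<dots> \<in> J"
      using p d's by (intro submodule_diff[OF J] fd c(2)) auto
    finally show "x \<odot>\<^bsub>L\<^esub> c (d' p) \<in> J" .
    show "c (d' p) \<in> carrier L" by fact
  qed
  then show thesis using that c by blast
qed

lemma add_smult_minus:
  assumes "module R L" "x \<in> carrier R" "a \<in> carrier L" "b \<in> carrier L" "c \<in> carrier L"
  shows "a \<ominus>\<^bsub>L\<^esub> x \<odot>\<^bsub>L\<^esub> b = (a \<ominus>\<^bsub>L\<^esub> x \<odot>\<^bsub>L\<^esub> c) \<oplus>\<^bsub>L\<^esub> x \<odot>\<^bsub>L\<^esub> (c \<ominus>\<^bsub>L\<^esub> b)"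
    and "a \<ominus>\<^bsub>L\<^esub> b = (a \<ominus>\<^bsub>L\<^esub> x \<odot>\<^bsub>L\<^esub> c \<ominus>\<^bsub>L\<^esub> b) \<oplus>\<^bsub>L\<^esub> x \<odot>\<^bsub>L\<^esub> c"
proof -
  interpret L: module R L by fact
  show "a \<ominus>\<^bsub>L\<^esub> x \<odot>\<^bsub>L\<^esub> b = (a \<ominus>\<^bsub>L\<^esub> x \<odot>\<^bsub>L\<^esub> c) \<oplus>\<^bsub>L\<^esub> x \<odot>\<^bsub>L\<^esub> (c \<ominus>\<^bsub>L\<^esub> b)"
    using assms(2-) by algebra
  show "a \<ominus>\<^bsub>L\<^esub> b = (a \<ominus>\<^bsub>L\<^esub> x \<odot>\<^bsub>L\<^esub> c \<ominus>\<^bsub>L\<^esub> b) \<oplus>\<^bsub>L\<^esub> x \<odot>\<^bsub>L\<^esub> c"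
    using assms(2-) by algebra
qed

text \<open>If \<open>Ext\<^sup>i(N, L) = 0\<close> for \<open>i > 0\<close>, the same holds for \<open>L/(xs)L\<close>, and \<open>Hom(N, L) \<rightarrow> Hom(N, L/(xs)L)\<close>
  is onto. Quotients are avoided by working with cochains modulo \<open>(xs)L\<close>.\<close>

lemma ext_van_mod_regular:
  assumes L: "module R L" and res: "resolution R N P d e" and fg: "\<And>i. fgp R (P i)"
    and van: "\<And>i. ext_van R P d L i" and xs: "set xs \<subseteq> carrier R" "wreg xs L"
  shows "(\<forall>i c. c \<in> module_hom R (P (Suc i)) L \<longrightarrow>
      (\<forall>p\<in>carrier (P (Suc (Suc i))). c (d (Suc i) p) \<in> lmul xs L) \<longrightarrow>
      (\<exists>b\<in>module_hom R (P i) L. \<forall>p\<in>carrier (P (Suc i)). c p \<ominus>\<^bsub>L\<^esub> b (d i p) \<in> lmul xs L)) \<and>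
    (\<forall>c. c \<in> module_hom R (P 0) L \<longrightarrow>
      (\<forall>p\<in>carrier (P (Suc 0)). c (d 0 p) \<in> lmul xs L) \<longrightarrow>
      (\<exists>b\<in>module_hom R (P 0) L. (\<forall>p\<in>carrier (P (Suc 0)). b (d 0 p) = \<zero>\<^bsub>L\<^esub>) \<and>
        (\<forall>p\<in>carrier (P 0). c p \<ominus>\<^bsub>L\<^esub> b p \<in> lmul xs L)))"
  using xs
proof (induction xs)
  interpret L: module R L by fact
  note P = resolutionD[OF res]
  case Nil
  show ?case
  proof (intro conjI allI impI)
    fix i c
    assume c: "c \<in> module_hom R (P (Suc i)) L"
      and "\<forall>p\<in>carrier (P (Suc (Suc i))). c (d (Suc i) p) \<in> lmul [] L"
    then obtain b where "b \<in> module_hom R (P i) L" "\<And>p. p \<in> carrier (P (Suc i)) \<Longrightarrow> c p = b (d i p)"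
      using ext_vanD[OF van c, of thesis] by auto
    then show "\<exists>b\<in>module_hom R (P i) L. \<forall>p\<in>carrier (P (Suc i)). c p \<ominus>\<^bsub>L\<^esub> b (d i p) \<in> lmul [] L"
      using hom_simps(1)[OF _ P(1) L] hom_simps(1)[OF P(2) P(1) P(1)]
      by (auto intro!: bexI[of _ b] simp: L.M.minus_other_side)
  next
    fix c
    assume c: "c \<in> module_hom R (P 0) L"
      and "\<forall>p\<in>carrier (P (Suc 0)). c (d 0 p) \<in> lmul [] L"
    then show "\<exists>b\<in>module_hom R (P 0) L. (\<forall>p\<in>carrier (P (Suc 0)). b (d 0 p) = \<zero>\<^bsub>L\<^esub>) \<and>
        (\<forall>p\<in>carrier (P 0). c p \<ominus>\<^bsub>L\<^esub> b p \<in> lmul [] L)"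
      using hom_simps(1)[OF c P(1) L]
      by (intro bexI[of _ c]) (auto simp: L.M.minus_other_side)
  qed
next
  interpret L: module R L by fact
  note P = resolutionD[OF res]
  note ds = hom_simps[OF P(2) P(1) P(1)]
  note lc = fgp_linear_choice[OF fg L]
  case (Cons x xs)
  have x: "x \<in> carrier R" and xs: "set xs \<subseteq> carrier R" "wreg xs L"
    and reg: "\<And>l. l \<in> carrier L \<Longrightarrow> x \<odot>\<^bsub>L\<^esub> l \<in> lmul xs L \<Longrightarrow> l \<in> lmul xs L"
    using Cons.prems by auto
  note IH = Cons.IH[OF xs]
  interpret J: submodule R "lmul xs L" L by (rule lmul_submodule[OF L xs(1)])
  \<comment> \<open>A snake argument: \<open>c\<close> after the differential is \<open>x\<close>
    times a cocycle \<open>c'\<close> modulo \<open>(xs)\<close>. By induction \<open>c'\<close> is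
    the coboundary of some \<open>b\<close> modulo \<open>(xs)\<close>, so subtracting
    \<open>x b\<close> makes \<open>c\<close> a cocycle modulo \<open>(xs)\<close>.\<close>
  have step: "\<exists>b\<in>module_hom R (P k) L. (\<lambda>p. c p \<ominus>\<^bsub>L\<^esub> x \<odot>\<^bsub>L\<^esub> b p) \<in> module_hom R (P k) L \<and>
      (\<forall>p\<in>carrier (P (Suc k)). c (d k p) \<ominus>\<^bsub>L\<^esub> x \<odot>\<^bsub>L\<^esub> b (d k p) \<in> lmul xs L)"
    if c: "c \<in> module_hom R (P k) L"
      and cd: "\<And>p. p \<in> carrier (P (Suc k)) \<Longrightarrow> c (d k p) \<in> lmul (x # xs) L" for k c
  proof -
    note cs = hom_simps[OF c P(1) L]
    obtain c' where c': "c' \<in> module_hom R (P (Suc k)) L"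
        "\<And>p. p \<in> carrier (P (Suc k)) \<Longrightarrow> c (d k p) \<ominus>\<^bsub>L\<^esub> x \<odot>\<^bsub>L\<^esub> c' p \<in> lmul xs L"
        "\<And>p. p \<in> carrier (P (Suc (Suc k))) \<Longrightarrow> c' (d (Suc k) p) \<in> lmul xs L"
    proof (rule divide_mod_regular[OF J.submodule_axioms x reg P(1) P(1) P(2) lc
          hom_comp[OF P(1) P(2) c]])
      show "c (d k (d (Suc k) p)) \<in> lmul xs L" if "p \<in> carrier (P (Suc (Suc k)))" for p
        using that by (simp add: P(7) cs)
      show "\<exists>j\<in>lmul xs L. \<exists>l\<in>carrier L. c (d k p) = j \<oplus>\<^bsub>L\<^esub> x \<odot>\<^bsub>L\<^esub> l"
        if "p \<in> carrier (P (Suc k))" for p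
        using cd[OF that] by auto
    qed blast+
    obtain b where b: "b \<in> module_hom R (P k) L"
        "\<And>p. p \<in> carrier (P (Suc k)) \<Longrightarrow> c' p \<ominus>\<^bsub>L\<^esub> b (d k p) \<in> lmul xs L"
      using conjunct1[OF IH] c'(1,3) by blast
    have "(\<lambda>p. c p \<ominus>\<^bsub>L\<^esub> x \<odot>\<^bsub>L\<^esub> b p) \<in> module_hom R (P k) L"
      by (rule hom_minus[OF P(1) L c hom_smult_map[OF P(1) L b(1) x]])
    moreover have "c (d k p) \<ominus>\<^bsub>L\<^esub> x \<odot>\<^bsub>L\<^esub> b (d k p) \<in> lmul xs L" if p: "p \<in> carrier (P (Suc k))" for p
    proof -
      have "c (d k p) \<in> carrier L" "b (d k p) \<in> carrier L" "c' p \<in> carrier L"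
        using p hom_simps(1)[OF b(1) P(1) L] hom_simps(1)[OF c'(1) P(1) L] by (auto simp: cs ds)
      from add_smult_minus(1)[OF L x this] show ?thesis
        using c'(2)[OF p] b(2)[OF p] x by simp
    qed
    ultimately show ?thesis using b(1) by blast
  qed
  show ?case
  proof (intro conjI allI impI)
    fix i c
    assume c: "c \<in> module_hom R (P (Suc i)) L"
      and cd: "\<forall>p\<in>carrier (P (Suc (Suc i))). c (d (Suc i) p) \<in> lmul (x # xs) L"
    obtain b where b: "b \<in> module_hom R (P (Suc i)) L"
        "(\<lambda>p. c p \<ominus>\<^bsub>L\<^esub> x \<odot>\<^bsub>L\<^esub> b p) \<in> module_hom R (P (Suc i)) L"
        "\<forall>p\<in>carrier (P (Suc (Suc i))). c (d (Suc i) p) \<ominus>\<^bsub>L\<^esub> x \<odot>\<^bsub>L\<^esub> b (d (Suc i) p) \<in> lmul xs L"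
      using step[OF c cd[rule_format]] by blast
    obtain a where a: "a \<in> module_hom R (P i) L"
        "\<forall>p\<in>carrier (P (Suc i)). c p \<ominus>\<^bsub>L\<^esub> x \<odot>\<^bsub>L\<^esub> b p \<ominus>\<^bsub>L\<^esub> a (d i p) \<in> lmul xs L"
      using conjunct1[OF IH, rule_format, OF b(2)] b(3) by blast
    have "c p \<ominus>\<^bsub>L\<^esub> a (d i p) \<in> lmul (x # xs) L" if p: "p \<in> carrier (P (Suc i))" for p
    proof -
      have "c p \<in> carrier L" "a (d i p) \<in> carrier L" "b p \<in> carrier L"
        using p hom_simps(1)[OF a(1) P(1) L] hom_simps(1)[OF b(1) P(1) L] hom_simps(1)[OF c P(1) L] ds
        by auto
      then show ?thesis
        using add_smult_minus(2)[OF L x, of "c p" "a (d i p)" "b p"] a(2) p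
        by (simp del: lmul.simps add: lmul_ConsI)
    qed
    then show "\<exists>b\<in>module_hom R (P i) L. \<forall>p\<in>carrier (P (Suc i)). c p \<ominus>\<^bsub>L\<^esub> b (d i p) \<in> lmul (x # xs) L"
      using a(1) by blast
  next
    fix c
    assume c: "c \<in> module_hom R (P 0) L"
      and cd: "\<forall>p\<in>carrier (P (Suc 0)). c (d 0 p) \<in> lmul (x # xs) L"
    obtain b where b: "b \<in> module_hom R (P 0) L"
        "(\<lambda>p. c p \<ominus>\<^bsub>L\<^esub> x \<odot>\<^bsub>L\<^esub> b p) \<in> module_hom R (P 0) L"
        "\<forall>p\<in>carrier (P (Suc 0)). c (d 0 p) \<ominus>\<^bsub>L\<^esub> x \<odot>\<^bsub>L\<^esub> b (d 0 p) \<in> lmul xs L"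
      using step[OF c cd[rule_format]] by blast
    obtain a where a: "a \<in> module_hom R (P 0) L" "\<forall>p\<in>carrier (P (Suc 0)). a (d 0 p) = \<zero>\<^bsub>L\<^esub>"
        "\<forall>p\<in>carrier (P 0). c p \<ominus>\<^bsub>L\<^esub> x \<odot>\<^bsub>L\<^esub> b p \<ominus>\<^bsub>L\<^esub> a p \<in> lmul xs L"
      using conjunct2[OF IH, rule_format, OF b(2)] b(3) by blast
    have "c p \<ominus>\<^bsub>L\<^esub> a p \<in> lmul (x # xs) L" if p: "p \<in> carrier (P 0)" for p
    proof -
      have "c p \<in> carrier L" "a p \<in> carrier L" "b p \<in> carrier L"
        using p hom_simps(1)[OF a(1) P(1) L] hom_simps(1)[OF b(1) P(1) L] hom_simps(1)[OF c P(1) L]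
        by auto
      then show ?thesis
        using add_smult_minus(2)[OF L x, of "c p" "a p" "b p"] a(3) p
        by (simp del: lmul.simps add: lmul_ConsI)
    qed
    then show "\<exists>b\<in>module_hom R (P 0) L. (\<forall>p\<in>carrier (P (Suc 0)). b (d 0 p) = \<zero>\<^bsub>L\<^esub>) \<and>
        (\<forall>p\<in>carrier (P 0). c p \<ominus>\<^bsub>L\<^esub> b p \<in> lmul (x # xs) L)"
      using a(1,2) by blast
  qed
qed

section \<open>Homomorphism modules modulo a weakly regular sequence\<close>

lemma hom_factor:
  assumes X: "module R X" and N: "module R N" and L: "module R L"
    and e: "e \<in> module_hom R X N" "\<And>n. n \<in> carrier N \<Longrightarrow> \<exists>p\<in>carrier X. e p = n"
    and b: "b \<in> module_hom R X L" "\<And>p. p \<in> carrier X \<Longrightarrow> e p = \<zero>\<^bsub>N\<^esub> \<Longrightarrow> b p = \<zero>\<^bsub>L\<^esub>"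
  shows "\<exists>g\<in>module_hom R N L. \<forall>p\<in>carrier X. g (e p) = b p"
proof -
  interpret L: module R L by fact
  interpret X: module R X by fact
  note es = hom_simps[OF e(1) X N]
  note bs = hom_simps[OF b(1) X L]
  define s where "s n = (SOME p. p \<in> carrier X \<and> e p = n)" for n
  have s: "s n \<in> carrier X \<and> e (s n) = n" if "n \<in> carrier N" for n
    unfolding s_def by (rule someI_ex) (use e(2)[OF that] in blast)
  have wd: "b p = b q" if pq: "p \<in> carrier X" "q \<in> carrier X" "e p = e q" for p q
  proof -
    have "e (p \<ominus>\<^bsub>X\<^esub> q) = \<zero>\<^bsub>N\<^esub>"
      using pq es abelian_group.minus_other_side[of N] N by (simp add: module_def)
    then have "b p \<ominus>\<^bsub>L\<^esub> b q = \<zero>\<^bsub>L\<^esub>"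
      using b(2)[of "p \<ominus>\<^bsub>X\<^esub> q"] pq by (simp add: bs)
    then show ?thesis using pq bs by simp
  qed
  have ge: "b (s (e p)) = b p" if "p \<in> carrier X" for p
    using s[of "e p"] that es(1) by (intro wd) auto
  interpret N: module R N by fact
  have "(\<lambda>n. b (s n)) \<in> module_hom R N L"
    unfolding module_hom_def
  proof (intro CollectI conjI allI impI)
    show "(\<lambda>n. b (s n)) \<in> carrier N \<rightarrow> carrier L"
      using s bs by auto
    fix m n assume mn: "m \<in> carrier N \<and> n \<in> carrier N"
    have "b (s (m \<oplus>\<^bsub>N\<^esub> n)) = b (s m \<oplus>\<^bsub>X\<^esub> s n)"
      using mn s[of m] s[of n] s[of "m \<oplus>\<^bsub>N\<^esub> n"] by (intro wd) (auto simp: es)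
    then show "b (s (m \<oplus>\<^bsub>N\<^esub> n)) = b (s m) \<oplus>\<^bsub>L\<^esub> b (s n)"
      using mn s bs by simp
  next
    fix r n assume rn: "r \<in> carrier R \<and> n \<in> carrier N"
    have "b (s (r \<odot>\<^bsub>N\<^esub> n)) = b (r \<odot>\<^bsub>X\<^esub> s n)"
      using rn s[of n] s[of "r \<odot>\<^bsub>N\<^esub> n"] by (intro wd) (auto simp: es)
    then show "b (s (r \<odot>\<^bsub>N\<^esub> n)) = r \<odot>\<^bsub>L\<^esub> b (s n)"
      using rn s bs by simp
  qed
  then show ?thesis
    by (rule bexI[rotated]) (simp add: ge)
qed

lemma resolution_factor:
  assumes res: "resolution R N P d e" and N: "module R N" and L: "module R L"
    and b: "b \<in> module_hom R (P 0) L" "\<forall>p\<in>carrier (P (Suc 0)). b (d 0 p) = \<zero>\<^bsub>L\<^esub>"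
  shows "\<exists>g\<in>module_hom R N L. \<forall>p\<in>carrier (P 0). g (e p) = b p"
proof (rule hom_factor[OF resolutionD(1)[OF res] N L resolutionD(3,4)[OF res] b(1)])
  fix p assume "p \<in> carrier (P 0)" "e p = \<zero>\<^bsub>N\<^esub>"
  then obtain q where "q \<in> carrier (P (Suc 0))" "d 0 q = p"
    using resolutionD(6)[OF res] by blast
  then show "b p = \<zero>\<^bsub>L\<^esub>" using b(2) by auto
qed

lemma eval_hom:
  assumes "module R N" "module R L" "n \<in> carrier N"
  shows "(\<lambda>f. f n) \<in> module_hom R (hom_module R N L) L"
  using assms(3) hom_simps(1)[OF _ assms(1,2)] by (auto simp: module_hom_def[of R "hom_module R N L"])

lemma lmul_hom_module_eval:
  assumes "module R N" "module R L" "set xs \<subseteq> carrier R"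
    and "f \<in> lmul xs (hom_module R N L)" "n \<in> carrier N"
  shows "f n \<in> lmul xs L"
  using lmul_hom[OF hom_module_module[OF assms(1,2)] assms(2) eval_hom[OF assms(1,2,5)] assms(3,4)] .

lemma lmul_hom_moduleI:
  assumes "module R N" "module R L" "x \<in> carrier R"
    and f: "f \<in> carrier (hom_module R N L)" and g: "g \<in> module_hom R N L"
    and m: "(\<lambda>n\<in>carrier N. f n \<ominus>\<^bsub>L\<^esub> x \<odot>\<^bsub>L\<^esub> g n) \<in> lmul xs (hom_module R N L)"
  shows "f \<in> lmul (x # xs) (hom_module R N L)"
proof -
  interpret L: module R L by fact
  have "f n = (f n \<ominus>\<^bsub>L\<^esub> x \<odot>\<^bsub>L\<^esub> g n) \<oplus>\<^bsub>L\<^esub> x \<odot>\<^bsub>L\<^esub> g n" if "n \<in> carrier N" for n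
  proof -
    have "f n \<in> carrier L" "g n \<in> carrier L"
      using that f hom_simps(1)[OF _ assms(1,2)] g by auto
    then show ?thesis using assms(3) by algebra
  qed
  then have "f = (\<lambda>n\<in>carrier N. f n \<ominus>\<^bsub>L\<^esub> x \<odot>\<^bsub>L\<^esub> g n) \<oplus>\<^bsub>hom_module R N L\<^esub>
      x \<odot>\<^bsub>hom_module R N L\<^esub> restrict g (carrier N)"
    using f by (intro extensionalityI[of f "carrier N"]) auto
  then show ?thesis
    using lmul_ConsI[OF m, of "restrict g (carrier N)" x] g assms(1) by simp
qed

text \<open>One element is peeled off at a time: as \<open>P\<close> is projective, the
  decompositions of the values \<open>f p\<close> into \<open>j + x l\<close> can be chosen with
  \<open>l\<close> linear in \<open>p\<close>.\<close>

lemma hom_lmul_fgp: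
  assumes P: "fgp R P" and L: "module R L" and xs: "set xs \<subseteq> carrier R"
    and f: "f \<in> carrier (hom_module R P L)" "\<And>p. p \<in> carrier P \<Longrightarrow> f p \<in> lmul xs L"
  shows "f \<in> lmul xs (hom_module R P L)"
  using xs f
proof (induction xs arbitrary: f)
  case Nil
  then show ?case by (auto intro!: extensionalityI[of _ "carrier P"])
next
  case (Cons x xs)
  interpret L: module R L by fact
  interpret P: module R P using P by (rule fgp_module)
  interpret J: submodule R "lmul xs L" L by (rule lmul_submodule[OF L]) (use Cons.prems in auto)
  have x: "x \<in> carrier R" and f: "f \<in> module_hom R P L"
    using Cons.prems by auto
  note fs = hom_simps[OF f P.module_axioms L]
  obtain c where c: "c \<in> module_hom R P L" "\<And>p. p \<in> carrier P \<Longrightarrow> f p \<ominus>\<^bsub>L\<^esub> x \<odot>\<^bsub>L\<^esub> c p \<in> lmul xs L"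
  proof (rule linear_choiceE[OF fgp_linear_choice[OF P L], where \<Phi> = "\<lambda>p l. f p \<ominus>\<^bsub>L\<^esub> x \<odot>\<^bsub>L\<^esub> l \<in> lmul xs L"])
    fix p assume p: "p \<in> carrier P"
    obtain j l where jl: "j \<in> lmul xs L" "l \<in> carrier L" "f p = j \<oplus>\<^bsub>L\<^esub> x \<odot>\<^bsub>L\<^esub> l"
      using Cons.prems(3)[OF p] by auto
    have "j \<in> carrier L" using jl J.subset by auto
    then have "f p \<ominus>\<^bsub>L\<^esub> x \<odot>\<^bsub>L\<^esub> l = j"
      unfolding jl(3) using jl(2) x by algebra
    then have "f p \<ominus>\<^bsub>L\<^esub> x \<odot>\<^bsub>L\<^esub> l \<in> lmul xs L"
      using jl(1) by (simp only:)
    then show "\<exists>l\<in>carrier L. f p \<ominus>\<^bsub>L\<^esub> x \<odot>\<^bsub>L\<^esub> l \<in> lmul xs L"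
      using jl(2) by blast
  next
    show "f \<zero>\<^bsub>P\<^esub> \<ominus>\<^bsub>L\<^esub> x \<odot>\<^bsub>L\<^esub> \<zero>\<^bsub>L\<^esub> \<in> lmul xs L"
      using x by (simp add: fs L.M.minus_eq)
  next
    fix p q l k
    assume a: "p \<in> carrier P" "q \<in> carrier P" "l \<in> carrier L" "k \<in> carrier L"
      "f p \<ominus>\<^bsub>L\<^esub> x \<odot>\<^bsub>L\<^esub> l \<in> lmul xs L" "f q \<ominus>\<^bsub>L\<^esub> x \<odot>\<^bsub>L\<^esub> k \<in> lmul xs L"
    have "f (p \<oplus>\<^bsub>P\<^esub> q) \<ominus>\<^bsub>L\<^esub> x \<odot>\<^bsub>L\<^esub> (l \<oplus>\<^bsub>L\<^esub> k) =
        (f p \<ominus>\<^bsub>L\<^esub> x \<odot>\<^bsub>L\<^esub> l) \<oplus>\<^bsub>L\<^esub> (f q \<ominus>\<^bsub>L\<^esub> x \<odot>\<^bsub>L\<^esub> k)"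
      unfolding fs(2)[OF a(1,2)] using a(3,4) x fs(1)[OF a(1)] fs(1)[OF a(2)] by algebra
    then show "f (p \<oplus>\<^bsub>P\<^esub> q) \<ominus>\<^bsub>L\<^esub> x \<odot>\<^bsub>L\<^esub> (l \<oplus>\<^bsub>L\<^esub> k) \<in> lmul xs L"
      using a by simp
  next
    fix r p l
    assume a: "r \<in> carrier R" "p \<in> carrier P" "l \<in> carrier L" "f p \<ominus>\<^bsub>L\<^esub> x \<odot>\<^bsub>L\<^esub> l \<in> lmul xs L"
    have "f (r \<odot>\<^bsub>P\<^esub> p) \<ominus>\<^bsub>L\<^esub> x \<odot>\<^bsub>L\<^esub> (r \<odot>\<^bsub>L\<^esub> l) = r \<odot>\<^bsub>L\<^esub> (f p \<ominus>\<^bsub>L\<^esub> x \<odot>\<^bsub>L\<^esub> l)"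
      using a x fs(1)[OF a(2)]
      by (simp add: fs L.M.minus_eq L.smult_r_distr L.smult_r_minus L.smult_assoc1[symmetric] L.R.m_comm)
    then show "f (r \<odot>\<^bsub>P\<^esub> p) \<ominus>\<^bsub>L\<^esub> x \<odot>\<^bsub>L\<^esub> (r \<odot>\<^bsub>L\<^esub> l) \<in> lmul xs L"
      using a by simp
  qed blast
  show ?case
  proof (rule lmul_hom_moduleI[OF P.module_axioms L x Cons.prems(2) c(1)])
    show "(\<lambda>n\<in>carrier P. f n \<ominus>\<^bsub>L\<^esub> x \<odot>\<^bsub>L\<^esub> c n) \<in> lmul xs (hom_module R P L)"
    proof (rule Cons.IH)
      show "(\<lambda>n\<in>carrier P. f n \<ominus>\<^bsub>L\<^esub> x \<odot>\<^bsub>L\<^esub> c n) \<in> carrier (hom_module R P L)"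
        using hom_minus[OF P.module_axioms L f hom_smult_map[OF P.module_axioms L c(1) x]] P.module_axioms
        by (simp only: hom_module_simps Int_iff hom_restrict_iff restrict_extensional simp_thms)
    qed (use Cons.prems c(2) in auto)
  qed
qed

context
  fixes R :: "('a, 'r) ring_scheme" and N :: "('a, 'b, 'm) module_scheme" and L :: "('a, 'l, 'n) module_scheme"
    and xs
  assumes N: "module R N" and L: "module R L" and van: "ext_vanishes R N L" and xs: "set xs \<subseteq> carrier R" "wreg xs L"
begin

text \<open>The quotient by \<open>x\<close> of the pullback of \<open>f\<close> to
  \<open>P 0\<close> kills boundaries only modulo the remaining elements.
  \<open>ext_van_mod_regular\<close> replaces it by a map that kills them exactly and so descends to
  some \<open>g\<close> on \<open>N\<close>; the difference of \<open>f\<close> and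
  \<open>x g\<close> is left to the induction.\<close>

lemma hom_lmul:
  assumes f: "f \<in> carrier (hom_module R N L)" "\<And>n. n \<in> carrier N \<Longrightarrow> f n \<in> lmul xs L"
  shows "f \<in> lmul xs (hom_module R N L)"
proof -
  obtain P :: "nat \<Rightarrow> ('a, nat \<Rightarrow> 'a) module" and d e
    where res: "resolution R N P d e" and fg: "\<And>i. fgp R (P i)" and v: "\<And>i. ext_van R P d L i"
    using van unfolding ext_vanishes_def by blast
  note P = resolutionD[OF res]
  note es = hom_simps[OF P(3) P(1) N]
  interpret L: module R L by (rule L)
  interpret N: module R N by (rule N)
  show ?thesis
    using xs f
  proof (induction xs arbitrary: f)
    case Nil
    then show ?case by (auto intro!: extensionalityI[of _ "carrier N"])
  next
    case (Cons x xs)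
    have x: "x \<in> carrier R" and xs: "set xs \<subseteq> carrier R" "wreg xs L"
      and reg: "\<And>l. l \<in> carrier L \<Longrightarrow> x \<odot>\<^bsub>L\<^esub> l \<in> lmul xs L \<Longrightarrow> l \<in> lmul xs L"
      using Cons.prems by auto
    interpret J: submodule R "lmul xs L" L by (rule lmul_submodule[OF L xs(1)])
    have f: "f \<in> module_hom R N L"
      using Cons.prems by auto
    note fs = hom_simps[OF f N L]
    have fe: "(\<lambda>p. f (e p)) \<in> module_hom R (P 0) L"
      by (rule hom_comp[OF P(1) P(3) f])
    obtain c where c: "c \<in> module_hom R (P 0) L"
        "\<And>p. p \<in> carrier (P 0) \<Longrightarrow> f (e p) \<ominus>\<^bsub>L\<^esub> x \<odot>\<^bsub>L\<^esub> c p \<in> lmul xs L"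
        "\<And>p. p \<in> carrier (P (Suc 0)) \<Longrightarrow> c (d 0 p) \<in> lmul xs L"
    proof (rule divide_mod_regular[OF J.submodule_axioms x reg P(1) P(1) P(2) fgp_linear_choice[OF fg L] fe])
      show "f (e (d 0 p)) \<in> lmul xs L" if "p \<in> carrier (P (Suc 0))" for p
        using that by (simp add: P(5) fs)
      show "\<exists>j\<in>lmul xs L. \<exists>l\<in>carrier L. f (e p) = j \<oplus>\<^bsub>L\<^esub> x \<odot>\<^bsub>L\<^esub> l" if "p \<in> carrier (P 0)" for p
        using Cons.prems(4)[of "e p"] es(1)[OF that] by auto
    qed blast+
    obtain b where b: "b \<in> module_hom R (P 0) L" "\<And>p. p \<in> carrier (P (Suc 0)) \<Longrightarrow> b (d 0 p) = \<zero>\<^bsub>L\<^esub>"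
        "\<And>p. p \<in> carrier (P 0) \<Longrightarrow> c p \<ominus>\<^bsub>L\<^esub> b p \<in> lmul xs L"
      using conjunct2[OF ext_van_mod_regular[OF L res fg v xs]] c(1,3) by blast
    obtain g where g: "g \<in> module_hom R N L" "\<And>p. p \<in> carrier (P 0) \<Longrightarrow> g (e p) = b p"
      using resolution_factor[OF res N L b(1)] b(2) by blast
    have fg: "f n \<ominus>\<^bsub>L\<^esub> x \<odot>\<^bsub>L\<^esub> g n \<in> lmul xs L" if n: "n \<in> carrier N" for n
    proof -
      obtain p where p: "p \<in> carrier (P 0)" "e p = n" using P(4)[OF n] by auto
      have "f n \<in> carrier L" "g n \<in> carrier L" "c p \<in> carrier L"
        using n p fs hom_simps(1)[OF g(1) N L] hom_simps(1)[OF c(1) P(1) L] by auto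
      from add_smult_minus(1)[OF L x this] show ?thesis
        using c(2)[OF p(1)] b(3)[OF p(1)] x g(2)[OF p(1)] by (simp add: p(2))
    qed
    show ?case
    proof (rule lmul_hom_moduleI[OF N L x Cons.prems(3) g(1)])
      show "(\<lambda>n\<in>carrier N. f n \<ominus>\<^bsub>L\<^esub> x \<odot>\<^bsub>L\<^esub> g n) \<in> lmul xs (hom_module R N L)"
      proof (rule Cons.IH)
        show "(\<lambda>n\<in>carrier N. f n \<ominus>\<^bsub>L\<^esub> x \<odot>\<^bsub>L\<^esub> g n) \<in> carrier (hom_module R N L)"
          using hom_minus[OF N L f hom_smult_map[OF N L g(1) x]] N
          by (simp only: hom_module_simps Int_iff hom_restrict_iff restrict_extensional simp_thms)
      qed (use Cons.prems fg in auto)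
    qed
  qed
qed

end

text \<open>A relation modulo \<open>(xs)\<close> in the Hom module holds pointwise in
  \<open>L\<close>, where \<open>x\<close> can be cancelled; \<open>hom_lmul\<close> turns pointwise
  membership back into membership. This takes the place of depth estimates for Hom modules.\<close>

lemma wreg_hom:
  assumes N: "module R N" and L: "module R L" and van: "ext_vanishes R N L"
    and xs: "set xs \<subseteq> carrier R" "wreg xs L"
  shows "wreg xs (hom_module R N L)"
  using xs
proof (induction xs)
  case (Cons x xs)
  have "f \<in> lmul xs (hom_module R N L)"
    if f: "f \<in> carrier (hom_module R N L)"
      and xf: "x \<odot>\<^bsub>hom_module R N L\<^esub> f \<in> lmul xs (hom_module R N L)" for f
  proof (rule hom_lmul[OF N L van _ _ f])
    fix n assume n: "n \<in> carrier N"
    have "x \<odot>\<^bsub>L\<^esub> f n \<in> lmul xs L"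
      using lmul_hom_module_eval[OF N L _ xf n] n Cons.prems by simp
    then show "f n \<in> lmul xs L"
      using Cons.prems hom_simps(1)[OF _ N L, of f] n f by auto
  qed (use Cons.prems in auto)
  then show ?case using Cons by (auto simp del: hom_module_simps)
qed simp

text \<open>Representatives of the linear maps from \<open>N\<close> to \<open>L/J\<close>. The
  values stay in \<open>L\<close>, so no module of cosets is formed.\<close>

definition hom_mod ::
    "('a, 'r) ring_scheme \<Rightarrow> ('a, 'b, 'm) module_scheme \<Rightarrow> ('a, 'l, 'n) module_scheme \<Rightarrow> 'l set \<Rightarrow> ('b \<Rightarrow> 'l) set" where
  "hom_mod R N L J = {f. f \<in> carrier N \<rightarrow> carrier L \<and>
     (\<forall>m\<in>carrier N. \<forall>n\<in>carrier N. f (m \<oplus>\<^bsub>N\<^esub> n) \<ominus>\<^bsub>L\<^esub> (f m \<oplus>\<^bsub>L\<^esub> f n) \<in> J) \<and>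
     (\<forall>r\<in>carrier R. \<forall>n\<in>carrier N. f (r \<odot>\<^bsub>N\<^esub> n) \<ominus>\<^bsub>L\<^esub> r \<odot>\<^bsub>L\<^esub> f n \<in> J)}"

text \<open>Projectivity of \<open>P 0\<close> replaces the pullback of \<open>f\<close> by a linear
  map \<open>c\<close> congruent to it. Then \<open>c\<close> kills boundaries modulo
  \<open>(xs)\<close>, and vanishing of Ext corrects it to a map that kills them exactly and
  descends to \<open>N\<close>.\<close>

lemma hom_mod_lift:
  assumes N: "module R N" and L: "module R L" and van: "ext_vanishes R N L"
    and xs: "set xs \<subseteq> carrier R" "wreg xs L" and f: "f \<in> hom_mod R N L (lmul xs L)"
  shows "\<exists>g\<in>module_hom R N L. \<forall>n\<in>carrier N. f n \<ominus>\<^bsub>L\<^esub> g n \<in> lmul xs L"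
proof -
  obtain P :: "nat \<Rightarrow> ('a, nat \<Rightarrow> 'a) module" and d e
    where res: "resolution R N P d e" and fg: "\<And>i. fgp R (P i)" and v: "\<And>i. ext_van R P d L i"
    using van unfolding ext_vanishes_def by blast
  note P = resolutionD[OF res]
  note es = hom_simps[OF P(3) P(1) N]
  interpret L: module R L by (rule L)
  interpret N: module R N by (rule N)
  interpret J: submodule R "lmul xs L" L by (rule lmul_submodule[OF L xs(1)])
  have fc: "f n \<in> carrier L" if "n \<in> carrier N" for n
    using f that by (auto simp: hom_mod_def)
  have fa: "f (m \<oplus>\<^bsub>N\<^esub> n) \<ominus>\<^bsub>L\<^esub> (f m \<oplus>\<^bsub>L\<^esub> f n) \<in> lmul xs L" if "m \<in> carrier N" "n \<in> carrier N" for m n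
    using f that by (auto simp: hom_mod_def)
  have fm: "f (r \<odot>\<^bsub>N\<^esub> n) \<ominus>\<^bsub>L\<^esub> r \<odot>\<^bsub>L\<^esub> f n \<in> lmul xs L" if "r \<in> carrier R" "n \<in> carrier N" for r n
    using f that by (auto simp: hom_mod_def)
  have f0: "f \<zero>\<^bsub>N\<^esub> \<in> lmul xs L"
    using fm[of "\<zero>\<^bsub>R\<^esub>" "\<zero>\<^bsub>N\<^esub>"] fc[of "\<zero>\<^bsub>N\<^esub>"] by (simp add: L.M.minus_eq)
  obtain c where c: "c \<in> module_hom R (P 0) L" "\<And>p. p \<in> carrier (P 0) \<Longrightarrow> f (e p) \<ominus>\<^bsub>L\<^esub> c p \<in> lmul xs L"
  proof (rule linear_choiceE[OF fgp_linear_choice[OF fg L], where \<Phi> = "\<lambda>p l. f (e p) \<ominus>\<^bsub>L\<^esub> l \<in> lmul xs L"])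
    fix p assume p: "p \<in> carrier (P 0)"
    then show "\<exists>l\<in>carrier L. f (e p) \<ominus>\<^bsub>L\<^esub> l \<in> lmul xs L"
      using fc es(1) by (intro bexI[of _ "f (e p)"]) (auto simp: L.M.minus_eq L.M.r_neg)
  next
    show "f (e \<zero>\<^bsub>P 0\<^esub>) \<ominus>\<^bsub>L\<^esub> \<zero>\<^bsub>L\<^esub> \<in> lmul xs L"
      using f0 fc by (simp add: es L.M.minus_eq)
  next
    fix p q l k
    assume a: "p \<in> carrier (P 0)" "q \<in> carrier (P 0)" "l \<in> carrier L" "k \<in> carrier L"
      "f (e p) \<ominus>\<^bsub>L\<^esub> l \<in> lmul xs L" "f (e q) \<ominus>\<^bsub>L\<^esub> k \<in> lmul xs L"
    have c: "f (e p \<oplus>\<^bsub>N\<^esub> e q) \<in> carrier L" "f (e p) \<in> carrier L" "f (e q) \<in> carrier L"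
      using a fc es by auto
    have "f (e p \<oplus>\<^bsub>N\<^esub> e q) \<ominus>\<^bsub>L\<^esub> (l \<oplus>\<^bsub>L\<^esub> k) =
        (f (e p \<oplus>\<^bsub>N\<^esub> e q) \<ominus>\<^bsub>L\<^esub> (f (e p) \<oplus>\<^bsub>L\<^esub> f (e q))) \<oplus>\<^bsub>L\<^esub>
        ((f (e p) \<ominus>\<^bsub>L\<^esub> l) \<oplus>\<^bsub>L\<^esub> (f (e q) \<ominus>\<^bsub>L\<^esub> k))"
      using a(3,4) c by algebra
    then show "f (e (p \<oplus>\<^bsub>P 0\<^esub> q)) \<ominus>\<^bsub>L\<^esub> (l \<oplus>\<^bsub>L\<^esub> k) \<in> lmul xs L"
      using a fa[of "e p" "e q"] by (simp add: es)
  next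
    fix r p l
    assume a: "r \<in> carrier R" "p \<in> carrier (P 0)" "l \<in> carrier L" "f (e p) \<ominus>\<^bsub>L\<^esub> l \<in> lmul xs L"
    have c: "f (r \<odot>\<^bsub>N\<^esub> e p) \<in> carrier L" "f (e p) \<in> carrier L"
      using a fc es by auto
    have "f (r \<odot>\<^bsub>N\<^esub> e p) \<ominus>\<^bsub>L\<^esub> r \<odot>\<^bsub>L\<^esub> l =
        (f (r \<odot>\<^bsub>N\<^esub> e p) \<ominus>\<^bsub>L\<^esub> r \<odot>\<^bsub>L\<^esub> f (e p)) \<oplus>\<^bsub>L\<^esub> r \<odot>\<^bsub>L\<^esub> (f (e p) \<ominus>\<^bsub>L\<^esub> l)"
      using a(1,3) c by algebra
    then show "f (e (r \<odot>\<^bsub>P 0\<^esub> p)) \<ominus>\<^bsub>L\<^esub> r \<odot>\<^bsub>L\<^esub> l \<in> lmul xs L"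
      using a fm[of r "e p"] by (simp add: es)
  qed blast
  note cs = hom_simps[OF c(1) P(1) L]
  have cd: "c (d 0 p) \<in> lmul xs L" if p: "p \<in> carrier (P (Suc 0))" for p
  proof -
    have p': "d 0 p \<in> carrier (P 0)" using p hom_simps(1)[OF P(2) P(1) P(1)] by simp
    have "f (e (d 0 p)) \<ominus>\<^bsub>L\<^esub> (f (e (d 0 p)) \<ominus>\<^bsub>L\<^esub> c (d 0 p)) \<in> lmul xs L"
      using submodule_diff(1)[OF J.submodule_axioms f0 c(2)[OF p']] p by (simp add: P(5))
    also have "f (e (d 0 p)) \<ominus>\<^bsub>L\<^esub> (f (e (d 0 p)) \<ominus>\<^bsub>L\<^esub> c (d 0 p)) = c (d 0 p)"
      using fc[OF es(1)[OF p']] cs(1)[OF p'] by algebra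
    finally show ?thesis .
  qed
  obtain b where b: "b \<in> module_hom R (P 0) L" "\<And>p. p \<in> carrier (P (Suc 0)) \<Longrightarrow> b (d 0 p) = \<zero>\<^bsub>L\<^esub>"
      "\<And>p. p \<in> carrier (P 0) \<Longrightarrow> c p \<ominus>\<^bsub>L\<^esub> b p \<in> lmul xs L"
    using conjunct2[OF ext_van_mod_regular[OF L res fg v xs]] c(1) cd by blast
  obtain g where g: "g \<in> module_hom R N L" "\<And>p. p \<in> carrier (P 0) \<Longrightarrow> g (e p) = b p"
    using resolution_factor[OF res N L b(1)] b(2) by blast
  have "f n \<ominus>\<^bsub>L\<^esub> g n \<in> lmul xs L" if n: "n \<in> carrier N" for n
  proof -
    obtain p where p: "p \<in> carrier (P 0)" "e p = n" using P(4)[OF n] by auto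
    have cl: "f n \<in> carrier L" "g n \<in> carrier L" "c p \<in> carrier L"
      using n p fc hom_simps(1)[OF g(1) N L] cs by auto
    have "f n \<ominus>\<^bsub>L\<^esub> g n = (f n \<ominus>\<^bsub>L\<^esub> c p) \<oplus>\<^bsub>L\<^esub> (c p \<ominus>\<^bsub>L\<^esub> g n)"
      using cl by algebra
    then show ?thesis
      using c(2)[OF p(1)] b(3)[OF p(1)] g(2)[OF p(1)] by (simp add: p(2))
  qed
  then show ?thesis using g(1) by blast
qed

section \<open>Extending functionals\<close>

text \<open>Generation is used in this form: to show a property of all elements of \<open>N\<close>,
  exhibit a submodule that contains the generators.\<close>

lemma finite_moduleD:
  assumes "finite_module R N"
  obtains A where "finite A" "A \<subseteq> carrier N" "\<And>T. submodule R T N \<Longrightarrow> A \<subseteq> T \<Longrightarrow> T = carrier N"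
proof -
  interpret N: module R N using assms by (simp add: finite_module_def)
  obtain A where A: "finite A" "A \<subseteq> carrier N" "N.span A = carrier N"
    using assms by (auto simp: finite_module_def)
  show thesis
  proof (rule that[OF A(1,2)])
    fix T assume T: "submodule R T N" "A \<subseteq> T"
    show "T = carrier N"
      using N.span_is_subset[OF T(2,1)] A(3) submodule.subset[OF T(1)] by auto
  qed
qed

lemma finite_moduleI:
  assumes "module R N" "finite A" "A \<subseteq> carrier N"
    and "\<And>T. submodule R T N \<Longrightarrow> A \<subseteq> T \<Longrightarrow> carrier N \<subseteq> T"
  shows "finite_module R N"
proof -
  interpret N: module R N by fact
  have "carrier N \<subseteq> N.span A"
    using assms(4)[OF N.span_is_submodule[OF assms(3)] N.in_own_span[OF assms(3)]] .
  then have "N.span A = carrier N"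
    using N.span_is_subset2[OF assms(3)] by auto
  then show ?thesis
    using assms(1-3) unfolding finite_module_def by blast
qed

lemma adjoin_submodule:
  assumes W: "submodule R W N" and a: "a \<in> carrier N"
  shows "submodule R {w \<oplus>\<^bsub>N\<^esub> r \<odot>\<^bsub>N\<^esub> a | w r. w \<in> W \<and> r \<in> carrier R} N" (is "submodule R ?T N")
    and "W \<subseteq> {w \<oplus>\<^bsub>N\<^esub> r \<odot>\<^bsub>N\<^esub> a | w r. w \<in> W \<and> r \<in> carrier R}"
    and "a \<in> {w \<oplus>\<^bsub>N\<^esub> r \<odot>\<^bsub>N\<^esub> a | w r. w \<in> W \<and> r \<in> carrier R}"
proof -
  interpret W: submodule R W N by fact
  interpret N: module R N by (rule W.module)
  have I: "w \<oplus>\<^bsub>N\<^esub> r \<odot>\<^bsub>N\<^esub> a \<in> ?T" if "w \<in> W" "r \<in> carrier R" for w r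
    using that by auto
  show "W \<subseteq> ?T"
  proof
    fix w assume w: "w \<in> W"
    then have "w \<in> carrier N" using W.subset by auto
    then show "w \<in> ?T"
      using I[OF w, of "\<zero>\<^bsub>R\<^esub>"] a by simp
  qed
  show "a \<in> ?T"
    using I[OF W.zero_closed, of "\<one>\<^bsub>R\<^esub>"] a by simp
  show "submodule R ?T N"
  proof (rule submodule.intro)
    show "\<zero>\<^bsub>N\<^esub> \<in> ?T"
      using \<open>W \<subseteq> ?T\<close> W.zero_closed by blast
    show "?T \<subseteq> carrier N"
      using W.subset a by auto
    fix v v' assume v: "v \<in> ?T" "v' \<in> ?T"
    obtain w r where v1: "v = w \<oplus>\<^bsub>N\<^esub> r \<odot>\<^bsub>N\<^esub> a" "w \<in> W" "r \<in> carrier R"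
      using v(1) by auto
    obtain w' r' where v2: "v' = w' \<oplus>\<^bsub>N\<^esub> r' \<odot>\<^bsub>N\<^esub> a" "w' \<in> W" "r' \<in> carrier R"
      using v(2) by auto
    have "w \<in> carrier N" "w' \<in> carrier N" using v1 v2 W.subset by auto
    then have "v \<oplus>\<^bsub>N\<^esub> v' = (w \<oplus>\<^bsub>N\<^esub> w') \<oplus>\<^bsub>N\<^esub> (r \<oplus>\<^bsub>R\<^esub> r') \<odot>\<^bsub>N\<^esub> a"
      using v1 v2 a by (simp add: N.smult_l_distr N.M.a_ac)
    then show "v \<oplus>\<^bsub>N\<^esub> v' \<in> ?T"
      using I v1 v2 by simp
  next
    fix c v assume c: "c \<in> carrier R" and v: "v \<in> ?T"
    obtain w r where v1: "v = w \<oplus>\<^bsub>N\<^esub> r \<odot>\<^bsub>N\<^esub> a" "w \<in> W" "r \<in> carrier R"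
      using v by auto
    have "w \<in> carrier N" using v1 W.subset by auto
    then have "c \<odot>\<^bsub>N\<^esub> v = c \<odot>\<^bsub>N\<^esub> w \<oplus>\<^bsub>N\<^esub> (c \<otimes>\<^bsub>R\<^esub> r) \<odot>\<^bsub>N\<^esub> a"
      using v1 a c by (simp add: N.smult_r_distr N.smult_assoc1)
    then show "c \<odot>\<^bsub>N\<^esub> v \<in> ?T"
      using I[of "c \<odot>\<^bsub>N\<^esub> w" "c \<otimes>\<^bsub>R\<^esub> r"] v1 c by simp
  qed (rule N.module_axioms)
qed

text \<open>A stand-in for a maximal submodule containing \<open>W\<close>: the quotient \<open>N/V\<close> is nonzero and cyclic.\<close>

lemma cyclic_quotient:
  assumes fin: "finite_module R N" and W: "submodule R W N" "W \<noteq> carrier N"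
  obtains V a where "submodule R V N" "W \<subseteq> V" "a \<in> carrier N" "a \<notin> V"
    "\<And>n. n \<in> carrier N \<Longrightarrow> \<exists>v\<in>V. \<exists>r\<in>carrier R. n = v \<oplus>\<^bsub>N\<^esub> r \<odot>\<^bsub>N\<^esub> a"
proof -
  obtain A where A: "finite A" "A \<subseteq> carrier N" "\<And>T. submodule R T N \<Longrightarrow> A \<subseteq> T \<Longrightarrow> T = carrier N"
    using finite_moduleD[OF fin] by blast
  have "(\<And>T. submodule R T N \<Longrightarrow> W \<subseteq> T \<Longrightarrow> A \<subseteq> T \<Longrightarrow> T = carrier N) \<Longrightarrow>
    \<exists>V a. submodule R V N \<and> W \<subseteq> V \<and> a \<in> carrier N \<and> a \<notin> V \<and>
      (\<forall>n\<in>carrier N. \<exists>v\<in>V. \<exists>r\<in>carrier R. n = v \<oplus>\<^bsub>N\<^esub> r \<odot>\<^bsub>N\<^esub> a)"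
    using A(1,2) W
  proof (induction A arbitrary: W)
    case empty
    then show ?case by blast
  next
    case (insert a A)
    let ?W = "{w \<oplus>\<^bsub>N\<^esub> r \<odot>\<^bsub>N\<^esub> a | w r. w \<in> W \<and> r \<in> carrier R}"
    have a: "a \<in> carrier N" using insert by auto
    note adj = adjoin_submodule[OF insert.prems(3) a]
    \<comment> \<open>Generators are adjoined to \<open>W\<close> one at a time; the first one that
      completes it to all of \<open>N\<close> generates the cyclic quotient.\<close>
    show ?case
    proof (cases "?W = carrier N")
      case True
      have "a \<notin> W"
      proof
        assume aW: "a \<in> W"
        have "?W \<subseteq> W"
          using aW submodule.m_closed[OF insert.prems(3)] submodule.smult_closed[OF insert.prems(3)] by auto
        then show False
          using True insert.prems(4) submodule.subset[OF insert.prems(3)] by auto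
      qed
      moreover have "\<forall>n\<in>carrier N. \<exists>v\<in>W. \<exists>r\<in>carrier R. n = v \<oplus>\<^bsub>N\<^esub> r \<odot>\<^bsub>N\<^esub> a"
        unfolding True[symmetric] by auto
      ultimately show ?thesis
        using a insert.prems(3) by blast
    next
      case False
      have "\<exists>V a. submodule R V N \<and> ?W \<subseteq> V \<and> a \<in> carrier N \<and> a \<notin> V \<and>
          (\<forall>n\<in>carrier N. \<exists>v\<in>V. \<exists>r\<in>carrier R. n = v \<oplus>\<^bsub>N\<^esub> r \<odot>\<^bsub>N\<^esub> a)"
      proof (rule insert.IH)
        fix T assume T: "submodule R T N" "?W \<subseteq> T" "A \<subseteq> T"
        then show "T = carrier N"
          using adj(2,3) by (intro insert.prems(1)) blast+
      qed (use insert.prems adj False in auto)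
      then obtain V b where V: "submodule R V N" "?W \<subseteq> V" "b \<in> carrier N" "b \<notin> V"
          "\<forall>n\<in>carrier N. \<exists>v\<in>V. \<exists>r\<in>carrier R. n = v \<oplus>\<^bsub>N\<^esub> r \<odot>\<^bsub>N\<^esub> b"
        by (elim exE conjE)
      have "W \<subseteq> V"
        by (rule order_trans[OF adj(2) V(2)])
      with V(1,3-) show ?thesis
        by (intro exI[of _ V] exI[of _ b] conjI)
    qed
  qed
  then show thesis using A(3) that by blast
qed

context cring
begin

text \<open>In terms of \<open>cyclic_quotient\<close>, \<open>v + r a\<close> is sent to
  \<open>r y\<close>. Two coefficients \<open>r\<close> of the same element differ by a nonunit,
  since a unit would put \<open>a\<close> into \<open>V\<close>, and nonunits multiply
  \<open>y\<close> into \<open>I\<close>. So the map is well defined and linear modulo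
  \<open>I\<close>, and it sends \<open>a\<close> to \<open>y\<close> modulo
  \<open>I\<close>.\<close>

lemma functional_mod_ideal:
  assumes fin: "finite_module R N" and W: "submodule R W N" "W \<noteq> carrier N"
    and I: "submodule R I (self_module R)" and y: "y \<in> carrier R" "y \<notin> I"
    and soc: "\<And>c. c \<in> carrier R \<Longrightarrow> c \<notin> Units R \<Longrightarrow> c \<otimes> y \<in> I"
  shows "\<exists>\<phi>\<in>hom_mod R N (self_module R) I. (\<forall>w\<in>W. \<phi> w \<in> I) \<and> (\<exists>n\<in>carrier N. \<phi> n \<notin> I)"
proof -
  interpret N: module R N using fin by (simp add: finite_module_def)
  interpret I: submodule R I "self_module R" by fact
  have Isub: "I \<subseteq> carrier R" using I.subset by simp
  obtain V a where V: "submodule R V N" "W \<subseteq> V" "a \<in> carrier N" "a \<notin> V"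
    "\<And>n. n \<in> carrier N \<Longrightarrow> \<exists>v\<in>V. \<exists>r\<in>carrier R. n = v \<oplus>\<^bsub>N\<^esub> r \<odot>\<^bsub>N\<^esub> a"
    using cyclic_quotient[OF fin W] by blast
  interpret V: submodule R V N by (rule V)
  define rep where "rep n r \<longleftrightarrow> r \<in> carrier R \<and> n \<ominus>\<^bsub>N\<^esub> r \<odot>\<^bsub>N\<^esub> a \<in> V" for n r
  have ex: "\<exists>r. rep n r" if n: "n \<in> carrier N" for n
  proof -
    obtain v r where vr: "v \<in> V" "r \<in> carrier R" "n = v \<oplus>\<^bsub>N\<^esub> r \<odot>\<^bsub>N\<^esub> a"
      using V(5)[OF n] by blast
    have "v \<in> carrier N" using vr V.subset by auto
    then have "n \<ominus>\<^bsub>N\<^esub> r \<odot>\<^bsub>N\<^esub> a = v"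
      unfolding vr(3) using V(3) vr(2) N.smult_closed[OF vr(2) V(3)] by algebra
    then show ?thesis using vr by (auto simp: rep_def)
  qed
  have uniq: "(r \<ominus> r') \<otimes> y \<in> I" if n: "n \<in> carrier N" "rep n r" "rep n r'" for n r r'
  proof (rule soc)
    have r: "r \<in> carrier R" "r' \<in> carrier R" using n by (auto simp: rep_def)
    then show "r \<ominus> r' \<in> carrier R" by simp
    have ra: "r \<odot>\<^bsub>N\<^esub> a \<in> carrier N" "r' \<odot>\<^bsub>N\<^esub> a \<in> carrier N"
      using r V(3) by auto
    have "(n \<ominus>\<^bsub>N\<^esub> r' \<odot>\<^bsub>N\<^esub> a) \<ominus>\<^bsub>N\<^esub> (n \<ominus>\<^bsub>N\<^esub> r \<odot>\<^bsub>N\<^esub> a) \<in> V"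
      using n by (simp add: rep_def submodule_diff(1)[OF V(1)])
    also have "(n \<ominus>\<^bsub>N\<^esub> r' \<odot>\<^bsub>N\<^esub> a) \<ominus>\<^bsub>N\<^esub> (n \<ominus>\<^bsub>N\<^esub> r \<odot>\<^bsub>N\<^esub> a) = r \<odot>\<^bsub>N\<^esub> a \<ominus>\<^bsub>N\<^esub> r' \<odot>\<^bsub>N\<^esub> a"
      using n(1) V(3) r by algebra
    also have "\<dots> = (r \<ominus> r') \<odot>\<^bsub>N\<^esub> a"
      using r V(3) by (simp add: minus_eq N.smult_l_distr N.smult_l_minus N.M.minus_eq)
    finally have m: "(r \<ominus> r') \<odot>\<^bsub>N\<^esub> a \<in> V" .
    show "r \<ominus> r' \<notin> Units R"
    proof
      assume u: "r \<ominus> r' \<in> Units R"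
      have "inv (r \<ominus> r') \<odot>\<^bsub>N\<^esub> ((r \<ominus> r') \<odot>\<^bsub>N\<^esub> a) \<in> V"
        using u m by auto
      then have "a \<in> V"
        using u V(3) r by (simp add: N.smult_assoc1[symmetric])
      then show False using V(4) by simp
    qed
  qed
  have add: "rep (m \<oplus>\<^bsub>N\<^esub> n) (r \<oplus> s)" if "m \<in> carrier N" "n \<in> carrier N" "rep m r" "rep n s" for m n r s
  proof -
    have rs: "r \<in> carrier R" "s \<in> carrier R" using that by (auto simp: rep_def)
    have "(m \<oplus>\<^bsub>N\<^esub> n) \<ominus>\<^bsub>N\<^esub> (r \<oplus> s) \<odot>\<^bsub>N\<^esub> a = (m \<ominus>\<^bsub>N\<^esub> r \<odot>\<^bsub>N\<^esub> a) \<oplus>\<^bsub>N\<^esub> (n \<ominus>\<^bsub>N\<^esub> s \<odot>\<^bsub>N\<^esub> a)"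
      unfolding N.smult_l_distr[OF rs V(3)] using that(1,2) rs V(3) by algebra
    then show ?thesis using that rs by (simp add: rep_def)
  qed
  have sm: "rep (c \<odot>\<^bsub>N\<^esub> n) (c \<otimes> r)" if "c \<in> carrier R" "n \<in> carrier N" "rep n r" for c n r
  proof -
    have rs: "r \<in> carrier R" using that by (auto simp: rep_def)
    have "c \<odot>\<^bsub>N\<^esub> n \<ominus>\<^bsub>N\<^esub> (c \<otimes> r) \<odot>\<^bsub>N\<^esub> a = c \<odot>\<^bsub>N\<^esub> (n \<ominus>\<^bsub>N\<^esub> r \<odot>\<^bsub>N\<^esub> a)"
      unfolding N.smult_assoc1[OF that(1) rs V(3)] using that(1,2) rs V(3) by algebra
    then show ?thesis using that rs by (simp add: rep_def)
  qed
  define \<rho> where "\<rho> n = (SOME r. rep n r)" for n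
  have \<rho>: "rep n (\<rho> n)" if "n \<in> carrier N" for n
    unfolding \<rho>_def by (rule someI_ex) (rule ex[OF that])
  have \<rho>c: "\<rho> n \<in> carrier R" if "n \<in> carrier N" for n
    using \<rho>[OF that] by (simp add: rep_def)
  show ?thesis
  proof (intro bexI[of _ "\<lambda>n. \<rho> n \<otimes> y"] conjI ballI)
    show "(\<lambda>n. \<rho> n \<otimes> y) \<in> hom_mod R N (self_module R) I"
      unfolding hom_mod_def
    proof (intro CollectI conjI ballI)
      show "(\<lambda>n. \<rho> n \<otimes> y) \<in> carrier N \<rightarrow> carrier (self_module R)"
        using \<rho>c y by auto
      fix m n assume mn: "m \<in> carrier N" "n \<in> carrier N"
      have "(\<rho> (m \<oplus>\<^bsub>N\<^esub> n) \<ominus> (\<rho> m \<oplus> \<rho> n)) \<otimes> y \<in> I"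
        using mn by (intro uniq[of "m \<oplus>\<^bsub>N\<^esub> n"] \<rho> add) auto
      then show "\<rho> (m \<oplus>\<^bsub>N\<^esub> n) \<otimes> y \<ominus>\<^bsub>self_module R\<^esub> (\<rho> m \<otimes> y \<oplus>\<^bsub>self_module R\<^esub> \<rho> n \<otimes> y) \<in> I"
        using mn \<rho>c y by (simp add: minus_eq l_distr l_minus minus_add)
    next
      fix r n assume rn: "r \<in> carrier R" "n \<in> carrier N"
      have "(\<rho> (r \<odot>\<^bsub>N\<^esub> n) \<ominus> (r \<otimes> \<rho> n)) \<otimes> y \<in> I"
        using rn by (intro uniq[of "r \<odot>\<^bsub>N\<^esub> n"] \<rho> sm) auto
      then show "\<rho> (r \<odot>\<^bsub>N\<^esub> n) \<otimes> y \<ominus>\<^bsub>self_module R\<^esub> r \<odot>\<^bsub>self_module R\<^esub> (\<rho> n \<otimes> y) \<in> I"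
        using rn \<rho>c y by (simp add: minus_eq l_distr l_minus m_assoc)
    qed
    show "\<rho> w \<otimes> y \<in> I" if w: "w \<in> W" for w
    proof -
      have wN: "w \<in> carrier N" "w \<in> V" using w V(2) V.subset by auto
      have "rep w \<zero>" using wN V(3) by (simp add: rep_def N.M.minus_eq)
      from uniq[OF wN(1) \<rho>[OF wN(1)] this] show ?thesis
        using \<rho>c[OF wN(1)] by (simp add: minus_eq)
    qed
    show "\<exists>n\<in>carrier N. \<rho> n \<otimes> y \<notin> I"
    proof (rule bexI[OF _ V(3)], rule notI)
      assume a: "\<rho> a \<otimes> y \<in> I"
      have "rep a \<one>" using V(3) by (simp add: rep_def N.M.minus_eq N.M.r_neg)
      from uniq[OF V(3) this \<rho>[OF V(3)]] have "(\<one> \<ominus> \<rho> a) \<otimes> y \<in> I" .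
      then have "(\<one> \<ominus> \<rho> a) \<otimes> y \<oplus> \<rho> a \<otimes> y \<in> I"
        using a I.m_closed by simp
      also have "(\<one> \<ominus> \<rho> a) \<otimes> y \<oplus> \<rho> a \<otimes> y = y"
        using \<rho>c[OF V(3)] y by algebra
      finally show False using y by simp
    qed
  qed
qed

text \<open>The key step of the Auslander--Bridger formula. If \<open>F\<^sup>* \<rightarrow> G\<^sup>*\<close> is not onto, its cokernel has a
  nonzero map to the socle of \<open>R/(xs)\<close>. It is induced by some \<open>u \<in> G\<close>, which then lies in
  \<open>(xs)F \<inter> G = (xs)G\<close>, so the map is zero.\<close>

lemma functional_extends:
  assumes S: "short_exact R G F Y \<iota> \<pi>" and xs: "set xs \<subseteq> carrier R" and reg: "wreg xs Y"
    and y: "y \<in> carrier R" "y \<notin> lmul xs (self_module R)"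
    and soc: "\<And>c. c \<in> carrier R \<Longrightarrow> c \<notin> Units R \<Longrightarrow> c \<otimes> y \<in> lmul xs (self_module R)"
    and fin: "finite_module R (dual_module R G)"
    and G: "\<And>\<phi>. \<phi> \<in> hom_mod R (dual_module R G) (self_module R) (lmul xs (self_module R)) \<Longrightarrow>
        \<exists>u\<in>carrier G. \<forall>h\<in>carrier (dual_module R G). \<phi> h \<ominus> h u \<in> lmul xs (self_module R)"
    and F: "\<And>u. u \<in> carrier F \<Longrightarrow>
        (\<And>f. f \<in> module_hom R F (self_module R) \<Longrightarrow> f u \<in> lmul xs (self_module R)) \<Longrightarrow> u \<in> lmul xs F"
    and g: "g \<in> module_hom R G (self_module R)"
  shows "\<exists>f\<in>module_hom R F (self_module R). \<forall>a\<in>carrier G. f (\<iota> a) = g a"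
proof -
  note S' = short_exactD[OF S]
  note sm = self_module_module
  note ios = hom_simps[OF S'(4) S'(1,2)]
  let ?I = "lmul xs (self_module R)"
  interpret I: submodule R ?I "self_module R" by (rule lmul_submodule[OF sm xs])
  interpret D: module R "dual_module R G" using fin by (simp add: finite_module_def)
  define W where "W = {h \<in> carrier (dual_module R G). \<exists>f\<in>module_hom R F (self_module R). \<forall>a\<in>carrier G. h a = f (\<iota> a)}"
  have W: "submodule R W (dual_module R G)"
  proof (rule submodule.intro)
    show "\<zero>\<^bsub>dual_module R G\<^esub> \<in> W"
      unfolding W_def using hom_zero_map[OF S'(2) sm] hom_zero_map[OF S'(1) sm]
      by (auto simp: dual_module_def hom_zero_map[OF S'(1) sm] S'(1) intro!: bexI[of _ "\<lambda>_. \<zero>"])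
    fix h h' assume h: "h \<in> W" "h' \<in> W"
    then obtain f f' where f: "f \<in> module_hom R F (self_module R)" "\<forall>a\<in>carrier G. h a = f (\<iota> a)"
      and f': "f' \<in> module_hom R F (self_module R)" "\<forall>a\<in>carrier G. h' a = f' (\<iota> a)"
      unfolding W_def by auto
    have "h \<oplus>\<^bsub>dual_module R G\<^esub> h' \<in> carrier (dual_module R G)"
      using h by (auto simp: W_def simp del: hom_module_simps)
    then show "h \<oplus>\<^bsub>dual_module R G\<^esub> h' \<in> W"
      using hom_plus[OF S'(2) sm f(1) f'(1)] f(2) f'(2)
      unfolding W_def by (auto simp: dual_module_def intro!: bexI[of _ "\<lambda>x. f x \<oplus> f' x"])
  next
    fix c h assume c: "c \<in> carrier R" and h: "h \<in> W"
    then obtain f where f: "f \<in> module_hom R F (self_module R)" "\<forall>a\<in>carrier G. h a = f (\<iota> a)"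
      unfolding W_def by auto
    have "c \<odot>\<^bsub>dual_module R G\<^esub> h \<in> carrier (dual_module R G)"
      using h c by (auto simp: W_def simp del: hom_module_simps)
    then show "c \<odot>\<^bsub>dual_module R G\<^esub> h \<in> W"
      using hom_smult_map[OF S'(2) sm f(1) c] f(2)
      unfolding W_def by (auto simp: dual_module_def intro!: bexI[of _ "\<lambda>x. c \<otimes> f x"])
  qed (auto simp: W_def D.module_axioms)
  have "W = carrier (dual_module R G)"
  proof (rule ccontr)
    assume "W \<noteq> carrier (dual_module R G)"
    then obtain \<phi> n where \<phi>: "\<phi> \<in> hom_mod R (dual_module R G) (self_module R) ?I" "\<And>w. w \<in> W \<Longrightarrow> \<phi> w \<in> ?I"
      "n \<in> carrier (dual_module R G)" "\<phi> n \<notin> ?I"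
      using functional_mod_ideal[OF fin W _ I.submodule_axioms y soc] by blast
    obtain u where u: "u \<in> carrier G" "\<And>h. h \<in> carrier (dual_module R G) \<Longrightarrow> \<phi> h \<ominus> h u \<in> ?I"
      using G[OF \<phi>(1)] by blast
    have ev: "h u \<in> carrier R" if "h \<in> carrier (dual_module R G)" for h
      using that hom_simps(1)[OF _ S'(1) sm, of h] u(1) by (simp add: dual_module_def)
    have \<phi>c: "\<phi> h \<in> carrier R" if "h \<in> carrier (dual_module R G)" for h
      using that \<phi>(1) by (auto simp: hom_mod_def)
    \<comment> \<open>A functional on \<open>F\<close> restricts to a member of \<open>W\<close>,
      where \<open>\<phi>\<close> vanishes modulo \<open>(xs)\<close>. Since \<open>\<phi>\<close>
      is evaluation at \<open>u\<close> modulo \<open>(xs)\<close>, every functional on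
      \<open>F\<close> vanishes at \<open>\<iota> u\<close> modulo \<open>(xs)\<close>.\<close>
    have "\<iota> u \<in> lmul xs F"
    proof (rule F)
      show "\<iota> u \<in> carrier F" using u ios by simp
      fix f assume f: "f \<in> module_hom R F (self_module R)"
      define h where "h = (\<lambda>a\<in>carrier G. f (\<iota> a))"
      have "h \<in> carrier (dual_module R G)"
        using hom_comp[OF S'(1,4) f] S'(1) by (simp add: dual_module_def h_def)
      then have "h \<in> W" unfolding W_def using f by (auto simp: h_def)
      have h: "h \<in> carrier (dual_module R G)" by fact
      have "\<phi> h \<ominus> (\<phi> h \<ominus> h u) \<in> ?I"
        using submodule_diff(1)[OF I.submodule_axioms \<phi>(2)[OF \<open>h \<in> W\<close>] u(2)[OF h]] by simp
      also have "\<phi> h \<ominus> (\<phi> h \<ominus> h u) = h u"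
        using ev[OF h] \<phi>c[OF h] by algebra
      finally show "f (\<iota> u) \<in> ?I" using u(1) by (simp add: h_def)
    qed
    then have "\<iota> u \<in> \<iota> ` lmul xs G"
      using S'(9)[OF u(1)] by (intro lmul_short_exact[OF S xs reg])
    then obtain k where k: "k \<in> lmul xs G" "\<iota> u = \<iota> k" by auto
    have "k \<in> carrier G" using k(1) submodule.subset[OF lmul_submodule[OF S'(1) xs]] by auto
    then have uG: "u \<in> lmul xs G" using k S'(6) u(1) by auto
    have "n u \<in> ?I"
      using lmul_hom[OF S'(1) sm _ xs uG, of n] \<phi>(3) by (simp add: dual_module_def)
    then have "(\<phi> n \<ominus> n u) \<oplus> n u \<in> ?I"
      using u(2)[OF \<phi>(3)] I.m_closed by simp
    also have "(\<phi> n \<ominus> n u) \<oplus> n u = \<phi> n"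
      using ev[OF \<phi>(3)] \<phi>c[OF \<phi>(3)] by algebra
    finally show False using \<phi>(4) by simp
  qed
  moreover have "restrict g (carrier G) \<in> carrier (dual_module R G)"
    using g S'(1) by (simp add: dual_module_def)
  ultimately have "restrict g (carrier G) \<in> W" by simp
  then show ?thesis unfolding W_def by force
qed

end

section \<open>Modules over a Noetherian ring\<close>

definition free_mod :: "('a, 'r) ring_scheme \<Rightarrow> nat \<Rightarrow> ('a, nat \<Rightarrow> 'a) module" where
  "free_mod R n = \<lparr>carrier = {f. (\<forall>i<n. f i \<in> carrier R) \<and> (\<forall>i\<ge>n. f i = \<zero>\<^bsub>R\<^esub>)},
     monoid.mult = (\<lambda>f g i. \<zero>\<^bsub>R\<^esub>), one = (\<lambda>i. \<zero>\<^bsub>R\<^esub>), ring.zero = (\<lambda>i. \<zero>\<^bsub>R\<^esub>),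
     ring.add = (\<lambda>f g i. f i \<oplus>\<^bsub>R\<^esub> g i), smult = (\<lambda>r f i. r \<otimes>\<^bsub>R\<^esub> f i)\<rparr>"

lemma free_mod_simps [simp]:
  "f \<in> carrier (free_mod R n) \<longleftrightarrow> (\<forall>i<n. f i \<in> carrier R) \<and> (\<forall>i\<ge>n. f i = \<zero>\<^bsub>R\<^esub>)"
  "\<zero>\<^bsub>free_mod R n\<^esub> = (\<lambda>i. \<zero>\<^bsub>R\<^esub>)"
  "f \<oplus>\<^bsub>free_mod R n\<^esub> g = (\<lambda>i. f i \<oplus>\<^bsub>R\<^esub> g i)"
  "r \<odot>\<^bsub>free_mod R n\<^esub> f = (\<lambda>i. r \<otimes>\<^bsub>R\<^esub> f i)"
  by (simp_all add: free_mod_def)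

lemma (in cring) free_mod_carrier: "f \<in> carrier (free_mod R n) \<Longrightarrow> f i \<in> carrier R"
  by (cases "i < n") auto

lemma (in cring) free_mod_module: "module R (free_mod R n)"
proof -
  have c: "f i \<in> carrier R" if "f \<in> carrier (free_mod R n)" for f i
    using that by (rule free_mod_carrier)
  show ?thesis
  proof (rule module_criteria)
    show "\<forall>v\<in>carrier (free_mod R n). \<exists>w\<in>carrier (free_mod R n).
        v \<oplus>\<^bsub>free_mod R n\<^esub> w = \<zero>\<^bsub>free_mod R n\<^esub>"
    proof
      fix v assume v: "v \<in> carrier (free_mod R n)"
      show "\<exists>w\<in>carrier (free_mod R n). v \<oplus>\<^bsub>free_mod R n\<^esub> w = \<zero>\<^bsub>free_mod R n\<^esub>"
        by (rule bexI[of _ "\<lambda>i. \<ominus> v i"]) (use v c[OF v] in \<open>auto simp: r_neg\<close>)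
    qed
    show "\<zero>\<^bsub>free_mod R n\<^esub> \<in> carrier (free_mod R n)"
      "\<forall>v w. v \<in> carrier (free_mod R n) \<and> w \<in> carrier (free_mod R n) \<longrightarrow>
         v \<oplus>\<^bsub>free_mod R n\<^esub> w \<in> carrier (free_mod R n)"
      "\<forall>r v. r \<in> carrier R \<and> v \<in> carrier (free_mod R n) \<longrightarrow>
         r \<odot>\<^bsub>free_mod R n\<^esub> v \<in> carrier (free_mod R n)"
      by auto
  qed (auto simp: is_cring a_ac m_assoc l_distr r_distr c simp del: free_mod_simps(1))
qed

definition unit_vec :: "('a, 'r) ring_scheme \<Rightarrow> nat \<Rightarrow> nat \<Rightarrow> 'a" where
  "unit_vec R k = (\<lambda>i. if i = k then \<one>\<^bsub>R\<^esub> else \<zero>\<^bsub>R\<^esub>)"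

lemma (in cring) unit_vec_closed: "k < n \<Longrightarrow> unit_vec R k \<in> carrier (free_mod R n)"
  by (auto simp: unit_vec_def)

lemma msum_free_mod: "msum (free_mod R n) g k i = msum (self_module R) (\<lambda>j. g j i) k"
  by (induction k) auto

lemma (in cring) free_mod_expand:
  assumes "f \<in> carrier (free_mod R n)"
  shows "msum (free_mod R n) (\<lambda>i. f i \<odot>\<^bsub>free_mod R n\<^esub> unit_vec R i) n = f"
proof
  fix i
  interpret S: module R "self_module R" by (rule self_module_module)
  show "msum (free_mod R n) (\<lambda>i. f i \<odot>\<^bsub>free_mod R n\<^esub> unit_vec R i) n i = f i"
  proof (cases "i < n")
    case True
    then have "msum (self_module R) (\<lambda>j. f j \<otimes> unit_vec R j i) n = f i \<otimes> unit_vec R i i"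
      using assms by (intro S.msum_single) (auto simp: unit_vec_def)
    then show ?thesis
      using True assms by (simp add: msum_free_mod unit_vec_def)
  next
    case False
    then have "msum (self_module R) (\<lambda>j. f j \<otimes> unit_vec R j i) n = \<zero>"
      using S.msum_zero[of n "\<lambda>j. f j \<otimes> unit_vec R j i"] assms by (auto simp: unit_vec_def)
    then show ?thesis
      using False assms by (simp add: msum_free_mod)
  qed
qed

lemma (in cring) coord_hom: "k < n \<Longrightarrow> (\<lambda>f. f k) \<in> module_hom R (free_mod R n) (self_module R)"
  by (auto simp: module_hom_def)

lemma (in cring) free_mod_fgp: "fgp R (free_mod R n)"
  by (rule fgpI[where n = n and u = "unit_vec R" and h = "\<lambda>i f. f i"])
    (auto simp: free_mod_module unit_vec_closed coord_hom free_mod_expand simp del: free_mod_simps)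

lemma free_mod_hom:
  assumes "module R N" "\<And>i. i < n \<Longrightarrow> u i \<in> carrier N"
  shows "(\<lambda>f. msum N (\<lambda>i. f i \<odot>\<^bsub>N\<^esub> u i) n) \<in> module_hom R (free_mod R n) N"
proof -
  interpret N: module R N by fact
  show ?thesis
    using assms(2) unfolding module_hom_def
    by (auto simp: N.msum_closed N.msum_plus[symmetric] N.msum_smult[symmetric] N.smult_l_distr
        N.smult_assoc1 intro!: msum_cong)
qed

lemma free_mod_hom_unit_vec:
  assumes "module R N" "\<And>i. i < n \<Longrightarrow> u i \<in> carrier N" "k < n"
  shows "msum N (\<lambda>i. unit_vec R k i \<odot>\<^bsub>N\<^esub> u i) n = u k"
proof -
  interpret N: module R N by fact
  have "msum N (\<lambda>i. unit_vec R k i \<odot>\<^bsub>N\<^esub> u i) n = unit_vec R k k \<odot>\<^bsub>N\<^esub> u k"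
    using assms(2,3) by (intro N.msum_single) (auto simp: unit_vec_def)
  then show ?thesis using assms(2,3) by (simp add: unit_vec_def)
qed

text \<open>Generators are tested against submodules of the ambient \<open>N\<close>, so that
  \<open>S\<close> need not be made into a module of its own.\<close>

definition fg_submodule ::
    "('a, 'r) ring_scheme \<Rightarrow> ('a, 'b, 'm) module_scheme \<Rightarrow> 'b set \<Rightarrow> bool" where
  "fg_submodule R N S \<longleftrightarrow> submodule R S N \<and>
     (\<exists>A. finite A \<and> A \<subseteq> S \<and> (\<forall>T. submodule R T N \<longrightarrow> A \<subseteq> T \<longrightarrow> S \<subseteq> T))"

section \<open>Submodules, images and finite generation\<close>

lemma carrier_submodule: "module R M \<Longrightarrow> submodule R (carrier M) M"
proof -
  assume "module R M"
  then interpret M: module R M .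
  show ?thesis by (rule submodule.intro) (auto simp: M.module_axioms)
qed

lemma finite_module_iff:
  assumes "module R N"
  shows "finite_module R N \<longleftrightarrow> fg_submodule R N (carrier N)"
proof
  assume N: "finite_module R N"
  obtain A where A: "finite A" "A \<subseteq> carrier N" "\<And>T. submodule R T N \<Longrightarrow> A \<subseteq> T \<Longrightarrow> T = carrier N"
    using finite_moduleD[OF N] by blast
  have "\<forall>T. submodule R T N \<longrightarrow> A \<subseteq> T \<longrightarrow> carrier N \<subseteq> T"
    using A(3) by (intro allI impI equalityD2) 
  with A(1,2) carrier_submodule[OF assms] show "fg_submodule R N (carrier N)"
    unfolding fg_submodule_def by (intro conjI exI[of _ A])
next
  assume "fg_submodule R N (carrier N)"
  then obtain A where A: "finite A" "A \<subseteq> carrier N"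
      and T: "\<forall>T. submodule R T N \<longrightarrow> A \<subseteq> T \<longrightarrow> carrier N \<subseteq> T"
    unfolding fg_submodule_def by (elim conjE exE)
  show "finite_module R N"
    by (rule finite_moduleI[OF assms A]) (rule T[rule_format])
qed

lemma hom_image_submodule:
  assumes "module R M" "module R N" "f \<in> module_hom R M N" "submodule R T M"
  shows "submodule R (f ` T) N"
proof -
  interpret T: submodule R T M by fact
  note fs = hom_simps[OF assms(3,1,2)]
  have c: "x \<in> carrier M" if "x \<in> T" for x using that T.subset by auto
  show ?thesis
  proof (rule submodule.intro)
    show "f ` T \<subseteq> carrier N" using c fs(1) by auto
    show "\<zero>\<^bsub>N\<^esub> \<in> f ` T" using fs(4) T.zero_closed by (metis imageI)
    show "v \<oplus>\<^bsub>N\<^esub> w \<in> f ` T" if vw: "v \<in> f ` T" "w \<in> f ` T" for v w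
    proof -
      obtain a b where "a \<in> T" "b \<in> T" "v = f a" "w = f b" using vw by auto
      then show ?thesis using fs(2)[of a b] c T.m_closed[of a b] by (metis imageI)
    qed
    show "r \<odot>\<^bsub>N\<^esub> v \<in> f ` T" if rv: "r \<in> carrier R" "v \<in> f ` T" for r v
    proof -
      obtain a where "a \<in> T" "v = f a" using rv by auto
      then show ?thesis using rv fs(3)[of r a] c T.smult_closed[of r a] by (metis imageI)
    qed
  qed fact
qed

lemma hom_vimage_submodule:
  assumes "module R M" "module R N" "f \<in> module_hom R M N" "submodule R T N"
  shows "submodule R {x \<in> carrier M. f x \<in> T} M"
proof -
  interpret T: submodule R T N by fact
  interpret M: module R M by fact
  show ?thesis
    by (rule submodule.intro) (auto simp: hom_simps[OF assms(3,1,2)] M.module_axioms)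
qed

lemma zero_submodule: "module R M \<Longrightarrow> submodule R {\<zero>\<^bsub>M\<^esub>} M"
proof -
  assume "module R M"
  then interpret M: module R M .
  show ?thesis by (rule submodule.intro) (auto simp: M.module_axioms)
qed

lemma submodule_Int: "submodule R S M \<Longrightarrow> submodule R T M \<Longrightarrow> submodule R (S \<inter> T) M"
  by (auto simp: LinearCombinations.submodule_def)

lemma hom_kernel_submodule:
  assumes "module R M" "module R N" "f \<in> module_hom R M N"
  shows "submodule R {x \<in> carrier M. f x = \<zero>\<^bsub>N\<^esub>} M"
  using hom_vimage_submodule[OF assms zero_submodule[OF assms(2)]] by simp

lemma fg_submodule_cover:
  assumes N: "module R N" and S: "fg_submodule R N S"
  obtains n u where "\<And>i. i < n \<Longrightarrow> u i \<in> S" "(\<lambda>f. msum N (\<lambda>i. f i \<odot>\<^bsub>N\<^esub> u i) n) ` carrier (free_mod R n) = S"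
proof -
  interpret S: submodule R S N using S by (simp add: fg_submodule_def)
  interpret N: module R N by fact
  obtain A where A: "finite A" "A \<subseteq> S" "\<And>T. submodule R T N \<Longrightarrow> A \<subseteq> T \<Longrightarrow> S \<subseteq> T"
    using S unfolding fg_submodule_def by blast
  obtain n :: nat and u where u: "A = u ` {i. i < n}"
    using finite_imp_nat_seg_image_inj_on[OF A(1)] by auto
  let ?f = "\<lambda>f. msum N (\<lambda>i. f i \<odot>\<^bsub>N\<^esub> u i) n"
  have uS: "u i \<in> S" if "i < n" for i using u A(2) that by auto
  have uN: "u i \<in> carrier N" if "i < n" for i using uS[OF that] S.subset by auto
  have f: "?f \<in> module_hom R (free_mod R n) N" by (rule free_mod_hom[OF N uN])
  have sub: "submodule R (?f ` carrier (free_mod R n)) N"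
    by (rule hom_image_submodule[OF N.free_mod_module N f carrier_submodule[OF N.free_mod_module]])
  have "A \<subseteq> ?f ` carrier (free_mod R n)"
  proof
    fix a assume "a \<in> A"
    then obtain k where k: "k < n" "a = u k" using u by auto
    show "a \<in> ?f ` carrier (free_mod R n)"
      using free_mod_hom_unit_vec[OF N uN k(1)] N.unit_vec_closed[OF k(1)]
      by (intro image_eqI[of _ _ "unit_vec R k"]) (simp_all only: k(2))
  qed
  then have "S \<subseteq> ?f ` carrier (free_mod R n)" by (rule A(3)[OF sub])
  moreover have "?f ` carrier (free_mod R n) \<subseteq> S"
    using uS by (auto intro!: submodule_msum[OF S.submodule_axioms])
  ultimately show thesis
    by (intro that[of n u] uS equalityI)
qed

lemma fg_submodule_image:
  assumes "module R M" "module R N" "f \<in> module_hom R M N" "fg_submodule R M S"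
  shows "fg_submodule R N (f ` S)"
proof -
  obtain A where A: "finite A" "A \<subseteq> S" "\<And>T. submodule R T M \<Longrightarrow> A \<subseteq> T \<Longrightarrow> S \<subseteq> T"
    and S: "submodule R S M"
    using assms(4) unfolding fg_submodule_def by blast
  have "f ` S \<subseteq> T" if T: "submodule R T N" "f ` A \<subseteq> T" for T
  proof -
    have "A \<subseteq> {x \<in> carrier M. f x \<in> T}"
      using A(2) T(2) submodule.subset[OF S] by auto
    then show ?thesis
      using A(3)[OF hom_vimage_submodule[OF assms(1-3) T(1)]] by auto
  qed
  then show ?thesis
    unfolding fg_submodule_def using A(1,2) hom_image_submodule[OF assms(1-3) S]
    by (intro conjI exI[of _ "f ` A"]) auto
qed

lemma finite_module_surj:
  assumes "finite_module R M" "module R N" "f \<in> module_hom R M N"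
    and "\<And>n. n \<in> carrier N \<Longrightarrow> \<exists>m\<in>carrier M. f m = n"
  shows "finite_module R N"
proof -
  have M: "module R M" using assms(1) by (simp add: finite_module_def)
  have "f ` carrier M = carrier N"
    using hom_simps(1)[OF assms(3) M assms(2)] assms(4) by (auto simp: image_iff)
  then show ?thesis
    using fg_submodule_image[OF M assms(2,3)] assms(1) finite_module_iff[OF M] finite_module_iff[OF assms(2)]
    by metis
qed

lemma finite_module_inj:
  assumes "module R A" "module R B" "f \<in> module_hom R A B" "inj_on f (carrier A)"
    and fg: "fg_submodule R B (f ` carrier A)"
  shows "finite_module R A"
proof -
  obtain T0 where T0: "finite T0" "T0 \<subseteq> f ` carrier A"
    "\<And>T. submodule R T B \<Longrightarrow> T0 \<subseteq> T \<Longrightarrow> f ` carrier A \<subseteq> T"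
    using fg unfolding fg_submodule_def by blast
  obtain C where C: "C \<subseteq> carrier A" "finite C" "T0 = f ` C"
    using T0(1,2) by (meson finite_subset_image)
  show ?thesis
  proof (rule finite_moduleI[OF assms(1) C(2,1)])
    fix T assume T: "submodule R T A" "C \<subseteq> T"
    have "f ` carrier A \<subseteq> f ` T"
      using T0(3)[OF hom_image_submodule[OF assms(1-3) T(1)]] T(2) C(3) by auto
    then show "carrier A \<subseteq> T"
      using inj_on_image_mem_iff[OF assms(4) _ submodule.subset[OF T(1)]] by blast
  qed
qed

locale noetherian_cring = cring R + noetherian_ring R for R (structure)

sublocale noetherian_local_ring \<subseteq> noetherian_cring ..

lemma (in cring) idealI_cring:
  assumes "I \<subseteq> carrier R" "\<zero> \<in> I" "\<And>a b. a \<in> I \<Longrightarrow> b \<in> I \<Longrightarrow> a \<oplus> b \<in> I"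
    and m: "\<And>a r. a \<in> I \<Longrightarrow> r \<in> carrier R \<Longrightarrow> r \<otimes> a \<in> I"
  shows "ideal I R"
proof (rule idealI)
  show "ring R" by (rule ring_axioms)
  show "subgroup I (add_monoid R)"
  proof (rule group.subgroupI)
    show "group (add_monoid R)" by (rule a_group)
    show "inv\<^bsub>add_monoid R\<^esub> a \<in> I" if a: "a \<in> I" for a
    proof -
      have "(\<ominus> \<one>) \<otimes> a \<in> I" by (rule m[OF a]) simp
      moreover have "(\<ominus> \<one>) \<otimes> a = \<ominus> a" using a assms(1) by (auto simp: l_minus)
      ultimately show ?thesis by (simp add: a_inv_def)
    qed
  qed (use assms in auto)
  show "x \<otimes> a \<in> I" if "a \<in> I" "x \<in> carrier R" for a x using m that by blast
  then show "a \<otimes> x \<in> I" if "a \<in> I" "x \<in> carrier R" for a x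
    using that assms(1) m_comm[of a x] by auto
qed

text \<open>The leading coefficients at \<open>a\<close> of the elements of \<open>S\<close>, as in
  the Hilbert basis theorem; the Noetherian hypothesis is applied to such ideals.\<close>

lemma (in cring) coefficient_ideal:
  assumes V: "submodule R V N" and S: "submodule R S N" and a: "a \<in> carrier N"
  shows "ideal {r \<in> carrier R. \<exists>v\<in>V. v \<oplus>\<^bsub>N\<^esub> r \<odot>\<^bsub>N\<^esub> a \<in> S} R"
proof -
  interpret V: submodule R V N by fact
  interpret S: submodule R S N by fact
  interpret N: module R N by (rule V.module)
  have Vc: "v \<in> carrier N" if "v \<in> V" for v using that V.subset by auto
  show ?thesis
  proof (rule idealI_cring)
    show "\<zero> \<in> {r \<in> carrier R. \<exists>v\<in>V. v \<oplus>\<^bsub>N\<^esub> r \<odot>\<^bsub>N\<^esub> a \<in> S}"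
      using a by (auto intro!: bexI[of _ "\<zero>\<^bsub>N\<^esub>"])
    fix r s assume r: "r \<in> {r \<in> carrier R. \<exists>v\<in>V. v \<oplus>\<^bsub>N\<^esub> r \<odot>\<^bsub>N\<^esub> a \<in> S}"
    then obtain v where v: "r \<in> carrier R" "v \<in> V" "v \<oplus>\<^bsub>N\<^esub> r \<odot>\<^bsub>N\<^esub> a \<in> S" by auto
    { assume "s \<in> {r \<in> carrier R. \<exists>v\<in>V. v \<oplus>\<^bsub>N\<^esub> r \<odot>\<^bsub>N\<^esub> a \<in> S}"
      then obtain w where w: "s \<in> carrier R" "w \<in> V" "w \<oplus>\<^bsub>N\<^esub> s \<odot>\<^bsub>N\<^esub> a \<in> S" by auto
      have "(v \<oplus>\<^bsub>N\<^esub> w) \<oplus>\<^bsub>N\<^esub> (r \<oplus> s) \<odot>\<^bsub>N\<^esub> a = (v \<oplus>\<^bsub>N\<^esub> r \<odot>\<^bsub>N\<^esub> a) \<oplus>\<^bsub>N\<^esub> (w \<oplus>\<^bsub>N\<^esub> s \<odot>\<^bsub>N\<^esub> a)"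
        using v(1) w(1) a Vc[OF v(2)] Vc[OF w(2)] by (simp add: N.smult_l_distr N.M.a_ac)
      also have "\<dots> \<in> S" using v w by simp
      finally have "(v \<oplus>\<^bsub>N\<^esub> w) \<oplus>\<^bsub>N\<^esub> (r \<oplus> s) \<odot>\<^bsub>N\<^esub> a \<in> S" .
      then show "r \<oplus> s \<in> {r \<in> carrier R. \<exists>v\<in>V. v \<oplus>\<^bsub>N\<^esub> r \<odot>\<^bsub>N\<^esub> a \<in> S}"
        using v w by blast }
    { assume s: "s \<in> carrier R"
      have "s \<odot>\<^bsub>N\<^esub> v \<oplus>\<^bsub>N\<^esub> (s \<otimes> r) \<odot>\<^bsub>N\<^esub> a = s \<odot>\<^bsub>N\<^esub> (v \<oplus>\<^bsub>N\<^esub> r \<odot>\<^bsub>N\<^esub> a)"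
        using v(1) s a Vc[OF v(2)] by (simp add: N.smult_r_distr N.smult_assoc1)
      also have "\<dots> \<in> S" using v s by simp
      finally show "s \<otimes> r \<in> {r \<in> carrier R. \<exists>v\<in>V. v \<oplus>\<^bsub>N\<^esub> r \<odot>\<^bsub>N\<^esub> a \<in> S}"
        using v s by blast }
  qed auto
qed

text \<open>Induction on the generators of \<open>N\<close>. Elements of \<open>S\<close> whose
  coefficients at \<open>a\<close> generate the coefficient ideal, together with generators of the
  intersection of \<open>S\<close> with the span of the other generators, generate
  \<open>S\<close>.\<close>

lemma (in noetherian_cring) fg_submodule_of_finite:
  assumes fin: "finite_module R N" and S: "submodule R S N"
  shows "fg_submodule R N S"
proof -
  interpret N: module R N using fin by (simp add: finite_module_def)
  obtain B where B: "finite B" "B \<subseteq> carrier N" "N.span B = carrier N"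
    using fin by (auto simp: finite_module_def)
  have "S \<subseteq> N.span B \<Longrightarrow> fg_submodule R N S"
    using B(1,2) S
  proof (induction B arbitrary: S)
    case empty
    have "N.span {} \<subseteq> {\<zero>\<^bsub>N\<^esub>}"
      by (rule N.span_is_subset[OF _ zero_submodule[OF N.module_axioms]]) auto
    then have "S = {\<zero>\<^bsub>N\<^esub>}"
      using empty submodule.zero_closed[OF empty.prems(3)] by auto
    then show ?case
      using empty.prems(3) submodule.zero_closed unfolding fg_submodule_def
      by (intro conjI exI[of _ "{}"]) auto
  next
    case (insert a B)
    have a: "a \<in> carrier N" and B: "B \<subseteq> carrier N" using insert by auto
    let ?V = "N.span B"
    have V: "submodule R ?V N" by (rule N.span_is_submodule[OF B])
    interpret V: submodule R ?V N by (rule V)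
    interpret S: submodule R S N by (rule insert.prems(3))
    have Sc: "s \<in> carrier N" if "s \<in> S" for s using that S.subset by auto
    have Vc: "s \<in> carrier N" if "s \<in> ?V" for s using that V.subset by auto
    have Sdec: "\<exists>v\<in>?V. \<exists>r\<in>carrier R. s = v \<oplus>\<^bsub>N\<^esub> r \<odot>\<^bsub>N\<^esub> a" if s: "s \<in> S" for s
    proof -
      have "N.span (insert a B) \<subseteq> {w \<oplus>\<^bsub>N\<^esub> r \<odot>\<^bsub>N\<^esub> a | w r. w \<in> ?V \<and> r \<in> carrier R}"
        using adjoin_submodule[OF V a] N.in_own_span[OF B] by (intro N.span_is_subset) auto
      then show ?thesis using insert.prems(1) s by blast
    qed
    define I where "I = {r \<in> carrier R. \<exists>v\<in>?V. v \<oplus>\<^bsub>N\<^esub> r \<odot>\<^bsub>N\<^esub> a \<in> S}"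
    have "ideal I R" unfolding I_def by (rule coefficient_ideal[OF V S.submodule_axioms a])
    then obtain A0 where A0: "A0 \<subseteq> carrier R" "finite A0" "I = Idl A0"
      using finetely_gen by blast
    have "\<forall>r\<in>A0. \<exists>s. s \<in> S \<and> (\<exists>v\<in>?V. s = v \<oplus>\<^bsub>N\<^esub> r \<odot>\<^bsub>N\<^esub> a)"
      using genideal_self[OF A0(1)] A0(3) unfolding I_def by blast
    then obtain \<sigma> where \<sigma>: "\<And>r. r \<in> A0 \<Longrightarrow> \<sigma> r \<in> S" "\<And>r. r \<in> A0 \<Longrightarrow> \<exists>v\<in>?V. \<sigma> r = v \<oplus>\<^bsub>N\<^esub> r \<odot>\<^bsub>N\<^esub> a"
      by metis
    have "fg_submodule R N (S \<inter> ?V)"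
      using insert.IH[OF _ B submodule_Int[OF S.submodule_axioms V]] by auto
    then obtain T0 where T0: "finite T0" "T0 \<subseteq> S \<inter> ?V"
      "\<And>T. submodule R T N \<Longrightarrow> T0 \<subseteq> T \<Longrightarrow> S \<inter> ?V \<subseteq> T"
      unfolding fg_submodule_def by blast
    have "S \<subseteq> T" if T: "submodule R T N" "T0 \<union> \<sigma> ` A0 \<subseteq> T" for T
    proof
      fix s assume s: "s \<in> S"
      interpret T: submodule R T N by (rule T)
      obtain v r where vr: "v \<in> ?V" "r \<in> carrier R" "s = v \<oplus>\<^bsub>N\<^esub> r \<odot>\<^bsub>N\<^esub> a"
        using Sdec[OF s] by blast
      have "r \<in> I" using s vr unfolding I_def by blast
      \<comment> \<open>The coefficients attained on \<open>S \<inter> T\<close> again form an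
        ideal, and it contains \<open>A0\<close>. So every element of \<open>S\<close> agrees with
        one of \<open>S \<inter> T\<close> up to the span of \<open>B\<close>.\<close>
      moreover have "Idl A0 \<subseteq> {r \<in> carrier R. \<exists>v\<in>?V. v \<oplus>\<^bsub>N\<^esub> r \<odot>\<^bsub>N\<^esub> a \<in> S \<inter> T}"
      proof (rule genideal_minimal[OF coefficient_ideal[OF V submodule_Int[OF S.submodule_axioms T(1)] a]])
        show "A0 \<subseteq> {r \<in> carrier R. \<exists>v\<in>?V. v \<oplus>\<^bsub>N\<^esub> r \<odot>\<^bsub>N\<^esub> a \<in> S \<inter> T}"
        proof
          fix r assume r: "r \<in> A0"
          obtain v where v: "v \<in> ?V" "\<sigma> r = v \<oplus>\<^bsub>N\<^esub> r \<odot>\<^bsub>N\<^esub> a" using \<sigma>(2)[OF r] by auto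
          have "\<sigma> r \<in> S \<inter> T" "r \<in> carrier R"
            using r A0(1) \<sigma>(1)[OF r] T(2) by auto
          then show "r \<in> {r \<in> carrier R. \<exists>v\<in>?V. v \<oplus>\<^bsub>N\<^esub> r \<odot>\<^bsub>N\<^esub> a \<in> S \<inter> T}"
            unfolding v(2) using v(1) by blast
        qed
      qed
      ultimately obtain w where w: "w \<in> ?V" "w \<oplus>\<^bsub>N\<^esub> r \<odot>\<^bsub>N\<^esub> a \<in> S" "w \<oplus>\<^bsub>N\<^esub> r \<odot>\<^bsub>N\<^esub> a \<in> T"
        using A0(3) by auto
      have c: "v \<in> carrier N" "w \<in> carrier N" using vr w Vc by auto
      have "s \<ominus>\<^bsub>N\<^esub> (w \<oplus>\<^bsub>N\<^esub> r \<odot>\<^bsub>N\<^esub> a) = v \<ominus>\<^bsub>N\<^esub> w"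
        unfolding vr(3) using c vr(2) a by algebra
      then have "v \<ominus>\<^bsub>N\<^esub> w \<in> S"
        using submodule_diff(1)[OF S.submodule_axioms s w(2)] by simp
      moreover have "v \<ominus>\<^bsub>N\<^esub> w \<in> ?V"
        by (rule submodule_diff(1)[OF V vr(1) w(1)])
      ultimately have "v \<ominus>\<^bsub>N\<^esub> w \<in> T"
        using T0(3)[OF T(1)] T(2) by auto
      then have "(v \<ominus>\<^bsub>N\<^esub> w) \<oplus>\<^bsub>N\<^esub> (w \<oplus>\<^bsub>N\<^esub> r \<odot>\<^bsub>N\<^esub> a) \<in> T"
        using w by simp
      also have "(v \<ominus>\<^bsub>N\<^esub> w) \<oplus>\<^bsub>N\<^esub> (w \<oplus>\<^bsub>N\<^esub> r \<odot>\<^bsub>N\<^esub> a) = s"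
        unfolding vr(3) using c vr(2) a by algebra
      finally show "s \<in> T" .
    qed
    then show ?case
      unfolding fg_submodule_def using T0(1,2) A0(2) \<sigma>(1) S.submodule_axioms
      by (intro conjI exI[of _ "T0 \<union> \<sigma> ` A0"]) auto
  qed
  then show ?thesis using B(3) submodule.subset[OF S] by simp
qed

lemma fgp_finite:
  assumes "fgp R P"
  shows "finite_module R P"
proof -
  interpret P: module R P using assms by (rule fgp_module)
  obtain n u h where u: "\<And>i. i < n \<Longrightarrow> u i \<in> carrier P"
    and h: "\<And>i. i < n \<Longrightarrow> h i \<in> module_hom R P (self_module R)"
    and uh: "\<And>q. q \<in> carrier P \<Longrightarrow> msum P (\<lambda>i. h i q \<odot>\<^bsub>P\<^esub> u i) n = q"
    by (rule fgpE[OF assms]) blast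
  show ?thesis
  proof (rule finite_moduleI[OF P.module_axioms, of "u ` {..<n}"])
    fix T assume T: "submodule R T P" "u ` {..<n} \<subseteq> T"
    show "carrier P \<subseteq> T"
    proof
      fix q assume q: "q \<in> carrier P"
      have "msum P (\<lambda>i. h i q \<odot>\<^bsub>P\<^esub> u i) n \<in> T"
        using T(2) hom_simps(1)[OF h P.module_axioms P.self_module_module] q
        by (intro submodule_msum[OF T(1)] submodule.smult_closed[OF T(1)]) auto
      then show "q \<in> T" by (simp only: uh[OF q])
    qed
  qed (use u in auto)
qed

lemma ext_van_fgp_trivial:
  fixes N :: "('a, 'b) module"
  assumes N: "fgp R N" and L: "module R L"
  obtains Q :: "nat \<Rightarrow> ('a, 'b) module" and d e where "resolution R N Q d e" "\<And>i. fgp R (Q i)"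
    "\<And>i. ext_van R Q d L i"
proof -
  interpret N: module R N using N by (rule fgp_module)
  interpret L: module R L by fact
  \<comment> \<open>The zero module is \<open>N\<close> cut down to its zero, so that all terms
    share one type and identity functions serve as differentials.\<close>
  define Q where "Q i = (if i = (0::nat) then N else N\<lparr>carrier := {\<zero>\<^bsub>N\<^esub>}\<rparr>)" for i
  have Z: "module R (N\<lparr>carrier := {\<zero>\<^bsub>N\<^esub>}\<rparr>)"
    by (rule N.submodule_is_module[OF zero_submodule[OF N.module_axioms]])
  have m: "module R (Q i)" for i using Z N.module_axioms by (simp add: Q_def)
  have fg: "fgp R (Q i)" for i
  proof (cases "i = 0")
    case False
    then show ?thesis
      by (intro fgpI[where n = 0 and u = undefined and h = undefined] m) (auto simp: Q_def)
  qed (simp add: Q_def N)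
  have res: "resolution R N Q (\<lambda>i x. x) (\<lambda>x. x)"
    by (rule resolutionI) (auto simp: Q_def module_hom_def Z N.module_axioms)
  have ev: "ext_van R Q (\<lambda>i x. x) L i" for i
    unfolding ext_van_def
  proof (intro ballI impI)
    fix c assume "c \<in> module_hom R (Q (Suc i)) L" "\<forall>p\<in>carrier (Q (Suc (Suc i))). c p = \<zero>\<^bsub>L\<^esub>"
    then have "c \<zero>\<^bsub>N\<^esub> = \<zero>\<^bsub>L\<^esub>" by (simp add: Q_def)
    then show "\<exists>b\<in>module_hom R (Q i) L. \<forall>p\<in>carrier (Q (Suc i)). c p = b p"
      using hom_zero_map[OF m L] by (intro bexI[of _ "\<lambda>_. \<zero>\<^bsub>L\<^esub>"]) (auto simp: Q_def)
  qed
  show thesis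
    by (rule that[of Q "\<lambda>i x. x" "\<lambda>x. x"]) (fact res fg ev)+
qed

section \<open>Free resolutions of finite modules\<close>

context noetherian_cring
begin

lemma finite_kernel_cover:
  assumes "submodule R K (free_mod R n)"
  obtains m \<delta> where "\<delta> \<in> module_hom R (free_mod R m) (free_mod R n)" "\<delta> ` carrier (free_mod R m) = K"
proof -
  have "fg_submodule R (free_mod R n) K"
    by (rule fg_submodule_of_finite[OF fgp_finite[OF free_mod_fgp] assms])
  then obtain m u where u: "\<And>i. i < m \<Longrightarrow> u i \<in> K"
    "(\<lambda>f. msum (free_mod R n) (\<lambda>i. f i \<odot>\<^bsub>free_mod R n\<^esub> u i) m) ` carrier (free_mod R m) = K"
    by (rule fg_submodule_cover[OF free_mod_module]) blast
  show thesis
    by (rule that[OF free_mod_hom[OF free_mod_module] u(2)]) (use u(1) submodule.subset[OF assms] in blast)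
qed

lemma exists_free_resolution:
  assumes "finite_module R N"
  obtains n d e where "resolution R N (\<lambda>i. free_mod R (n i)) d e"
proof -
  have N: "module R N" using assms by (simp add: finite_module_def)
  have "fg_submodule R N (carrier N)" using assms finite_module_iff[OF N] by blast
  then obtain n0 u where u: "\<And>i. i < n0 \<Longrightarrow> u i \<in> carrier N"
    "(\<lambda>f. msum N (\<lambda>i. f i \<odot>\<^bsub>N\<^esub> u i) n0) ` carrier (free_mod R n0) = carrier N"
    by (rule fg_submodule_cover[OF N]) blast
  define e where "e f = msum N (\<lambda>i. f i \<odot>\<^bsub>N\<^esub> u i) n0" for f
  have e: "e \<in> module_hom R (free_mod R n0) N"
    unfolding e_def by (rule free_mod_hom[OF N u(1)])
  have eim: "e ` carrier (free_mod R n0) = carrier N"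
    unfolding e_def by (rule u(2))
  define K0 where "K0 = {x \<in> carrier (free_mod R n0). e x = \<zero>\<^bsub>N\<^esub>}"
  have K0: "submodule R K0 (free_mod R n0)"
    unfolding K0_def by (rule hom_kernel_submodule[OF free_mod_module N e])
  \<comment> \<open>A state is a rank together with the kernel that remains to be covered. The
    covering map depends on two consecutive states and is picked afterwards.\<close>
  define A where "A k s \<longleftrightarrow> submodule R (snd s) (free_mod R (fst s)) \<and> (k = 0 \<longrightarrow> s = (n0, K0))"
    for k :: nat and s :: "nat \<times> (nat \<Rightarrow> 'a) set"
  define B where "B s t \<delta> \<longleftrightarrow> \<delta> \<in> module_hom R (free_mod R (fst t)) (free_mod R (fst s)) \<and>
      \<delta> ` carrier (free_mod R (fst t)) = snd s \<and>
      snd t = {x \<in> carrier (free_mod R (fst t)). \<delta> x = \<zero>\<^bsub>free_mod R (fst s)\<^esub>}"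
    for s t :: "nat \<times> (nat \<Rightarrow> 'a) set" and \<delta>
  have "\<exists>s. A 0 s" using K0 by (auto simp: A_def)
  moreover have "\<exists>t. A (Suc k) t \<and> (\<exists>\<delta>. B s t \<delta>)" if s: "A k s" for s k
  proof -
    have "submodule R (snd s) (free_mod R (fst s))" using s by (simp add: A_def)
    then obtain m \<delta> where \<delta>: "\<delta> \<in> module_hom R (free_mod R m) (free_mod R (fst s))"
      "\<delta> ` carrier (free_mod R m) = snd s"
      by (rule finite_kernel_cover)
    let ?K = "{x \<in> carrier (free_mod R m). \<delta> x = \<zero>\<^bsub>free_mod R (fst s)\<^esub>}"
    have "A (Suc k) (m, ?K)"
      using hom_kernel_submodule[OF free_mod_module free_mod_module \<delta>(1)]
      by (simp only: A_def fst_conv snd_conv simp_thms nat.distinct)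
    moreover have "B s (m, ?K) \<delta>"
      using \<delta> by (simp only: B_def fst_conv snd_conv simp_thms)
    ultimately show ?thesis by blast
  qed
  ultimately obtain s where s: "\<And>k. A k (s k) \<and> (\<exists>\<delta>. B (s k) (s (Suc k)) \<delta>)"
    using dependent_nat_choice[of A "\<lambda>_ s t. \<exists>\<delta>. B s t \<delta>"] by blast
  define n where "n k = fst (s k)" for k
  define K where "K k = snd (s k)" for k
  define d where "d k = (SOME \<delta>. B (s k) (s (Suc k)) \<delta>)" for k
  have d: "B (s k) (s (Suc k)) (d k)" for k
  proof -
    have "\<exists>\<delta>. B (s k) (s (Suc k)) \<delta>" using s by blast
    then show ?thesis unfolding d_def by (rule someI_ex)
  qed
  have s0: "n 0 = n0" "K 0 = K0"
    using s[of 0] by (auto simp: A_def n_def K_def)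
  have d1: "d k \<in> module_hom R (free_mod R (n (Suc k))) (free_mod R (n k))" for k
    using d[of k] by (simp add: B_def n_def)
  have d2: "d k ` carrier (free_mod R (n (Suc k))) = K k" for k
    using d[of k] by (simp add: B_def n_def K_def)
  have d3: "K (Suc k) = {x \<in> carrier (free_mod R (n (Suc k))). d k x = \<zero>\<^bsub>free_mod R (n k)\<^esub>}" for k
    using d[of k] by (simp only: B_def n_def K_def)
  have "resolution R N (\<lambda>i. free_mod R (n i)) d e"
    unfolding resolution_def a_kernel_def' One_nat_def
    by (intro conjI allI)
      (simp_all only: free_mod_module d1 d2 s0 e eim K0_def[symmetric] d3[symmetric])
  then show thesis by (rule that)
qed

text \<open>The trivial resolution has the element type of \<open>N\<close>; comparison with a free
  resolution moves the vanishing to the type fixed in \<open>ext_vanishes\<close>.\<close>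

lemma ext_vanishes_fgp:
  fixes N :: "('a, 'c) module"
  assumes N: "fgp R N" and L: "module R L"
  shows "ext_vanishes R N L"
proof -
  obtain Q :: "nat \<Rightarrow> ('a, 'c) module" and d' e' where Q: "resolution R N Q d' e'" "\<And>i. fgp R (Q i)"
    "\<And>i. ext_van R Q d' L i"
    using ext_van_fgp_trivial[OF N L] by blast
  obtain n d e where P: "resolution R N (\<lambda>i. free_mod R (n i)) d e"
    using exists_free_resolution[OF fgp_finite[OF N]] by blast
  have "ext_van R (\<lambda>i. free_mod R (n i)) d L i" for i
    by (rule ext_van_indep[OF Q(1) P fgp_module[OF N] L])
      (use Q(2,3) free_mod_fgp free_mod_module in \<open>auto intro!: fgp_linear_choice[OF _ fgp_module]\<close>)
  then show ?thesis
    unfolding ext_vanishes_def using P free_mod_fgp by blast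
qed

text \<open>The values at finitely many generators determine a functional, which embeds the dual
  into a free module of finite rank.\<close>

lemma finite_dual:
  assumes "finite_module R X"
  shows "finite_module R (dual_module R X)"
proof -
  have X: "module R X" using assms by (simp add: finite_module_def)
  note sm = self_module_module
  have D: "module R (dual_module R X)" unfolding dual_module_def by (rule hom_module_module[OF X sm])
  obtain n u where u: "\<And>i. i < n \<Longrightarrow> u i \<in> carrier X"
    "(\<lambda>f. msum X (\<lambda>i. f i \<odot>\<^bsub>X\<^esub> u i) n) ` carrier (free_mod R n) = carrier X"
    using assms finite_module_iff[OF X] by (auto intro: fg_submodule_cover[OF X])
  define r where "r = (\<lambda>h i. if i < n then h (u i) else \<zero>)"
  have r: "r \<in> module_hom R (dual_module R X) (free_mod R n)"
    using u(1) hom_simps(1)[OF _ X sm]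
    by (auto simp: module_hom_def[of _ "hom_module R X (self_module R)"] r_def dual_module_def fun_eq_iff)
  have "inj_on r (carrier (dual_module R X))"
  proof (rule inj_onI)
    fix h k assume h: "h \<in> carrier (dual_module R X)" and k: "k \<in> carrier (dual_module R X)" and e: "r h = r k"
    have hk: "h \<in> module_hom R X (self_module R)" "k \<in> module_hom R X (self_module R)"
      using h k by (auto simp: dual_module_def)
    have eu: "h (u i) = k (u i)" if "i < n" for i
      using that fun_cong[OF e, of i] by (simp add: r_def)
    interpret X: module R X by (rule X)
    show "h = k"
    proof (rule extensionalityI[of _ "carrier X"])
      fix x assume "x \<in> carrier X"
      then obtain f where f: "f \<in> carrier (free_mod R n)" "x = msum X (\<lambda>i. f i \<odot>\<^bsub>X\<^esub> u i) n"
        using u(2) by blast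
      have fi: "f i \<in> carrier R" if "i < n" for i using f(1) that by auto
      have gx: "g x = msum (self_module R) (\<lambda>i. f i \<otimes> g (u i)) n" if "g \<in> module_hom R X (self_module R)" for g
        unfolding f(2) using u(1) fi
        by (subst hom_msum[OF that X sm]) (auto simp: hom_simps[OF that X sm] intro!: msum_cong)
      show "h x = k x"
        unfolding gx[OF hk(1)] gx[OF hk(2)] by (rule msum_cong) (simp add: eu)
    qed (use h k in \<open>auto simp: dual_module_def\<close>)
  qed
  moreover have "fg_submodule R (free_mod R n) (r ` carrier (dual_module R X))"
    by (rule fg_submodule_of_finite[OF fgp_finite[OF free_mod_fgp]
        hom_image_submodule[OF D free_mod_module r carrier_submodule[OF D]]])
  ultimately show ?thesis
    by (rule finite_module_inj[OF D free_mod_module r])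
qed

end

text \<open>The part \<open>Ext\<^sup>i\<^sup>-\<^sup>1(A) \<rightarrow> Ext\<^sup>i(C) \<rightarrow> Ext\<^sup>i(B)\<close> of the long exact sequence.\<close>

lemma ext_van_cokernel:
  assumes resA: "resolution R A P d e" and resC: "resolution R C Q d' e'"
    and S: "short_exact R A B C \<iota> \<pi>" and L: "module R L"
    and fg: "\<And>k. fgp R (P k)" "\<And>k. fgp R (Q k)"
    and vB: "\<And>D E. resolution R B (\<lambda>k. direct_sum (P k) (Q k)) D E \<Longrightarrow>
        ext_van R (\<lambda>k. direct_sum (P k) (Q k)) D L i"
    and vA: "\<And>k. i = Suc k \<Longrightarrow> ext_van R P d L k"
    and ext: "\<And>g. g \<in> module_hom R A L \<Longrightarrow> \<exists>f\<in>module_hom R B L. \<forall>a\<in>carrier A. f (\<iota> a) = g a"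
  shows "ext_van R Q d' L i"
  unfolding ext_van_def
proof (intro ballI impI)
  fix c assume c: "c \<in> module_hom R (Q (Suc i)) L"
    and cd: "\<forall>q\<in>carrier (Q (Suc (Suc i))). c (d' (Suc i) q) = \<zero>\<^bsub>L\<^esub>"
  note P = resolutionD[OF resA]
  note Q = resolutionD[OF resC]
  note S' = short_exactD[OF S]
  interpret L: module R L by fact
  interpret Pi: module R "P i" by (rule P)
  interpret Qi: module R "Q i" by (rule Q)
  interpret P1: module R "P (Suc i)" by (rule P)
  interpret Q1: module R "Q (Suc i)" by (rule Q)
  note ds = hom_simps[OF P(2) P(1) P(1)]
  note d's = hom_simps[OF Q(2) Q(1) Q(1)]
  note cs = hom_simps[OF c Q(1) L]
  note ios = hom_simps[OF S'(4) S'(1,2)]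
  obtain D E th where res: "resolution R B (\<lambda>k. direct_sum (P k) (Q k)) D E"
    and th0: "\<forall>k. th k \<in> module_hom R (Q (Suc k)) (P k)"
       "\<forall>k. \<forall>q\<in>carrier (Q (Suc (Suc k))). d k (th (Suc k) q) = \<ominus>\<^bsub>P k\<^esub> th k (d' (Suc k) q)"
    and D: "D = (\<lambda>k (p, q). (d k p \<oplus>\<^bsub>P k\<^esub> th k q, d' k q))"
    and E0: "\<forall>p\<in>carrier (P 0). E (p, \<zero>\<^bsub>Q 0\<^esub>) = \<iota> (e p)"
    using horseshoe[OF resA resC S fg] by blast
  note th = th0[rule_format]
  note ts = hom_simps[OF th(1) Q(1) P(1)]
  note B = resolutionD[OF res]
  have inr: "(\<lambda>q. (\<zero>\<^bsub>P k\<^esub>, q)) \<in> module_hom R (Q k) (direct_sum (P k) (Q k))" for k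
  proof -
    interpret module R "P k" by (rule P)
    show ?thesis by (auto simp: module_hom_def)
  qed
  have inl: "(\<lambda>p. (p, \<zero>\<^bsub>Q k\<^esub>)) \<in> module_hom R (P k) (direct_sum (P k) (Q k))" for k
  proof -
    interpret module R "Q k" by (rule Q)
    show ?thesis by (auto simp: module_hom_def)
  qed
  have "(\<lambda>x. c (snd x)) \<in> module_hom R (direct_sum (P (Suc i)) (Q (Suc i))) L"
    by (auto simp: module_hom_def cs)
  moreover have "c (snd (D (Suc i) x)) = \<zero>\<^bsub>L\<^esub>"
    if "x \<in> carrier (direct_sum (P (Suc (Suc i))) (Q (Suc (Suc i))))" for x
    using that cd by (auto simp: D)
  ultimately obtain b where b: "b \<in> module_hom R (direct_sum (P i) (Q i)) L"
      "\<And>x. x \<in> carrier (direct_sum (P (Suc i)) (Q (Suc i))) \<Longrightarrow> c (snd x) = b (D i x)"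
    by (rule ext_vanD[OF vB[OF res]]) blast+
  note bs = hom_simps[OF b(1) B(1) L]
  define a where "a p = b (p, \<zero>\<^bsub>Q i\<^esub>)" for p
  have a: "a \<in> module_hom R (P i) L"
    unfolding a_def by (rule hom_comp[OF P(1) inl b(1)])
  note as = hom_simps[OF a P(1) L]
  have b2: "(\<lambda>q. b (\<zero>\<^bsub>P i\<^esub>, q)) \<in> module_hom R (Q i) L"
    by (rule hom_comp[OF Q(1) inr b(1)])
  have ad: "a (d i p) = \<zero>\<^bsub>L\<^esub>" if p: "p \<in> carrier (P (Suc i))" for p
    using b(2)[of "(p, \<zero>\<^bsub>Q (Suc i)\<^esub>)"] p by (simp add: D ts d's ds a_def cs)
  \<comment> \<open>The second summand is already a coboundary, that of \<open>b\<close> on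
    \<open>Q i\<close>; it remains to write \<open>a\<close> after \<open>th i\<close> as
    one.\<close>
  have cq: "c q = a (th i q) \<oplus>\<^bsub>L\<^esub> b (\<zero>\<^bsub>P i\<^esub>, d' i q)" if q: "q \<in> carrier (Q (Suc i))" for q
  proof -
    have "c q = b (th i q, d' i q)"
      using b(2)[of "(\<zero>\<^bsub>P (Suc i)\<^esub>, q)"] q by (simp add: D ds ts)
    also have "(th i q, d' i q) = (th i q, \<zero>\<^bsub>Q i\<^esub>) \<oplus>\<^bsub>direct_sum (P i) (Q i)\<^esub> (\<zero>\<^bsub>P i\<^esub>, d' i q)"
      using q by (simp add: ts d's)
    also have "b \<dots> = a (th i q) \<oplus>\<^bsub>L\<^esub> b (\<zero>\<^bsub>P i\<^esub>, d' i q)"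
      using q by (subst bs(2)) (auto simp: a_def ts d's)
    finally show ?thesis .
  qed
  show "\<exists>b\<in>module_hom R (Q i) L. \<forall>q\<in>carrier (Q (Suc i)). c q = b (d' i q)"
  proof (cases i)
    \<comment> \<open>Here \<open>a\<close> descends to a map \<open>g\<close> on \<open>A\<close>,
      which \<open>f\<close> extends to \<open>B\<close>. Applying \<open>f\<close> to the relation
      that \<open>E\<close> kills the boundaries \<open>D 0 x\<close> exhibits \<open>a\<close>
      after \<open>th 0\<close> as a coboundary.\<close>
    case 0
    obtain g where g: "g \<in> module_hom R A L" "\<forall>p\<in>carrier (P 0). g (e p) = a p"
      using resolution_factor[OF resA S'(1) L] a ad unfolding 0 by blast
    obtain f where f: "f \<in> module_hom R B L" "\<forall>x\<in>carrier A. f (\<iota> x) = g x"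
      using ext[OF g(1)] by blast
    note fs = hom_simps[OF f(1) S'(2) L]
    note Es = hom_simps[OF B(3) B(1) S'(2)]
    have fE: "(\<lambda>q. f (E (\<zero>\<^bsub>P i\<^esub>, q))) \<in> module_hom R (Q i) L"
      unfolding 0 by (rule hom_comp[OF Q(1) hom_comp[OF Q(1) inr B(3)] f(1)])
    show ?thesis
    proof (intro bexI[OF _ hom_minus[OF Q(1) L b2 fE]] ballI)
      fix q assume q: "q \<in> carrier (Q (Suc i))"
      have w: "th 0 q \<in> carrier (P 0)" "d' 0 q \<in> carrier (Q 0)" "q \<in> carrier (Q (Suc 0))"
        using q 0 by (auto simp: ts d's)
      have "D 0 (\<zero>\<^bsub>P (Suc 0)\<^esub>, q) = (th 0 q, d' 0 q)"
        using w Pi.M.l_zero 0 by (simp add: D ds)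
      moreover have "E (D 0 (\<zero>\<^bsub>P (Suc 0)\<^esub>, q)) = \<zero>\<^bsub>B\<^esub>"
        using w P1.M.zero_closed 0 by (intro B(5)) simp
      ultimately have "E (th 0 q, d' 0 q) = \<zero>\<^bsub>B\<^esub>" by simp
      moreover have "(th 0 q, d' 0 q) = (th 0 q, \<zero>\<^bsub>Q 0\<^esub>) \<oplus>\<^bsub>direct_sum (P 0) (Q 0)\<^esub> (\<zero>\<^bsub>P 0\<^esub>, d' 0 q)"
        using w Pi.M.r_zero Qi.M.l_zero 0 by simp
      ultimately have "E (th 0 q, \<zero>\<^bsub>Q 0\<^esub>) \<oplus>\<^bsub>B\<^esub> E (\<zero>\<^bsub>P 0\<^esub>, d' 0 q) = \<zero>\<^bsub>B\<^esub>"
        using w Pi.M.zero_closed Qi.M.zero_closed 0 Es(2)[of "(th 0 q, \<zero>\<^bsub>Q 0\<^esub>)" "(\<zero>\<^bsub>P 0\<^esub>, d' 0 q)"]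
        by (simp del: direct_sum_simps(3))
      then have "f (\<iota> (e (th 0 q)) \<oplus>\<^bsub>B\<^esub> E (\<zero>\<^bsub>P 0\<^esub>, d' 0 q)) = \<zero>\<^bsub>L\<^esub>"
        using E0 w fs(4) by simp
      moreover have c: "E (\<zero>\<^bsub>P 0\<^esub>, d' 0 q) \<in> carrier B" "e (th 0 q) \<in> carrier A"
        using w Es(1) Pi.M.zero_closed 0 hom_simps(1)[OF P(3) P(1) S'(1)] by auto
      ultimately have "a (th 0 q) \<oplus>\<^bsub>L\<^esub> f (E (\<zero>\<^bsub>P 0\<^esub>, d' 0 q)) = \<zero>\<^bsub>L\<^esub>"
        using f(2) g(2) w ios by (simp add: fs)
      moreover have cl: "a (th 0 q) \<in> carrier L" "f (E (\<zero>\<^bsub>P 0\<^esub>, d' 0 q)) \<in> carrier L"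
        "b (\<zero>\<^bsub>P 0\<^esub>, d' 0 q) \<in> carrier L"
        using w c as(1) fs(1) bs(1) 0 Pi.M.zero_closed by auto
      ultimately have "a (th 0 q) = \<ominus>\<^bsub>L\<^esub> f (E (\<zero>\<^bsub>P 0\<^esub>, d' 0 q))"
        using L.minus_equality by simp
      then have "c q = \<ominus>\<^bsub>L\<^esub> f (E (\<zero>\<^bsub>P 0\<^esub>, d' 0 q)) \<oplus>\<^bsub>L\<^esub> b (\<zero>\<^bsub>P 0\<^esub>, d' 0 q)"
        using cq[OF q] 0 by simp
      also have "\<dots> = b (\<zero>\<^bsub>P 0\<^esub>, d' 0 q) \<ominus>\<^bsub>L\<^esub> f (E (\<zero>\<^bsub>P 0\<^esub>, d' 0 q))"
        using cl by algebra
      finally show "c q = b (\<zero>\<^bsub>P i\<^esub>, d' i q) \<ominus>\<^bsub>L\<^esub> f (E (\<zero>\<^bsub>P i\<^esub>, d' i q))"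
        using 0 by simp
    qed
  next
    \<comment> \<open>Here \<open>a\<close> is itself a coboundary of some \<open>a'\<close>, and
      \<open>th\<close> anticommutes with the differentials, so \<open>a\<close> after
      \<open>th\<close> is up to sign the coboundary of \<open>a'\<close> after
      \<open>th k\<close>.\<close>
    case (Suc k)
    obtain a' where a': "a' \<in> module_hom R (P k) L" "\<And>p. p \<in> carrier (P (Suc k)) \<Longrightarrow> a p = a' (d k p)"
      by (rule ext_vanD[OF vA[OF Suc], of a]) (use a ad Suc in blast)+
    note a's = hom_simps[OF a'(1) P(1) L]
    have at: "(\<lambda>q. a' (th k q)) \<in> module_hom R (Q i) L"
      unfolding Suc by (rule hom_comp[OF Q(1) th(1) a'(1)])
    show ?thesis
    proof (intro bexI[OF _ hom_minus[OF Q(1) L b2 at]] ballI)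
      fix q assume q: "q \<in> carrier (Q (Suc i))"
      have w: "q \<in> carrier (Q (Suc (Suc k)))" "th (Suc k) q \<in> carrier (P (Suc k))"
        "d' (Suc k) q \<in> carrier (Q (Suc k))"
        using q Suc by (auto simp: ts d's)
      have "a (th i q) = \<ominus>\<^bsub>L\<^esub> a' (th k (d' i q))"
        unfolding Suc using w a's ts by (simp add: a'(2) th(2))
      then have "c q = \<ominus>\<^bsub>L\<^esub> a' (th k (d' i q)) \<oplus>\<^bsub>L\<^esub> b (\<zero>\<^bsub>P i\<^esub>, d' i q)"
        using cq[OF q] by simp
      moreover have "a' (th k (d' i q)) \<in> carrier L" "b (\<zero>\<^bsub>P i\<^esub>, d' i q) \<in> carrier L"
        using w a's ts bs(1) Suc Pi.M.zero_closed by auto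
      ultimately show "c q = b (\<zero>\<^bsub>P i\<^esub>, d' i q) \<ominus>\<^bsub>L\<^esub> a' (th k (d' i q))"
        by (simp add: L.M.minus_eq L.M.a_comm)
    qed
  qed
qed

lemma ext_vanishes_cokernel:
  fixes P Q :: "nat \<Rightarrow> ('a, nat \<Rightarrow> 'a) module"
  assumes S: "short_exact R A B C \<iota> \<pi>" and L: "module R L" and van: "ext_vanishes R A L" "ext_vanishes R B L"
    and ext: "\<And>g. g \<in> module_hom R A L \<Longrightarrow> \<exists>f\<in>module_hom R B L. \<forall>a\<in>carrier A. f (\<iota> a) = g a"
    and Q: "resolution R C Q d' e'" "\<And>i. fgp R (Q i)"
  shows "ext_vanishes R C L"
proof -
  obtain P :: "nat \<Rightarrow> ('a, nat \<Rightarrow> 'a) module" and d e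
    where P: "resolution R A P d e" "\<And>i. fgp R (P i)" "\<And>i. ext_van R P d L i"
    using van(1) unfolding ext_vanishes_def by blast
  have "ext_van R Q d' L i" for i
  proof (rule ext_van_cokernel[OF P(1) Q(1) S L P(2) Q(2)])
    fix D E assume "resolution R B (\<lambda>k. direct_sum (P k) (Q k)) D E"
    then show "ext_van R (\<lambda>k. direct_sum (P k) (Q k)) D L i"
      using P(2) Q(2) by (intro ext_vanishesD[OF van(2) short_exactD(2)[OF S] L] fgp_direct_sum) auto
  qed (use P(3) ext in auto)
  then show ?thesis
    using Q unfolding ext_vanishes_def by blast
qed

text \<open>\<open>B\<close> is the image of the direct sum of \<open>A\<close> and
  \<open>Q 0\<close> under \<open>(a, q) \<mapsto> \<iota> a + l q\<close>, and the kernel consists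
  of pairs \<open>(t q', d 0 q')\<close>. As \<open>f\<close> after \<open>t\<close> is a cocycle,
  it is \<open>b\<close> after \<open>d 0\<close> for some \<open>b\<close>; then
  \<open>f a - b q\<close> vanishes on the kernel and defines the extension.\<close>

lemma hom_extend:
  assumes S: "short_exact R A B C \<iota> \<pi>" and L: "module R L" and van: "ext_vanishes R C L"
    and f: "f \<in> module_hom R A L"
  shows "\<exists>g\<in>module_hom R B L. \<forall>a\<in>carrier A. g (\<iota> a) = f a"
proof -
  obtain Q :: "nat \<Rightarrow> ('a, nat \<Rightarrow> 'a) module" and d e
    where res: "resolution R C Q d e" and fg: "\<And>i. fgp R (Q i)" and v: "\<And>i. ext_van R Q d L i"
    using van unfolding ext_vanishes_def by blast
  note Q = resolutionD[OF res]
  note S' = short_exactD[OF S]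
  interpret A: module R A by (rule S')
  interpret B: module R B by (rule S')
  interpret L: module R L by (rule L)
  interpret Q0: module R "Q 0" by (rule Q)
  obtain l t where lt: "l \<in> module_hom R (Q 0) B" "t \<in> module_hom R (Q (Suc 0)) A"
      "\<forall>q\<in>carrier (Q 0). \<pi> (l q) = e q" "\<forall>q\<in>carrier (Q (Suc 0)). \<iota> (t q) = \<ominus>\<^bsub>B\<^esub> l (d 0 q)"
      "\<forall>q\<in>carrier (Q (Suc (Suc 0))). t (d (Suc 0) q) = \<zero>\<^bsub>A\<^esub>"
    using connecting_map[OF res S fg] by blast
  note l = lt(1) lt(3)[rule_format] and t = lt(2) lt(4)[rule_format]
  note ls = hom_simps[OF l(1) Q(1) S'(2)]
  note ts = hom_simps[OF t(1) Q(1) S'(1)]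
  note fs = hom_simps[OF f S'(1) L]
  note es = hom_simps[OF Q(3) Q(1) S'(3)]
  note ds = hom_simps[OF Q(2) Q(1) Q(1)]
  note ios = hom_simps[OF S'(4) S'(1,2)]
  note ps = hom_simps[OF S'(5) S'(2,3)]
  have ft: "(\<lambda>q. f (t q)) \<in> module_hom R (Q (Suc 0)) L"
    by (rule hom_comp[OF Q(1) t(1) f])
  have "f (t (d (Suc 0) q)) = \<zero>\<^bsub>L\<^esub>" if "q \<in> carrier (Q (Suc (Suc 0)))" for q
    using that lt(5) fs by simp
  then obtain b where b: "b \<in> module_hom R (Q 0) L" "\<And>q. q \<in> carrier (Q (Suc 0)) \<Longrightarrow> f (t q) = b (d 0 q)"
    by (rule ext_vanD[OF v ft]) blast+
  note bs = hom_simps[OF b(1) Q(1) L]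
  let ?X = "direct_sum A (Q 0)"
  have X: "module R ?X" by (rule direct_sum_is_module[OF S'(1) Q(1)])
  have \<sigma>: "(\<lambda>(a, q). \<iota> a \<oplus>\<^bsub>B\<^esub> l q) \<in> module_hom R ?X B"
    by (auto simp: module_hom_def ios ls B.a_ac B.smult_r_distr)
  have \<Phi>: "(\<lambda>(a, q). f a \<ominus>\<^bsub>L\<^esub> b q) \<in> module_hom R ?X L"
    by (auto simp: module_hom_def fs bs L.minus_eq L.minus_add L.a_ac L.smult_r_distr L.smult_r_minus)
  have "\<exists>g\<in>module_hom R B L. \<forall>p\<in>carrier ?X. g ((\<lambda>(a, q). \<iota> a \<oplus>\<^bsub>B\<^esub> l q) p) = (\<lambda>(a, q). f a \<ominus>\<^bsub>L\<^esub> b q) p"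
  proof (rule hom_factor[OF X S'(2) L \<sigma> _ \<Phi>])
    fix y assume y: "y \<in> carrier B"
    obtain q where q: "q \<in> carrier (Q 0)" "e q = \<pi> y"
      using Q(4)[of "\<pi> y"] ps y by auto
    have "\<pi> (y \<ominus>\<^bsub>B\<^esub> l q) = \<zero>\<^bsub>C\<^esub>"
      using q y module.axioms(2)[OF S'(3)] by (simp add: ps ls l(2) abelian_group.minus_other_side)
    then obtain a where a: "a \<in> carrier A" "\<iota> a = y \<ominus>\<^bsub>B\<^esub> l q"
      using S'(8)[of "y \<ominus>\<^bsub>B\<^esub> l q"] y ls q by auto
    have "\<iota> a \<oplus>\<^bsub>B\<^esub> l q = y"
      unfolding a(2) using y ls(1)[OF q(1)] by algebra
    then show "\<exists>p\<in>carrier ?X. (\<lambda>(a, q). \<iota> a \<oplus>\<^bsub>B\<^esub> l q) p = y"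
      using a(1) q(1) by (intro bexI[of _ "(a, q)"]) auto
  next
    fix p assume p: "p \<in> carrier ?X" "(\<lambda>(a, q). \<iota> a \<oplus>\<^bsub>B\<^esub> l q) p = \<zero>\<^bsub>B\<^esub>"
    obtain a q where aq: "p = (a, q)" "a \<in> carrier A" "q \<in> carrier (Q 0)"
      using p(1) by auto
    have s: "\<iota> a \<oplus>\<^bsub>B\<^esub> l q = \<zero>\<^bsub>B\<^esub>" using p(2) aq by simp
    then have "\<pi> (\<iota> a \<oplus>\<^bsub>B\<^esub> l q) = \<zero>\<^bsub>C\<^esub>" by (simp add: ps)
    then have "e q = \<zero>\<^bsub>C\<^esub>"
      using aq module.axioms(2)[OF S'(3)] by (simp add: ps ios ls l(2) S'(9) es abelian_group.axioms(1) abelian_monoid.l_zero)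
    then obtain q' where q': "q' \<in> carrier (Q (Suc 0))" "d 0 q' = q"
      using Q(6)[OF aq(3)] by blast
    have "\<iota> a = \<ominus>\<^bsub>B\<^esub> l q"
      using s aq B.minus_equality[of "\<iota> a" "l q"] by (simp add: ios ls)
    then have "\<iota> a = \<iota> (t q')" using t(2)[OF q'(1)] q'(2) by simp
    then have "a = t q'" using S'(6) aq(2) ts q'(1) by simp
    then have "f a = b q" using b(2)[OF q'(1)] q'(2) by simp
    then show "(\<lambda>(a, q). f a \<ominus>\<^bsub>L\<^esub> b q) p = \<zero>\<^bsub>L\<^esub>"
      using aq bs by simp
  qed
  then obtain g where g: "g \<in> module_hom R B L" "\<forall>p\<in>carrier ?X. g ((\<lambda>(a, q). \<iota> a \<oplus>\<^bsub>B\<^esub> l q) p) = (\<lambda>(a, q). f a \<ominus>\<^bsub>L\<^esub> b q) p"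
    by blast
  have "g (\<iota> a) = f a" if a: "a \<in> carrier A" for a
    using bspec[OF g(2), of "(a, \<zero>\<^bsub>Q 0\<^esub>)"] a by (simp add: ls bs ios fs L.minus_eq)
  then show ?thesis using g(1) by blast
qed

text \<open>Left exactness of Hom is elementary. \<open>ext\<close> supplies surjectivity at the
  right end; it comes from vanishing of Ext in some uses and from \<open>functional_extends\<close>
  in others.\<close>

lemma hom_module_short_exact:
  assumes S: "short_exact R G F Y \<iota> \<pi>" and L: "module R L"
    and ext: "\<And>g. g \<in> module_hom R G L \<Longrightarrow> \<exists>f\<in>module_hom R F L. \<forall>a\<in>carrier G. f (\<iota> a) = g a"
  shows "short_exact R (hom_module R Y L) (hom_module R F L) (hom_module R G L)
    (\<lambda>h. \<lambda>x\<in>carrier F. h (\<pi> x)) (\<lambda>f. \<lambda>a\<in>carrier G. f (\<iota> a))"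
proof -
  note S' = short_exactD[OF S]
  interpret L: module R L by (rule L)
  interpret F: module R F by (rule S')
  interpret G: module R G by (rule S')
  note ios = hom_simps[OF S'(4) S'(1,2)]
  note ps = hom_simps[OF S'(5) S'(2,3)]
  have 1: "(\<lambda>h. \<lambda>x\<in>carrier F. h (\<pi> x)) \<in> module_hom R (hom_module R Y L) (hom_module R F L)"
    using hom_comp[OF S'(2,5), of _ L] S'(2) ps(1)
    by (auto simp: module_hom_def[of _ "hom_module R Y L"] fun_eq_iff)
  have 2: "(\<lambda>f. \<lambda>a\<in>carrier G. f (\<iota> a)) \<in> module_hom R (hom_module R F L) (hom_module R G L)"
    using hom_comp[OF S'(1,4), of _ L] S'(1) ios(1)
    by (auto simp: module_hom_def[of _ "hom_module R F L"] fun_eq_iff)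
  have 3: "inj_on (\<lambda>h. \<lambda>x\<in>carrier F. h (\<pi> x)) (carrier (hom_module R Y L))"
  proof (rule inj_onI)
    fix h k assume hk: "h \<in> carrier (hom_module R Y L)" "k \<in> carrier (hom_module R Y L)"
      and e: "(\<lambda>x\<in>carrier F. h (\<pi> x)) = (\<lambda>x\<in>carrier F. k (\<pi> x))"
    show "h = k"
    proof (rule extensionalityI[of _ "carrier Y"])
      fix c assume "c \<in> carrier Y"
      then obtain x where x: "x \<in> carrier F" "\<pi> x = c" using S'(7) by blast
      show "h c = k c" using fun_cong[OF e, of x] x by simp
    qed (use hk in auto)
  qed
  have 4: "\<exists>f\<in>carrier (hom_module R F L). (\<lambda>a\<in>carrier G. f (\<iota> a)) = g"
    if g: "g \<in> carrier (hom_module R G L)" for g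
  proof -
    obtain f where f: "f \<in> module_hom R F L" "\<forall>a\<in>carrier G. f (\<iota> a) = g a"
      using ext[of g] g by auto
    show ?thesis
      using f g S'(2) ios(1) by (intro bexI[of _ "restrict f (carrier F)"]) (auto intro!: extensionalityI[of _ "carrier G"])
  qed
  have 5: "(\<lambda>a\<in>carrier G. f (\<iota> a)) = \<zero>\<^bsub>hom_module R G L\<^esub> \<longleftrightarrow>
      (\<exists>h\<in>carrier (hom_module R Y L). (\<lambda>x\<in>carrier F. h (\<pi> x)) = f)"
    if f: "f \<in> carrier (hom_module R F L)" for f
  proof
    assume z: "(\<lambda>a\<in>carrier G. f (\<iota> a)) = \<zero>\<^bsub>hom_module R G L\<^esub>"
    have z': "f (\<iota> a) = \<zero>\<^bsub>L\<^esub>" if "a \<in> carrier G" for a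
      using fun_cong[OF z, of a] that by simp
    have "\<exists>h\<in>module_hom R Y L. \<forall>x\<in>carrier F. h (\<pi> x) = f x"
    proof (rule hom_factor[OF S'(2,3) L S'(5,7)])
      show "f x = \<zero>\<^bsub>L\<^esub>" if x: "x \<in> carrier F" "\<pi> x = \<zero>\<^bsub>Y\<^esub>" for x
        using S'(8)[OF x] z' by auto
    qed (use f in auto)
    then obtain h where h: "h \<in> module_hom R Y L" "\<forall>x\<in>carrier F. h (\<pi> x) = f x" by blast
    show "\<exists>h\<in>carrier (hom_module R Y L). (\<lambda>x\<in>carrier F. h (\<pi> x)) = f"
      using h f S'(3) ps(1) by (intro bexI[of _ "restrict h (carrier Y)"]) (auto intro!: extensionalityI[of _ "carrier F"])
  next
    assume "\<exists>h\<in>carrier (hom_module R Y L). (\<lambda>x\<in>carrier F. h (\<pi> x)) = f"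
    then obtain h where h: "h \<in> module_hom R Y L" "f = (\<lambda>x\<in>carrier F. h (\<pi> x))" by auto
    show "(\<lambda>a\<in>carrier G. f (\<iota> a)) = \<zero>\<^bsub>hom_module R G L\<^esub>"
      unfolding h(2) using ios(1) S'(9) hom_simps(4)[OF h(1) S'(3) L]
      by (auto simp: fun_eq_iff)
  qed
  show ?thesis
    unfolding short_exact_def
    using 1 2 3 4 5 hom_module_module[OF S'(1) L] hom_module_module[OF S'(2) L] hom_module_module[OF S'(3) L]
    by blast
qed

section \<open>Totally reflexive modules\<close>

text \<open>Total reflexivity, stated with \<^const>\<open>ext_vanishes\<close>, hence independent of a chosen resolution.\<close>

definition tref :: "('a, 'r) ring_scheme \<Rightarrow> ('a, 'b, 'm) module_scheme \<Rightarrow> bool" where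
  "tref R X \<longleftrightarrow> finite_module R X \<and>
     (\<forall>\<phi>\<in>module_hom R (dual_module R X) (self_module R).
        \<exists>u\<in>carrier X. \<forall>h\<in>carrier (dual_module R X). \<phi> h = h u) \<and>
     (\<forall>u\<in>carrier X. (\<forall>h\<in>carrier (dual_module R X). h u = \<zero>\<^bsub>R\<^esub>) \<longrightarrow> u = \<zero>\<^bsub>X\<^esub>) \<and>
     ext_vanishes R (dual_module R X) (self_module R) \<and> ext_vanishes R X (self_module R)"

lemma trefD:
  assumes "tref R X"
  shows "finite_module R X" "module R X" "ext_vanishes R (dual_module R X) (self_module R)"
    and "\<And>\<phi>. \<phi> \<in> module_hom R (dual_module R X) (self_module R) \<Longrightarrow>
        \<exists>u\<in>carrier X. \<forall>h\<in>carrier (dual_module R X). \<phi> h = h u"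
    and "\<And>u. u \<in> carrier X \<Longrightarrow> (\<And>h. h \<in> carrier (dual_module R X) \<Longrightarrow> h u = \<zero>\<^bsub>R\<^esub>) \<Longrightarrow> u = \<zero>\<^bsub>X\<^esub>"
    and "ext_vanishes R X (self_module R)"
  using assms by (auto simp: tref_def finite_module_def)

lemma dual_carrier:
  "carrier (dual_module R X) = module_hom R X (self_module R) \<inter> extensional (carrier X)"
  by (simp add: dual_module_def)

section \<open>Duals of finitely generated projective modules\<close>

context cring
begin

lemma dual_module_module: "module R X \<Longrightarrow> module R (dual_module R X)"
  unfolding dual_module_def by (rule hom_module_module[OF _ self_module_module])

lemma restrict_dual:
  "module R X \<Longrightarrow> h \<in> module_hom R X (self_module R) \<Longrightarrow> restrict h (carrier X) \<in> carrier (dual_module R X)"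
  by (simp add: dual_carrier)

text \<open>The coordinates of \<open>k\<close> with respect to the \<open>h i\<close> are the
  values \<open>k (u i)\<close>: a dual basis with its two halves exchanged is one for the dual
  module.\<close>

lemma fgp_dual_expand:
  assumes P: "module R P" and u: "\<And>i. i < n \<Longrightarrow> u i \<in> carrier P"
    and h: "\<And>i. i < n \<Longrightarrow> h i \<in> module_hom R P (self_module R)"
    and uh: "\<And>q. q \<in> carrier P \<Longrightarrow> msum P (\<lambda>i. h i q \<odot>\<^bsub>P\<^esub> u i) n = q"
    and k: "k \<in> carrier (dual_module R P)"
  shows "msum (dual_module R P) (\<lambda>i. k (u i) \<odot>\<^bsub>dual_module R P\<^esub> restrict (h i) (carrier P)) n = k"
proof -
  note sm = self_module_module
  interpret P: module R P by fact
  interpret D: module R "dual_module R P" by (rule dual_module_module[OF P])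
  have kh: "k \<in> module_hom R P (self_module R)" using k by (simp add: dual_carrier)
  note ks = hom_simps[OF kh P sm, simplified]
  note hs = hom_simps[OF h P sm, simplified]
  have c: "k (u i) \<odot>\<^bsub>dual_module R P\<^esub> restrict (h i) (carrier P) \<in> carrier (dual_module R P)" if "i < n" for i
    using that u ks h by (intro D.smult_closed restrict_dual[OF P]) auto
  have S: "msum (dual_module R P) (\<lambda>i. k (u i) \<odot>\<^bsub>dual_module R P\<^esub> restrict (h i) (carrier P)) n
      \<in> carrier (dual_module R P)"
    by (rule D.msum_closed[OF c])
  show ?thesis
  proof (rule extensionalityI[of _ "carrier P"])
    fix x assume x: "x \<in> carrier P"
    have "msum (dual_module R P) (\<lambda>i. k (u i) \<odot>\<^bsub>dual_module R P\<^esub> restrict (h i) (carrier P)) n x =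
        msum (self_module R) (\<lambda>i. (k (u i) \<odot>\<^bsub>dual_module R P\<^esub> restrict (h i) (carrier P)) x) n"
      using hom_msum[OF eval_hom[OF P sm x, folded dual_module_def] D.module_axioms sm c] .
    also have "\<dots> = msum (self_module R) (\<lambda>i. k (h i x \<odot>\<^bsub>P\<^esub> u i)) n"
      using x u hs ks by (intro msum_cong) (auto simp: dual_module_def m_comm)
    also have "\<dots> = k (msum P (\<lambda>i. h i x \<odot>\<^bsub>P\<^esub> u i) n)"
      using hs(1) x u by (intro hom_msum[OF kh P sm, symmetric]) auto
    finally show "msum (dual_module R P) (\<lambda>i. k (u i) \<odot>\<^bsub>dual_module R P\<^esub> restrict (h i) (carrier P)) n x = k x"
      by (simp only: uh[OF x])
  qed (use S k in \<open>auto simp: dual_carrier\<close>)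
qed

lemma fgp_dual:
  assumes "fgp R P"
  shows "fgp R (dual_module R P)"
proof -
  have P: "module R P" using assms by (rule fgp_module)
  note sm = self_module_module
  obtain n u h where u: "\<And>i. i < n \<Longrightarrow> u i \<in> carrier P"
    and h: "\<And>i. i < n \<Longrightarrow> h i \<in> module_hom R P (self_module R)"
    and uh: "\<And>q. q \<in> carrier P \<Longrightarrow> msum P (\<lambda>i. h i q \<odot>\<^bsub>P\<^esub> u i) n = q"
    by (rule fgpE[OF assms]) blast
  show ?thesis
  proof (rule fgpI[where n = n and u = "\<lambda>i. restrict (h i) (carrier P)" and h = "\<lambda>i k. k (u i)"])
    show "(\<lambda>k. k (u i)) \<in> module_hom R (dual_module R P) (self_module R)" if "i < n" for i
      unfolding dual_module_def by (rule eval_hom[OF P sm u[OF that]])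
    show "q = msum (dual_module R P) (\<lambda>i. q (u i) \<odot>\<^bsub>dual_module R P\<^esub> restrict (h i) (carrier P)) n"
      if "q \<in> carrier (dual_module R P)" for q
      by (rule fgp_dual_expand[OF P u h uh that, symmetric])
  qed (use dual_module_module[OF P] restrict_dual[OF P h] in auto)
qed

end

lemma (in noetherian_cring) fgp_tref:
  fixes P :: "('a, 'p) module"
  assumes "fgp R P"
  shows "tref R P"
  unfolding tref_def
proof (intro conjI ballI impI)
  have P: "module R P" using assms by (rule fgp_module)
  interpret P: module R P by fact
  note sm = self_module_module
  interpret D: module R "dual_module R P" by (rule dual_module_module[OF P])
  obtain n u h where u: "\<And>i. i < n \<Longrightarrow> u i \<in> carrier P"
    and h: "\<And>i. i < n \<Longrightarrow> h i \<in> module_hom R P (self_module R)"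
    and uh: "\<And>q. q \<in> carrier P \<Longrightarrow> msum P (\<lambda>i. h i q \<odot>\<^bsub>P\<^esub> u i) n = q"
    by (rule fgpE[OF assms]) blast
  let ?h = "\<lambda>i. restrict (h i) (carrier P)"
  have rh: "?h i \<in> carrier (dual_module R P)" if "i < n" for i
    by (rule restrict_dual[OF P h[OF that]])
  show "finite_module R P" by (rule fgp_finite[OF assms])
  show "ext_vanishes R (dual_module R P) (self_module R)"
    by (rule ext_vanishes_fgp[OF fgp_dual[OF assms] sm])
  show "ext_vanishes R P (self_module R)"
    by (rule ext_vanishes_fgp[OF assms sm])
  { fix \<phi> assume \<phi>: "\<phi> \<in> module_hom R (dual_module R P) (self_module R)"
    note \<phi>s = hom_simps[OF \<phi> D.module_axioms sm, simplified]
    \<comment> \<open>An element at which \<open>\<phi>\<close> is evaluation must have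
      \<open>\<phi> (?h i)\<close> as its coordinate number \<open>i\<close>.\<close>
    let ?u = "msum P (\<lambda>i. \<phi> (?h i) \<odot>\<^bsub>P\<^esub> u i) n"
    have "\<phi> k = k ?u" if k: "k \<in> carrier (dual_module R P)" for k
    proof -
      have kh: "k \<in> module_hom R P (self_module R)" using k by (simp add: dual_carrier)
      note ks = hom_simps[OF kh P sm, simplified]
      have "\<phi> (msum (dual_module R P) (\<lambda>i. k (u i) \<odot>\<^bsub>dual_module R P\<^esub> ?h i) n) =
          msum (self_module R) (\<lambda>i. \<phi> (k (u i) \<odot>\<^bsub>dual_module R P\<^esub> ?h i)) n"
        using rh u ks by (intro hom_msum[OF \<phi> D.module_axioms sm] D.smult_closed) auto
      also have "\<dots> = msum (self_module R) (\<lambda>i. k (\<phi> (?h i) \<odot>\<^bsub>P\<^esub> u i)) n"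
        using rh u ks \<phi>s by (intro msum_cong) (simp add: m_comm)
      also have "\<dots> = k ?u"
        using rh u \<phi>s by (intro hom_msum[OF kh P sm, symmetric]) auto
      finally show ?thesis
        by (simp only: fgp_dual_expand[OF P u h uh k])
    qed
    moreover have "?u \<in> carrier P"
      using rh u \<phi>s by (intro P.msum_closed) auto
    ultimately show "\<exists>u\<in>carrier P. \<forall>h\<in>carrier (dual_module R P). \<phi> h = h u" by blast }
  { fix v assume v: "v \<in> carrier P" "\<forall>h\<in>carrier (dual_module R P). h v = \<zero>"
    have "h i v = \<zero>" if "i < n" for i
      using v(2) rh[OF that] v(1) by force
    then have "msum P (\<lambda>i. h i v \<odot>\<^bsub>P\<^esub> u i) n = \<zero>\<^bsub>P\<^esub>"
      using u by (intro P.msum_zero) auto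
    then show "v = \<zero>\<^bsub>P\<^esub>" by (simp only: uh[OF v(1)]) }
qed

text \<open>\<open>y\<close> is a socle element of the local ring \<open>R/(xs)\<close>.\<close>

locale maximal_regular = noetherian_cring +
  fixes xs y
  assumes xs: "set xs \<subseteq> carrier R" and reg: "wreg xs (self_module R)"
    and y: "y \<in> carrier R" "y \<notin> lmul xs (self_module R)"
    and soc: "\<And>c. c \<in> carrier R \<Longrightarrow> c \<notin> Units R \<Longrightarrow> c \<otimes> y \<in> lmul xs (self_module R)"
begin

text \<open>This identifies \<open>X\<close> with the Hom module from its dual to \<open>R\<close>,
  so that \<open>hom_lmul\<close> and \<open>wreg_hom\<close> can be used for \<open>X\<close>
  itself.\<close>

lemma tref_ev:
  assumes X: "tref R X"
  defines "b \<equiv> \<lambda>u. \<lambda>h\<in>carrier (dual_module R X). h u"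
  shows "b \<in> module_hom R X (dual_module R (dual_module R X))"
    and "\<And>c. c \<in> carrier (dual_module R (dual_module R X)) \<Longrightarrow> \<exists>u\<in>carrier X. b u = c"
    and "inj_on b (carrier X)"
proof -
  note T = trefD[OF X]
  note sm = self_module_module
  interpret X: module R X by (rule T)
  have D: "module R (dual_module R X)" by (rule dual_module_module[OF T(2)])
  have hX: "h \<in> module_hom R X (self_module R)" if "h \<in> carrier (dual_module R X)" for h
    using that by (simp add: dual_carrier)
  note hs = hom_simps[OF hX T(2) sm, simplified]
  have bc: "b u \<in> carrier (dual_module R (dual_module R X))" if "u \<in> carrier X" for u
    using restrict_dual[OF D, of "\<lambda>h. h u"] eval_hom[OF T(2) sm that] by (simp add: b_def dual_module_def)
  show "b \<in> module_hom R X (dual_module R (dual_module R X))"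
    unfolding module_hom_def
  proof (intro CollectI conjI allI impI)
    show "b \<in> carrier X \<rightarrow> carrier (dual_module R (dual_module R X))" using bc by auto
    show "b (m1 \<oplus>\<^bsub>X\<^esub> m2) = b m1 \<oplus>\<^bsub>dual_module R (dual_module R X)\<^esub> b m2"
      if "m1 \<in> carrier X \<and> m2 \<in> carrier X" for m1 m2
      using that hs by (auto simp: b_def dual_module_def[of R "dual_module R X"] fun_eq_iff)
    show "b (r \<odot>\<^bsub>X\<^esub> m) = r \<odot>\<^bsub>dual_module R (dual_module R X)\<^esub> b m"
      if "r \<in> carrier R \<and> m \<in> carrier X" for r m
      using that hs by (auto simp: b_def dual_module_def[of R "dual_module R X"] fun_eq_iff)
  qed
  show "\<exists>u\<in>carrier X. b u = c" if c: "c \<in> carrier (dual_module R (dual_module R X))" for c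
  proof -
    obtain u where u: "u \<in> carrier X" "\<forall>h\<in>carrier (dual_module R X). c h = h u"
      using T(4)[of c] c by (auto simp: dual_carrier[of R "dual_module R X"])
    then show ?thesis
      using c by (intro bexI[of _ u]) (auto simp: b_def dual_carrier[of R "dual_module R X"]
          intro!: extensionalityI[of _ "carrier (dual_module R X)"])
  qed
  show "inj_on b (carrier X)"
  proof (rule inj_onI)
    fix u v assume uv: "u \<in> carrier X" "v \<in> carrier X" "b u = b v"
    have "h (u \<ominus>\<^bsub>X\<^esub> v) = \<zero>" if h: "h \<in> carrier (dual_module R X)" for h
    proof -
      have "h u = h v" using fun_cong[OF uv(3), of h] h by (simp add: b_def)
      moreover have "h (u \<ominus>\<^bsub>X\<^esub> v) = h u \<ominus> h v"
        using hom_simps(6)[OF hX[OF h] T(2) sm uv(1,2)] by simp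
      ultimately show ?thesis using hs(1)[OF h uv(2)] by (simp add: minus_eq r_neg)
    qed
    then have "u \<ominus>\<^bsub>X\<^esub> v = \<zero>\<^bsub>X\<^esub>" using uv by (intro T(5)) auto
    then show "u = v" using uv by simp
  qed
qed

text \<open>Seen in the bidual, the assumption says that evaluation at \<open>u\<close> lies in
  \<open>(xs)R\<close> pointwise, and \<open>hom_lmul\<close> gathers the pointwise statements into
  one.\<close>

lemma tref_torsionless:
  assumes X: "tref R X" and u: "u \<in> carrier X"
    and f: "\<And>f. f \<in> module_hom R X (self_module R) \<Longrightarrow> f u \<in> lmul xs (self_module R)"
  shows "u \<in> lmul xs X"
proof -
  note T = trefD[OF X]
  have D: "module R (dual_module R X)" by (rule dual_module_module[OF T(2)])
  show ?thesis
  proof (rule lmul_iso[OF T(2) dual_module_module[OF D] tref_ev[OF X] xs u])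
    have "(\<lambda>h\<in>carrier (dual_module R X). h u) \<in> carrier (dual_module R (dual_module R X))"
      using hom_simps(1)[OF tref_ev(1)[OF X] T(2) dual_module_module[OF D] u] .
    then show "(\<lambda>h\<in>carrier (dual_module R X). h u) \<in> lmul xs (dual_module R (dual_module R X))"
      unfolding dual_module_def[of R "dual_module R X"]
      by (rule hom_lmul[OF D self_module_module T(3) xs reg]) (auto simp: dual_carrier intro: f)
  qed
qed

lemma tref_wreg:
  assumes X: "tref R X"
  shows "wreg xs X"
proof -
  note T = trefD[OF X]
  have D: "module R (dual_module R X)" by (rule dual_module_module[OF T(2)])
  show ?thesis
  proof (rule wreg_iso[OF T(2) dual_module_module[OF D] tref_ev[OF X] xs])
    show "wreg xs (dual_module R (dual_module R X))"
      unfolding dual_module_def[of R "dual_module R X"]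
      by (rule wreg_hom[OF D self_module_module T(3) xs reg])
  qed
qed

text \<open>A map modulo \<open>(xs)\<close> on the dual of \<open>G\<close> lifts to a functional
  because Ext of that dual vanishes, and reflexivity makes the functional an evaluation. This is the
  hypothesis on \<open>G\<close> in \<open>functional_extends\<close>.\<close>

lemma tref_functional_extends:
  assumes S: "short_exact R G F Y \<iota> \<pi>" and G: "tref R G" and wr: "wreg xs Y"
    and F: "\<And>u. u \<in> carrier F \<Longrightarrow>
        (\<And>f. f \<in> module_hom R F (self_module R) \<Longrightarrow> f u \<in> lmul xs (self_module R)) \<Longrightarrow> u \<in> lmul xs F"
    and g: "g \<in> module_hom R G (self_module R)"
  shows "\<exists>f\<in>module_hom R F (self_module R). \<forall>a\<in>carrier G. f (\<iota> a) = g a"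
proof (rule functional_extends[OF S xs wr y soc finite_dual _ F g])
  note T = trefD[OF G]
  have D: "module R (dual_module R G)" by (rule dual_module_module[OF T(2)])
  show "finite_module R G" by (rule T)
  fix \<phi> assume \<phi>: "\<phi> \<in> hom_mod R (dual_module R G) (self_module R) (lmul xs (self_module R))"
  obtain g where g: "g \<in> module_hom R (dual_module R G) (self_module R)"
    "\<forall>n\<in>carrier (dual_module R G). \<phi> n \<ominus> g n \<in> lmul xs (self_module R)"
    using hom_mod_lift[OF D self_module_module T(3) xs reg \<phi>] by auto
  obtain u where u: "u \<in> carrier G" "\<forall>h\<in>carrier (dual_module R G). g h = h u"
    using T(4)[OF g(1)] by blast
  show "\<exists>u\<in>carrier G. \<forall>h\<in>carrier (dual_module R G). \<phi> h \<ominus> h u \<in> lmul xs (self_module R)"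
    using u g(2) by (intro bexI[of _ u]) auto
qed

text \<open>Functionals on \<open>G\<close> extend to \<open>F\<close>, so the dual sequence is
  exact, and the long exact sequences give vanishing of Ext for \<open>Y\<close> and for its dual.
  Biduality is onto because functionals on the dual of \<open>Y\<close> extend to the dual of
  \<open>F\<close>, Ext of the dual of \<open>G\<close> being zero.\<close>

lemma tref_quotient:
  assumes S: "short_exact R G F Y \<iota> \<pi>" and G: "tref R G" and F: "tref R F" and wr: "wreg xs Y"
  shows "tref R Y"
proof -
  note S' = short_exactD[OF S]
  note TG = trefD[OF G]
  note TF = trefD[OF F]
  note sm = self_module_module
  note DG = dual_module_module[OF S'(1)] and DF = dual_module_module[OF S'(2)] and DY = dual_module_module[OF S'(3)]
  interpret F: module R F by (rule S')
  note ios = hom_simps[OF S'(4) S'(1,2)]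
  note ps = hom_simps[OF S'(5) S'(2,3)]
  let ?\<alpha> = "\<lambda>h. \<lambda>x\<in>carrier F. h (\<pi> x)" and ?\<beta> = "\<lambda>f. \<lambda>a\<in>carrier G. f (\<iota> a)"
  have SD: "short_exact R (dual_module R Y) (dual_module R F) (dual_module R G) ?\<alpha> ?\<beta>"
    unfolding dual_module_def
    by (rule hom_module_short_exact[OF S sm tref_functional_extends[OF S G wr tref_torsionless[OF F]]])
  note SD' = short_exactD[OF SD]
  have fin: "finite_module R Y"
    by (rule finite_module_surj[OF TF(1) S'(3,5,7)])
  obtain n d e where res: "resolution R (dual_module R Y) (\<lambda>i. free_mod R (n i)) d e"
    using exists_free_resolution[OF finite_dual[OF fin]] by blast
  have van: "ext_vanishes R (dual_module R Y) (self_module R)"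
    by (rule ext_vanishes_short_exact[OF SD sm TF(3) TG(3) res free_mod_fgp])
  obtain m d' e' where resY: "resolution R Y (\<lambda>i. free_mod R (m i)) d' e'"
    using exists_free_resolution[OF fin] by blast
  have vanY: "ext_vanishes R Y (self_module R)"
    by (rule ext_vanishes_cokernel[OF S sm TG(6) TF(6) tref_functional_extends[OF S G wr tref_torsionless[OF F]]
          resY free_mod_fgp])
  have onto: "\<exists>v\<in>carrier Y. \<forall>h\<in>carrier (dual_module R Y). \<phi> h = h v"
    if \<phi>: "\<phi> \<in> module_hom R (dual_module R Y) (self_module R)" for \<phi>
  proof -
    obtain \<psi> where \<psi>: "\<psi> \<in> module_hom R (dual_module R F) (self_module R)"
      "\<forall>h\<in>carrier (dual_module R Y). \<psi> (?\<alpha> h) = \<phi> h"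
      using hom_extend[OF SD sm TG(3) \<phi>] by blast
    obtain u where u: "u \<in> carrier F" "\<forall>h\<in>carrier (dual_module R F). \<psi> h = h u"
      using TF(4)[OF \<psi>(1)] by blast
    have "\<phi> h = h (\<pi> u)" if h: "h \<in> carrier (dual_module R Y)" for h
      using \<psi>(2) u h hom_simps(1)[OF SD'(4) DY DF h] by auto
    then show ?thesis using ps(1)[OF u(1)] by blast
  qed
  have inj: "v = \<zero>\<^bsub>Y\<^esub>" if v: "v \<in> carrier Y" "\<And>h. h \<in> carrier (dual_module R Y) \<Longrightarrow> h v = \<zero>" for v
  proof -
    obtain u where u: "u \<in> carrier F" "\<pi> u = v" using S'(7)[OF v(1)] by blast
    \<comment> \<open>Evaluation at \<open>u\<close> is zero on functionals that come from
      \<open>Y\<close>, so it factors through the dual of \<open>G\<close>, where it is evaluation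
      at some \<open>g\<close>. Then no functional on \<open>F\<close> separates \<open>u\<close>
      from \<open>\<iota> g\<close>.\<close>
    have "\<exists>\<psi>\<in>module_hom R (dual_module R G) (self_module R). \<forall>f\<in>carrier (dual_module R F). \<psi> (?\<beta> f) = f u"
    proof (rule hom_factor[OF DF DG sm SD'(5,7)])
      show "(\<lambda>f. f u) \<in> module_hom R (dual_module R F) (self_module R)"
        unfolding dual_module_def by (rule eval_hom[OF S'(2) sm u(1)])
      fix f assume "f \<in> carrier (dual_module R F)" "?\<beta> f = \<zero>\<^bsub>dual_module R G\<^esub>"
      then obtain h where "h \<in> carrier (dual_module R Y)" "?\<alpha> h = f"
        using SD'(8) by blast
      then show "f u = \<zero>\<^bsub>self_module R\<^esub>" using u v(2) by auto
    qed
    then obtain \<psi> where \<psi>: "\<psi> \<in> module_hom R (dual_module R G) (self_module R)"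
      "\<forall>f\<in>carrier (dual_module R F). \<psi> (?\<beta> f) = f u" by blast
    obtain g where g: "g \<in> carrier G" "\<forall>h\<in>carrier (dual_module R G). \<psi> h = h g"
      using TG(4)[OF \<psi>(1)] by blast
    have "f (u \<ominus>\<^bsub>F\<^esub> \<iota> g) = \<zero>" if f: "f \<in> carrier (dual_module R F)" for f
    proof -
      have fh: "f \<in> module_hom R F (self_module R)" using f by (simp add: dual_carrier)
      have "f u = f (\<iota> g)"
        using \<psi>(2) g f hom_simps(1)[OF SD'(5) DF DG f] by auto
      then show ?thesis
        using hom_simps[OF fh S'(2) sm, simplified] u(1) g(1) ios by (simp add: minus_eq r_neg)
    qed
    then have "u \<ominus>\<^bsub>F\<^esub> \<iota> g = \<zero>\<^bsub>F\<^esub>"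
      using u(1) g(1) ios by (intro TF(5)) auto
    then have "u = \<iota> g" using u(1) g(1) ios by simp
    then show ?thesis using u(2) S'(9)[OF g(1)] by simp
  qed
  show ?thesis
    unfolding tref_def using fin van vanY onto inj by auto
qed

text \<open>The coordinate functionals of \<open>G\<close> extend to \<open>F\<close> and assemble
  to a retraction \<open>\<rho>\<close> of \<open>\<iota>\<close>. So the sequence splits, and
  \<open>f - \<iota> (\<rho> f)\<close> induces a section of \<open>\<pi>\<close> through which
  \<open>Y\<close> inherits the dual basis of \<open>F\<close>.\<close>

lemma fgp_quotient:
  fixes G :: "('a, 'g) module"
  assumes S: "short_exact R G F Y \<iota> \<pi>" and G: "fgp R G" and F: "fgp R F" and wr: "wreg xs Y"
    and F': "\<And>u. u \<in> carrier F \<Longrightarrow>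
        (\<And>f. f \<in> module_hom R F (self_module R) \<Longrightarrow> f u \<in> lmul xs (self_module R)) \<Longrightarrow> u \<in> lmul xs F"
  shows "fgp R Y"
proof -
  note S' = short_exactD[OF S]
  note sm = self_module_module
  interpret F: module R F by (rule S')
  interpret G: module R G by (rule S')
  note ios = hom_simps[OF S'(4) S'(1,2)]
  note ps = hom_simps[OF S'(5) S'(2,3)]
  obtain n u h where u: "\<And>i. i < n \<Longrightarrow> u i \<in> carrier G"
    and h: "\<And>i. i < n \<Longrightarrow> h i \<in> module_hom R G (self_module R)"
    and uh: "\<And>q. q \<in> carrier G \<Longrightarrow> msum G (\<lambda>i. h i q \<odot>\<^bsub>G\<^esub> u i) n = q"
    by (rule fgpE[OF G]) blast
  obtain m v k where v: "\<And>i. i < m \<Longrightarrow> v i \<in> carrier F"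
    and k: "\<And>i. i < m \<Longrightarrow> k i \<in> module_hom R F (self_module R)"
    and vk: "\<And>q. q \<in> carrier F \<Longrightarrow> msum F (\<lambda>i. k i q \<odot>\<^bsub>F\<^esub> v i) m = q"
    by (rule fgpE[OF F]) blast
  have "\<forall>i\<in>{..<n}. \<exists>f. f \<in> module_hom R F (self_module R) \<and> (\<forall>a\<in>carrier G. f (\<iota> a) = h i a)"
    using tref_functional_extends[OF S fgp_tref[OF G] wr F' h] by blast
  then obtain h' where h'0: "\<forall>i\<in>{..<n}. h' i \<in> module_hom R F (self_module R) \<and> (\<forall>a\<in>carrier G. h' i (\<iota> a) = h i a)"
    by (rule bchoice[THEN exE])
  have h': "\<And>i. i < n \<Longrightarrow> h' i \<in> module_hom R F (self_module R)"
    "\<And>i a. i < n \<Longrightarrow> a \<in> carrier G \<Longrightarrow> h' i (\<iota> a) = h i a"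
    using h'0 by auto
  define \<rho> where "\<rho> f = msum G (\<lambda>i. h' i f \<odot>\<^bsub>G\<^esub> u i) n" for f
  note h's = hom_simps[OF h'(1) S'(2) sm, simplified]
  have \<rho>: "\<rho> \<in> module_hom R F G"
    unfolding module_hom_def \<rho>_def using u h's
    by (auto simp: G.msum_closed G.msum_plus[symmetric] G.msum_smult[symmetric] G.smult_l_distr
        G.smult_assoc1 intro!: msum_cong)
  have \<rho>\<iota>: "\<rho> (\<iota> a) = a" if a: "a \<in> carrier G" for a
  proof -
    have "\<rho> (\<iota> a) = msum G (\<lambda>i. h i a \<odot>\<^bsub>G\<^esub> u i) n"
      unfolding \<rho>_def using h'(2) a by (intro msum_cong) simp
    then show ?thesis by (simp only: uh[OF a])
  qed
  note \<rho>s = hom_simps[OF \<rho> S'(2,1)]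
  have "\<exists>s\<in>module_hom R Y F. \<forall>f\<in>carrier F. s (\<pi> f) = f \<ominus>\<^bsub>F\<^esub> \<iota> (\<rho> f)"
  proof (rule hom_factor[OF S'(2,3,2,5,7)])
    show "(\<lambda>f. f \<ominus>\<^bsub>F\<^esub> \<iota> (\<rho> f)) \<in> module_hom R F F"
      by (rule hom_minus[OF S'(2,2) hom_id hom_comp[OF S'(2) \<rho> S'(4)]])
    fix f assume f: "f \<in> carrier F" "\<pi> f = \<zero>\<^bsub>Y\<^esub>"
    then obtain a where "a \<in> carrier G" "\<iota> a = f" using S'(8) by blast
    then show "f \<ominus>\<^bsub>F\<^esub> \<iota> (\<rho> f) = \<zero>\<^bsub>F\<^esub>" using \<rho>\<iota> f(1) by auto
  qed
  then obtain s where s: "s \<in> module_hom R Y F" "\<forall>f\<in>carrier F. s (\<pi> f) = f \<ominus>\<^bsub>F\<^esub> \<iota> (\<rho> f)"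
    by blast
  have \<pi>s: "\<pi> (s z) = z" if z: "z \<in> carrier Y" for z
  proof -
    obtain f where f: "f \<in> carrier F" "\<pi> f = z" using S'(7)[OF z] by blast
    interpret Y: module R Y by (rule S')
    have "s z = f \<ominus>\<^bsub>F\<^esub> \<iota> (\<rho> f)" using s(2) f by auto
    then show ?thesis
      using f z \<rho>s ios S'(9) by (simp add: ps Y.M.minus_eq)
  qed
  have ss: "s z \<in> carrier F" if "z \<in> carrier Y" for z
    using hom_simps(1)[OF s(1) S'(3,2) that] .
  show ?thesis
  proof (rule fgpI[where n = m and u = "\<lambda>i. \<pi> (v i)" and h = "\<lambda>i z. k i (s z)"])
    show "module R Y" by (rule S')
    show "\<pi> (v i) \<in> carrier Y" if "i < m" for i using v[OF that] ps by simp
    show "(\<lambda>z. k i (s z)) \<in> module_hom R Y (self_module R)" if "i < m" for i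
      by (rule hom_comp[OF S'(3) s(1) k[OF that]])
    show "z = msum Y (\<lambda>i. k i (s z) \<odot>\<^bsub>Y\<^esub> \<pi> (v i)) m" if z: "z \<in> carrier Y" for z
    proof -
      note ks = hom_simps(1)[OF k S'(2) sm, simplified]
      have "\<pi> (msum F (\<lambda>i. k i (s z) \<odot>\<^bsub>F\<^esub> v i) m) = msum Y (\<lambda>i. \<pi> (k i (s z) \<odot>\<^bsub>F\<^esub> v i)) m"
        using ks v ss[OF z] by (intro hom_msum[OF S'(5,2,3)]) auto
      also have "\<dots> = msum Y (\<lambda>i. k i (s z) \<odot>\<^bsub>Y\<^esub> \<pi> (v i)) m"
        using ks v ss[OF z] ps by (intro msum_cong) simp
      finally show ?thesis
        by (simp only: vk[OF ss[OF z]] \<pi>s[OF z])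
    qed
  qed
qed

end

section \<open>Maximal regular sequences\<close>

text \<open>A nonempty chain of ideals contains its own union, so Zorn's lemma works inside an
  arbitrary set \<open>C\<close> of ideals. Below, \<open>C\<close> consists of annihilators, of
  ideals with finitely many chosen generators, of proper ideals, or of ideals of regular
  sequences.\<close>

lemma (in noetherian_ring) maximal_ideal_in:
  assumes "C \<noteq> {}" "\<And>I. I \<in> C \<Longrightarrow> ideal I R"
  shows "\<exists>M\<in>C. \<forall>I\<in>C. M \<subseteq> I \<longrightarrow> I = M"
proof (rule subset_Zorn)
  fix D assume D: "subset.chain C D"
  show "\<exists>U\<in>C. \<forall>X\<in>D. X \<subseteq> U"
  proof (cases "D = {}")
    case True
    then show ?thesis using assms(1) by blast
  next
    case False
    have "D \<subseteq> C" using D by (auto simp: pred_on.chain_def)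
    have "subset.chain {I. ideal I R} D"
      using D assms(2) unfolding pred_on.chain_def by blast
    then have "\<Union>D \<in> D" by (rule ideal_chain_is_trivial[OF False])
    then show ?thesis using \<open>D \<subseteq> C\<close> by (intro bexI[of _ "\<Union>D"]) auto
  qed
qed

section \<open>Prime avoidance and associated primes\<close>

lemma (in cring) ideal_quotient_elem:
  assumes "ideal I R" "z \<in> carrier R"
  shows "ideal {c \<in> carrier R. c \<otimes> z \<in> I} R"
proof -
  interpret I: ideal I R by fact
  show ?thesis
    by (rule idealI_cring) (use assms(2) in \<open>auto simp: l_distr m_assoc I.I_l_closed\<close>)
qed

text \<open>Multiply an element of \<open>m\<close> outside \<open>p\<close> by one element outside
  \<open>p\<close> from each \<open>q\<close>; primality keeps the product outside
  \<open>p\<close>.\<close>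

lemma (in cring) element_outside_prime:
  assumes "finite Q" "\<And>q. q \<in> Q \<Longrightarrow> ideal q R" "\<And>q. q \<in> Q \<Longrightarrow> \<not> q \<subseteq> p"
    and "\<And>a b. a \<in> carrier R \<Longrightarrow> b \<in> carrier R \<Longrightarrow> a \<otimes> b \<in> p \<Longrightarrow> a \<in> p \<or> b \<in> p"
    and "ideal m R" "\<not> m \<subseteq> p"
  shows "\<exists>w\<in>m. w \<notin> p \<and> (\<forall>q\<in>Q. w \<in> q)"
  using assms(1-3)
proof (induction Q)
  case empty
  then show ?case using assms(6) by blast
next
  case (insert q Q)
  interpret m: ideal m R by fact
  obtain w where w: "w \<in> m" "w \<notin> p" "\<forall>q\<in>Q. w \<in> q" using insert by blast
  have q: "ideal q R" using insert by blast
  obtain b where b: "b \<in> q" "b \<notin> p" using insert by blast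
  have c: "w \<in> carrier R" "b \<in> carrier R"
    using w(1) b(1) ideal.Icarr[OF assms(5)] ideal.Icarr[OF q] by auto
  have "w \<otimes> b \<in> m" using w(1) c by (intro m.I_r_closed)
  moreover have "w \<otimes> b \<notin> p" using assms(4) c w b by blast
  moreover have "w \<otimes> b \<in> q'" if "q' \<in> insert q Q" for q'
  proof (cases "q' = q")
    case True
    then show ?thesis using ideal.I_l_closed[OF q b(1) c(1)] by simp
  next
    case False
    then have "q' \<in> Q" using that by simp
    then show ?thesis
      using ideal.I_r_closed[of q' R w b] insert.prems(1)[of q'] w(3) c(2) by simp
  qed
  ultimately show ?case by blast
qed

text \<open>If the element found for the other primes lies in \<open>p\<close>, add an element of
  \<open>m\<close> that lies in all of them but not in \<open>p\<close>. Such an element exists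
  because the primes are incomparable.\<close>

lemma (in cring) prime_avoidance:
  assumes "finite Q" "\<And>q. q \<in> Q \<Longrightarrow> ideal q R"
    and "\<And>q a b. q \<in> Q \<Longrightarrow> a \<in> carrier R \<Longrightarrow> b \<in> carrier R \<Longrightarrow> a \<otimes> b \<in> q \<Longrightarrow> a \<in> q \<or> b \<in> q"
    and "\<And>q q'. q \<in> Q \<Longrightarrow> q' \<in> Q \<Longrightarrow> q \<subseteq> q' \<Longrightarrow> q = q'"
    and m: "ideal m R" and "\<And>q. q \<in> Q \<Longrightarrow> \<not> m \<subseteq> q"
  shows "\<exists>x\<in>m. \<forall>q\<in>Q. x \<notin> q"
  using assms(1-4,6)
proof (induction Q)
  case empty
  then show ?case using additive_subgroup.zero_closed[OF ideal.axioms(1)[OF m]] by blast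
next
  case (insert p Q)
  have "\<exists>x\<in>m. \<forall>q\<in>Q. x \<notin> q"
  proof (rule insert.IH)
    show "a \<in> q \<or> b \<in> q" if "q \<in> Q" "a \<in> carrier R" "b \<in> carrier R" "a \<otimes> b \<in> q" for q a b
      using insert.prems(2)[of q a b] that by blast
  qed (use insert.prems(1,3,4) in blast)+
  then obtain x where x: "x \<in> m" "\<forall>q\<in>Q. x \<notin> q" by blast
  interpret m: ideal m R by fact
  show ?case
  proof (cases "x \<in> p")
    case False
    then show ?thesis using x by blast
  next
    case True
    have p: "ideal p R" using insert.prems(1) by blast
    have "\<exists>w\<in>m. w \<notin> p \<and> (\<forall>q\<in>Q. w \<in> q)"
    proof (rule element_outside_prime[OF insert.hyps(1) _ _ _ m])
      show "ideal q R" if "q \<in> Q" for q using insert.prems(1) that by blast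
      show "\<not> q \<subseteq> p" if "q \<in> Q" for q using insert.prems(3)[of q p] insert.hyps(2) that by blast
      show "a \<in> p \<or> b \<in> p" if "a \<in> carrier R" "b \<in> carrier R" "a \<otimes> b \<in> p" for a b
        using insert.prems(2)[of p a b] that by blast
      show "\<not> m \<subseteq> p" using insert.prems(4) by blast
    qed
    then obtain w where w: "w \<in> m" "w \<notin> p" "\<forall>q\<in>Q. w \<in> q" by blast
    have c: "x \<in> carrier R" "w \<in> carrier R" using x w m.Icarr by auto
    have sub: "u \<in> I" if "ideal I R" "v \<in> I" "u \<oplus> v \<in> I" "u \<in> carrier R" for u v I
    proof -
      interpret I: ideal I R by fact
      have "(u \<oplus> v) \<oplus> \<ominus> v \<in> I" by (rule I.a_closed[OF that(3) I.a_inv_closed[OF that(2)]])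
      also have "(u \<oplus> v) \<oplus> \<ominus> v = u" using that I.Icarr[OF that(2)] by algebra
      finally show ?thesis .
    qed
    have "x \<oplus> w \<notin> q" if "q \<in> Q" for q
      using sub[of q w x] x(2) w(3) that insert.prems(1)[of q] c by blast
    moreover have "x \<oplus> w \<notin> p"
      using sub[OF p True, of w] w(2) c a_comm[of x w] by auto
    moreover have "x \<oplus> w \<in> m" using x w by simp
    ultimately show ?thesis by blast
  qed
qed

text \<open>Prime avoidance over the maximal associated primes of \<open>R/I\<close>. Rather than
  counting these, one chooses a finite set \<open>F\<close> of elements whose annihilators turn out
  to include all of them.\<close>

lemma (in noetherian_cring) socle_or_regular:
  assumes m: "ideal m R" and I: "ideal I R"
  shows "(\<exists>y\<in>carrier R. y \<notin> I \<and> (\<forall>c\<in>m. c \<otimes> y \<in> I)) \<or> (\<exists>x\<in>m. \<forall>z\<in>carrier R. x \<otimes> z \<in> I \<longrightarrow> z \<in> I)"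
proof (rule disjCI)
  assume no: "\<not> (\<exists>x\<in>m. \<forall>z\<in>carrier R. x \<otimes> z \<in> I \<longrightarrow> z \<in> I)"
  show "\<exists>y\<in>carrier R. y \<notin> I \<and> (\<forall>c\<in>m. c \<otimes> y \<in> I)"
  proof (rule ccontr)
    assume nosoc: "\<not> (\<exists>y\<in>carrier R. y \<notin> I \<and> (\<forall>c\<in>m. c \<otimes> y \<in> I))"
    interpret m: ideal m R by fact
    interpret I: ideal I R by fact
    define ann where "ann z = {c \<in> carrier R. c \<otimes> z \<in> I}" for z
    have ai: "ideal (ann z) R" if "z \<in> carrier R" for z
      unfolding ann_def by (rule ideal_quotient_elem[OF I that])
    \<comment> \<open>Maximality of the annihilator among all nonzero elements modulo
      \<open>I\<close> makes it prime, as prime avoidance demands.\<close>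
    define Y where "Y = {w \<in> carrier R. w \<notin> I \<and> (\<forall>z\<in>carrier R. z \<notin> I \<longrightarrow> ann w \<subseteq> ann z \<longrightarrow> ann z = ann w)}"
    have YI: "\<exists>w\<in>Y. ann z \<subseteq> ann w" if z: "z \<in> carrier R" "z \<notin> I" for z
    proof -
      let ?C = "ann ` {w \<in> carrier R. w \<notin> I \<and> ann z \<subseteq> ann w}"
      have "z \<in> {w \<in> carrier R. w \<notin> I \<and> ann z \<subseteq> ann w}" using z by simp
      then have "?C \<noteq> {}" by blast
      then have "\<exists>M\<in>?C. \<forall>J\<in>?C. M \<subseteq> J \<longrightarrow> J = M"
        by (rule maximal_ideal_in) (use ai in blast)
      then obtain w where w: "w \<in> carrier R" "w \<notin> I" "ann z \<subseteq> ann w"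
        and M: "\<forall>J\<in>?C. ann w \<subseteq> J \<longrightarrow> J = ann w" by blast
      have "ann v = ann w" if v: "v \<in> carrier R" "v \<notin> I" "ann w \<subseteq> ann v" for v
      proof -
        have "v \<in> {w \<in> carrier R. w \<notin> I \<and> ann z \<subseteq> ann w}" using v w(3) by blast
        then show ?thesis using M v(3) by blast
      qed
      then have "w \<in> Y" using w by (auto simp: Y_def)
      then show ?thesis using w by blast
    qed
    have prime: "a \<in> ann w \<or> b \<in> ann w"
      if w: "w \<in> Y" and ab: "a \<in> carrier R" "b \<in> carrier R" "a \<otimes> b \<in> ann w" for w a b
    proof (cases "a \<in> ann w")
      case False
      then have az: "a \<otimes> w \<notin> I" using ab by (auto simp: ann_def)
      have wc: "w \<in> carrier R" using w by (simp add: Y_def)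
      have "ann w \<subseteq> ann (a \<otimes> w)"
      proof
        fix c assume c: "c \<in> ann w"
        then have "a \<otimes> (c \<otimes> w) \<in> I" using ab by (auto simp: ann_def I.I_l_closed)
        then show "c \<in> ann (a \<otimes> w)" using c ab wc by (auto simp: ann_def m_lcomm)
      qed
      then have "ann (a \<otimes> w) = ann w" using w az ab wc by (auto simp: Y_def)
      moreover have "b \<in> ann (a \<otimes> w)"
        using ab wc by (auto simp: ann_def m_assoc m_lcomm)
      ultimately show ?thesis by simp
    qed simp
    have Yc: "Y \<subseteq> carrier R" by (auto simp: Y_def)
    have Ic: "I \<subseteq> carrier R" using I.a_subset .
    \<comment> \<open>For a finite \<open>F\<close> with maximal \<open>Idl (I \<union> F)\<close>,
      a further element of \<open>Y\<close> cannot enlarge this ideal, which therefore contains all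
      of \<open>Y\<close>.\<close>
    let ?C = "(\<lambda>F. Idl (I \<union> F)) ` {F. finite F \<and> F \<subseteq> Y}"
    have "?C \<noteq> {}" by blast
    then have "\<exists>M\<in>?C. \<forall>J\<in>?C. M \<subseteq> J \<longrightarrow> J = M"
    proof (rule maximal_ideal_in)
      fix J assume "J \<in> ?C"
      then obtain F where F: "F \<subseteq> Y" "J = Idl (I \<union> F)" by blast
      then have "I \<union> F \<subseteq> carrier R" using Yc Ic by blast
      then show "ideal J R" unfolding F(2) by (rule genideal_ideal)
    qed
    then obtain F where F: "finite F" "F \<subseteq> Y"
      and M: "\<forall>J\<in>?C. Idl (I \<union> F) \<subseteq> J \<longrightarrow> J = Idl (I \<union> F)" by blast
    have wM: "w \<in> Idl (I \<union> F)" if w: "w \<in> Y" for w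
    proof -
      have c: "I \<union> insert w F \<subseteq> carrier R" using Ic F(2) Yc w by auto
      have "Idl (I \<union> F) \<subseteq> Idl (I \<union> insert w F)"
        by (rule subset_Idl_subset[OF c]) auto
      moreover have "Idl (I \<union> insert w F) \<in> ?C"
        by (rule imageI) (use F w in simp)
      ultimately have "Idl (I \<union> insert w F) = Idl (I \<union> F)"
        using M by blast
      then show ?thesis using genideal_self[OF c] by auto
    qed
    have "\<exists>x\<in>m. \<forall>q\<in>ann ` F. x \<notin> q"
    proof (rule prime_avoidance[OF _ _ _ _ m])
      show "finite (ann ` F)" using F by simp
      show "ideal q R" if "q \<in> ann ` F" for q using that ai F(2) Yc by auto
      show "a \<in> q \<or> b \<in> q" if "q \<in> ann ` F" "a \<in> carrier R" "b \<in> carrier R" "a \<otimes> b \<in> q" for q a b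
        using that prime F(2) by auto
      show "q = q'" if q: "q \<in> ann ` F" "q' \<in> ann ` F" "q \<subseteq> q'" for q q'
      proof -
        obtain f f' where ff: "f \<in> F" "f' \<in> F" "q = ann f" "q' = ann f'" using q by auto
        have "f \<in> Y" "f' \<in> Y" using ff F(2) by auto
        then show ?thesis using q(3) unfolding ff(3,4) Y_def by blast
      qed
      show "\<not> m \<subseteq> q" if "q \<in> ann ` F" for q
      proof
        assume mq: "m \<subseteq> q"
        obtain f where f: "f \<in> Y" "q = ann f" using \<open>q \<in> ann ` F\<close> F(2) by auto
        then have "\<forall>c\<in>m. c \<otimes> f \<in> I" using mq by (auto simp: ann_def)
        then show False using nosoc f by (auto simp: Y_def)
      qed
    qed
    then obtain x where x: "x \<in> m" "\<And>f. f \<in> F \<Longrightarrow> x \<notin> ann f" by auto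
    obtain z where z: "z \<in> carrier R" "x \<otimes> z \<in> I" "z \<notin> I" using no x(1) by blast
    obtain w where w: "w \<in> Y" "ann z \<subseteq> ann w" using YI[OF z(1,3)] by blast
    have xw: "x \<in> ann w" using z w(2) m.Icarr[OF x(1)] by (auto simp: ann_def)
    have wc: "w \<in> carrier R" "w \<notin> I" using w(1) by (auto simp: Y_def)
    show False
    proof (cases "\<exists>f\<in>F. ann f \<subseteq> ann w")
      case True
      then obtain f where f: "f \<in> F" "ann f \<subseteq> ann w" by blast
      then have "f \<in> Y" using F(2) by auto
      then have "ann w = ann f" using f(2) wc unfolding Y_def by blast
      then show False using xw x(2)[OF f(1)] by simp
    next
      case False
      \<comment> \<open>Some \<open>b\<close> outside \<open>ann w\<close> multiplies every member
        of \<open>F\<close> into \<open>I\<close>, hence all of \<open>Idl (I \<union> F)\<close>;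
        but this ideal contains \<open>w\<close>.\<close>
      have "\<exists>b\<in>carrier R. b \<notin> ann w \<and> (\<forall>q\<in>ann ` F. b \<in> q)"
      proof (rule element_outside_prime[OF _ _ _ prime[OF w(1)] oneideal])
        show "finite (ann ` F)" using F by simp
        show "ideal q R" if "q \<in> ann ` F" for q using that ai F(2) Yc by auto
        show "\<not> q \<subseteq> ann w" if "q \<in> ann ` F" for q using that False by auto
        have "\<one> \<notin> ann w" using wc by (simp add: ann_def)
        then show "\<not> carrier R \<subseteq> ann w" by auto
      qed
      then obtain b where b: "b \<in> carrier R" "b \<notin> ann w" "\<And>f. f \<in> F \<Longrightarrow> b \<in> ann f" by auto
      have "Idl (I \<union> F) \<subseteq> {c \<in> carrier R. c \<otimes> b \<in> I}"
      proof (rule genideal_minimal[OF ideal_quotient_elem[OF I b(1)]])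
        show "I \<union> F \<subseteq> {c \<in> carrier R. c \<otimes> b \<in> I}"
        proof
          fix c assume "c \<in> I \<union> F"
          then show "c \<in> {c \<in> carrier R. c \<otimes> b \<in> I}"
          proof
            assume "c \<in> I"
            then show ?thesis using I.I_r_closed[OF _ b(1)] I.Icarr by blast
          next
            assume c: "c \<in> F"
            then have "c \<in> carrier R" "b \<otimes> c \<in> I"
              using b(3)[OF c] F(2) Yc by (auto simp: ann_def)
            then show ?thesis using m_comm[of c b] b(1) by simp
          qed
        qed
      qed
      then have "w \<otimes> b \<in> I" using wM[OF w(1)] by auto
      then show False using b(1,2) wc by (simp add: ann_def m_comm)
    qed
  qed
qed

section \<open>Regular sequences in the local ring\<close>

context noetherian_local_ring
begin

text \<open>A nonunit lies in some maximal ideal, which the Noetherian condition provides, and there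
  is only one.\<close>

lemma nonunits_ideal: "ideal (carrier R - Units R) R"
proof -
  obtain m where m: "maximalideal m R" "\<And>J. maximalideal J R \<Longrightarrow> J = m"
    using unique_maximal_ideal by blast
  interpret m: maximalideal m R by fact
  have "c \<in> m" if c: "c \<in> carrier R" "c \<notin> Units R" for c
  proof -
    have ne: "carrier R \<noteq> PIdl c"
    proof
      assume "carrier R = PIdl c"
      then have "\<one> \<in> PIdl c" using one_closed by blast
      then obtain d where d: "d \<in> carrier R" "\<one> = d \<otimes> c" by (auto simp: cgenideal_def)
      then have "c \<in> Units R" using c(1) by (auto simp: Units_def m_comm intro!: bexI[of _ d])
      then show False using c(2) by simp
    qed
    let ?C = "{J. ideal J R \<and> c \<in> J \<and> J \<noteq> carrier R}"
    have "PIdl c \<in> ?C"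
      using cgenideal_ideal[OF c(1)] cgenideal_self[OF c(1)] ne by blast
    then have "?C \<noteq> {}" by blast
    then obtain M where M: "M \<in> ?C" "\<forall>J\<in>?C. M \<subseteq> J \<longrightarrow> J = M"
      using maximal_ideal_in[of ?C] by blast
    have "maximalideal M R"
    proof (rule maximalidealI)
      show "J = M \<or> J = carrier R" if "ideal J R" "M \<subseteq> J" "J \<subseteq> carrier R" for J
        using M that by blast
    qed (use M(1) in auto)
    then show ?thesis using m(2) M(1) by auto
  qed
  moreover have "c \<notin> Units R" if "c \<in> m" for c
  proof
    assume "c \<in> Units R"
    then have "inv c \<otimes> c \<in> m" using that by (intro m.I_l_closed) auto
    then have "\<one> \<in> m" using \<open>c \<in> Units R\<close> by simp
    then show False using m.I_notcarr m.one_imp_carrier by blast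
  qed
  ultimately have "carrier R - Units R = m" using m.a_subset by blast
  then show ?thesis using m.is_ideal by simp
qed

lemma lmul_self_ideal:
  assumes "set xs \<subseteq> carrier R"
  shows "ideal (lmul xs (self_module R)) R"
proof -
  interpret S: submodule R "lmul xs (self_module R)" "self_module R"
    by (rule lmul_submodule[OF self_module_module assms])
  show ?thesis
    by (rule idealI_cring) (use S.subset S.zero_closed S.m_closed S.smult_closed in auto)
qed

text \<open>Among weakly regular sequences of nonunits, one with a maximal ideal \<open>(xs)\<close>
  is taken; the Noetherian condition provides it without a bound on the lengths.\<close>

lemma exists_maximal_regular: "\<exists>xs y. maximal_regular R xs y"
proof -
  let ?m = "carrier R - Units R"
  let ?C = "{lmul xs (self_module R) | xs. set xs \<subseteq> ?m \<and> wreg xs (self_module R)}"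
  interpret m: ideal ?m R by (rule nonunits_ideal)
  have "lmul [] (self_module R) \<in> ?C" by (intro CollectI exI[of _ "[]"]) simp
  then have "?C \<noteq> {}" by blast
  then have "\<exists>M\<in>?C. \<forall>J\<in>?C. M \<subseteq> J \<longrightarrow> J = M"
  proof (rule maximal_ideal_in)
    fix J assume "J \<in> ?C"
    then obtain xs where xs: "set xs \<subseteq> ?m" "J = lmul xs (self_module R)" by blast
    then show "ideal J R" using lmul_self_ideal[of xs] by blast
  qed
  then obtain xs where xs: "set xs \<subseteq> ?m" "wreg xs (self_module R)"
    and M: "\<forall>J\<in>?C. lmul xs (self_module R) \<subseteq> J \<longrightarrow> J = lmul xs (self_module R)"
    by blast
  have xc: "set xs \<subseteq> carrier R" using xs(1) by auto
  interpret I: ideal "lmul xs (self_module R)" R by (rule lmul_self_ideal[OF xc])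
  have Im: "lmul xs (self_module R) \<subseteq> ?m"
    using xs(1)
  proof (induction xs)
    case Nil
    have "\<zero> \<in> ?m" by (rule m.zero_closed)
    then show ?case by simp
  next
    case (Cons x xs)
    then have x: "x \<in> ?m" and sub: "lmul xs (self_module R) \<subseteq> ?m" by auto
    show ?case
    proof
      fix c assume "c \<in> lmul (x # xs) (self_module R)"
      then obtain j l where "c = j \<oplus> x \<otimes> l" "j \<in> lmul xs (self_module R)" "l \<in> carrier R" by auto
      then show "c \<in> ?m" using sub m.I_r_closed[OF x] by (auto intro!: m.a_closed simp del: Diff_iff)
    qed
  qed
  \<comment> \<open>Appending a regular \<open>x\<close> could not enlarge the ideal, so
    \<open>x\<close> times one would lie in it, and cancelling \<open>x\<close> would put one among
    the nonunits.\<close>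
  have "\<not> (\<exists>x\<in>?m. \<forall>z\<in>carrier R. x \<otimes> z \<in> lmul xs (self_module R) \<longrightarrow> z \<in> lmul xs (self_module R))"
  proof
    assume "\<exists>x\<in>?m. \<forall>z\<in>carrier R. x \<otimes> z \<in> lmul xs (self_module R) \<longrightarrow> z \<in> lmul xs (self_module R)"
    then obtain x where x: "x \<in> ?m"
      "\<And>z. z \<in> carrier R \<Longrightarrow> x \<otimes> z \<in> lmul xs (self_module R) \<Longrightarrow> z \<in> lmul xs (self_module R)" by blast
    have xR: "x \<in> carrier R" using x(1) by simp
    have "wreg (x # xs) (self_module R)"
      unfolding wreg.simps self_module_simps using xs(2) x(2) by blast
    moreover have "set (x # xs) \<subseteq> ?m" using x(1) xs(1) by simp
    ultimately have "lmul (x # xs) (self_module R) \<in> ?C" by blast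
    moreover have "lmul xs (self_module R) \<subseteq> lmul (x # xs) (self_module R)"
    proof
      fix j assume j: "j \<in> lmul xs (self_module R)"
      have "j \<oplus> x \<otimes> \<zero> \<in> lmul (x # xs) (self_module R)"
        using lmul_ConsI[OF j, of \<zero> x] by (simp del: lmul.simps)
      then show "j \<in> lmul (x # xs) (self_module R)"
        using I.Icarr[OF j] xR by (simp del: lmul.simps)
    qed
    ultimately have eq: "lmul (x # xs) (self_module R) = lmul xs (self_module R)"
      using M by blast
    have "\<zero> \<oplus> x \<otimes> \<one> \<in> lmul (x # xs) (self_module R)"
      using lmul_ConsI[OF I.zero_closed, of \<one> x] by (simp del: lmul.simps)
    then have "x \<otimes> \<one> \<in> lmul xs (self_module R)"
      using xR unfolding eq by simp
    then have "\<one> \<in> ?m" using x(2)[OF one_closed] Im by blast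
    then show False by simp
  qed
  then obtain y where y: "y \<in> carrier R" "y \<notin> lmul xs (self_module R)"
      "\<forall>c\<in>?m. c \<otimes> y \<in> lmul xs (self_module R)"
    using socle_or_regular[OF nonunits_ideal I.is_ideal] by blast
  have "maximal_regular R xs y"
    by (intro maximal_regular.intro maximal_regular_axioms.intro noetherian_cring_axioms)
      (use xc xs(2) y in auto)
  then show ?thesis by blast
qed

end

section \<open>Modules of finite Gorenstein or projective dimension\<close>

text \<open>The syzygy of number \<open>i + 1\<close>: for \<open>i = 0\<close> it is the kernel of
  the augmentation.\<close>

definition cycle_module ::
    "('a, 'b, 'm) module_scheme \<Rightarrow> (nat \<Rightarrow> ('a, 'p) module) \<Rightarrow> (nat \<Rightarrow> 'p \<Rightarrow> 'p) \<Rightarrow> ('p \<Rightarrow> 'b)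
      \<Rightarrow> nat \<Rightarrow> ('a, 'p) module" where
  "cycle_module N P d e i = (P i)\<lparr>carrier := {p \<in> carrier (P i). cyc N P d e i p}\<rparr>"

lemma cycle_module_simps [simp]:
  "p \<in> carrier (cycle_module N P d e i) \<longleftrightarrow> p \<in> carrier (P i) \<and> cyc N P d e i p"
  "add (cycle_module N P d e i) = add (P i)" "zero (cycle_module N P d e i) = zero (P i)"
  "smult (cycle_module N P d e i) = smult (P i)"
  by (simp_all add: cycle_module_def)

lemma cycle_submodule:
  assumes res: "resolution R N P d e" and N: "module R N"
  shows "submodule R {p \<in> carrier (P i). cyc N P d e i p} (P i)"
  using hom_kernel_submodule[OF resolutionD(1)[OF res] N resolutionD(3)[OF res]]
    hom_kernel_submodule[OF resolutionD(1)[OF res] resolutionD(1)[OF res] resolutionD(2)[OF res]]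
  by (cases i) (simp_all add: cyc_def)

lemma cycle_module_module:
  assumes res: "resolution R N P d e" and N: "module R N"
  shows "module R (cycle_module N P d e i)"
  unfolding cycle_module_def
  by (rule module.submodule_is_module[OF resolutionD(1)[OF res] cycle_submodule[OF res N]])

lemma cycle_short_exact_0:
  assumes res: "resolution R N P d e" and N: "module R N"
  shows "short_exact R (cycle_module N P d e 0) (P 0) N (\<lambda>x. x) e"
  using resolutionD[OF res] N cycle_module_module[OF res N]
  by (auto simp: short_exact_def module_hom_def[of _ "cycle_module N P d e 0"] cyc_def)

lemma cycle_short_exact_Suc:
  assumes res: "resolution R N P d e" and N: "module R N"
  shows "short_exact R (cycle_module N P d e (Suc i)) (P (Suc i)) (cycle_module N P d e i) (\<lambda>x. x) (d i)"
proof -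
  note P = resolutionD[OF res]
  have "d i \<in> module_hom R (P (Suc i)) (cycle_module N P d e i)"
    using P(2)[of i] resolution_cyc(2)[OF res] by (auto simp: module_hom_def)
  moreover have "(\<lambda>x. x) \<in> module_hom R (cycle_module N P d e (Suc i)) (P (Suc i))"
    by (auto simp: module_hom_def)
  moreover have "\<exists>b\<in>carrier (P (Suc i)). d i b = c" if "c \<in> carrier (cycle_module N P d e i)" for c
    using resolution_cyc(1)[OF res, of c i] that by simp
  ultimately show ?thesis
    using P(1) cycle_module_module[OF res N] by (auto simp: short_exact_def cyc_def)
qed

lemma resolution_tail:
  assumes res: "resolution R N P d e" and N: "module R N"
  shows "resolution R (cycle_module N P d e 0) (\<lambda>i. P (Suc i)) (\<lambda>i. d (Suc i)) (d 0)"
proof -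
  note P = resolutionD[OF res]
  note S = short_exactD[OF cycle_short_exact_Suc[OF res N, of 0]]
  show ?thesis
  proof (rule resolutionI)
    show "\<exists>q\<in>carrier (P (Suc (Suc 0))). d (Suc 0) q = p"
      if "p \<in> carrier (P (Suc 0))" "d 0 p = \<zero>\<^bsub>cycle_module N P d e 0\<^esub>" for p
      using P(8)[of p 0] that by simp
  qed (use P S(5,7) in auto)
qed

text \<open>Dimension shift: degree \<open>i + 1\<close> of the tail of the resolution is degree
  \<open>i + 2\<close> for \<open>N\<close>.\<close>

lemma ext_vanishes_cycle:
  fixes P :: "nat \<Rightarrow> ('a, nat \<Rightarrow> 'a) module"
  assumes res: "resolution R N P d e" and N: "module R N" and L: "module R L"
    and fg: "\<And>i. fgp R (P i)" and van: "ext_vanishes R N L"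
  shows "ext_vanishes R (cycle_module N P d e 0) L"
proof -
  have "ext_van R (\<lambda>i. P (Suc i)) (\<lambda>i. d (Suc i)) L i" for i
    using ext_vanishesD[OF van N L res fg, of "Suc i"] by (simp add: ext_van_def)
  then show ?thesis
    unfolding ext_vanishes_def using resolution_tail[OF res N] fg by blast
qed

text \<open>Descending along a resolution whose cycle module in degree \<open>n\<close> belongs to \<open>C\<close>: all cycle modules
  are weakly regular, by ascending induction, and belong to \<open>C\<close>, by descending induction.\<close>

lemma cycle_module_class:
  assumes res: "resolution R N P d e" and N: "module R N" and xs: "set xs \<subseteq> carrier R" and wr: "wreg xs N"
    and CP: "\<And>i. C (P i)" and CZ: "C (cycle_module N P d e n)"
    and Cw: "\<And>X. C X \<Longrightarrow> wreg xs X"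
    and Cq: "\<And>i. C (cycle_module N P d e (Suc i)) \<Longrightarrow> wreg xs (cycle_module N P d e i) \<Longrightarrow>
        C (cycle_module N P d e i)"
  shows "C (cycle_module N P d e 0)"
proof -
  have w: "wreg xs (cycle_module N P d e i)" for i
  proof (induction i)
    case 0
    show ?case by (rule wreg_short_exact[OF cycle_short_exact_0[OF res N] xs Cw[OF CP] wr])
  next
    case (Suc i)
    show ?case by (rule wreg_short_exact[OF cycle_short_exact_Suc[OF res N] xs Cw[OF CP] Suc])
  qed
  show ?thesis
    by (rule inc_induct[where j = n and i = 0]) (use CZ Cq w in auto)
qed

lemma fgp_retract:
  assumes F: "fgp R F" and Z: "module R Z" and s: "s \<in> module_hom R Z F" and b: "b \<in> module_hom R F Z"
    and bs: "\<And>z. z \<in> carrier Z \<Longrightarrow> b (s z) = z"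
  shows "fgp R Z"
proof -
  have Fm: "module R F" using F by (rule fgp_module)
  interpret F: module R F by fact
  obtain n u h where u: "\<And>i. i < n \<Longrightarrow> u i \<in> carrier F"
    and h: "\<And>i. i < n \<Longrightarrow> h i \<in> module_hom R F (self_module R)"
    and uh: "\<And>q. q \<in> carrier F \<Longrightarrow> msum F (\<lambda>i. h i q \<odot>\<^bsub>F\<^esub> u i) n = q"
    by (rule fgpE[OF F]) blast
  note bss = hom_simps[OF b Fm Z]
  note ss = hom_simps(1)[OF s Z Fm]
  note hs = hom_simps(1)[OF h Fm F.self_module_module, simplified]
  show ?thesis
  proof (rule fgpI[where n = n and u = "\<lambda>i. b (u i)" and h = "\<lambda>i z. h i (s z)"])
    show "z = msum Z (\<lambda>i. h i (s z) \<odot>\<^bsub>Z\<^esub> b (u i)) n" if z: "z \<in> carrier Z" for z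
    proof -
      have "b (msum F (\<lambda>i. h i (s z) \<odot>\<^bsub>F\<^esub> u i) n) = msum Z (\<lambda>i. b (h i (s z) \<odot>\<^bsub>F\<^esub> u i)) n"
        using u hs ss[OF z] by (intro hom_msum[OF b Fm Z]) auto
      also have "\<dots> = msum Z (\<lambda>i. h i (s z) \<odot>\<^bsub>Z\<^esub> b (u i)) n"
        using u hs ss[OF z] bss by (intro msum_cong) simp
      finally show ?thesis by (simp only: uh[OF ss[OF z]] bs[OF z])
    qed
  qed (use u bss Z hom_comp[OF Z s h] in auto)
qed

section \<open>Descent along resolutions of finite length\<close>

context maximal_regular
begin

lemma finite_tref_dim:
  fixes P :: "nat \<Rightarrow> ('a, nat \<Rightarrow> 'a) module"
  assumes res: "resolution R N P d e" and N: "module R N" and wr: "wreg xs N"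
    and T: "\<And>i. tref R (P i)" and van: "vanishes_above P n"
  shows "tref R N"
proof -
  have "tref R (cycle_module N P d e 0)"
  proof (rule cycle_module_class[where C = "tref R", OF res N xs wr T _ tref_wreg])
    let ?Z = "cycle_module N P d e n"
    have m: "module R ?Z" by (rule cycle_module_module[OF res N])
    \<comment> \<open>\<open>P (Suc n)\<close> is zero and maps onto this cycle module, which
      therefore has an empty dual basis; \<open>undefined\<close> stands for its missing vectors and
      functionals.\<close>
    have z0: "z = msum ?Z (\<lambda>i. undefined i z \<odot>\<^bsub>?Z\<^esub> undefined i) 0" if z: "z \<in> carrier ?Z" for z
    proof -
      obtain q where q: "q \<in> carrier (P (Suc n))" "d n q = z"
        using resolution_cyc(1)[OF res, of z n] z by auto
      then have "q = \<zero>\<^bsub>P (Suc n)\<^esub>" using van by (auto simp: vanishes_above_def)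
      then show ?thesis
        using q(2) hom_simps(4)[OF resolutionD(2)[OF res, of n] resolutionD(1)[OF res] resolutionD(1)[OF res]] by simp
    qed
    have "fgp R ?Z"
      by (rule fgpI[OF m _ _ z0]) simp_all
    then show "tref R ?Z" by (rule fgp_tref)
    show "tref R (cycle_module N P d e i)"
      if "tref R (cycle_module N P d e (Suc i))" "wreg xs (cycle_module N P d e i)" for i
      by (rule tref_quotient[OF cycle_short_exact_Suc[OF res N] that(1) T that(2)])
  qed
  then show ?thesis
    by (rule tref_quotient[OF cycle_short_exact_0[OF res N] _ T wr])
qed

text \<open>The terms \<open>P i\<close> may be infinitely generated; they serve to show that Ext
  vanishes in degree \<open>n + 1\<close>. The descent takes place in a resolution by free modules
  of finite rank, once its cycle module in degree \<open>n\<close> is known to be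
  projective.\<close>

lemma finite_proj_dim:
  fixes P :: "nat \<Rightarrow> ('a, nat \<Rightarrow> 'a) module"
  assumes res: "resolution R N P d e" and fin: "finite_module R N" and wr: "wreg xs N"
    and proj: "\<And>i (F :: ('a, nat \<Rightarrow> 'a) module). module R F \<Longrightarrow> linear_choice R (P i) F"
    and van: "vanishes_above P n"
  shows "fgp R N"
proof -
  have N: "module R N" using fin by (simp add: finite_module_def)
  obtain k \<delta> \<epsilon> where resF: "resolution R N (\<lambda>i. free_mod R (k i)) \<delta> \<epsilon>"
    using exists_free_resolution[OF fin] by blast
  let ?F = "\<lambda>i. free_mod R (k i)"
  let ?Z = "\<lambda>i. cycle_module N ?F \<delta> \<epsilon> i"
  note F = resolutionD[OF resF]
  note Zm = cycle_module_module[OF resF N]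
  note Sn = short_exactD[OF cycle_short_exact_Suc[OF resF N, of n]]
  \<comment> \<open>The coefficients are the cycle module itself, so that \<open>\<delta> n\<close>,
    read as a map onto it, is a cocycle. That it is a coboundary \<open>b (\<delta> n p)\<close>
    says that \<open>b\<close> retracts \<open>?F n\<close> onto \<open>?Z n\<close>.\<close>
  have "ext_van R P d (?Z n) n"
    unfolding ext_van_def
  proof (intro ballI impI)
    fix c assume c: "c \<in> module_hom R (P (Suc n)) (?Z n)"
    have "c p = \<zero>\<^bsub>?Z n\<^esub>" if "p \<in> carrier (P (Suc n))" for p
      using that van hom_simps(4)[OF c resolutionD(1)[OF res] Zm] by (auto simp: vanishes_above_def)
    then show "\<exists>b\<in>module_hom R (P n) (?Z n). \<forall>p\<in>carrier (P (Suc n)). c p = b (d n p)"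
      using hom_zero_map[OF resolutionD(1)[OF res] Zm] by (intro bexI[of _ "\<lambda>_. \<zero>\<^bsub>?Z n\<^esub>"]) auto
  qed
  then have v: "ext_van R ?F \<delta> (?Z n) n"
    by (rule ext_van_indep[OF res resF N Zm proj[OF free_mod_module]
          fgp_linear_choice[OF free_mod_fgp resolutionD(1)[OF res]] fgp_linear_choice[OF free_mod_fgp free_mod_module]])
  moreover have "\<delta> n (\<delta> (Suc n) p) = \<zero>\<^bsub>?Z n\<^esub>" if "p \<in> carrier (?F (Suc (Suc n)))" for p
    using F(7)[OF that] by simp
  ultimately have "\<exists>b\<in>module_hom R (?F n) (?Z n). \<forall>p\<in>carrier (?F (Suc n)). \<delta> n p = b (\<delta> n p)"
    using Sn(5) unfolding ext_van_def by (metis (no_types))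
  then obtain b where b: "b \<in> module_hom R (?F n) (?Z n)" "\<And>p. p \<in> carrier (?F (Suc n)) \<Longrightarrow> \<delta> n p = b (\<delta> n p)"
    by blast
  have "fgp R (?Z n)"
  proof (rule fgp_retract[OF free_mod_fgp Zm _ b(1)])
    show "(\<lambda>x. x) \<in> module_hom R (?Z n) (?F n)"
      by (auto simp: module_hom_def simp del: free_mod_simps)
    show "b z = z" if z: "z \<in> carrier (?Z n)" for z
      using Sn(7)[OF z] b(2) by metis
  qed
  note tw = fgp_tref[OF free_mod_fgp]
  have "fgp R (?Z 0)"
  proof (rule cycle_module_class[where C = "fgp R", OF resF N xs wr free_mod_fgp \<open>fgp R (?Z n)\<close>])
    show "wreg xs X" if "fgp R X" for X :: "('a, nat \<Rightarrow> 'a) module"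
      by (rule tref_wreg[OF fgp_tref[OF that]])
    show "fgp R (?Z i)" if "fgp R (?Z (Suc i))" "wreg xs (?Z i)" for i
      by (rule fgp_quotient[OF cycle_short_exact_Suc[OF resF N] that(1) free_mod_fgp that(2) tref_torsionless[OF tw]])
  qed
  then show ?thesis
    by (rule fgp_quotient[OF cycle_short_exact_0[OF resF N] _ free_mod_fgp wr tref_torsionless[OF tw]])
qed

text \<open>As Ext of \<open>N\<close> vanishes, the dual of the syzygy sequence is exact and its
  cokernel, the dual of the syzygy, is weakly regular. So that cokernel is totally reflexive, and
  functionals on the dual of \<open>N\<close> extend to the dual of \<open>F 0\<close>, where they
  are evaluations. Injectivity of biduality for \<open>N\<close> is reduced to surjectivity for the
  syzygy.\<close>

lemma dual_tref_step:
  fixes F :: "nat \<Rightarrow> ('a, nat \<Rightarrow> 'a) module"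
  assumes res: "resolution R N F d e" and N: "module R N" and fg: "\<And>i. fgp R (F i)"
    and van: "ext_vanishes R N (self_module R)" and T: "tref R (dual_module R N)"
  shows "\<phi> \<in> module_hom R (dual_module R N) (self_module R) \<Longrightarrow>
      \<exists>u\<in>carrier N. \<forall>h\<in>carrier (dual_module R N). \<phi> h = h u"
    and "tref R (dual_module R (cycle_module N F d e 0))"
    and "(\<And>\<psi>. \<psi> \<in> module_hom R (dual_module R (cycle_module N F d e 0)) (self_module R) \<Longrightarrow>
        \<exists>z\<in>carrier (cycle_module N F d e 0). \<forall>h\<in>carrier (dual_module R (cycle_module N F d e 0)). \<psi> h = h z) \<Longrightarrow>
      u \<in> carrier N \<Longrightarrow> (\<And>h. h \<in> carrier (dual_module R N) \<Longrightarrow> h u = \<zero>) \<Longrightarrow> u = \<zero>\<^bsub>N\<^esub>"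
proof -
  let ?Z = "cycle_module N F d e 0"
  note sm = self_module_module
  note P = resolutionD[OF res]
  note es = hom_simps[OF P(3) P(1) N]
  note S = cycle_short_exact_0[OF res N]
  note S' = short_exactD[OF S]
  note DZ = dual_module_module[OF S'(1)] and DF = dual_module_module[OF S'(2)] and DN = dual_module_module[OF N]
  have TF: "tref R (F 0)" by (rule fgp_tref[OF fg])
  have TDF: "tref R (dual_module R (F 0))" by (rule fgp_tref[OF fgp_dual[OF fg]])
  let ?\<alpha> = "\<lambda>h. \<lambda>x\<in>carrier (F 0). h (e x)" and ?\<beta> = "\<lambda>f. \<lambda>a\<in>carrier ?Z. f a"
  have SD: "short_exact R (dual_module R N) (dual_module R (F 0)) (dual_module R ?Z) ?\<alpha> ?\<beta>"
    unfolding dual_module_def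
    by (rule hom_module_short_exact[OF S sm hom_extend[OF S sm van]])
  note SD' = short_exactD[OF SD]
  have wZ: "wreg xs (dual_module R ?Z)"
    unfolding dual_module_def
    by (rule wreg_hom[OF S'(1) sm ext_vanishes_cycle[OF res N sm fg van] xs reg])
  show "tref R (dual_module R ?Z)"
    by (rule tref_quotient[OF SD T TDF wZ])
  show "\<exists>u\<in>carrier N. \<forall>h\<in>carrier (dual_module R N). \<phi> h = h u"
    if \<phi>: "\<phi> \<in> module_hom R (dual_module R N) (self_module R)"
  proof -
    obtain \<psi> where \<psi>: "\<psi> \<in> module_hom R (dual_module R (F 0)) (self_module R)"
      "\<forall>h\<in>carrier (dual_module R N). \<psi> (?\<alpha> h) = \<phi> h"
      using tref_functional_extends[OF SD T wZ tref_torsionless[OF TDF] \<phi>] by blast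
    obtain v where v: "v \<in> carrier (F 0)" "\<forall>f\<in>carrier (dual_module R (F 0)). \<psi> f = f v"
      using trefD(4)[OF TF \<psi>(1)] by blast
    have "\<phi> h = h (e v)" if h: "h \<in> carrier (dual_module R N)" for h
      using \<psi>(2) v h hom_simps(1)[OF SD'(4) DN DF h] by auto
    then show ?thesis using es(1)[OF v(1)] by blast
  qed
  assume onto: "\<And>\<psi>. \<psi> \<in> module_hom R (dual_module R ?Z) (self_module R) \<Longrightarrow>
        \<exists>z\<in>carrier ?Z. \<forall>h\<in>carrier (dual_module R ?Z). \<psi> h = h z"
    and u: "u \<in> carrier N" "\<And>h. h \<in> carrier (dual_module R N) \<Longrightarrow> h u = \<zero>"
  obtain v where v: "v \<in> carrier (F 0)" "e v = u" using P(4)[OF u(1)] by blast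
  have "\<exists>\<psi>\<in>module_hom R (dual_module R ?Z) (self_module R). \<forall>f\<in>carrier (dual_module R (F 0)). \<psi> (?\<beta> f) = f v"
  proof (rule hom_factor[OF DF DZ sm SD'(5,7)])
    show "(\<lambda>f. f v) \<in> module_hom R (dual_module R (F 0)) (self_module R)"
      unfolding dual_module_def by (rule eval_hom[OF S'(2) sm v(1)])
    fix f assume "f \<in> carrier (dual_module R (F 0))" "?\<beta> f = \<zero>\<^bsub>dual_module R ?Z\<^esub>"
    then obtain h where "h \<in> carrier (dual_module R N)" "?\<alpha> h = f"
      using SD'(8) by blast
    then show "f v = \<zero>\<^bsub>self_module R\<^esub>" using v u(2) by auto
  qed
  then obtain \<psi> where \<psi>: "\<psi> \<in> module_hom R (dual_module R ?Z) (self_module R)"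
    "\<forall>f\<in>carrier (dual_module R (F 0)). \<psi> (?\<beta> f) = f v" by blast
  obtain z where z: "z \<in> carrier ?Z" "\<forall>h\<in>carrier (dual_module R ?Z). \<psi> h = h z"
    using onto[OF \<psi>(1)] by blast
  interpret F0: module R "F 0" by (rule P)
  have zF: "z \<in> carrier (F 0)" "e z = \<zero>\<^bsub>N\<^esub>" using z by (auto simp: cyc_def)
  have "f (v \<ominus>\<^bsub>F 0\<^esub> z) = \<zero>" if f: "f \<in> carrier (dual_module R (F 0))" for f
  proof -
    have fh: "f \<in> module_hom R (F 0) (self_module R)" using f by (simp add: dual_carrier)
    have "?\<beta> f \<in> carrier (dual_module R ?Z)"
      using hom_simps(1)[OF SD'(5) DF DZ f] .
    then have "\<psi> (?\<beta> f) = f z" using z by auto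
    then have "f v = f z" using \<psi>(2) f by auto
    then show ?thesis
      using hom_simps[OF fh S'(2) sm, simplified] v(1) zF(1) by (simp add: minus_eq r_neg)
  qed
  then have "v \<ominus>\<^bsub>F 0\<^esub> z = \<zero>\<^bsub>F 0\<^esub>"
    using v(1) zF(1) by (intro trefD(5)[OF TF]) auto
  then have "v = z" using v(1) zF(1) by simp
  then show "u = \<zero>\<^bsub>N\<^esub>" using v(2) zF(2) by simp
qed

text \<open>The step is applied to \<open>M\<close> and then to its first syzygy, whose dual is
  totally reflexive by \<open>step(2)\<close>; surjectivity there is what injectivity for
  \<open>M\<close> consumes.\<close>

theorem tref_of_dual:
  assumes fin: "finite_module R M" and van: "ext_vanishes R M (self_module R)" and T: "tref R (dual_module R M)"
  shows "tref R M"
proof -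
  have M: "module R M" using fin by (simp add: finite_module_def)
  note sm = self_module_module
  obtain n d e where res: "resolution R M (\<lambda>i. free_mod R (n i)) d e"
    using exists_free_resolution[OF fin] by blast
  let ?Z = "cycle_module M (\<lambda>i. free_mod R (n i)) d e 0"
  note step = dual_tref_step[OF res M free_mod_fgp van T]
  have Zm: "module R ?Z" by (rule cycle_module_module[OF res M])
  note stepZ = dual_tref_step(1)[OF resolution_tail[OF res M] Zm free_mod_fgp
      ext_vanishes_cycle[OF res M sm free_mod_fgp van] step(2)]
  show ?thesis
    unfolding tref_def
  proof (intro conjI ballI impI)
    show "\<exists>u\<in>carrier M. \<forall>h\<in>carrier (dual_module R M). \<phi> h = h u"
      if "\<phi> \<in> module_hom R (dual_module R M) (self_module R)" for \<phi>
      by (rule step(1)[OF that])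
    show "u = \<zero>\<^bsub>M\<^esub>" if "u \<in> carrier M" "\<forall>h\<in>carrier (dual_module R M). h u = \<zero>" for u
      using step(3)[OF stepZ that(1)] that(2) by blast
  qed (use fin van trefD(6)[OF T] in auto)
qed

end

section \<open>Splitting off free summands\<close>

text \<open>Applying \<open>h i\<close> to a linear relation isolates the coefficient of
  \<open>u i\<close>.\<close>

lemma free_moduleI:
  fixes R (structure)
  assumes M: "module R M" and u: "\<And>i. i < n \<Longrightarrow> u i \<in> carrier M"
    and h: "\<And>i. i < n \<Longrightarrow> h i \<in> module_hom R M (self_module R)"
    and hu: "\<And>i j. i < n \<Longrightarrow> j < n \<Longrightarrow> h i (u j) = (if i = j then \<one> else \<zero>)"
    and ex: "\<And>x. x \<in> carrier M \<Longrightarrow> msum M (\<lambda>i. h i x \<odot>\<^bsub>M\<^esub> u i) n = x"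
  shows "free_module R M"
proof -
  interpret M: module R M by fact
  note hs = hom_simps[OF h M M.self_module_module, simplified]
  have B: "u ` {..<n} \<subseteq> carrier M" using u by auto
  have "carrier M \<subseteq> M.span (u ` {..<n})"
  proof
    fix x assume x: "x \<in> carrier M"
    have "msum M (\<lambda>i. h i x \<odot>\<^bsub>M\<^esub> u i) n \<in> M.span (u ` {..<n})"
    proof (rule submodule_msum[OF M.span_is_submodule[OF B]])
      fix i assume i: "i < n"
      then have "u i \<in> M.span (u ` {..<n})" using M.in_own_span[OF B] by blast
      then show "h i x \<odot>\<^bsub>M\<^esub> u i \<in> M.span (u ` {..<n})"
        using submodule.smult_closed[OF M.span_is_submodule[OF B]] hs(1)[OF i x] by blast
    qed
    then show "x \<in> M.span (u ` {..<n})" by (simp only: ex[OF x])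
  qed
  moreover have "M.span (u ` {..<n}) \<subseteq> carrier M" by (rule M.span_is_subset2[OF B])
  moreover have "\<not> M.lin_dep (u ` {..<n})"
  proof
    assume "M.lin_dep (u ` {..<n})"
    then obtain A a v where A: "finite A" "A \<subseteq> u ` {..<n}" "a \<in> A \<rightarrow> carrier R" "M.lincomb a A = \<zero>\<^bsub>M\<^esub>"
      "v \<in> A" "a v \<noteq> \<zero>"
      unfolding M.lin_dep_def by blast
    then obtain i where i: "i < n" "v = u i" by blast
    \<comment> \<open>Formulated for subsets \<open>A'\<close> so that the vectors can be inserted
      one by one; the value stays zero until \<open>v\<close> is reached.\<close>
    have "h i (M.lincomb a A') = (if v \<in> A' then a v else \<zero>)" if "finite A'" "A' \<subseteq> A" for A'
      using that
    proof (induction A' rule: finite_induct)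
      case empty
      show ?case using hs(4)[OF i(1)] by (simp add: M.lincomb_def)
    next
      case (insert w A')
      then have w: "w \<in> A" "a w \<in> carrier R" "a v \<in> carrier R" using A(3,5) by auto
      then obtain j where j: "j < n" "w = u j" using A(2) by blast
      have ac: "\<And>x. x \<in> A' \<Longrightarrow> a x \<in> carrier R" "\<And>x. x \<in> A' \<Longrightarrow> x \<in> carrier M"
        using insert.prems A(2,3) B by blast+
      have "M.lincomb a (insert w A') = a w \<odot>\<^bsub>M\<^esub> w \<oplus>\<^bsub>M\<^esub> M.lincomb a A'"
        unfolding M.lincomb_def using insert.hyps ac w j u by (intro M.finsum_insert) auto
      moreover have "M.lincomb a A' \<in> carrier M"
        unfolding M.lincomb_def using ac by (intro M.finsum_closed) auto
      moreover have "h i w = (if w = v then \<one> else \<zero>)"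
      proof (cases "i = j")
        case False
        then have "w \<noteq> v" using hu[OF i(1) i(1)] hu[OF i(1) j(1)] i j A(3,5,6) M.R.one_zeroD by fastforce
        then show ?thesis using hu[OF i(1) j(1)] j False by simp
      qed (use hu i j in simp)
      ultimately show ?case
        using insert w j u hs(1-3)[OF i(1)] by (auto simp: M.R.m_comm)
    qed
    from this[OF A(1)] show False using A hs(4)[OF i(1)] by simp
  qed
  ultimately show ?thesis using B M unfolding free_module_def by blast
qed

text \<open>A homomorphism out of \<open>F\<close> is recovered from its values at the
  \<open>u i\<close>, each spread over \<open>F\<close> by \<open>h i\<close>. This presents the Hom
  module as a sum of images of \<open>M\<close>.\<close>

lemma hom_module_expand:
  fixes R (structure)
  assumes F: "module R F" and M: "module R M" and u: "\<And>i. i < n \<Longrightarrow> u i \<in> carrier F"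
    and h: "\<And>i. i < n \<Longrightarrow> h i \<in> module_hom R F (self_module R)"
    and ex: "\<And>x. x \<in> carrier F \<Longrightarrow> msum F (\<lambda>i. h i x \<odot>\<^bsub>F\<^esub> u i) n = x"
  shows "i < n \<Longrightarrow> (\<lambda>m. \<lambda>p\<in>carrier F. h i p \<odot>\<^bsub>M\<^esub> m) \<in> module_hom R M (hom_module R F M)"
    and "w \<in> carrier (hom_module R F M) \<Longrightarrow>
      msum (hom_module R F M) (\<lambda>i. \<lambda>p\<in>carrier F. h i p \<odot>\<^bsub>M\<^esub> w (u i)) n = w"
proof -
  interpret F: module R F by fact
  interpret M: module R M by fact
  note hs = hom_simps[OF h F F.self_module_module, simplified]
  have c: "(\<lambda>p\<in>carrier F. h i p \<odot>\<^bsub>M\<^esub> m) \<in> carrier (hom_module R F M)" if "i < n" "m \<in> carrier M" for i m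
  proof -
    have "(\<lambda>p. h i p \<odot>\<^bsub>M\<^esub> m) \<in> module_hom R F M"
      using hs that by (auto simp: module_hom_def M.smult_l_distr M.smult_assoc1)
    then show ?thesis using F by simp
  qed
  show "(\<lambda>m. \<lambda>p\<in>carrier F. h i p \<odot>\<^bsub>M\<^esub> m) \<in> module_hom R M (hom_module R F M)" if i: "i < n"
    using c[OF i] hs(1)[OF i]
    by (auto simp: module_hom_def[of _ M] M.smult_r_distr M.smult_assoc1[symmetric] F.R.m_comm simp del: hom_module_simps(1) cong: restrict_cong)
  assume w: "w \<in> carrier (hom_module R F M)"
  then have wh: "w \<in> module_hom R F M" by simp
  note ws = hom_simps[OF wh F M]
  note HM = hom_module_module[OF F M]
  let ?s = "msum (hom_module R F M) (\<lambda>i. \<lambda>p\<in>carrier F. h i p \<odot>\<^bsub>M\<^esub> w (u i)) n"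
  have sc: "?s \<in> carrier (hom_module R F M)"
    using c u ws by (intro module.msum_closed[OF HM]) blast
  show "?s = w"
  proof (rule extensionalityI)
    show "?s \<in> extensional (carrier F)" "w \<in> extensional (carrier F)" using sc w by simp_all
    fix p assume p: "p \<in> carrier F"
    have "?s p = msum M (\<lambda>i. (\<lambda>p\<in>carrier F. h i p \<odot>\<^bsub>M\<^esub> w (u i)) p) n"
      using c u ws by (intro hom_msum[OF eval_hom[OF F M p] HM M]) blast
    also have "\<dots> = msum M (\<lambda>i. w (h i p \<odot>\<^bsub>F\<^esub> u i)) n"
      using p u ws hs by (intro msum_cong) simp
    also have "\<dots> = w (msum F (\<lambda>i. h i p \<odot>\<^bsub>F\<^esub> u i) n)"
      using p u hs by (intro hom_msum[OF wh F M, symmetric]) simp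
    finally show "?s p = w p" by (simp only: ex[OF p])
  qed
qed

lemma finite_hom_fgp:
  assumes F: "fgp R F" and fin: "finite_module R M"
  shows "finite_module R (hom_module R F M)"
proof -
  have Fm: "module R F" using F by (rule fgp_module)
  have M: "module R M" using fin by (simp add: finite_module_def)
  interpret M: module R M by fact
  obtain n u h where u: "\<And>i. i < n \<Longrightarrow> u i \<in> carrier F"
    and h: "\<And>i. i < n \<Longrightarrow> h i \<in> module_hom R F (self_module R)"
    and ex: "\<And>q. q \<in> carrier F \<Longrightarrow> msum F (\<lambda>i. h i q \<odot>\<^bsub>F\<^esub> u i) n = q"
    by (rule fgpE[OF F]) blast
  obtain A where A: "finite A" "A \<subseteq> carrier M" "\<And>T. submodule R T M \<Longrightarrow> A \<subseteq> T \<Longrightarrow> T = carrier M"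
    by (rule finite_moduleD[OF fin]) blast
  note HM = hom_module_module[OF Fm M]
  let ?g = "\<lambda>i m. \<lambda>p\<in>carrier F. h i p \<odot>\<^bsub>M\<^esub> m"
  have E: "?g i \<in> module_hom R M (hom_module R F M)" if "i < n" for i
    by (rule hom_module_expand(1)[OF Fm M u h ex]) (assumption | rule that)+
  have E': "msum (hom_module R F M) (\<lambda>i. ?g i (w (u i))) n = w" if "w \<in> carrier (hom_module R F M)" for w
    by (rule hom_module_expand(2)[OF Fm M u h ex]) (assumption | rule that)+
  note gs = hom_simps[OF E M HM]
  show ?thesis
  proof (rule finite_moduleI[OF HM])
    show "finite (case_prod ?g ` ({..<n} \<times> A))" using A(1) by simp
    show "case_prod ?g ` ({..<n} \<times> A) \<subseteq> carrier (hom_module R F M)"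
      using gs(1) A(2) by (auto simp del: hom_module_simps)
    fix T assume T: "submodule R T (hom_module R F M)" "case_prod ?g ` ({..<n} \<times> A) \<subseteq> T"
    have gT: "?g i m \<in> T" if i: "i < n" and m: "m \<in> carrier M" for i m
    proof -
      have "{m \<in> carrier M. ?g i m \<in> T} = carrier M"
        using T(2) i A(2) by (intro A(3)[OF hom_vimage_submodule[OF M HM E[OF i] T(1)]]) auto
      then show ?thesis using m by blast
    qed
    show "carrier (hom_module R F M) \<subseteq> T"
    proof
      fix w assume w: "w \<in> carrier (hom_module R F M)"
      then have "w (u i) \<in> carrier M" if "i < n" for i
        using that u hom_simps(1)[OF _ Fm M] by simp
      then have "msum (hom_module R F M) (\<lambda>i. ?g i (w (u i))) n \<in> T"
        using gT by (intro submodule_msum[OF T(1)]) blast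
      then show "w \<in> T" by (simp only: E'[OF w])
    qed
  qed
qed

text \<open>Composition with a surjection from a free module of finite rank embeds this module into
  homomorphisms from that free module.\<close>

lemma (in noetherian_cring) finite_hom:
  assumes N: "finite_module R N" and M: "finite_module R M"
  shows "finite_module R (hom_module R N M)"
proof -
  have Nm: "module R N" and Mm: "module R M" using N M by (simp_all add: finite_module_def)
  obtain n d e where res: "resolution R N (\<lambda>i. free_mod R (n i)) d e"
    using exists_free_resolution[OF N] by blast
  let ?F = "free_mod R (n 0)"
  note P = resolutionD[OF res]
  note es = hom_simps[OF P(3) free_mod_module Nm]
  note HN = hom_module_module[OF Nm Mm] and HF = hom_module_module[OF free_mod_module Mm]
  let ?\<alpha> = "\<lambda>h. \<lambda>x\<in>carrier ?F. h (e x)"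
  have \<alpha>: "?\<alpha> \<in> module_hom R (hom_module R N M) (hom_module R ?F M)"
    using es(1) hom_comp[OF free_mod_module P(3)] free_mod_module[of "n 0"]
    by (auto simp: module_hom_def[of _ "hom_module R N M"] simp del: free_mod_simps cong: restrict_cong)
  have inj: "inj_on ?\<alpha> (carrier (hom_module R N M))"
  proof (rule inj_onI)
    fix f g assume f: "f \<in> carrier (hom_module R N M)" "g \<in> carrier (hom_module R N M)" and eq: "?\<alpha> f = ?\<alpha> g"
    show "f = g"
    proof (rule extensionalityI)
      show "f \<in> extensional (carrier N)" "g \<in> extensional (carrier N)" using f by simp_all
      fix x assume "x \<in> carrier N"
      then obtain v where "v \<in> carrier ?F" "e v = x" using P(4) by blast
      then show "f x = g x" using fun_cong[OF eq, of v] by (simp del: free_mod_simps)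
    qed
  qed
  show ?thesis
    by (rule finite_module_inj[OF HN HF \<alpha> inj fg_submodule_of_finite[OF finite_hom_fgp[OF free_mod_fgp M]
          hom_image_submodule[OF HN HF \<alpha> carrier_submodule[OF HN]]]])
qed

lemma (in maximal_regular) end_functional_extends:
  fixes F :: "nat \<Rightarrow> ('a, nat \<Rightarrow> 'a) module"
  assumes M: "tref R M" and van: "ext_vanishes R M M" and H: "fgp R (hom_module R M M)"
    and res: "resolution R M F d e" and fg: "\<And>i. fgp R (F i)"
    and g: "g \<in> module_hom R (hom_module R M M) (self_module R)"
  shows "\<exists>f\<in>module_hom R (hom_module R (F 0) M) (self_module R).
    \<forall>a\<in>carrier (hom_module R M M). f (\<lambda>x\<in>carrier (F 0). a (e x)) = g a"
proof -
  have Mm: "module R M" using M by (rule trefD)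
  have wM: "wreg xs M" by (rule tref_wreg[OF M])
  note S = cycle_short_exact_0[OF res Mm]
  note S' = short_exactD[OF S]
  have SE: "short_exact R (hom_module R M M) (hom_module R (F 0) M) (hom_module R (cycle_module M F d e 0) M)
      (\<lambda>h. \<lambda>x\<in>carrier (F 0). h (e x)) (\<lambda>f. \<lambda>a\<in>carrier (cycle_module M F d e 0). f a)"
    by (rule hom_module_short_exact[OF S Mm hom_extend[OF S Mm van]])
  have wZ: "wreg xs (hom_module R (cycle_module M F d e 0) M)"
    by (rule wreg_hom[OF S'(1) Mm ext_vanishes_cycle[OF res Mm Mm fg van] xs wM])
  show ?thesis
  proof (rule tref_functional_extends[OF SE fgp_tref[OF H] wZ _ g])
    fix w assume w: "w \<in> carrier (hom_module R (F 0) M)"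
      and f: "\<And>f. f \<in> module_hom R (hom_module R (F 0) M) (self_module R) \<Longrightarrow> f w \<in> lmul xs (self_module R)"
    \<comment> \<open>The functionals sending \<open>w\<close> to \<open>k (w p)\<close> suffice.
      They put each value \<open>w p\<close> into \<open>(xs)M\<close>, as \<open>M\<close> is
      torsionless modulo \<open>xs\<close>, and projectivity of \<open>F 0\<close> combines the
      values.\<close>
    show "w \<in> lmul xs (hom_module R (F 0) M)"
    proof (rule hom_lmul_fgp[OF fg Mm xs w])
      fix p assume p: "p \<in> carrier (F 0)"
      have wp: "w p \<in> carrier M" using w hom_simps(1)[OF _ S'(2) Mm p] by simp
      show "w p \<in> lmul xs M"
      proof (rule tref_torsionless[OF M wp])
        fix k assume k: "k \<in> module_hom R M (self_module R)"
        show "k (w p) \<in> lmul xs (self_module R)"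
          by (rule f[OF hom_comp[OF hom_module_module[OF S'(2) Mm] eval_hom[OF S'(2) Mm p] k]])
      qed
    qed
  qed
qed

lemma (in noetherian_local_ring) nonunits_submodule:
  "submodule R {c \<in> carrier R. c \<notin> Units R} (self_module R)"
proof -
  interpret I: ideal "carrier R - Units R" R by (rule nonunits_ideal)
  show ?thesis
    using self_module_module I.I_l_closed I.a_closed I.zero_closed by (intro submodule.intro) auto
qed

text \<open>Writing \<open>w\<close> in terms of the maps \<open>p \<mapsto> h p \<odot> w v\<close> shows that \<open>g w\<close> is a sum of values of functionals on \<open>M\<close> at
  the elements \<open>w v\<close>.\<close>

lemma (in noetherian_local_ring) hom_functional_nonunit:
  assumes F: "fgp R F" and M: "module R M" and g: "g \<in> module_hom R (hom_module R F M) (self_module R)"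
    and w: "w \<in> carrier (hom_module R F M)"
    and non: "\<And>f v. f \<in> module_hom R M (self_module R) \<Longrightarrow> v \<in> carrier F \<Longrightarrow> f (w v) \<notin> Units R"
  shows "g w \<notin> Units R"
proof -
  have Fm: "module R F" using F by (rule fgp_module)
  obtain n u h where u: "\<And>i. i < n \<Longrightarrow> u i \<in> carrier F"
    and h: "\<And>i. i < n \<Longrightarrow> h i \<in> module_hom R F (self_module R)"
    and ex: "\<And>q. q \<in> carrier F \<Longrightarrow> msum F (\<lambda>i. h i q \<odot>\<^bsub>F\<^esub> u i) n = q"
    by (rule fgpE[OF F]) blast
  note HM = hom_module_module[OF Fm M]
  let ?g = "\<lambda>i m. \<lambda>p\<in>carrier F. h i p \<odot>\<^bsub>M\<^esub> m"
  have E: "?g i \<in> module_hom R M (hom_module R F M)" if "i < n" for i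
    by (rule hom_module_expand(1)[OF Fm M u h ex]) (assumption | rule that)+
  have E': "msum (hom_module R F M) (\<lambda>i. ?g i (w (u i))) n = w"
    by (rule hom_module_expand(2)[OF Fm M u h ex]) (assumption | rule w)+
  have wu: "w (u i) \<in> carrier M" if "i < n" for i
    using that w u hom_simps(1)[OF _ Fm M] by simp
  have gu: "?g i (w (u i)) \<in> carrier (hom_module R F M)" if "i < n" for i
    by (rule hom_simps(1)[OF E[OF that] M HM wu[OF that]])
  have "g (msum (hom_module R F M) (\<lambda>i. ?g i (w (u i))) n) = msum (self_module R) (\<lambda>i. g (?g i (w (u i)))) n"
    by (rule hom_msum[OF g HM self_module_module gu])
  also have "\<dots> \<in> {c \<in> carrier R. c \<notin> Units R}"
  proof (rule submodule_msum[OF nonunits_submodule])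
    fix i assume i: "i < n"
    have "g (?g i (w (u i))) \<notin> Units R"
      by (rule non[OF hom_comp[OF M E[OF i] g] u[OF i]])
    then show "g (?g i (w (u i))) \<in> {c \<in> carrier R. c \<notin> Units R}"
      using hom_simps(1)[OF g HM self_module_module gu[OF i]] by simp
  qed
  finally show ?thesis by (simp only: E') blast
qed

text \<open>Nakayama's lemma for the summand \<open>p M\<close>, without forming it. In a nonzero
  cyclic quotient of \<open>M\<close> that kills the kernel of \<open>p\<close>, the generator
  \<open>a\<close> equals \<open>p a\<close>, which is a nonunit times \<open>a\<close>; so
  \<open>a\<close> is zero there, a contradiction.\<close>

lemma (in noetherian_local_ring) nakayama_idempotent:
  assumes fin: "finite_module R M" and p: "p \<in> module_hom R M M"
    and idem: "\<And>x. x \<in> carrier M \<Longrightarrow> p (p x) = p x"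
    and u: "\<And>i x. i < n \<Longrightarrow> x \<in> carrier M \<Longrightarrow> u i x \<in> carrier M"
    and c: "\<And>i. i < n \<Longrightarrow> c i \<in> carrier R" "\<And>i. i < n \<Longrightarrow> c i \<notin> Units R"
    and px: "\<And>x. x \<in> carrier M \<Longrightarrow> p x = msum M (\<lambda>i. c i \<odot>\<^bsub>M\<^esub> u i x) n"
    and x: "x \<in> carrier M"
  shows "p x = \<zero>\<^bsub>M\<^esub>"
proof (rule ccontr)
  assume nz: "p x \<noteq> \<zero>\<^bsub>M\<^esub>"
  have M: "module R M" using fin by (simp add: finite_module_def)
  interpret M: module R M by fact
  interpret I: ideal "carrier R - Units R" R by (rule nonunits_ideal)
  note ps = hom_simps[OF p M M]
  let ?W = "{x \<in> carrier M. p x = \<zero>\<^bsub>M\<^esub>}"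
  have "?W \<noteq> carrier M" using nz x by blast
  then obtain V a where V: "submodule R V M" "?W \<subseteq> V" "a \<in> carrier M" "a \<notin> V"
    "\<And>n. n \<in> carrier M \<Longrightarrow> \<exists>v\<in>V. \<exists>r\<in>carrier R. n = v \<oplus>\<^bsub>M\<^esub> r \<odot>\<^bsub>M\<^esub> a"
    by (rule cyclic_quotient[OF fin hom_kernel_submodule[OF M M p]]) blast
  note VM = submodule.subset[OF V(1)]
  have "k \<le> n \<Longrightarrow> \<exists>v\<in>V. \<exists>r\<in>carrier R - Units R. msum M (\<lambda>i. c i \<odot>\<^bsub>M\<^esub> u i a) k = v \<oplus>\<^bsub>M\<^esub> r \<odot>\<^bsub>M\<^esub> a" for k
  proof (induction k)
    case 0
    show ?case
      using submodule.zero_closed[OF V(1)] I.zero_closed V(3)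
      by (intro bexI[of _ "\<zero>\<^bsub>M\<^esub>"] bexI[of _ "\<zero>"]) auto
  next
    case (Suc k)
    then obtain v r where v: "v \<in> V" "r \<in> carrier R - Units R"
      "msum M (\<lambda>i. c i \<odot>\<^bsub>M\<^esub> u i a) k = v \<oplus>\<^bsub>M\<^esub> r \<odot>\<^bsub>M\<^esub> a" by auto
    have k: "k < n" using Suc.prems by simp
    obtain w s where w: "w \<in> V" "s \<in> carrier R" "u k a = w \<oplus>\<^bsub>M\<^esub> s \<odot>\<^bsub>M\<^esub> a"
      using V(5)[OF u[OF k V(3)]] by blast
    have vM: "v \<in> carrier M" "w \<in> carrier M" using v w VM by auto
    have rR: "r \<in> carrier R" "c k \<in> carrier R" using v c k by auto
    have "c k \<otimes> s \<in> carrier R - Units R" using I.I_r_closed[of "c k" s] c k w by blast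
    then have "r \<oplus> c k \<otimes> s \<in> carrier R - Units R" using I.a_closed v by blast
    moreover have "v \<oplus>\<^bsub>M\<^esub> c k \<odot>\<^bsub>M\<^esub> w \<in> V"
      using v w rR submodule.m_closed[OF V(1)] submodule.smult_closed[OF V(1)] by simp
    moreover have "v \<oplus>\<^bsub>M\<^esub> r \<odot>\<^bsub>M\<^esub> a \<oplus>\<^bsub>M\<^esub> c k \<odot>\<^bsub>M\<^esub> (w \<oplus>\<^bsub>M\<^esub> s \<odot>\<^bsub>M\<^esub> a) =
        v \<oplus>\<^bsub>M\<^esub> c k \<odot>\<^bsub>M\<^esub> w \<oplus>\<^bsub>M\<^esub> (r \<oplus> c k \<otimes> s) \<odot>\<^bsub>M\<^esub> a"
      using vM rR w(2) V(3) by (simp add: M.smult_r_distr M.smult_l_distr M.smult_assoc1 M.a_ac)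
    ultimately show ?case unfolding msum.simps v(3) w(3) by blast
  qed
  then obtain v r where v: "v \<in> V" "r \<in> carrier R - Units R" "p a = v \<oplus>\<^bsub>M\<^esub> r \<odot>\<^bsub>M\<^esub> a"
    using px[OF V(3)] by (metis order_refl)
  have vM: "v \<in> carrier M" "r \<in> carrier R" using v VM by auto
  have pa: "p a \<in> carrier M" using ps V(3) by blast
  have "p (a \<ominus>\<^bsub>M\<^esub> p a) = \<zero>\<^bsub>M\<^esub>"
    using ps V(3) pa idem by (simp add: M.r_neg M.minus_eq)
  then have "a \<ominus>\<^bsub>M\<^esub> p a \<in> V" using V(2,3) pa by auto
  then have "(a \<ominus>\<^bsub>M\<^esub> p a) \<oplus>\<^bsub>M\<^esub> v \<in> V" using v(1) submodule.m_closed[OF V(1)] by blast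
  moreover have "(a \<ominus>\<^bsub>M\<^esub> p a) \<oplus>\<^bsub>M\<^esub> v = (\<one> \<ominus> r) \<odot>\<^bsub>M\<^esub> a"
  proof -
    have "(\<one> \<ominus> r) \<odot>\<^bsub>M\<^esub> a = a \<ominus>\<^bsub>M\<^esub> r \<odot>\<^bsub>M\<^esub> a"
      using vM(2) V(3) by (simp add: minus_eq M.minus_eq M.smult_l_distr M.smult_l_minus)
    moreover have "r \<odot>\<^bsub>M\<^esub> a \<in> carrier M" using vM(2) V(3) by simp
    then have "a \<ominus>\<^bsub>M\<^esub> (v \<oplus>\<^bsub>M\<^esub> r \<odot>\<^bsub>M\<^esub> a) \<oplus>\<^bsub>M\<^esub> v = a \<ominus>\<^bsub>M\<^esub> r \<odot>\<^bsub>M\<^esub> a"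
      using vM(1) V(3) by algebra
    ultimately show ?thesis by (simp only: v(3))
  qed
  ultimately have rV: "(\<one> \<ominus> r) \<odot>\<^bsub>M\<^esub> a \<in> V" by simp
  have "\<one> \<ominus> r \<in> Units R"
  proof (rule ccontr)
    assume "\<one> \<ominus> r \<notin> Units R"
    then have "(\<one> \<ominus> r) \<oplus> r \<in> carrier R - Units R" using I.a_closed v(2) vM(2) by simp
    moreover have "(\<one> \<ominus> r) \<oplus> r = \<one>" using vM(2) one_closed by algebra
    ultimately show False by simp
  qed
  then have "inv (\<one> \<ominus> r) \<odot>\<^bsub>M\<^esub> ((\<one> \<ominus> r) \<odot>\<^bsub>M\<^esub> a) = a" "inv (\<one> \<ominus> r) \<in> carrier R"
    using V(3) vM(2) Units_l_inv[of "\<one> \<ominus> r"] by (simp_all add: M.smult_assoc1[symmetric])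
  then show False using rV V(4) submodule.smult_closed[OF V(1)] by metis
qed

text \<open>One summand isomorphic to \<open>R\<close> after the other is split off; \<open>p\<close> is the projection to the remaining
  summand, and the number of given generators it does not kill decreases.\<close>

lemma (in noetherian_local_ring) free_module_by_splitting:
  assumes fin: "finite_module R M"
    and split: "\<And>p. p \<in> module_hom R M M \<Longrightarrow> (\<And>x. x \<in> carrier M \<Longrightarrow> p (p x) = p x) \<Longrightarrow>
      (\<And>h x. h \<in> module_hom R M (self_module R) \<Longrightarrow> x \<in> carrier M \<Longrightarrow> h (p x) \<notin> Units R) \<Longrightarrow>
      (\<And>x. x \<in> carrier M \<Longrightarrow> p x = \<zero>\<^bsub>M\<^esub>)"
  shows "free_module R M"
proof -
  have M: "module R M" using fin by (simp add: finite_module_def)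
  interpret M: module R M by fact
  obtain A where A: "finite A" "A \<subseteq> carrier M" "\<And>T. submodule R T M \<Longrightarrow> A \<subseteq> T \<Longrightarrow> T = carrier M"
    by (rule finite_moduleD[OF fin]) blast
  note sm = self_module_module
  have one: "\<one> \<noteq> \<zero>" using nonunits_submodule by (metis (mono_tags, lifting) Units_one_closed mem_Collect_eq self_module_simps(3) submodule.zero_closed)
  \<comment> \<open>Invariant: the identity is the sum of \<open>p\<close> and of the projections
    onto the \<open>n\<close> copies of \<open>R\<close> split off so far, all of them
    orthogonal.\<close>
  have main: "free_module R M"
    if "card {a \<in> A. p a \<noteq> \<zero>\<^bsub>M\<^esub>} = k" and p: "p \<in> module_hom R M M" "\<And>x. x \<in> carrier M \<Longrightarrow> p (p x) = p x"
      and u: "\<And>i. i < n \<Longrightarrow> u i \<in> carrier M" "\<And>i. i < n \<Longrightarrow> p (u i) = \<zero>\<^bsub>M\<^esub>"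
      and h: "\<And>i. i < n \<Longrightarrow> h i \<in> module_hom R M (self_module R)"
        "\<And>i x. i < n \<Longrightarrow> x \<in> carrier M \<Longrightarrow> h i (p x) = \<zero>"
      and hu: "\<And>i j. i < n \<Longrightarrow> j < n \<Longrightarrow> h i (u j) = (if i = j then \<one> else \<zero>)"
      and px: "\<And>x. x \<in> carrier M \<Longrightarrow> msum M (\<lambda>i. h i x \<odot>\<^bsub>M\<^esub> u i) n \<oplus>\<^bsub>M\<^esub> p x = x"
    for k p n u h
    using that
  proof (induction k arbitrary: p n u h rule: less_induct)
    case (less k p n u h)
    note p = less.prems(2,3) and u = less.prems(4,5) and h = less.prems(6,7) and hu = less.prems(8)
      and px = less.prems(9)
    note ps = hom_simps[OF p(1) M M] and hs = hom_simps[OF h(1) M sm, simplified]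
    show ?case
    proof (cases "\<exists>f\<in>module_hom R M (self_module R). \<exists>x\<in>carrier M. f (p x) \<in> Units R")
      case False
      then have p0: "p x = \<zero>\<^bsub>M\<^esub>" if "x \<in> carrier M" for x
        using split[OF p _ that] by blast
      have ex: "msum M (\<lambda>i. h i x \<odot>\<^bsub>M\<^esub> u i) n = x" if x: "x \<in> carrier M" for x
      proof -
        have "msum M (\<lambda>i. h i x \<odot>\<^bsub>M\<^esub> u i) n \<in> carrier M" using x u hs by (intro M.msum_closed) simp
        then show ?thesis using px[OF x] p0[OF x] by simp
      qed
      show ?thesis by (rule free_moduleI[OF M u(1) h(1) hu ex])
    next
      case True
      then obtain f x where f: "f \<in> module_hom R M (self_module R)" and x: "x \<in> carrier M" "f (p x) \<in> Units R"
        by blast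
      note fs = hom_simps[OF f M sm, simplified]
      \<comment> \<open>Nonunits form a submodule of \<open>R\<close>, so nonunit values of
        \<open>f\<close> after \<open>p\<close> on the generators would exclude unit values
        altogether.\<close>
      have "\<exists>a\<in>A. f (p a) \<in> Units R"
      proof (rule ccontr)
        assume "\<not> (\<exists>a\<in>A. f (p a) \<in> Units R)"
        then have "A \<subseteq> {x \<in> carrier M. f (p x) \<in> {c \<in> carrier R. c \<notin> Units R}}" using A(2) fs(1) ps(1) by auto
        then have "{x \<in> carrier M. f (p x) \<in> {c \<in> carrier R. c \<notin> Units R}} = carrier M"
          by (rule A(3)[OF hom_vimage_submodule[OF M sm hom_comp[OF M p(1) f] nonunits_submodule]])
        then show False using x by blast
      qed
      then obtain a where a: "a \<in> A" "f (p a) \<in> Units R" by blast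
      have aM: "a \<in> carrier M" "p a \<in> carrier M" using a A(2) ps(1) by auto
      let ?r = "inv (f (p a))"
      have r: "?r \<in> carrier R" "f (p a) \<in> carrier R" "?r \<otimes> f (p a) = \<one>" "f (p a) \<otimes> ?r = \<one>" using a by auto
      \<comment> \<open>Scaled so that \<open>f v\<close> is one; being in the image of
        \<open>p\<close>, it is killed by the earlier \<open>h i\<close>.\<close>
      define v where "v = ?r \<odot>\<^bsub>M\<^esub> p a"
      have v: "v \<in> carrier M" "p v = v" "f v = \<one>" "\<And>i. i < n \<Longrightarrow> h i v = \<zero>"
        using aM r ps(3) fs(3) hs(3) h(2) p(2) by (auto simp: v_def)
      define q where "q = (\<lambda>x. p x \<ominus>\<^bsub>M\<^esub> f (p x) \<odot>\<^bsub>M\<^esub> v)"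
      have fp: "(\<lambda>x. f (p x)) \<in> module_hom R M (self_module R)" by (rule hom_comp[OF M p(1) f])
      note fps = hom_simps[OF fp M sm, simplified]
      have q: "q \<in> module_hom R M M"
        unfolding q_def
        using fps v(1) by (intro hom_minus[OF M M p(1)]) (auto simp: module_hom_def M.smult_l_distr M.smult_assoc1)
      have pq: "p (q x) = q x" and qp: "q (p x) = q x" and fq: "f (q x) = \<zero>" and qM: "q x \<in> carrier M"
        if x: "x \<in> carrier M" for x
        using x ps fs fps v p(2) by (simp_all add: q_def r_neg minus_eq)
      have q0: "q x = \<zero>\<^bsub>M\<^esub>" if "x \<in> carrier M" "p x = \<zero>\<^bsub>M\<^esub>" for x
        using that fs(4) v(1) by (simp add: q_def M.minus_eq)
      have qv: "q v = \<zero>\<^bsub>M\<^esub>" using v by (simp add: q_def M.minus_eq M.r_neg)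
      have "q (p a) = f (p a) \<odot>\<^bsub>M\<^esub> q v"
        using aM r hom_simps(3)[OF q M M, of "f (p a)" v] v(1)
        by (simp add: v_def M.smult_assoc1[symmetric])
      then have qa: "q a = \<zero>\<^bsub>M\<^esub>" using qp[OF aM(1)] qv r by simp
      \<comment> \<open>\<open>q\<close> kills what \<open>p\<close> kills and in addition
        \<open>a\<close>.\<close>
      have "{b \<in> A. q b \<noteq> \<zero>\<^bsub>M\<^esub>} \<subset> {b \<in> A. p b \<noteq> \<zero>\<^bsub>M\<^esub>}"
      proof -
        have "p a \<noteq> \<zero>\<^bsub>M\<^esub>" using r one fs(4) by force
        then show ?thesis using q0 qa a(1) A(2) by blast
      qed
      then have "card {b \<in> A. q b \<noteq> \<zero>\<^bsub>M\<^esub>} < k"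
        unfolding less.prems(1)[symmetric] using A(1) by (intro psubset_card_mono) auto
      then show ?thesis
      proof (rule less.IH[of _ q "Suc n" "u(n := v)" "h(n := \<lambda>x. f (p x))", OF _ refl q])
        show "q (q x) = q x" if "x \<in> carrier M" for x
          using that pq fq qM v(1) fun_cong[OF q_def, of "q x"] by (simp add: M.minus_eq)
        show "msum M (\<lambda>i. (h(n := \<lambda>x. f (p x))) i x \<odot>\<^bsub>M\<^esub> (u(n := v)) i) (Suc n) \<oplus>\<^bsub>M\<^esub> q x = x"
          if x: "x \<in> carrier M" for x
        proof -
          have cancel: "s \<oplus>\<^bsub>M\<^esub> b \<oplus>\<^bsub>M\<^esub> (c \<ominus>\<^bsub>M\<^esub> b) = s \<oplus>\<^bsub>M\<^esub> c"
            if "s \<in> carrier M" "b \<in> carrier M" "c \<in> carrier M" for s b c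
            using that by algebra
          have s: "msum M (\<lambda>i. h i x \<odot>\<^bsub>M\<^esub> u i) n \<in> carrier M" using x u hs by (intro M.msum_closed) simp
          have "msum M (\<lambda>i. (h(n := \<lambda>x. f (p x))) i x \<odot>\<^bsub>M\<^esub> (u(n := v)) i) n = msum M (\<lambda>i. h i x \<odot>\<^bsub>M\<^esub> u i) n"
            by (rule msum_cong) simp
          moreover have "msum M (\<lambda>i. h i x \<odot>\<^bsub>M\<^esub> u i) n \<oplus>\<^bsub>M\<^esub> f (p x) \<odot>\<^bsub>M\<^esub> v \<oplus>\<^bsub>M\<^esub> (p x \<ominus>\<^bsub>M\<^esub> f (p x) \<odot>\<^bsub>M\<^esub> v) =
              msum M (\<lambda>i. h i x \<odot>\<^bsub>M\<^esub> u i) n \<oplus>\<^bsub>M\<^esub> p x"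
            using cancel s ps(1)[OF x] fps(1)[OF x] v(1) by simp
          ultimately show ?thesis using px[OF x] by (simp add: q_def)
        qed
        show "(u(n := v)) i \<in> carrier M" "q ((u(n := v)) i) = \<zero>\<^bsub>M\<^esub>"
          "(h(n := \<lambda>x. f (p x))) i \<in> module_hom R M (self_module R)" if "i < Suc n" for i
          using that u v(1) qv q0 h(1) fp by (auto simp: less_Suc_eq)
        show "(h(n := \<lambda>x. f (p x))) i (q x) = \<zero>" if "i < Suc n" "x \<in> carrier M" for i x
          using that pq fq qM h(2)[of i "q x"] by (auto simp: less_Suc_eq)
        show "(h(n := \<lambda>x. f (p x))) i ((u(n := v)) j) = (if i = j then \<one> else \<zero>)" if "i < Suc n" "j < Suc n" for i j
          using that hu v u(2) fs(4) by (auto simp: less_Suc_eq)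
      qed
    qed
  qed
  show ?thesis
    by (rule main[of "\<lambda>x. x" _ 0, OF refl hom_id]) simp_all
qed

lemma (in noetherian_local_ring) free_of_fgp_end:
  assumes mr: "maximal_regular R xs y" and M: "tref R M" and van: "ext_vanishes R M M"
    and H: "fgp R (hom_module R M M)"
  shows "free_module R M"
proof (rule free_module_by_splitting)
  interpret MR: maximal_regular R xs y by (rule mr)
  show fin: "finite_module R M" using M by (rule trefD)
  have Mm: "module R M" using M by (rule trefD)
  interpret M: module R M by fact
  note sm = self_module_module and HM = hom_module_module[OF Mm Mm]
  fix p x
  assume p: "p \<in> module_hom R M M" "\<And>x. x \<in> carrier M \<Longrightarrow> p (p x) = p x"
    and non: "\<And>h x. h \<in> module_hom R M (self_module R) \<Longrightarrow> x \<in> carrier M \<Longrightarrow> h (p x) \<notin> Units R"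
    and x: "x \<in> carrier M"
  obtain k d e where res: "resolution R M (\<lambda>i. free_mod R (k i)) d e"
    using exists_free_resolution[OF fin] by blast
  let ?F = "free_mod R (k 0)"
  note P = resolutionD[OF res]
  have eM: "e v \<in> carrier M" if "v \<in> carrier ?F" for v
    by (rule hom_simps(1)[OF P(3) free_mod_module Mm that])
  let ?p = "restrict p (carrier M)" and ?w = "\<lambda>v\<in>carrier ?F. p (e v)"
  have pH: "?p \<in> carrier (hom_module R M M)" using p(1) Mm by simp
  have w: "?w \<in> carrier (hom_module R ?F M)"
    using hom_comp[OF free_mod_module P(3) p(1)] free_mod_module by (simp del: free_mod_simps)
  have w': "(\<lambda>v\<in>carrier ?F. ?p (e v)) = ?w" using eM by (intro restrict_ext) simp
  obtain n u h where u: "\<And>i. i < n \<Longrightarrow> u i \<in> carrier (hom_module R M M)"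
    and h: "\<And>i. i < n \<Longrightarrow> h i \<in> module_hom R (hom_module R M M) (self_module R)"
    and ex: "\<And>q. q \<in> carrier (hom_module R M M) \<Longrightarrow> msum (hom_module R M M) (\<lambda>i. h i q \<odot>\<^bsub>hom_module R M M\<^esub> u i) n = q"
    by (rule fgpE[OF H]) blast
  have c: "h i ?p \<in> carrier R" if "i < n" for i
    using hom_simps(1)[OF h[OF that] HM sm pH] by simp
  \<comment> \<open>The functional \<open>h i\<close> is computed at \<open>p\<close> through its
    extension \<open>f\<close> to maps out of the free module, where only the elements
    \<open>p (e v)\<close> enter.\<close>
  have c': "h i ?p \<notin> Units R" if i: "i < n" for i
  proof -
    obtain f where f: "f \<in> module_hom R (hom_module R ?F M) (self_module R)"
      "\<forall>a\<in>carrier (hom_module R M M). f (\<lambda>v\<in>carrier ?F. a (e v)) = h i a"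
      using MR.end_functional_extends[OF M van H res free_mod_fgp h[OF i]] by blast
    have "f ?w \<notin> Units R"
    proof (rule hom_functional_nonunit[OF free_mod_fgp Mm f(1) w])
      show "g (?w v) \<notin> Units R" if "g \<in> module_hom R M (self_module R)" "v \<in> carrier ?F" for g v
        using non[OF that(1) eM[OF that(2)]] that(2) by (simp del: free_mod_simps)
    qed
    moreover have "f ?w = h i ?p" using bspec[OF f(2) pH] unfolding w' .
    ultimately show ?thesis by simp
  qed
  have uM: "u i z \<in> carrier M" if "i < n" "z \<in> carrier M" for i z
    using u[OF that(1)] hom_simps(1)[OF _ Mm Mm that(2)] by simp
  have pz: "p z = msum M (\<lambda>i. h i ?p \<odot>\<^bsub>M\<^esub> u i z) n" if z: "z \<in> carrier M" for z
  proof -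
    have "p z = msum (hom_module R M M) (\<lambda>i. h i ?p \<odot>\<^bsub>hom_module R M M\<^esub> u i) n z"
      unfolding ex[OF pH] using z by simp
    also have "\<dots> = msum M (\<lambda>i. (h i ?p \<odot>\<^bsub>hom_module R M M\<^esub> u i) z) n"
      using c u module.smult_closed[OF HM] by (intro hom_msum[OF eval_hom[OF Mm Mm z] HM Mm]) blast
    also have "\<dots> = msum M (\<lambda>i. h i ?p \<odot>\<^bsub>M\<^esub> u i z) n"
      using z by simp
    finally show ?thesis .
  qed
  show "p x = \<zero>\<^bsub>M\<^esub>"
    by (rule nakayama_idempotent[OF fin p uM c c' pz x])
qed

section \<open>Projective modules and the vanishing of Ext\<close>

text \<open>\<open>lincomb\<close> takes its coefficients as a function of the vector; on the graph
  they are therefore indexed by the pairs \<open>(b, t b)\<close>.\<close>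

lemma direct_sum_lincomb_graph:
  assumes D: "module R D" and L: "module R L" and A: "finite A" "A \<subseteq> carrier D"
    and t: "\<And>b. b \<in> A \<Longrightarrow> t b \<in> carrier L" and a: "\<And>b. b \<in> A \<Longrightarrow> a (b, t b) \<in> carrier R"
  shows "module.lincomb (direct_sum D L) a ((\<lambda>b. (b, t b)) ` A) =
    (module.lincomb D (\<lambda>b. a (b, t b)) A, finsum L (\<lambda>b. a (b, t b) \<odot>\<^bsub>L\<^esub> t b) A)"
proof -
  interpret D: module R D by fact
  interpret L: module R L by fact
  interpret S: module R "direct_sum D L" by (rule direct_sum_is_module[OF D L])
  show ?thesis
    using A t a
  proof (induction A rule: finite_induct)
    case empty
    show ?case by (simp add: S.lincomb_def D.lincomb_def)
  next
    case (insert b A)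
    have c: "\<And>x. x \<in> A \<Longrightarrow> x \<in> carrier D" "\<And>x. x \<in> A \<Longrightarrow> t x \<in> carrier L" "\<And>x. x \<in> A \<Longrightarrow> a (x, t x) \<in> carrier R"
      "b \<in> carrier D" "t b \<in> carrier L" "a (b, t b) \<in> carrier R"
      using insert.prems by blast+
    have "finsum (direct_sum D L) (\<lambda>v. a v \<odot>\<^bsub>direct_sum D L\<^esub> v) (insert (b, t b) ((\<lambda>b. (b, t b)) ` A)) =
      a (b, t b) \<odot>\<^bsub>direct_sum D L\<^esub> (b, t b) \<oplus>\<^bsub>direct_sum D L\<^esub>
        finsum (direct_sum D L) (\<lambda>v. a v \<odot>\<^bsub>direct_sum D L\<^esub> v) ((\<lambda>b. (b, t b)) ` A)"
      using insert.hyps c by (intro S.finsum_insert) auto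
    moreover have "finsum D (\<lambda>v. a (v, t v) \<odot>\<^bsub>D\<^esub> v) (insert b A) =
      a (b, t b) \<odot>\<^bsub>D\<^esub> b \<oplus>\<^bsub>D\<^esub> finsum D (\<lambda>v. a (v, t v) \<odot>\<^bsub>D\<^esub> v) A"
      using insert.hyps c by (intro D.finsum_insert) auto
    moreover have "finsum L (\<lambda>v. a (v, t v) \<odot>\<^bsub>L\<^esub> t v) (insert b A) =
      a (b, t b) \<odot>\<^bsub>L\<^esub> t b \<oplus>\<^bsub>L\<^esub> finsum L (\<lambda>v. a (v, t v) \<odot>\<^bsub>L\<^esub> t v) A"
      using insert.hyps c by (intro L.finsum_insert) auto
    moreover have "finsum (direct_sum D L) (\<lambda>v. a v \<odot>\<^bsub>direct_sum D L\<^esub> v) ((\<lambda>b. (b, t b)) ` A) =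
        (finsum D (\<lambda>v. a (v, t v) \<odot>\<^bsub>D\<^esub> v) A, finsum L (\<lambda>b. a (b, t b) \<odot>\<^bsub>L\<^esub> t b) A)"
      using insert.IH insert.prems by (simp add: S.lincomb_def D.lincomb_def)
    ultimately show ?case by (simp add: S.lincomb_def D.lincomb_def)
  qed
qed

text \<open>The span of the pairs \<open>(b, t b)\<close>, \<open>b\<close> in a basis of \<open>D\<close>, is the graph of a linear map.\<close>

lemma free_linear_choice:
  fixes R (structure)
  assumes D: "free_module R D" and L: "module R L"
  shows "linear_choice R D L"
  unfolding linear_choice_def
proof (intro allI impI)
  fix \<Phi>
  assume ex: "\<forall>p\<in>carrier D. \<exists>l\<in>carrier L. \<Phi> p l" and z: "\<Phi> \<zero>\<^bsub>D\<^esub> \<zero>\<^bsub>L\<^esub>"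
    and add: "\<forall>p\<in>carrier D. \<forall>q\<in>carrier D. \<forall>l\<in>carrier L. \<forall>k\<in>carrier L.
           \<Phi> p l \<longrightarrow> \<Phi> q k \<longrightarrow> \<Phi> (p \<oplus>\<^bsub>D\<^esub> q) (l \<oplus>\<^bsub>L\<^esub> k)"
    and sm: "\<forall>r\<in>carrier R. \<forall>p\<in>carrier D. \<forall>l\<in>carrier L. \<Phi> p l \<longrightarrow> \<Phi> (r \<odot>\<^bsub>D\<^esub> p) (r \<odot>\<^bsub>L\<^esub> l)"
  have Dm: "module R D" using D by (simp add: free_module_def)
  interpret D: module R D by fact
  interpret L: module R L by fact
  have Sm: "module R (direct_sum D L)" by (rule direct_sum_is_module[OF Dm L])
  interpret S: module R "direct_sum D L" by (rule Sm)
  obtain B where B: "B \<subseteq> carrier D" "\<not> D.lin_dep B" "D.span B = carrier D"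
    using D unfolding free_module_def by blast
  obtain t where t: "\<And>b. b \<in> B \<Longrightarrow> t b \<in> carrier L" "\<And>b. b \<in> B \<Longrightarrow> \<Phi> b (t b)"
    using ex B(1) by (metis subsetD)
  let ?g = "\<lambda>b. (b, t b)"
  define G where "G = S.span (?g ` B)"
  have gB: "?g ` B \<subseteq> carrier (direct_sum D L)" using B(1) t(1) by auto
  have G: "submodule R G (direct_sum D L)" unfolding G_def by (rule S.span_is_submodule[OF gB])
  have Gc: "x \<in> carrier D \<and> l \<in> carrier L" if "(x, l) \<in> G" for x l
    using submodule.subset[OF G] that by auto
  \<comment> \<open>The relation \<open>\<Phi>\<close>, read as a submodule of the direct sum,
    contains the chosen pairs and hence their span \<open>G\<close>.\<close>
  let ?K = "{p \<in> carrier (direct_sum D L). \<Phi> (fst p) (snd p)}"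
  have "submodule R ?K (direct_sum D L)"
  proof (rule submodule.intro[OF Sm])
    show "p \<oplus>\<^bsub>direct_sum D L\<^esub> q \<in> ?K" if "p \<in> ?K" "q \<in> ?K" for p q
      using that add by (cases p; cases q) simp
    show "r \<odot>\<^bsub>direct_sum D L\<^esub> p \<in> ?K" if "r \<in> carrier R" "p \<in> ?K" for r p
      using that sm by (cases p) simp
  qed (use z in auto)
  moreover have "?g ` B \<subseteq> ?K" using gB t(2) by auto
  ultimately have "G \<subseteq> ?K" unfolding G_def by (intro S.span_is_subset)
  then have G\<Phi>: "\<Phi> x l" if "(x, l) \<in> G" for x l
    using that by auto
  have "fst \<in> module_hom R (direct_sum D L) D" by (auto simp: module_hom_def)
  then have "submodule R (fst ` G) D" by (rule hom_image_submodule[OF Sm Dm _ G])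
  moreover have "?g ` B \<subseteq> G" unfolding G_def by (rule S.in_own_span[OF gB])
  then have "B \<subseteq> fst ` G" by force
  ultimately have "carrier D \<subseteq> fst ` G" using D.span_is_subset[of B] B(3) by simp
  then have exG: "\<exists>l. (x, l) \<in> G" if "x \<in> carrier D" for x using that by force
  \<comment> \<open>Single-valuedness at zero: a combination of pairs with vanishing first component
    has zero coefficients, as \<open>B\<close> is linearly independent.\<close>
  have un0: "l = \<zero>\<^bsub>L\<^esub>" if l: "(\<zero>\<^bsub>D\<^esub>, l) \<in> G" for l
  proof -
    obtain a A where A: "finite A" "A \<subseteq> ?g ` B" "a \<in> A \<rightarrow> carrier R" "S.lincomb a A = (\<zero>\<^bsub>D\<^esub>, l)"
      using l unfolding G_def S.span_def by force
    define C where "C = {b \<in> B. ?g b \<in> A}"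
    have C: "C \<subseteq> B" "A = ?g ` C" using A(2) by (auto simp: C_def)
    then have fC: "finite C" using A(1) by (metis finite_imageD inj_onI prod.inject)
    have aC: "a (b, t b) \<in> carrier R" if "b \<in> C" for b using that A(3) by (auto simp: C_def)
    have "S.lincomb a (?g ` C) = (D.lincomb (\<lambda>b. a (b, t b)) C, finsum L (\<lambda>b. a (b, t b) \<odot>\<^bsub>L\<^esub> t b) C)"
      by (rule direct_sum_lincomb_graph[OF Dm L fC]) (use C(1) B(1) t(1) aC in blast)+
    then have e: "D.lincomb (\<lambda>b. a (b, t b)) C = \<zero>\<^bsub>D\<^esub>" "finsum L (\<lambda>b. a (b, t b) \<odot>\<^bsub>L\<^esub> t b) C = l"
      using A(4) unfolding C(2) by simp_all
    have "a (b, t b) = \<zero>" if b: "b \<in> C" for b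
    proof (rule ccontr)
      assume nz: "a (b, t b) \<noteq> \<zero>"
      have "D.lin_dep B"
        unfolding D.lin_dep_def
        by (intro exI[of _ C] exI[of _ "\<lambda>b. a (b, t b)"] exI[of _ b] conjI fC C(1) e(1) b nz) (use aC in blast)
      then show False using B(2) by blast
    qed
    then have "finsum L (\<lambda>b. a (b, t b) \<odot>\<^bsub>L\<^esub> t b) C = finsum L (\<lambda>b. \<zero>\<^bsub>L\<^esub>) C"
      using C t(1) by (intro L.finsum_cong') auto
    then show ?thesis using e(2) by simp
  qed
  have un: "l = k" if "(x, l) \<in> G" "(x, k) \<in> G" for x l k
  proof -
    have c: "x \<in> carrier D" "l \<in> carrier L" "k \<in> carrier L" using Gc that by blast+
    have "(x, l) \<oplus>\<^bsub>direct_sum D L\<^esub> (\<ominus> \<one>) \<odot>\<^bsub>direct_sum D L\<^esub> (x, k) \<in> G"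
      by (rule submodule.m_closed[OF G that(1) submodule.smult_closed[OF G _ that(2)]]) simp
    then have "l \<oplus>\<^bsub>L\<^esub> (\<ominus> \<one>) \<odot>\<^bsub>L\<^esub> k = \<zero>\<^bsub>L\<^esub>"
      using c by (intro un0) (simp add: D.smult_l_minus D.r_neg)
    then show ?thesis
      using c L.minus_equality[of l "\<ominus>\<^bsub>L\<^esub> k"] by (simp add: L.smult_l_minus)
  qed
  define c where "c x = (SOME l. (x, l) \<in> G)" for x
  have cG: "(x, c x) \<in> G" if "x \<in> carrier D" for x
    unfolding c_def using exG[OF that] by (rule someI_ex)
  have "c \<in> module_hom R D L"
    unfolding module_hom_def
  proof (intro CollectI conjI allI impI funcsetI)
    show "c x \<in> carrier L" if "x \<in> carrier D" for x using cG[OF that] Gc by blast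
    show "c (x \<oplus>\<^bsub>D\<^esub> x') = c x \<oplus>\<^bsub>L\<^esub> c x'" if "x \<in> carrier D \<and> x' \<in> carrier D" for x x'
      using that submodule.m_closed[OF G cG cG, of x x'] by (intro un[OF cG]) auto
    show "c (r \<odot>\<^bsub>D\<^esub> x) = r \<odot>\<^bsub>L\<^esub> c x" if "r \<in> carrier R \<and> x \<in> carrier D" for r x
      using that submodule.smult_closed[OF G _ cG, of r x] by (intro un[OF cG]) auto
  qed
  then show "\<exists>c\<in>module_hom R D L. \<forall>p\<in>carrier D. \<Phi> p (c p)"
    using cG G\<Phi> by blast
qed

text \<open>The relation is extended to the sum of \<open>P\<close> and its complement by ignoring
  the second component; a linear choice on this free module restricts to \<open>P\<close>.\<close>

lemma projective_linear_choice:
  fixes R :: "('a, 'r) ring_scheme" and P :: "('a, 'p, 'm) module_scheme"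
  assumes P: "projective_module R P" and L: "module R L"
  shows "linear_choice R P L"
proof -
  obtain Q :: "('a, 'p \<Rightarrow> 'a) module" where Pm: "module R P" and Q: "module R Q" and D: "free_module R (direct_sum P Q)"
    using P unfolding projective_module_def by blast
  interpret P: module R P by fact
  interpret Q: module R Q by fact
  interpret L: module R L by fact
  note Dm = direct_sum_is_module[OF Pm Q]
  show ?thesis
    unfolding linear_choice_def
  proof (intro allI impI)
    fix \<Phi>
    assume ex: "\<forall>p\<in>carrier P. \<exists>l\<in>carrier L. \<Phi> p l" and z: "\<Phi> \<zero>\<^bsub>P\<^esub> \<zero>\<^bsub>L\<^esub>"
      and add: "\<forall>p\<in>carrier P. \<forall>q\<in>carrier P. \<forall>l\<in>carrier L. \<forall>k\<in>carrier L.
             \<Phi> p l \<longrightarrow> \<Phi> q k \<longrightarrow> \<Phi> (p \<oplus>\<^bsub>P\<^esub> q) (l \<oplus>\<^bsub>L\<^esub> k)"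
      and sm: "\<forall>r\<in>carrier R. \<forall>p\<in>carrier P. \<forall>l\<in>carrier L. \<Phi> p l \<longrightarrow> \<Phi> (r \<odot>\<^bsub>P\<^esub> p) (r \<odot>\<^bsub>L\<^esub> l)"
    obtain c where c: "c \<in> module_hom R (direct_sum P Q) L"
      "\<And>p. p \<in> carrier (direct_sum P Q) \<Longrightarrow> \<Phi> (fst p) (c p)"
      using ex z add sm
      by (rule_tac linear_choiceE[OF free_linear_choice[OF D L], where \<Phi> = "\<lambda>p. \<Phi> (fst p)"]) auto
    have i: "(\<lambda>p. (p, \<zero>\<^bsub>Q\<^esub>)) \<in> module_hom R P (direct_sum P Q)"
      by (auto simp: module_hom_def)
    show "\<exists>c\<in>module_hom R P L. \<forall>p\<in>carrier P. \<Phi> p (c p)"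
      using hom_comp[OF Pm i c(1)] c(2)[of "(p, \<zero>\<^bsub>Q\<^esub>)" for p]
      by (intro bexI[of _ "\<lambda>p. c (p, \<zero>\<^bsub>Q\<^esub>)"]) auto
  qed
qed

lemma (in cring) projective_free_mod: "projective_module R (free_mod R n)"
proof -
  \<comment> \<open>A zero module whose elements have the type that \<open>projective_module\<close>
    prescribes for a complement.\<close>
  let ?Q = "dual_module R (free_mod R 0)"
  let ?D = "direct_sum (free_mod R n) ?Q"
  have Q: "module R ?Q" by (rule dual_module_module[OF free_mod_module])
  have Dm: "module R ?D" by (rule direct_sum_is_module[OF free_mod_module Q])
  interpret Q: module R ?Q by (rule Q)
  have q0: "q = \<zero>\<^bsub>?Q\<^esub>" if q: "q \<in> carrier ?Q" for q
  proof -
    have "q (\<lambda>_. \<zero>) = \<zero>"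
      using hom_simps(4)[OF _ free_mod_module self_module_module, of q 0] q by (simp add: dual_carrier)
    moreover have "q \<in> extensional (carrier (free_mod R 0))" "\<zero>\<^bsub>?Q\<^esub> \<in> extensional (carrier (free_mod R 0))"
      using q Q.zero_closed by (simp_all add: dual_carrier del: free_mod_simps)
    moreover have "q x = \<zero>\<^bsub>?Q\<^esub> x" if x: "x \<in> carrier (free_mod R 0)" for x
    proof -
      have "x = (\<lambda>_. \<zero>)" using x by auto
      then have "q x = \<zero>" using \<open>q (\<lambda>_. \<zero>) = \<zero>\<close> by simp
      then show ?thesis using x by (simp add: dual_module_def del: free_mod_simps)
    qed
    ultimately show ?thesis by (intro extensionalityI[of _ "carrier (free_mod R 0)"])
  qed
  have f: "fst \<in> module_hom R ?D (free_mod R n)" "snd \<in> module_hom R ?D ?Q"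
    by (auto simp: module_hom_def simp del: free_mod_simps)
  have "free_module R ?D"
  proof (rule free_moduleI[OF Dm, where n = n and u = "\<lambda>i. (unit_vec R i, \<zero>\<^bsub>?Q\<^esub>)" and h = "\<lambda>i x. fst x i"])
    show u: "(unit_vec R i, \<zero>\<^bsub>?Q\<^esub>) \<in> carrier ?D" if "i < n" for i
      using unit_vec_closed[OF that] by simp
    show h: "(\<lambda>x. fst x i) \<in> module_hom R ?D (self_module R)" if "i < n" for i
      by (rule hom_comp[OF Dm f(1) coord_hom[OF that]])
    show "fst (unit_vec R j, \<zero>\<^bsub>?Q\<^esub>) i = (if i = j then \<one> else \<zero>)" for i j
      by (simp add: unit_vec_def)
    fix x assume x: "x \<in> carrier ?D"
    have x': "fst x \<in> carrier (free_mod R n)" "snd x \<in> carrier ?Q"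
      using x by (simp_all only: direct_sum_simps mem_Times_iff)
    let ?g = "\<lambda>i. fst x i \<odot>\<^bsub>?D\<^esub> (unit_vec R i, \<zero>\<^bsub>?Q\<^esub>)"
    have g: "?g i \<in> carrier ?D" if "i < n" for i
      using module.smult_closed[OF Dm _ u[OF that]] hom_simps(1)[OF h[OF that] Dm self_module_module x] by simp
    have "fst (msum ?D ?g n) = msum (free_mod R n) (\<lambda>i. fst (?g i)) n"
      by (rule hom_msum[OF f(1) Dm free_mod_module g])
    also have "\<dots> = msum (free_mod R n) (\<lambda>i. fst x i \<odot>\<^bsub>free_mod R n\<^esub> unit_vec R i) n"
      by (rule msum_cong) (simp only: direct_sum_simps fst_conv)
    also have "\<dots> = fst x" by (rule free_mod_expand[OF x'(1)])
    finally have "fst (msum ?D ?g n) = fst x" .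
    moreover have "snd (msum ?D ?g n) = snd x"
      unfolding q0[OF x'(2)]
      by (rule q0[OF hom_simps(1)[OF f(2) Dm Q module.msum_closed[OF Dm g]]])
    ultimately show "msum ?D ?g n = x" by (rule prod_eqI)
  qed
  then show ?thesis
    unfolding projective_module_def using free_mod_module Q by blast
qed

section \<open>From the chosen resolution to an arbitrary one\<close>

lemma (in noetherian_cring) chosen_resolution:
  assumes "finite_module R N" "chosen_resolution R N = (P, d, e)"
  shows "projective_resolution R N P d e"
proof -
  obtain n d' e' where "resolution R N (\<lambda>i. free_mod R (n i)) d' e'"
    using exists_free_resolution[OF assms(1)] by blast
  then have "case ((\<lambda>i. free_mod R (n i)), d', e') of (P, d, e) \<Rightarrow> projective_resolution R N P d e"
    using projective_free_mod by (simp add: projective_resolution_def)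
  then have "case chosen_resolution R N of (P, d, e) \<Rightarrow> projective_resolution R N P d e"
    unfolding chosen_resolution_def by (rule someI)
  then show ?thesis using assms(2) by simp
qed

lemma trivial_cohomology_ext_van:
  assumes P: "\<And>i. module R (P i)" and d: "\<And>i. d i \<in> module_hom R (P (Suc i)) (P i)" and L: "module R L"
    and tr: "trivial_group (hom_cohomology R P d L (Suc i))"
  shows "ext_van R P d L i"
  unfolding ext_van_def
proof (intro ballI impI)
  fix c assume c: "c \<in> module_hom R (P (Suc i)) L"
    and cd: "\<forall>p\<in>carrier (P (Suc (Suc i))). c (d (Suc i) p) = \<zero>\<^bsub>L\<^esub>"
  interpret L: module R L by fact
  let ?H = "hom_module R (P (Suc i)) L" and ?B = "hom_coboundaries R P d L (Suc i)"
  let ?Z = "?H\<lparr>carrier := hom_cocycles R P d L (Suc i)\<rparr>"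
  note ds = hom_simps(1)[OF d P P]
  interpret H: module R ?H by (rule hom_module_module[OF P L])
  \<comment> \<open>Members of \<open>hom_module\<close> are extensional, hence the
    restriction.\<close>
  let ?c = "restrict c (carrier (P (Suc i)))"
  have "?c \<in> carrier ?H" using c P by simp
  moreover have "hom_diff P d (Suc i) ?c = \<zero>\<^bsub>hom_module R (P (Suc (Suc i))) L\<^esub>"
    using cd ds by (auto simp: hom_diff_def compose_def intro!: restrict_ext)
  ultimately have cZ: "?c \<in> carrier ?Z" by (simp add: hom_cocycles_def a_kernel_def' del: hom_module_simps)
  have "carrier (?Z A_Mod ?B) = {?B}"
    using tr unfolding trivial_group_def hom_cohomology_def by (simp add: A_FactGroup_def')
  then have co: "?B +>\<^bsub>?Z\<^esub> ?c = ?B"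
    using cZ by (auto simp: A_FactGroup_def' A_RCOSETS_def')
  have z: "\<zero>\<^bsub>?H\<^esub> \<in> ?B"
  proof -
    have "(\<lambda>p\<in>carrier (P i). \<zero>\<^bsub>L\<^esub>) \<in> carrier (hom_module R (P i) L)"
      using hom_zero_map[OF P L] P by simp
    moreover have "hom_diff P d i (\<lambda>p\<in>carrier (P i). \<zero>\<^bsub>L\<^esub>) = \<zero>\<^bsub>?H\<^esub>"
      using ds by (auto simp: hom_diff_def compose_def intro!: restrict_ext)
    ultimately show ?thesis
      unfolding hom_coboundaries_def by (auto simp del: hom_module_simps intro: image_eqI[OF sym])
  qed
  \<comment> \<open>There is only one coset, the set \<open>?B\<close> itself, and \<open>?c\<close>
    belongs to its own coset because zero is a coboundary.\<close>
  have "?c = \<zero>\<^bsub>?H\<^esub> \<oplus>\<^bsub>?H\<^esub> ?c" using \<open>?c \<in> carrier ?H\<close> by (simp del: hom_module_simps)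
  then have "?c \<in> ?B +>\<^bsub>?Z\<^esub> ?c" using z unfolding a_r_coset_def' by (auto simp del: hom_module_simps)
  then have "?c \<in> ?B" by (simp only: co)
  then obtain b where b: "b \<in> carrier (hom_module R (P i) L)" "?c = hom_diff P d i b"
    by (auto simp: hom_coboundaries_def simp del: hom_module_simps)
  have "c p = b (d i p)" if "p \<in> carrier (P (Suc i))" for p
    using fun_cong[OF b(2), of p] that by (simp add: hom_diff_def compose_def)
  then show "\<exists>b\<in>module_hom R (P i) L. \<forall>p\<in>carrier (P (Suc i)). c p = b (d i p)"
    using b(1) by auto
qed

text \<open>The chosen resolution may have infinitely generated projective terms;
  \<open>ext_van_indep\<close> moves the vanishing to a resolution by the modules
  \<open>free_mod R n\<close>.\<close>

lemma (in noetherian_cring) ext_vanishesI: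
  assumes fin: "finite_module R N" and L: "module R L" and tr: "\<And>i. i > 0 \<Longrightarrow> trivial_group (Ext R i N L)"
  shows "ext_vanishes R N L"
proof -
  have N: "module R N" using fin by (simp add: finite_module_def)
  obtain P d e where ch: "chosen_resolution R N = (P, d, e)" by (metis prod_cases3)
  note pr = chosen_resolution[OF fin ch]
  have res: "resolution R N P d e" and proj: "\<And>i. projective_module R (P i)"
    using pr by (auto simp: projective_resolution_def)
  note P = resolutionD[OF res]
  have ev: "ext_van R P d L i" for i
    using tr[of "Suc i"] by (intro trivial_cohomology_ext_van[where P = P and d = d, OF P(1) P(2) L]) (simp add: Ext_def ch)
  obtain n d' e' where res': "resolution R N (\<lambda>i. free_mod R (n i)) d' e'"
    using exists_free_resolution[OF fin] by blast
  have "ext_van R (\<lambda>i. free_mod R (n i)) d' L i" for i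
    by (rule ext_van_indep[OF res res' N L projective_linear_choice[OF proj free_mod_module]
          fgp_linear_choice[OF free_mod_fgp P(1)] fgp_linear_choice[OF free_mod_fgp free_mod_module] ev])
  then show ?thesis
    unfolding ext_vanishes_def using res' free_mod_fgp by blast
qed

text \<open>A cocycle with values in the retract becomes a coboundary in \<open>D\<close>, and
  \<open>\<rho>\<close> carries the bounding map back.\<close>

lemma ext_vanishes_retract:
  assumes A: "module R A" and D: "module R D" and van: "ext_vanishes R N D"
    and i: "\<iota> \<in> module_hom R A D" and r: "\<rho> \<in> module_hom R D A" and ri: "\<And>a. a \<in> carrier A \<Longrightarrow> \<rho> (\<iota> a) = a"
  shows "ext_vanishes R N A"
proof -
  obtain P :: "nat \<Rightarrow> ('a, nat \<Rightarrow> 'a) module" and d e where res: "resolution R N P d e" and fg: "\<forall>i. fgp R (P i)"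
    and van: "\<And>i. ext_van R P d D i"
    using van unfolding ext_vanishes_def by blast
  note P = resolutionD[OF res]
  note im = hom_simps[OF i A D]
  have "ext_van R P d A k" for k
    unfolding ext_van_def
  proof (intro ballI impI)
    fix c assume c: "c \<in> module_hom R (P (Suc k)) A" "\<forall>p\<in>carrier (P (Suc (Suc k))). c (d (Suc k) p) = \<zero>\<^bsub>A\<^esub>"
    have "\<iota> (c (d (Suc k) p)) = \<zero>\<^bsub>D\<^esub>" if "p \<in> carrier (P (Suc (Suc k)))" for p
      using c(2) that im(4) by simp
    then have "\<exists>b\<in>module_hom R (P k) D. \<forall>p\<in>carrier (P (Suc k)). \<iota> (c p) = b (d k p)"
      using van[of k] hom_comp[OF P(1) c(1) i] unfolding ext_van_def by fast
    then obtain b where b: "b \<in> module_hom R (P k) D" "\<forall>p\<in>carrier (P (Suc k)). \<iota> (c p) = b (d k p)" by blast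
    have "c p = \<rho> (b (d k p))" if p: "p \<in> carrier (P (Suc k))" for p
      using ri[OF hom_simps(1)[OF c(1) P(1) A p]] b(2) p by simp
    then show "\<exists>b\<in>module_hom R (P k) A. \<forall>p\<in>carrier (P (Suc k)). c p = b (d k p)"
      using hom_comp[OF P(1) b(1) r] by (intro bexI[of _ "\<lambda>p. \<rho> (b p)"]) auto
  qed
  then show ?thesis
    unfolding ext_vanishes_def using res fg by blast
qed

lemma ext_vanishes_direct_sum:
  assumes A: "module R A" and B: "module R B" and van: "ext_vanishes R N (direct_sum A B)"
  shows "ext_vanishes R N A" "ext_vanishes R N B"
proof -
  interpret A: module R A by fact
  interpret B: module R B by fact
  note D = direct_sum_is_module[OF A B]
  show "ext_vanishes R N A"
    by (rule ext_vanishes_retract[where \<iota> = "\<lambda>a. (a, \<zero>\<^bsub>B\<^esub>)" and \<rho> = fst, OF A D van])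
      (auto simp: module_hom_def)
  show "ext_vanishes R N B"
    by (rule ext_vanishes_retract[where \<iota> = "\<lambda>b. (\<zero>\<^bsub>A\<^esub>, b)" and \<rho> = snd, OF B D van])
      (auto simp: module_hom_def)
qed

lemma (in noetherian_cring) totally_reflexive_tref:
  assumes T: "totally_reflexive R T"
  shows "tref R T"
proof -
  have fin: "finite_module R T" and bij: "bij_betw (biduality R T) (carrier T) (carrier (dual_module R (dual_module R T)))"
    using T by (simp_all add: totally_reflexive_def)
  have Tm: "module R T" using fin by (simp add: finite_module_def)
  interpret T: module R T by fact
  note Dm = dual_module_module[OF Tm]
  show ?thesis
    unfolding tref_def
  proof (intro conjI ballI impI fin)
    show "ext_vanishes R (dual_module R T) (self_module R)"
      by (rule ext_vanishesI[OF finite_dual[OF fin] self_module_module]) (use T in \<open>simp add: totally_reflexive_def\<close>)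
    show "ext_vanishes R T (self_module R)"
      by (rule ext_vanishesI[OF fin self_module_module]) (use T in \<open>simp add: totally_reflexive_def\<close>)
    fix \<phi> assume "\<phi> \<in> module_hom R (dual_module R T) (self_module R)"
    then have "restrict \<phi> (carrier (dual_module R T)) \<in> carrier (dual_module R (dual_module R T))"
      by (rule restrict_dual[OF Dm])
    then obtain u where u: "u \<in> carrier T" "biduality R T u = restrict \<phi> (carrier (dual_module R T))"
      using bij by (metis bij_betw_imp_surj_on imageE)
    have "\<phi> h = h u" if "h \<in> carrier (dual_module R T)" for h
      using fun_cong[OF u(2), of h] that by (simp add: biduality_def)
    then show "\<exists>u\<in>carrier T. \<forall>h\<in>carrier (dual_module R T). \<phi> h = h u" using u(1) by blast
  next
    fix u assume u: "u \<in> carrier T" "\<forall>h\<in>carrier (dual_module R T). h u = \<zero>"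
    have eq: "h u = h \<zero>\<^bsub>T\<^esub>" if "h \<in> carrier (dual_module R T)" for h
      using hom_simps(4)[OF _ Tm self_module_module, of h] u(2) that by (simp add: dual_carrier)
    have "biduality R T u = biduality R T \<zero>\<^bsub>T\<^esub>"
      unfolding biduality_def by (rule restrict_ext) (rule eq)
    then show "u = \<zero>\<^bsub>T\<^esub>"
      using inj_onD[OF bij_betw_imp_inj_on[OF bij]] u(1) T.zero_closed by blast
  qed
qed

theorem corollary26:
  fixes R :: "('a, 'r) ring_scheme" and M :: "('a, 'b, 'm) module_scheme"
  assumes "noetherian_local_ring R"
    and "finite_module R M"
    and "\<And>i. i > 0 \<Longrightarrow> trivial_group (Ext R i M (direct_sum M (self_module R)))"
    and "G_dim R (dual_module R M) < \<infinity>"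
    and "proj_dim R (hom_module R M M) < \<infinity>"
  shows "free_module R M"
proof -
  interpret noetherian_local_ring R by fact
  have M: "module R M" using assms(2) by (simp add: finite_module_def)
  note sm = self_module_module and DM = dual_module_module[OF M] and HM = hom_module_module[OF M M]
  note van = ext_vanishes_direct_sum[OF M sm ext_vanishesI[OF assms(2) direct_sum_is_module[OF M sm] assms(3)]]
  obtain xs y where mr: "maximal_regular R xs y" using exists_maximal_regular by blast
  interpret maximal_regular R xs y by (rule mr)
  \<comment> \<open>The infimum of the empty set is \<open>\<infinity>\<close> in
    \<open>enat\<close>, so a finite \<open>G_dim\<close> yields an actual resolution. The same
    device serves for \<open>proj_dim\<close> below.\<close>
  have "\<exists>n (P :: nat \<Rightarrow> ('a, nat \<Rightarrow> 'a) module) d e. resolution R (dual_module R M) P d e \<and>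
      (\<forall>i. totally_reflexive R (P i)) \<and> vanishes_above P n"
  proof (rule ccontr)
    assume "\<not> ?thesis"
    then have "G_dim R (dual_module R M) = Inf {}" unfolding G_dim_def by (intro arg_cong[of _ _ Inf]) blast
    then show False using assms(4) by (simp add: top_enat_def)
  qed
  then obtain n P d e where g: "resolution R (dual_module R M) P d e" "\<And>i. totally_reflexive R (P i)"
    "vanishes_above (P :: nat \<Rightarrow> ('a, nat \<Rightarrow> 'a) module) n" by blast
  have wD: "wreg xs (dual_module R M)"
    unfolding dual_module_def by (rule wreg_hom[OF M sm van(2) xs reg])
  have TD: "tref R (dual_module R M)"
    by (rule finite_tref_dim[OF g(1) DM wD totally_reflexive_tref[OF g(2)] g(3)])
  have T: "tref R M" by (rule tref_of_dual[OF assms(2) van(2) TD])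
  have "\<exists>n (P :: nat \<Rightarrow> ('a, nat \<Rightarrow> 'a) module) d e. projective_resolution R (hom_module R M M) P d e \<and>
      vanishes_above P n"
  proof (rule ccontr)
    assume "\<not> ?thesis"
    then have "proj_dim R (hom_module R M M) = Inf {}" unfolding proj_dim_def by (intro arg_cong[of _ _ Inf]) blast
    then show False using assms(5) by (simp add: top_enat_def)
  qed
  then obtain k Q d' e' where h: "resolution R (hom_module R M M) Q d' e'" "\<And>i. projective_module R (Q i)"
    "vanishes_above (Q :: nat \<Rightarrow> ('a, nat \<Rightarrow> 'a) module) k" unfolding projective_resolution_def by blast
  have wH: "wreg xs (hom_module R M M)"
    by (rule wreg_hom[OF M M van(1) xs tref_wreg[OF T]])
  have H: "fgp R (hom_module R M M)"
    by (rule finite_proj_dim[OF h(1) finite_hom[OF assms(2,2)] wH projective_linear_choice[OF h(2)] h(3)])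
  show ?thesis by (rule free_of_fgp_end[OF mr T van(1) H])
qed

end
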